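(* Let $D\subset R$ be a closed rectangle homothetic to $R$, $0<\alpha<|D|$, $r>0$, $U\in\{0,1\}$, $B\in\mathcal{C}_{\alpha,D}$, $\Omega=R\setminus B$, $(V_{\rm in},V_{\rm out})\in\mathcal{F}_{r,U}$, and let $\Lambda=\Lambda(r,D)>0$ be the uniqueness threshold described in the context. Given $\lambda\in[0,\Lambda]$, let $(u,p)\in V_*(\Omega)\times L^2_0(\Omega)$ be the unique weak solution of the boundary-value problem with flow $\lambda(V_{\rm in},V_{\rm out})$. If $\{(V^\varepsilon_{\rm in},V^\varepsilon_{\rm out})\}_{\varepsilon>0}\subset\mathcal{F}_{r,U}$ converges weakly-$\ast$ to $(V_{\rm in},V_{\rm out})$ in $W^{1,\infty}(-H,H)^2$ as $\varepsilon\to0$, then for any $\varepsilon>0$ the boundary-value problem in $\Omega$ with flow $\lambda(V^\varepsilon_{\rm in},V^\varepsilon_{\rm out})$ admits a unique weak solution $(u_\varepsilon,p_\varepsilon)\in V_*(\Omega)\times L^2_0(\Omega)$, and, viewing the lifts as functions of $\lambda\in[0,\Lambda]$, $$\lim_{\varepsilon\to0}\|\mathcal{L}_B(u_\varepsilon,p_\varepsilon)-\mathcal{L}_B(u,p)\|_{C([0,\Lambda])}=0.$$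
   Context: **Geometry.** Fix $L>H>0$ and $R=(-L,L)\times(-H,H)\subset\mathbb{R}^2$, with bottom, top, left and right sides $\Gamma_b,\Gamma_t,\Gamma_l,\Gamma_r$; $e_1,e_2$ is the canonical basis of $\mathbb{R}^2$ and $|\cdot|$ is Lebesgue measure (area). For a closed rectangle $D\subset R$ homothetic to $R$ and $0<\alpha<|D|$, $\mathcal{C}_{\alpha,D}$ is the set of nonempty compact convex domains $B\subset D$ with $|B|=\alpha$. **Flow shapes.** For $r>0$, $U\in\{0,1\}$, $\mathcal{F}_{r,U}$ is the set of pairs $(V_{\rm in},V_{\rm out})\in W^{1,\infty}(-H,H)^2$ such that: (1) $\|V_{\rm in}\|_{W^{1,\infty}(-H,H)}+\|V_{\rm out}\|_{W^{1,\infty}(-H,H)}\le r$; (2) $V_{\rm in}(-H)=V_{\rm out}(-H)=0$ and $V_{\rm in}(H)=V_{\rm out}(H)=U$; (3) $\int_{-H}^H V_{\rm in}\,dx_2=\int_{-H}^H V_{\rm out}\,dx_2=1$. **Boundary-value problem.** For $B\in\mathcal{C}_{\alpha,D}$, $\Omega=R\setminus B$, $\lambda\ge0$, $(V_{\rm in},V_{\rm out})\in\mathcal{F}_{r,U}$, the boundary-value problem with flow $\lambda(V_{\rm in},V_{\rm out})$ is $$-\Delta u+u\cdot\nabla u+\nabla p=0,\quad \nabla\cdot u=0\ \text{ in }\Omega,$$ $$u|_{\partial B}=u|_{\Gamma_b}=0,\quad u|_{\Gamma_t}=\lambda U e_1,\quad u|_{\Gamma_l}=\lambda V_{\rm in}e_1,\quad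 u|_{\Gamma_r}=\lambda V_{\rm out}e_1.$$ Let $H^1_*(\Omega)=\{u\in H^1(\Omega): u=0 \text{ on }\partial B\}$ (vector fields), $V_*(\Omega)=\{u\in H^1_*(\Omega):\nabla\cdot u=0\}$, $L^2_0(\Omega)=\{p\in L^2(\Omega):\int_\Omega p=0\}$. A weak solution is $(u,p)\in V_*(\Omega)\times L^2_0(\Omega)$ attaining the boundary data in the trace sense and satisfying $\int_\Omega\nabla u:\nabla\varphi+\int_\Omega(u\cdot\nabla u)\cdot\varphi-\int_\Omega p\,\nabla\cdot\varphi=0$ for all vector fields $\varphi\in H^1_0(\Omega)$. **Lift.** With $\mathbb{T}(u,p)=\nabla u+\nabla u^T-p\mathbb{I}$ and $n$ the unit normal to $\partial\Omega$ outward with respect to $\Omega$, the lift on $B$ is $\mathcal{L}_B(u,p)=-e_2\cdot\langle\mathbb{T}(u,p)n,1\rangle_{\partial B}$, where $\langle\cdot,\cdot\rangle_{\partial B}$ is the duality between $W^{-2/3,3/2}(\partial B)$ and $W^{2/3,3}(\partial B)$. Explicitly, since $\nabla\cdot\mathbb{T}(u,p)=u\cdot\nabla u$, $e_2\cdot\langle\mathbb{T}(u,p)n,1\rangle_{\partial B}=\int_\Omega \mathbb{T}(u,p):\nabla(\phi e_2)+\int_\Omega (u\cdot\nabla u)\cdot \phi e_2$ for any smooth $\phi$ on $\overline R$ equal to $1$ near $B$ and $0$ near $\partial R$. **Threshold $\Lambda$.** Let $\mathcal{S}_0(\Omega)=\min_{u\in H^1_0(\Omega)\setminus\{0\}}\|\nabla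 u\|_{L^2(\Omega)}^2/\|u\|_{L^4(\Omega)}^2$. $\Lambda=\Lambda(r,D)>0$ denotes a number such that, for some $C=C(r,D)>0$, for all $B\in\mathcal{C}_{\alpha,D}$, $(V_{\rm in},V_{\rm out})\in\mathcal{F}_{r,U}$ and $\lambda\in[0,\Lambda]$, the boundary-value problem with flow $\lambda(V_{\rm in},V_{\rm out})$ has a unique weak solution $(u,p)$, and it satisfies $\|\nabla u\|_{L^2(\Omega)}<\mathcal{S}_0(\Omega)$ and $\|\nabla u\|_{L^2(\Omega)}\le C\lambda$ (such $\Lambda$ exists). $C([0,\Lambda])$ carries the sup norm. *)

theory Defs
  imports "HOL-Analysis.Analysis" "HOL-Probability.Essential_Supremum"
begin

section \<open>Function spaces\<close>

subsection \<open>Smooth functions and test functions\<close>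

primrec cont_diff :: "nat \<Rightarrow> ('a::euclidean_space \<Rightarrow> 'b::real_normed_vector) \<Rightarrow> bool" where
  "cont_diff 0 f \<longleftrightarrow> continuous_on UNIV f"
| "cont_diff (Suc k) f \<longleftrightarrow>
     (\<forall>x. f differentiable (at x)) \<and>
     (\<forall>b\<in>Basis. cont_diff k (\<lambda>x. frechet_derivative f (at x) b))"

definition smooth :: "('a::euclidean_space \<Rightarrow> 'b::real_normed_vector) \<Rightarrow> bool" where
  "smooth f \<longleftrightarrow> (\<forall>k. cont_diff k f)"

definition test_functions :: "'a::euclidean_space set \<Rightarrow> ('a \<Rightarrow> 'b::real_normed_vector) set" where
  "test_functions S =
     {\<phi>. smooth \<phi> \<and> compact (closure {x. \<phi> x \<noteq> 0}) \<and> closure {x. \<phi> x \<noteq> 0} \<subseteq> S}"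

subsection \<open>Lebesgue spaces\<close>

text \<open>Elements of all function spaces below are representatives; equality of elements is
  equality almost everywhere.\<close>

definition Lp_space :: "nat \<Rightarrow> 'a::euclidean_space set \<Rightarrow> ('a \<Rightarrow> 'b::euclidean_space) set" where
  "Lp_space p S = {f. f \<in> borel_measurable (lebesgue_on S) \<and>
                      integrable (lebesgue_on S) (\<lambda>x. norm (f x) ^ p)}"

definition Lp_norm :: "nat \<Rightarrow> 'a::euclidean_space set \<Rightarrow> ('a \<Rightarrow> 'b::euclidean_space) \<Rightarrow> real" where
  "Lp_norm p S f = root p (LINT x:S|lebesgue. norm (f x) ^ p)"

definition Linf_norm :: "'a::euclidean_space set \<Rightarrow> ('a \<Rightarrow> 'b::euclidean_space) \<Rightarrow> ereal" where
  "Linf_norm S f = esssup (lebesgue_on S) (\<lambda>x. ereal (norm (f x)))"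

subsection \<open>Weak derivatives and Sobolev spaces\<close>

definition locally_integrable ::
    "'a::euclidean_space set \<Rightarrow> ('a \<Rightarrow> 'b::euclidean_space) \<Rightarrow> bool" where
  "locally_integrable S f \<longleftrightarrow> (\<forall>K. compact K \<and> K \<subseteq> S \<longrightarrow> set_integrable lebesgue K f)"

definition has_weak_deriv ::
    "'a::euclidean_space set \<Rightarrow> 'a \<Rightarrow> ('a \<Rightarrow> 'b::euclidean_space) \<Rightarrow> ('a \<Rightarrow> 'b) \<Rightarrow> bool" where
  "has_weak_deriv S b f g \<longleftrightarrow>
     locally_integrable S f \<and> locally_integrable S g \<and>
     (\<forall>\<phi> :: 'a \<Rightarrow> real. \<phi> \<in> test_functions S \<longrightarrow>
        (LINT x:S|lebesgue. frechet_derivative \<phi> (at x) b *\<^sub>R f x)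
        = - (LINT x:S|lebesgue. \<phi> x *\<^sub>R g x))"

text \<open>For open \<open>S\<close> the weak derivative is determined up to a null set; \<open>weak_deriv\<close> picks one
  representative.\<close>

definition weak_deriv ::
    "'a::euclidean_space set \<Rightarrow> 'a \<Rightarrow> ('a \<Rightarrow> 'b::euclidean_space) \<Rightarrow> 'a \<Rightarrow> 'b" where
  "weak_deriv S b f = (SOME g. has_weak_deriv S b f g)"

definition H1 :: "'a::euclidean_space set \<Rightarrow> ('a \<Rightarrow> 'b::euclidean_space) set" where
  "H1 S = {f. f \<in> Lp_space 2 S \<and>
              (\<forall>b\<in>Basis. \<exists>g. has_weak_deriv S b f g \<and> g \<in> Lp_space 2 S)}"

definition H1_norm :: "'a::euclidean_space set \<Rightarrow> ('a \<Rightarrow> 'b::euclidean_space) \<Rightarrow> real" where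
  "H1_norm S f = sqrt ((Lp_norm 2 S f)\<^sup>2 + (\<Sum>b\<in>Basis. (Lp_norm 2 S (weak_deriv S b f))\<^sup>2))"

definition H10 :: "'a::euclidean_space set \<Rightarrow> ('a \<Rightarrow> 'b::euclidean_space) set" where
  "H10 S = {f \<in> H1 S. \<exists>\<phi>. (\<forall>n. \<phi> n \<in> test_functions S) \<and>
                          (\<lambda>n. H1_norm S (\<lambda>x. f x - \<phi> n x)) \<longlonglongrightarrow> 0}"

subsection \<open>Boundary traces\<close>

definition hausdorff1_outer :: "'a::euclidean_space set \<Rightarrow> ennreal" where
  "hausdorff1_outer A =
     (SUP \<delta>\<in>{0<..}. INF C\<in>{C :: nat \<Rightarrow> 'a set. A \<subseteq> (\<Union>i. C i) \<and>
                                   (\<forall>i. bounded (C i) \<and> diameter (C i) \<le> \<delta>)}.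
        \<Sum>i. ennreal (diameter (C i)))"

text \<open>One-dimensional Hausdorff measure, i.e. arc length on rectifiable curves. The outer measure
  is a metric outer measure, so it is countably additive on Borel sets and \<open>measure_of\<close>
  does not degenerate.\<close>

definition hausdorff1 :: "'a::euclidean_space measure" where
  "hausdorff1 = measure_of UNIV (sets borel) hausdorff1_outer"

text \<open>The graph of the trace operator from \<open>H1 S\<close> to the square-integrable functions on the
  boundary of a bounded planar Lipschitz domain \<open>S\<close>: the continuous extension of the
  restriction map, defined on the functions that are smooth up to the boundary.\<close>

definition has_trace :: "(real^2) set \<Rightarrow> (real^2 \<Rightarrow> real^2) \<Rightarrow> (real^2 \<Rightarrow> real^2) \<Rightarrow> bool" where
  "has_trace S u g \<longleftrightarrow>
     u \<in> H1 S \<and> g \<in> borel_measurable borel \<and>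
     (\<exists>v. (\<forall>n. smooth (v n)) \<and>
          (\<lambda>n. H1_norm S (\<lambda>x. u x - v n x)) \<longlonglongrightarrow> 0 \<and>
          (\<lambda>n. \<integral>\<^sup>+x\<in>frontier S. ennreal ((norm (v n x - g x))\<^sup>2) \<partial>hausdorff1) \<longlonglongrightarrow> 0)"

subsection \<open>Planar vector fields\<close>

abbreviation e1 :: "real^2" where "e1 \<equiv> axis 1 1"
abbreviation e2 :: "real^2" where "e2 \<equiv> axis 2 1"

text \<open>The entry in row \<open>i\<close> and column \<open>j\<close> is the \<open>j\<close>-th derivative of the \<open>i\<close>-th component. The
  inner product and the norm of \<open>real^2^2\<close> are the Frobenius ones.\<close>

definition grad :: "(real^2) set \<Rightarrow> (real^2 \<Rightarrow> real^2) \<Rightarrow> real^2 \<Rightarrow> real^2^2" where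
  "grad S u x = (\<chi> i j. weak_deriv S (axis j 1) u x $ i)"

definition divergence :: "(real^2) set \<Rightarrow> (real^2 \<Rightarrow> real^2) \<Rightarrow> real^2 \<Rightarrow> real" where
  "divergence S u x = trace (grad S u x)"

definition convection :: "(real^2) set \<Rightarrow> (real^2 \<Rightarrow> real^2) \<Rightarrow> real^2 \<Rightarrow> real^2" where
  "convection S u x = grad S u x *v u x"

text \<open>The infimum is attained (compact embedding into the fourth-power integrable functions), and
  the scalar version of the quotient has the same minimum.\<close>

definition S0 :: "(real^2) set \<Rightarrow> real" where
  "S0 S = (INF u \<in> {u \<in> H10 S. \<not> (AE x in lebesgue_on S. u x = 0)}.
             (Lp_norm 2 S (grad S u))\<^sup>2 / (Lp_norm 4 S u)\<^sup>2)"

section \<open>Geometry and flow shapes\<close>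

definition channel :: "real \<Rightarrow> real \<Rightarrow> (real^2) set" where
  "channel L H = {x. -L < x$1 \<and> x$1 < L \<and> -H < x$2 \<and> x$2 < H}"

definition side_b :: "real \<Rightarrow> real \<Rightarrow> (real^2) set" where
  "side_b L H = {x. x$2 = -H \<and> -L \<le> x$1 \<and> x$1 \<le> L}"

definition side_t :: "real \<Rightarrow> real \<Rightarrow> (real^2) set" where
  "side_t L H = {x. x$2 = H \<and> -L \<le> x$1 \<and> x$1 \<le> L}"

definition side_l :: "real \<Rightarrow> real \<Rightarrow> (real^2) set" where
  "side_l L H = {x. x$1 = -L \<and> -H \<le> x$2 \<and> x$2 \<le> H}"

definition side_r :: "real \<Rightarrow> real \<Rightarrow> (real^2) set" where
  "side_r L H = {x. x$1 = L \<and> -H \<le> x$2 \<and> x$2 \<le> H}"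

definition homothetic_closed_rectangle :: "real \<Rightarrow> real \<Rightarrow> (real^2) set \<Rightarrow> bool" where
  "homothetic_closed_rectangle L H D \<longleftrightarrow>
     (\<exists>c s. s > 0 \<and> D = (\<lambda>x. c + s *\<^sub>R x) ` closure (channel L H))"

definition bodies :: "real \<Rightarrow> (real^2) set \<Rightarrow> (real^2) set set" where
  "bodies \<alpha> D = {B. B \<noteq> {} \<and> compact B \<and> convex B \<and> B \<subseteq> D \<and> measure lebesgue B = \<alpha>}"

text \<open>Elements of \<open>W1inf H\<close> are given by their representatives that are continuous on the closed
  interval, so that the values at the end points make sense.\<close>

definition W1inf_norm :: "real \<Rightarrow> (real \<Rightarrow> real) \<Rightarrow> ereal" where
  "W1inf_norm H V = Linf_norm {-H<..<H} V + Linf_norm {-H<..<H} (weak_deriv {-H<..<H} 1 V)"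

definition W1inf :: "real \<Rightarrow> (real \<Rightarrow> real) set" where
  "W1inf H = {V. continuous_on {-H..H} V \<and> (\<exists>g. has_weak_deriv {-H<..<H} 1 V g) \<and>
                 W1inf_norm H V < \<infinity>}"

definition flow_shapes :: "real \<Rightarrow> real \<Rightarrow> real \<Rightarrow> ((real \<Rightarrow> real) \<times> (real \<Rightarrow> real)) set" where
  "flow_shapes H r U =
     {(Vin, Vout). Vin \<in> W1inf H \<and> Vout \<in> W1inf H \<and>
        W1inf_norm H Vin + W1inf_norm H Vout \<le> ereal r \<and>
        Vin (-H) = 0 \<and> Vout (-H) = 0 \<and> Vin H = U \<and> Vout H = U \<and>
        (LINT y:{-H<..<H}|lebesgue. Vin y) = 1 \<and> (LINT y:{-H<..<H}|lebesgue. Vout y) = 1}"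

text \<open>Weak-star convergence of bounded functions and of their weak derivatives, tested against
  integrable functions.\<close>

definition weak_star_Linf ::
    "real set \<Rightarrow> ('i \<Rightarrow> real \<Rightarrow> real) \<Rightarrow> (real \<Rightarrow> real) \<Rightarrow> 'i filter \<Rightarrow> bool" where
  "weak_star_Linf I V W F \<longleftrightarrow>
     (\<forall>g :: real \<Rightarrow> real. set_integrable lebesgue I g \<longrightarrow>
        ((\<lambda>i. LINT y:I|lebesgue. V i y * g y) \<longlongrightarrow> (LINT y:I|lebesgue. W y * g y)) F)"

definition weak_star_W1inf ::
    "real \<Rightarrow> ('i \<Rightarrow> real \<Rightarrow> real) \<Rightarrow> (real \<Rightarrow> real) \<Rightarrow> 'i filter \<Rightarrow> bool" where
  "weak_star_W1inf H V W F \<longleftrightarrow>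
     weak_star_Linf {-H<..<H} V W F \<and>
     weak_star_Linf {-H<..<H} (\<lambda>i. weak_deriv {-H<..<H} 1 (V i)) (weak_deriv {-H<..<H} 1 W) F"

section \<open>The boundary-value problem\<close>

definition H1_star :: "real \<Rightarrow> real \<Rightarrow> (real^2) set \<Rightarrow> (real^2 \<Rightarrow> real^2) set" where
  "H1_star L H B = {u \<in> H1 (channel L H - B).
     \<exists>g. has_trace (channel L H - B) u g \<and> (AE x in hausdorff1. x \<in> frontier B \<longrightarrow> g x = 0)}"

definition V_star :: "real \<Rightarrow> real \<Rightarrow> (real^2) set \<Rightarrow> (real^2 \<Rightarrow> real^2) set" where
  "V_star L H B = {u \<in> H1_star L H B.
     AE x in lebesgue_on (channel L H - B). divergence (channel L H - B) u x = 0}"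

definition L20 :: "(real^2) set \<Rightarrow> (real^2 \<Rightarrow> real) set" where
  "L20 S = {p \<in> Lp_space 2 S. (LINT x:S|lebesgue. p x) = 0}"

definition attains_boundary_data ::
    "real \<Rightarrow> real \<Rightarrow> (real^2) set \<Rightarrow> real \<Rightarrow> real \<Rightarrow> (real \<Rightarrow> real) \<Rightarrow> (real \<Rightarrow> real)
      \<Rightarrow> (real^2 \<Rightarrow> real^2) \<Rightarrow> bool" where
  "attains_boundary_data L H B U lam Vin Vout u \<longleftrightarrow>
     (\<exists>g. has_trace (channel L H - B) u g \<and>
        (AE x in hausdorff1.
           (x \<in> frontier B \<longrightarrow> g x = 0) \<and>
           (x \<in> side_b L H \<longrightarrow> g x = 0) \<and>
           (x \<in> side_t L H \<longrightarrow> g x = (lam * U) *\<^sub>R e1) \<and>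
           (x \<in> side_l L H \<longrightarrow> g x = (lam * Vin (x$2)) *\<^sub>R e1) \<and>
           (x \<in> side_r L H \<longrightarrow> g x = (lam * Vout (x$2)) *\<^sub>R e1)))"

definition weak_solution ::
    "real \<Rightarrow> real \<Rightarrow> (real^2) set \<Rightarrow> real \<Rightarrow> real \<Rightarrow> (real \<Rightarrow> real) \<Rightarrow> (real \<Rightarrow> real)
      \<Rightarrow> (real^2 \<Rightarrow> real^2) \<Rightarrow> (real^2 \<Rightarrow> real) \<Rightarrow> bool" where
  "weak_solution L H B U lam Vin Vout u p \<longleftrightarrow>
     (let \<Omega> = channel L H - B in
        u \<in> V_star L H B \<and> p \<in> L20 \<Omega> \<and>
        attains_boundary_data L H B U lam Vin Vout u \<and>
        (\<forall>\<phi> \<in> H10 \<Omega>.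
           (LINT x:\<Omega>|lebesgue. grad \<Omega> u x \<bullet> grad \<Omega> \<phi> x)
         + (LINT x:\<Omega>|lebesgue. convection \<Omega> u x \<bullet> \<phi> x)
         - (LINT x:\<Omega>|lebesgue. p x * divergence \<Omega> \<phi> x) = 0))"

definition has_unique_weak_solution ::
    "real \<Rightarrow> real \<Rightarrow> (real^2) set \<Rightarrow> real \<Rightarrow> real \<Rightarrow> (real \<Rightarrow> real) \<Rightarrow> (real \<Rightarrow> real) \<Rightarrow> bool" where
  "has_unique_weak_solution L H B U lam Vin Vout \<longleftrightarrow>
     (\<exists>u p. weak_solution L H B U lam Vin Vout u p) \<and>
     (\<forall>u p u' p'. weak_solution L H B U lam Vin Vout u p \<and>
                  weak_solution L H B U lam Vin Vout u' p' \<longrightarrow>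
        (AE x in lebesgue_on (channel L H - B). u x = u' x \<and> p x = p' x))"

definition uniqueness_threshold ::
    "real \<Rightarrow> real \<Rightarrow> real \<Rightarrow> (real^2) set \<Rightarrow> real \<Rightarrow> real \<Rightarrow> real \<Rightarrow> bool" where
  "uniqueness_threshold L H r D \<alpha> U \<Lambda> \<longleftrightarrow>
     \<Lambda> > 0 \<and>
     (\<exists>C>0. \<forall>B \<in> bodies \<alpha> D. \<forall>(Vin, Vout) \<in> flow_shapes H r U. \<forall>lam \<in> {0..\<Lambda>}.
        has_unique_weak_solution L H B U lam Vin Vout \<and>
        (\<forall>u p. weak_solution L H B U lam Vin Vout u p \<longrightarrow>
           Lp_norm 2 (channel L H - B) (grad (channel L H - B) u) < S0 (channel L H - B) \<and>
           Lp_norm 2 (channel L H - B) (grad (channel L H - B) u) \<le> C * lam))"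

section \<open>The lift\<close>

definition stress ::
    "(real^2) set \<Rightarrow> (real^2 \<Rightarrow> real^2) \<Rightarrow> (real^2 \<Rightarrow> real) \<Rightarrow> real^2 \<Rightarrow> real^2^2" where
  "stress S u p x = grad S u x + transpose (grad S u x) - p x *\<^sub>R mat 1"

definition cutoff :: "real \<Rightarrow> real \<Rightarrow> (real^2) set \<Rightarrow> (real^2 \<Rightarrow> real) \<Rightarrow> bool" where
  "cutoff L H B \<phi> \<longleftrightarrow> smooth \<phi> \<and>
     (\<exists>N. open N \<and> B \<subseteq> N \<and> (\<forall>x\<in>N. \<phi> x = 1)) \<and>
     (\<exists>N. open N \<and> frontier (channel L H) \<subseteq> N \<and> (\<forall>x\<in>N. \<phi> x = 0))"

text \<open>The vertical component of the pairing of the normal stress with the constant \<open>1\<close> on the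
  boundary of \<open>B\<close> (normal outward with respect to the fluid domain), defined by the generalised
  Green formula with \<open>\<nabla>\<cdot>T = u\<cdot>\<nabla>u\<close>. For weak solutions its right-hand side does not depend on the
  cutoff.\<close>

definition vertical_stress_pairing ::
    "real \<Rightarrow> real \<Rightarrow> (real^2) set \<Rightarrow> (real^2 \<Rightarrow> real^2) \<Rightarrow> (real^2 \<Rightarrow> real) \<Rightarrow> real" where
  "vertical_stress_pairing L H B u p =
     (let \<Omega> = channel L H - B in
      THE s. \<forall>\<phi>. cutoff L H B \<phi> \<longrightarrow>
        s = (LINT x:\<Omega>|lebesgue. stress \<Omega> u p x \<bullet>
                matrix (frechet_derivative (\<lambda>y. \<phi> y *\<^sub>R e2) (at x)))
          + (LINT x:\<Omega>|lebesgue. convection \<Omega> u x \<bullet> (\<phi> x *\<^sub>R e2)))"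

definition lift ::
    "real \<Rightarrow> real \<Rightarrow> (real^2) set \<Rightarrow> (real^2 \<Rightarrow> real^2) \<Rightarrow> (real^2 \<Rightarrow> real) \<Rightarrow> real" where
  "lift L H B u p = - vertical_stress_pairing L H B u p"

text \<open>The norm of the space of continuous functions on a compact interval; only meaningful for
  functions that are continuous there.\<close>

definition C_norm :: "real \<Rightarrow> real \<Rightarrow> (real \<Rightarrow> real) \<Rightarrow> real" where
  "C_norm a b f = (SUP t\<in>{a..b}. \<bar>f t\<bar>)"

end

theory Submission
 imports Defs
begin

text \<open>Two solutions with nearby boundary data differ by a field whose trace is small and Lipschitz
along the sides. A stream function concentrated near the sides extends this trace to a solenoidal
field \<open>w\<close> that is small in \<open>H1\<close>: the only term not controlled by the supremum of the data lives on a
strip of small area. The rest \<open>z\<close> of the difference has zero trace, hence lies in \<open>H10\<close>, because the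
Lipschitz boundary allows cutting off along lines that leave the domain. Testing both equations with
the solenoidal \<open>z\<close> removes the pressure, and \<open>norm (grad u) < S0\<close> absorbs the remaining quadratic term,
so \<open>z\<close> is small as well. Testing with a solenoidal field equal to \<open>e2\<close> near the body expresses the lift
through the velocity alone. Weak-star convergence of the data is uniform convergence, and compactness
of the interval of \<open>\<lambda>\<close> gives the uniform estimate.\<close>

text \<open>The obstacle is that weak-star convergence gives no smallness of the derivatives of the
  data: the derivative of their difference is merely bounded, by \<open>2 * \<Lambda> * r\<close>.
  This fixes the order of the constants. The tolerance comes first; it determines the width of the
  side strips; the width determines the constant in front of the supremum of the data; only then are
  the data required to be close. The flow rate of the difference is \<open>lam' - lam\<close>, which
  need not vanish. It is carried by a parallel flow above the body, so that the corrections near the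
  vertical sides have zero flux and their stream functions vanish on bottom and top. The strict
  bound by \<open>S0\<close> is applied to the unperturbed solution alone: in the expanded
  convection term \<open>grad z\<close> meets the whole perturbed velocity, and that term is zero by
  skew-symmetry. One stability statement, in which \<open>lam\<close> and the flow shapes vary
  together, yields both the continuity of the lifts in \<open>lam\<close> and their
  convergence.\<close>

abbreviation fd where "fd f x \<equiv> frechet_derivative f (at x)"

abbreviation limseq (infix "---->" 60) where "X ----> a \<equiv> X \<longlonglongrightarrow> a"

abbreviation scale (infixr "*R" 75) where "a *R x \<equiv> a *\<^sub>R x"

section \<open>Calculus of smooth functions\<close>

lemma cont_diff_SucI:
 assumes "!!x. (f has_derivative D x) (at x)" "!!b. b : Basis ==> cont_diff k (%x. D x b)"
 shows "cont_diff (Suc k) f"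
proof -
 have "fd f x = D x" for x
 using frechet_derivative_at[OF assms(1)] by simp
 thus ?thesis using assms by (auto simp: differentiable_def)
qed

lemma cont_diff_SucD:
 assumes "cont_diff (Suc k) f"
 shows "(f has_derivative fd f x) (at x)"
 "b : Basis ==> cont_diff k (%x. fd f x b)"
 using assms by (auto simp: frechet_derivative_works[symmetric])

lemma cont_diff_Suc_imp: "cont_diff (Suc k) f ==> cont_diff k f"
proof (induction k arbitrary: f)
 case 0
 thus ?case
 using differentiable_imp_continuous_on[of f UNIV]
 by (auto simp: differentiable_on_def differentiable_at_withinI)
next
 case (Suc k)
 thus ?case by (auto simp del: cont_diff.simps(1))
qed

text \<open>Glues smooth functions. It serves for a test field that is defined by cases and agrees
  near each point with some globally smooth function.\<close>

lemma cont_diff_cong_local: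
 assumes "!!x. \<exists>N g. open N & x : N & cont_diff k g & (\<forall>y\<in>N. f y = g y)"
 shows "cont_diff k f"
 using assms
proof (induction k arbitrary: f)
 case 0
 have "isCont f x" for x
 proof -
 obtain N g where N: "open N" "x : N" "continuous_on UNIV g" "\<forall>y\<in>N. f y = g y"
 using 0[of x] by auto
 hence "isCont g x" by (simp add: continuous_on_eq_continuous_at)
 moreover have "eventually (%y. f y = g y) (nhds x)"
 using N by (auto simp: eventually_nhds)
 ultimately show ?thesis using isCont_cong by blast
 qed
 thus ?case by (simp add: continuous_on_eq_continuous_at)
next
 case (Suc k)
 have *: "\<exists>N g. open N & x : N & cont_diff (Suc k) g &
 (\<forall>y\<in>N. (f has_derivative fd g y) (at y))" for x
 proof -
 obtain N g where N: "open N" "x : N" "cont_diff (Suc k) g" "\<forall>y\<in>N. f y = g y"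
 using Suc.prems[of x] by blast
 have "(f has_derivative fd g y) (at y)" if "y : N" for y
 using has_derivative_transform_within_open[OF cont_diff_SucD(1)[OF N(3), of y] N(1) that]
 N(4) by auto
 thus ?thesis using N by blast
 qed
 have d: "\<forall>x. f differentiable (at x)"
 using * by (metis differentiable_def)
 moreover have "cont_diff k (%x. fd f x b)" if b: "b : Basis" for b
 proof (rule Suc.IH)
 fix x
 obtain N g where N: "open N" "x : N" "cont_diff (Suc k) g"
 "\<forall>y\<in>N. (f has_derivative fd g y) (at y)"
 using * by blast
 show "\<exists>N g. open N & x : N & cont_diff k g & (\<forall>y\<in>N. fd f y b = g y)"
 apply (rule exI[of _ N], rule exI[of _ "%y. fd g y b"])
 using N cont_diff_SucD(2)[OF N(3) b] by (metis frechet_derivative_at)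
 qed
 ultimately show ?case by simp
qed

lemma cont_diff_const: "cont_diff k (%x. c)"
proof (induction k arbitrary: c)
 case (Suc k)
 show ?case by (rule cont_diff_SucI[where D="%x b. 0"]) (use Suc in auto)
qed simp

lemma cont_diff_bounded_linear:
 assumes "bounded_linear L" "cont_diff k f"
 shows "cont_diff k (%x. L (f x))"
 using assms(2)
proof (induction k arbitrary: f)
 case 0
 thus ?case
 using bounded_linear.continuous_on[OF assms(1)] by auto
next
 case (Suc k)
 show ?case
 by (rule cont_diff_SucI[where D="%x b. L (fd f x b)"])
 (use Suc cont_diff_SucD[OF Suc.prems] in \<open>auto intro: bounded_linear.has_derivative[OF assms(1)]\<close>)
qed

lemma cont_diff_add:
 "cont_diff k f ==> cont_diff k g ==> cont_diff k (%x. f x + g x)"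
proof (induction k arbitrary: f g)
 case 0
 thus ?case by (auto intro: continuous_on_add)
next
 case (Suc k)
 show ?case
 by (rule cont_diff_SucI[where D="%x b. fd f x b + fd g x b"])
 (use Suc.IH cont_diff_SucD[OF Suc.prems(1)] cont_diff_SucD[OF Suc.prems(2)] in
 \<open>auto intro: has_derivative_add\<close>)
qed

lemma cont_diff_bilinear:
 assumes "bounded_bilinear B"
 shows "cont_diff k f ==> cont_diff k g ==> cont_diff k (%x. B (f x) (g x))"
proof (induction k arbitrary: f g)
 case 0
 thus ?case by (auto intro: bounded_bilinear.continuous_on[OF assms])
next
 case (Suc k)
 show ?case
 proof (rule cont_diff_SucI)
 show "((%x. B (f x) (g x)) has_derivative
 (%b. B (f x) (fd g x b) + B (fd f x b) (g x))) (at x)" for x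
 by (intro bounded_bilinear.FDERIV[OF assms] cont_diff_SucD(1)[OF Suc.prems(1)]
 cont_diff_SucD(1)[OF Suc.prems(2)])
 show "cont_diff k (%x. B (f x) (fd g x b) + B (fd f x b) (g x))"
 if "b : Basis" for b
 by (intro cont_diff_add Suc.IH cont_diff_SucD(2)[OF Suc.prems(1) that]
 cont_diff_SucD(2)[OF Suc.prems(2) that] cont_diff_Suc_imp[OF Suc.prems(1)] cont_diff_Suc_imp[OF Suc.prems(2)])
 qed
qed

lemma smooth_const [intro!, simp]: "smooth (%x. c)"
 by (simp add: smooth_def cont_diff_const)

lemma smooth_bounded_linear: "bounded_linear L ==> smooth f ==> smooth (%x. L (f x))"
 by (simp add: smooth_def cont_diff_bounded_linear)

lemma smooth_add [intro]: "smooth f ==> smooth g ==> smooth (%x. f x + g x)"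
 by (simp add: smooth_def cont_diff_add)

lemma smooth_minus [intro]: "smooth f ==> smooth (%x. - f x)"
 by (rule smooth_bounded_linear[OF bounded_linear_minus[OF bounded_linear_ident]])

lemma smooth_diff [intro]:
 assumes "smooth f" "smooth g" shows "smooth (%x. f x - g x)"
 using smooth_add[OF assms(1) smooth_minus[OF assms(2)]] by simp

lemma smooth_scaleR [intro]: "smooth f ==> smooth g ==> smooth (%x. f x *R g x)"
 by (simp add: smooth_def cont_diff_bilinear[OF bounded_bilinear_scaleR])

lemma smooth_mult [intro]:
 fixes f g :: "'a::euclidean_space => real"
 shows "smooth f ==> smooth g ==> smooth (%x. f x * g x)"
 by (simp add: smooth_def cont_diff_bilinear[OF bounded_bilinear_mult])

lemma smooth_inner [intro]: "smooth f ==> smooth g ==> smooth (%x. f x \<bullet> g x)"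
 by (simp add: smooth_def cont_diff_bilinear[OF bounded_bilinear_inner])

lemma smooth_sum [intro]: "(!!i. i : I ==> smooth (f i)) ==> smooth (%x. \<Sum>i\<in>I. f i x)"
 by (induction I rule: infinite_finite_induct) auto

lemma smooth_prod [intro]:
 fixes f :: "'i => 'a::euclidean_space => real"
 shows "(!!i. i : I ==> smooth (f i)) ==> smooth (%x. \<Prod>i\<in>I. f i x)"
 by (induction I rule: infinite_finite_induct) auto

lemma smooth_ident [intro!, simp]: "smooth (%x. x)"
proof -
 have "cont_diff k (%x::'a. x)" for k
 proof (cases k)
 case (Suc j)
 show ?thesis unfolding Suc
 by (rule cont_diff_SucI[where D="%x b. b"]) (auto simp: cont_diff_const)
 qed simp
 thus ?thesis by (simp add: smooth_def)
qed

lemma smooth_cong_local: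
 assumes "!!x. \<exists>N g. open N & x : N & smooth g & (\<forall>y\<in>N. f y = g y)"
 shows "smooth f"
 unfolding smooth_def
proof
 fix k show "cont_diff k f"
 by (rule cont_diff_cong_local) (metis assms smooth_def)
qed

lemma smooth_has_derivative:
 "smooth f ==> (f has_derivative fd f x) (at x)"
 unfolding smooth_def by (metis cont_diff_SucD(1))

lemma smooth_continuous_on: "smooth f ==> continuous_on S f"
 unfolding smooth_def by (metis cont_diff.simps(1) continuous_on_subset subset_UNIV)

lemma smooth_frechet_Basis: "smooth f ==> b : Basis ==> smooth (%x. fd f x b)"
 unfolding smooth_def by (metis cont_diff.simps(2))

lemma smooth_frechet:
 assumes "smooth f" shows "smooth (%x. fd f x h)"
proof -
 have "fd f x h = (\<Sum>b\<in>Basis. (h \<bullet> b) *R fd f x b)" for x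
 proof -
 interpret bounded_linear "fd f x"
 using smooth_has_derivative[OF assms] has_derivative_bounded_linear by blast
 have "fd f x h = fd f x (\<Sum>b\<in>Basis. (h \<bullet> b) *R b)"
 by (simp add: euclidean_representation)
 thus ?thesis by (simp add: sum scaleR)
 qed
 thus ?thesis using smooth_frechet_Basis[OF assms]
 by (simp only:) (intro smooth_sum smooth_bounded_linear[OF bounded_linear_scaleR_right])
qed

text \<open>The cutoffs, bumps and stream functions below are assembled from one-variable functions
  of affine functionals by sums and products, so this special chain rule takes the place of the
  general one.\<close>

lemma cont_diff_compose_inner:
 fixes h :: "real => 'b::real_normed_vector"
 shows "cont_diff k h ==> cont_diff k (%x::'a::euclidean_space. h (c + x \<bullet> v))"
proof (induction k arbitrary: h)
 case 0
 thus ?case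
 by (auto intro!: continuous_on_compose2[of UNIV h] continuous_intros)
next
 case (Suc k)
 show ?case
 proof (rule cont_diff_SucI)
 fix x :: 'a
 have "(h has_derivative fd h (c + x \<bullet> v)) (at (c + x \<bullet> v))"
 by (rule cont_diff_SucD[OF Suc.prems])
 moreover have "((%x. c + x \<bullet> v) has_derivative (%b. b \<bullet> v)) (at x)"
 by (auto intro!: derivative_eq_intros)
 ultimately show "((%x. h (c + x \<bullet> v)) has_derivative (%b. fd h (c + x \<bullet> v) (b \<bullet> v))) (at x)"
 using has_derivative_compose by blast
 next
 fix b :: 'a assume "b : Basis"
 have "fd h y (b \<bullet> v) = (b \<bullet> v) *R fd h y 1" for y
 proof -
 interpret bounded_linear "fd h y"
 using cont_diff_SucD[OF Suc.prems] has_derivative_bounded_linear by blast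
 show ?thesis using scaleR[of "b \<bullet> v" 1] by simp
 qed
 moreover have "cont_diff k (%y. fd h y 1)"
 using cont_diff_SucD(2)[OF Suc.prems, of 1] by simp
 ultimately show "cont_diff k (%x. fd h (c + x \<bullet> v) (b \<bullet> v))"
 using Suc.IH by (auto intro!: cont_diff_bounded_linear[OF bounded_linear_scaleR_right])
 qed
qed

lemma smooth_compose_inner:
 fixes h :: "real => 'b::real_normed_vector"
 shows "smooth h ==> smooth (%x::'a::euclidean_space. h (c + x \<bullet> v))"
 by (simp add: smooth_def cont_diff_compose_inner)

lemma smooth_real_affine:
 fixes h :: "real => 'b::real_normed_vector"
 shows "smooth h ==> smooth (%t. h (c + t * a))"
 using smooth_compose_inner[of h c a] by simp

lemma smooth_compose_component:
 fixes h :: "real => 'b::real_normed_vector"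
 shows "smooth h ==> smooth (%x::real^'n. h (x $ i))"
 using smooth_compose_inner[of h 0 "axis i (1::real)"] by (simp only: inner_axis inner_real_def mult_1_right add_0)

lemma smooth_real_polynomial_function: "real_polynomial_function f ==> smooth f"
 by (induction rule: real_polynomial_function.induct)
 (auto intro: smooth_bounded_linear smooth_ident)

lemma cont_diff_inverse:
 fixes f :: "'a::euclidean_space => real"
 assumes "!!x. f x ~= 0"
 shows "cont_diff k f ==> cont_diff k (%x. inverse (f x))"
proof (induction k)
 case 0
 thus ?case using assms by (auto intro: continuous_on_inverse)
next
 case (Suc k)
 show ?case
 proof (rule cont_diff_SucI)
 show "((%x. inverse (f x)) has_derivative
 (%b. - (inverse (f x) * fd f x b * inverse (f x)))) (at x)" for x
 by (intro Deriv.has_derivative_inverse[where f=f, OF assms] cont_diff_SucD(1)[OF Suc.prems])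
 have "cont_diff k (%x. inverse (f x))"
 using Suc cont_diff_Suc_imp by blast
 thus "cont_diff k (%x. - (inverse (f x) * fd f x b * inverse (f x)))"
 if "b : Basis" for b
 by (intro cont_diff_bounded_linear[OF bounded_linear_minus[OF bounded_linear_ident]]
 cont_diff_bilinear[OF bounded_bilinear_mult] cont_diff_SucD(2)[OF Suc.prems that])
 qed
qed

text \<open>The flat functions \<open>p (1/x) exp (-1/x)\<close> are closed under differentiation.\<close>

definition flat :: "real poly => real => real" where
 "flat p x = (if x > 0 then poly p (inverse x) * exp (- inverse x) else 0)"

lemma flat_limit: "((%h. poly p (inverse h) * exp (- inverse h)) \<longlongrightarrow> 0) (at_right (0::real))"
proof -
 have "((%y. poly p y * exp (- y)) \<longlongrightarrow> 0) at_top"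
 proof (induction p)
 case 0
 thus ?case by simp
 next
 case (pCons a p)
 have e: "eventually (%y::real. 0 < y) at_top" by (rule eventually_gt_at_top)
 have lim: "((%y::real. y ^ k * exp (-y)) \<longlongrightarrow> 0) at_top" for k
 using tendsto_power_div_exp_0[of k] by (simp add: exp_minus divide_inverse)
 have "((%y. poly q y * exp (-y)) \<longlongrightarrow> 0) at_top" for q :: "real poly"
 proof -
 have "((%y. \<Sum>i\<le>degree q. coeff q i * (y ^ i * exp (-y))) \<longlongrightarrow> (\<Sum>i\<le>degree q. coeff q i * 0)) at_top"
 by (intro tendsto_intros lim)
 thus ?thesis by (simp add: poly_altdef sum_distrib_right mult.assoc)
 qed
 thus ?case .
 qed
 thus ?thesis
 by (rule filterlim_compose) (rule filterlim_inverse_at_top_right)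
qed

text \<open>With \<open>y = 1 / x\<close> the chain rule gives
  \<open>y^2 * (p y - p' y) * exp (- y)\<close>, whose polynomial factor is
  \<open>monom 1 2 * (p - pderiv p)\<close>. At 0 the right difference quotient is the flat function
  of \<open>monom 1 1 * p\<close> and tends to 0.\<close>

lemma flat_has_derivative:
 "(flat p has_real_derivative flat (monom 1 2 * (p - pderiv p)) x) (at x)"
proof -
 consider "x > 0" | "x < 0" | "x = 0" by linarith
 thus ?thesis
 proof cases
 case 1
 have "((%x. poly p (inverse x) * exp (- inverse x)) has_real_derivative
 flat (monom 1 2 * (p - pderiv p)) x) (at x)"
 unfolding flat_def
 using 1 by (auto intro!: derivative_eq_intros poly_DERIV DERIV_chain2[OF poly_DERIV]
 simp: poly_monom field_simps power2_eq_square)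
 thus ?thesis
 proof (rule has_field_derivative_transform_within_open[where S="{0<..}"])
 qed (use 1 in \<open>auto simp: flat_def\<close>)
 next
 case 2
 have "((%x. 0) has_real_derivative 0) (at x)" by simp
 hence "(flat p has_real_derivative 0) (at x)"
 by (rule has_field_derivative_transform_within_open[where S="{..<0}"])
 (use 2 in \<open>auto simp: flat_def\<close>)
 thus ?thesis using 2 by (simp add: flat_def)
 next
 case 3
 have "((%h. (flat p h - flat p 0) / h) \<longlongrightarrow> 0) (at_right 0)"
 proof (rule Lim_transform_eventually)
 show "((%h. poly (monom 1 1 * p) (inverse h) * exp (- inverse h)) \<longlongrightarrow> 0) (at_right (0::real))"
 by (rule flat_limit)
 show "\<forall>\<^sub>F x in at_right 0. poly (monom 1 1 * p) (inverse x) * exp (- inverse x) = (flat p x - flat p 0) / x"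
 using eventually_at_right_less[of "0::real"]
 by eventually_elim (auto simp: flat_def poly_monom field_simps)
 qed
 moreover have "((%h. (flat p h - flat p 0) / h) \<longlongrightarrow> 0) (at_left 0)"
 proof (rule Lim_transform_eventually[OF tendsto_const])
 show "\<forall>\<^sub>F x in at_left 0. 0 = (flat p x - flat p 0) / x"
 by (auto simp: flat_def eventually_at_filter)
 qed
 ultimately have "((%h. (flat p h - flat p 0) / (h - 0)) \<longlongrightarrow> 0) (at 0)"
 by (simp add: filterlim_at_split)
 thus ?thesis using 3 by (simp add: has_field_derivative_iff flat_def)
 qed
qed

lemma smooth_flat: "smooth (flat p)"
proof -
 have "cont_diff k (flat p)" for k
 proof (induction k arbitrary: p)
 case 0
 thus ?case
 using DERIV_isCont[OF flat_has_derivative] by (simp add: continuous_on_eq_continuous_at)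
 next
 case (Suc k)
 show ?case
 proof (rule cont_diff_SucI)
 show "(flat p has_derivative (*) (flat (monom 1 2 * (p - pderiv p)) x)) (at x)" for x
 using flat_has_derivative by (simp add: has_field_derivative_def)
 show "cont_diff k (%x. flat (monom 1 2 * (p - pderiv p)) x * b)" if "b : Basis" for b
 using Suc that by simp
 qed
 qed
 thus ?thesis by (simp add: smooth_def)
qed

text \<open>The usual quotient of flat functions; its denominator is positive because
  \<open>t\<close> and \<open>1 - t\<close> cannot both be nonpositive.\<close>

definition step :: "real => real" where
 "step t = flat 1 t * inverse (flat 1 t + flat 1 (1 - t))"

lemma flat_1_sum_pos: "flat 1 t + flat 1 (1 - t) > 0"
 by (simp add: flat_def add_pos_pos)

lemma smooth_step: "smooth step"
proof -
 have "smooth (%t. flat 1 (1 - t))"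
 using smooth_real_affine[OF smooth_flat, of 1 1 "-1"] by simp
 hence "smooth (%t. flat 1 t + flat 1 (1 - t))"
 by (rule smooth_add[OF smooth_flat])
 hence "smooth (%t. inverse (flat 1 t + flat 1 (1 - t)))"
 using flat_1_sum_pos by (auto simp: smooth_def intro!: cont_diff_inverse) (metis less_irrefl)
 thus ?thesis unfolding step_def[abs_def] by (rule smooth_mult[OF smooth_flat])
qed

lemma step_le_0 [simp]: "t <= 0 ==> step t = 0"
 by (simp add: step_def flat_def)

lemma step_ge_1 [simp]: "t >= 1 ==> step t = 1"
 by (simp add: step_def flat_def)

lemma step_bounds: "0 <= step t" "step t <= 1"
proof -
 have "flat 1 s >= 0" for s by (simp add: flat_def)
 thus "0 <= step t" "step t <= 1"
 using flat_1_sum_pos[of t] unfolding step_def by (auto simp: field_simps)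
qed

section \<open>Square-integrable functions\<close>

definition sq_integrable :: "'a measure => ('a => 'b::euclidean_space) => bool" where
 "sq_integrable M f \<longleftrightarrow> f : borel_measurable M & integrable M (%x. (norm (f x))^2)"

text \<open>The Bochner integral of a nonintegrable function is 0, so the value has its meaning only
  together with \<open>sq_integrable\<close>. On \<open>lebesgue_on S\<close> it is
  \<open>Lp_norm 2 S\<close>, by \<open>Lp_norm_2\<close>.\<close>

definition L2n :: "'a measure => ('a => 'b::euclidean_space) => real" where
 "L2n M f = sqrt (LINT x|M. (norm (f x))^2)"

lemma L2n_nonneg [simp]: "0 <= L2n M f"
 by (simp add: L2n_def)

lemma L2n_sq: "(L2n M f)^2 = (LINT x|M. (norm (f x))^2)"
 by (simp add: L2n_def)

lemma L2n_norm [simp]: "L2n M (%x. norm (f x)) = L2n M f"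
 by (simp add: L2n_def)

lemma sq_integrable_bound:
 assumes "sq_integrable M f" "g : borel_measurable M" "AE x in M. norm (g x) <= C * norm (f x)"
 shows "sq_integrable M g"
 unfolding sq_integrable_def
proof
 show "integrable M (%x. (norm (g x))^2)"
 proof (rule Bochner_Integration.integrable_bound)
 show "integrable M (%x. C\<^sup>2 * (norm (f x))^2)"
 using assms(1) by (auto simp: sq_integrable_def)
 show "AE x in M. norm ((norm (g x))^2) <= norm (C\<^sup>2 * (norm (f x))^2)"
 using assms(3)
 proof eventually_elim
 case (elim x)
 hence "(norm (g x))^2 <= (C * norm (f x))^2" by (rule power_mono) simp
 thus ?case by (simp add: power_mult_distrib)
 qed
 qed (use assms(2) in simp)
qed (fact assms)

lemma L2n_bound:
 assumes "sq_integrable M f" "AE x in M. norm (g x) <= C * norm (f x)" "C >= 0"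
 shows "L2n M g <= C * L2n M f"
proof -
 have "(LINT x|M. (norm (g x))^2) <= (LINT x|M. C\<^sup>2 * (norm (f x))^2)"
 proof (rule integral_mono_AE')
 show "integrable M (%x. C\<^sup>2 * (norm (f x))^2)"
 using assms(1) by (simp add: sq_integrable_def)
 show "AE x in M. (norm (g x))^2 <= C\<^sup>2 * (norm (f x))^2"
 using assms(2)
 proof eventually_elim
 case (elim x)
 hence "(norm (g x))^2 <= (C * norm (f x))^2" by (rule power_mono) simp
 thus ?case by (simp add: power_mult_distrib)
 qed
 qed auto
 hence "(L2n M g)^2 <= (C * L2n M f)^2"
 by (simp add: L2n_sq power_mult_distrib)
 thus ?thesis
 by (rule power2_le_imp_le) (simp add: assms(3))
qed

lemma sq_integrable_mult:
 assumes "sq_integrable M f" "sq_integrable M g"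
 shows "integrable M (%x. norm (f x) * norm (g x))"
proof (rule Bochner_Integration.integrable_bound)
 show "integrable M (%x. (norm (f x))^2 + (norm (g x))^2)"
 using assms by (auto simp: sq_integrable_def)
 show "AE x in M. norm (norm (f x) * norm (g x)) <= norm ((norm (f x))^2 + (norm (g x))^2)"
 proof (rule AE_I2)
 fix x
 have "2 * (norm (f x) * norm (g x)) <= (norm (f x))^2 + (norm (g x))^2"
 using sum_squares_bound[of "norm (f x)" "norm (g x)"] by simp
 moreover have "0 <= norm (f x) * norm (g x)" by simp
 ultimately show "norm (norm (f x) * norm (g x)) <= norm ((norm (f x))^2 + (norm (g x))^2)"
 unfolding real_norm_def by linarith
 qed
 show "(%x. norm (f x) * norm (g x)) : borel_measurable M"
 using assms unfolding sq_integrable_def by (intro borel_measurable_times) auto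
qed

lemma L2_Cauchy_Schwarz:
 assumes "sq_integrable M f" "sq_integrable M g"
 shows "(LINT x|M. norm (f x) * norm (g x)) <= L2n M f * L2n M g"
proof -
 let ?I = "\<integral>x. norm (f x) * norm (g x) \<partial>M"
 have [measurable]: "f : borel_measurable M" "g : borel_measurable M"
 using assms by (auto simp: sq_integrable_def)
 have "(nn_integral M (%x. ennreal (norm (f x)) * ennreal (norm (g x))))^2 <=
 (nn_integral M (%x. (ennreal (norm (f x)))^2)) * (nn_integral M (%x. (ennreal (norm (g x)))^2))"
 by (rule Cauchy_Schwarz_nn_integral) auto
 hence "(nn_integral M (%x. ennreal (norm (f x) * norm (g x))))^2 <=
 (nn_integral M (%x. ennreal ((norm (f x))^2))) * (nn_integral M (%x. ennreal ((norm (g x))^2)))"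
 by (simp add: ennreal_mult'' ennreal_power)
 also have "(nn_integral M (%x. ennreal ((norm (f x))^2))) = ennreal ((L2n M f)^2)"
 using assms by (subst nn_integral_eq_integral) (auto simp: sq_integrable_def L2n_sq)
 also have "(nn_integral M (%x. ennreal ((norm (g x))^2))) = ennreal ((L2n M g)^2)"
 using assms by (subst nn_integral_eq_integral) (auto simp: sq_integrable_def L2n_sq)
 also have "(nn_integral M (%x. ennreal (norm (f x) * norm (g x)))) = ennreal ?I"
 using sq_integrable_mult[OF assms] by (intro nn_integral_eq_integral) auto
 finally have "ennreal (?I\<^sup>2) <= ennreal ((L2n M f * L2n M g)^2)"
 by (simp add: ennreal_power integral_nonneg_AE power_mult_distrib ennreal_mult)
 hence "?I\<^sup>2 <= (L2n M f * L2n M g)^2"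
 by (subst (asm) ennreal_le_iff) auto
 thus ?thesis by (rule power2_le_imp_le) simp
qed

lemma sq_integrable_add:
 assumes "sq_integrable M f" "sq_integrable M g"
 shows "sq_integrable M (%x. f x + g x)"
 unfolding sq_integrable_def
proof
 have [measurable]: "f : borel_measurable M" "g : borel_measurable M"
 using assms by (auto simp: sq_integrable_def)
 show "(%x. f x + g x) : borel_measurable M" by measurable
 show "integrable M (%x. (norm (f x + g x))^2)"
 proof (rule Bochner_Integration.integrable_bound)
 show "integrable M (%x. (norm (f x))^2 + 2 * (norm (f x) * norm (g x)) + (norm (g x))^2)"
 using assms sq_integrable_mult[OF assms] by (auto simp: sq_integrable_def)
 show "AE x in M. norm ((norm (f x + g x))^2) <= norm ((norm (f x))^2 + 2 * (norm (f x) * norm (g x)) + (norm (g x))^2)"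
 proof (rule AE_I2)
 fix x
 have "(norm (f x + g x))^2 <= (norm (f x) + norm (g x))^2"
 by (intro power_mono norm_triangle_ineq) auto
 thus "norm ((norm (f x + g x))^2) <= norm ((norm (f x))^2 + 2 * (norm (f x) * norm (g x)) + (norm (g x))^2)"
 by (simp add: power2_sum)
 qed
 qed measurable
qed

lemma L2n_triangle:
 assumes "sq_integrable M f" "sq_integrable M g"
 shows "L2n M (%x. f x + g x) <= L2n M f + L2n M g"
proof -
 have "(LINT x|M. (norm (f x + g x))^2) <=
 (LINT x|M. (norm (f x))^2 + 2 * (norm (f x) * norm (g x)) + (norm (g x))^2)"
 proof (rule integral_mono)
 show "integrable M (%x. (norm (f x))^2 + 2 * (norm (f x) * norm (g x)) + (norm (g x))^2)"
 using assms sq_integrable_mult[OF assms] by (auto simp: sq_integrable_def)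
 show "integrable M (%x. (norm (f x + g x))^2)"
 using sq_integrable_add[OF assms] by (auto simp: sq_integrable_def)
 fix x
 have "(norm (f x + g x))^2 <= (norm (f x) + norm (g x))^2"
 by (intro power_mono norm_triangle_ineq) auto
 thus "(norm (f x + g x))^2 <= (norm (f x))^2 + 2 * (norm (f x) * norm (g x)) + (norm (g x))^2"
 by (simp add: power2_sum)
 qed
 also have "... = (L2n M f)^2 + 2 * (LINT x|M. norm (f x) * norm (g x)) + (L2n M g)^2"
 using assms sq_integrable_mult[OF assms] by (simp add: sq_integrable_def L2n_sq)
 also have "... <= (L2n M f + L2n M g)^2"
 using L2_Cauchy_Schwarz[OF assms] by (simp add: power2_sum)
 finally have "(L2n M (%x. f x + g x))^2 <= (L2n M f + L2n M g)^2"
 by (simp add: L2n_sq)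
 thus ?thesis by (rule power2_le_imp_le) simp
qed

lemma sq_integrable_norm [simp]:
 "f : borel_measurable M ==> sq_integrable M (%x. norm (f x)) \<longleftrightarrow> sq_integrable M f"
 by (auto simp: sq_integrable_def)

lemma sq_integrable_scaleR: "sq_integrable M f ==> sq_integrable M (%x. c *R f x)"
 by (auto simp: sq_integrable_def power_mult_distrib)

lemma sq_integrable_minus: "sq_integrable M f ==> sq_integrable M (%x. - f x)"
 by (auto simp: sq_integrable_def)

lemma L2n_minus [simp]: "L2n M (%x. - f x) = L2n M f"
 by (simp add: L2n_def)

lemma L2n_minus_commute: "L2n M (%x. f x - g x) = L2n M (%x. g x - f x)"
 by (simp add: L2n_def norm_minus_commute)

lemma sq_integrable_diff:
 assumes "sq_integrable M f" "sq_integrable M g"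
 shows "sq_integrable M (%x. f x - g x)"
 using sq_integrable_add[OF assms(1) sq_integrable_minus[OF assms(2)]] by simp

lemma L2n_triangle_diff:
 assumes "sq_integrable M f" "sq_integrable M g"
 shows "L2n M (%x. f x - g x) <= L2n M f + L2n M g"
 using L2n_triangle[OF assms(1) sq_integrable_minus[OF assms(2)]] by simp

lemma L2n_cong_AE:
 assumes "AE x in M. f x = g x" "f : borel_measurable M" "g : borel_measurable M"
 shows "L2n M f = L2n M g"
proof -
 have "(LINT x|M. (norm (f x))^2) = (LINT x|M. (norm (g x))^2)"
 proof (rule integral_cong_AE)
 show "AE x in M. (norm (f x))^2 = (norm (g x))^2"
 using assms(1) by eventually_elim simp
 qed (use assms in simp_all)
 thus ?thesis by (simp add: L2n_def)
qed

text \<open>One majorant of product form covers inner products, convection terms with a bounded test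
  field and, with a product of two norms as second factor, the trilinear terms.\<close>

lemma L2_product_bound:
 fixes h :: "'a => 'c::euclidean_space"
 assumes "sq_integrable M f" "sq_integrable M g"
 and "h : borel_measurable M" "AE x in M. norm (h x) <= C * (norm (f x) * norm (g x))" "C >= 0"
 shows "integrable M h" "norm (LINT x|M. h x) <= C * (L2n M f * L2n M g)"
proof -
 have i: "integrable M (%x. C * (norm (f x) * norm (g x)))"
 using sq_integrable_mult[OF assms(1,2)] by simp
 show "integrable M h"
 proof (rule Bochner_Integration.integrable_bound[OF i assms(3)])
 show "AE x in M. norm (h x) <= norm (C * (norm (f x) * norm (g x)))"
 using assms(4) by eventually_elim simp
 qed
 have "norm (LINT x|M. h x) <= (LINT x|M. norm (h x))"
 by (rule integral_norm_bound)
 also have "... <= (LINT x|M. C * (norm (f x) * norm (g x)))"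
 by (rule integral_mono_AE) (use \<open>integrable M h\<close> i assms(4) in auto)
 also have "... <= C * (L2n M f * L2n M g)"
 using L2_Cauchy_Schwarz[OF assms(1,2)] assms(5) by (simp add: mult_left_mono)
 finally show "norm (LINT x|M. h x) <= C * (L2n M f * L2n M g)" .
qed

lemma L2_inner_bound:
 assumes "sq_integrable M f" "sq_integrable M g"
 shows "integrable M (%x. f x \<bullet> g x)" "(abs (\<integral>x. f x \<bullet> g x \<partial>M)) <= L2n M f * L2n M g"
proof -
 have m: "(%x. f x \<bullet> g x) : borel_measurable M"
 using assms by (auto simp: sq_integrable_def)
 have b: "AE x in M. norm (f x \<bullet> g x) <= 1 * (norm (f x) * norm (g x))"
 by (simp add: Cauchy_Schwarz_ineq2)
 show "integrable M (%x. f x \<bullet> g x)"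
 by (rule L2_product_bound(1)[OF assms m b zero_le_one])
 show "(abs (\<integral>x. f x \<bullet> g x \<partial>M)) <= L2n M f * L2n M g"
 using L2_product_bound(2)[OF assms m b zero_le_one] by simp
qed

lemma sq_integrable_imp_integrable:
 assumes "finite_measure M" "sq_integrable M f" shows "integrable M f"
proof (rule Bochner_Integration.integrable_bound)
 interpret finite_measure M by fact
 show "integrable M (%x. 1 + (norm (f x))^2)"
 using assms(2) by (auto simp: sq_integrable_def)
 show "AE x in M. norm (f x) <= norm (1 + (norm (f x))^2)"
 proof (rule AE_I2)
 fix x
 have "0 <= (norm (f x) - 1)^2" by simp
 hence "2 * norm (f x) <= 1 + (norm (f x))^2" by (simp add: power2_diff)
 hence "norm (f x) <= 1 + (norm (f x))^2"
 using norm_ge_zero[of "f x"] by linarith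
 thus "norm (f x) <= norm (1 + (norm (f x))^2)"
 by (simp add: abs_of_nonneg add_nonneg_nonneg)
 qed
 show "f : borel_measurable M" using assms(2) by (simp add: sq_integrable_def)
qed

lemma sq_integrable_bounded:
 assumes "finite_measure M" "f : borel_measurable M" "AE x in M. norm (f x) <= C"
 shows "sq_integrable M f" "(L2n M f)^2 <= C\<^sup>2 * measure M (space M)"
proof -
 interpret finite_measure M by fact
 have *: "AE x in M. (norm (f x))^2 <= C\<^sup>2"
 using assms(3) by eventually_elim (auto intro: power_mono)
 show sq: "sq_integrable M f"
 unfolding sq_integrable_def
 proof
 show "integrable M (%x. (norm (f x))^2)"
 by (rule integrable_const_bound[where B="C\<^sup>2"]) (use assms(2) * in auto)
 qed fact
 have "(LINT x|M. (norm (f x))^2) <= (LINT x|M. C\<^sup>2)"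
 by (rule integral_mono_AE) (use sq * in \<open>auto simp: sq_integrable_def\<close>)
 thus "(L2n M f)^2 <= C\<^sup>2 * measure M (space M)"
 by (simp add: L2n_sq mult.commute)
qed

lemma tendsto_L2n_dominated:
 assumes "!!n. f n : borel_measurable M" "sq_integrable M w"
 and "!!n. AE x in M. norm (f n x) <= norm (w x)"
 and "AE x in M. (%n. f n x) ----> 0"
 shows "(%n. L2n M (f n)) ----> 0"
proof -
 have "(%n. \<integral>x. (norm (f n x))^2 \<partial>M) ----> (LINT x|M. 0)"
 proof (rule integral_dominated_convergence)
 show "integrable M (%x. (norm (w x))^2)" using assms(2) by (simp add: sq_integrable_def)
 show "AE x in M. (%n. (norm (f n x))^2) ----> 0"
 using assms(4)
 proof eventually_elim
 case (elim x)
 have "(%n. (norm (f n x))^2) ----> (norm (0::'b))^2"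
 by (intro tendsto_intros elim)
 thus ?case by simp
 qed
 show "AE x in M. norm ((norm (f n x))^2) <= (norm (w x))^2" for n
 using assms(3)[of n] by eventually_elim (auto intro: power_mono)
 qed (use assms(1) in auto)
 hence "(%n. sqrt (LINT x|M. (norm (f n x))^2)) ----> sqrt 0"
 by (intro tendsto_real_sqrt) simp
 thus ?thesis by (simp add: L2n_def)
qed

text \<open>Used with \<open>scaleR\<close>: it carries the defining identity of a weak derivative
  over to L2 limits.\<close>

lemma tendsto_integral_L2:
 fixes f :: "nat => 'a => 'b::euclidean_space"
 assumes "bounded_bilinear B" "sq_integrable M g" "!!n. sq_integrable M (f n)" "sq_integrable M f'"
 and "(%n. L2n M (%x. f n x - f' x)) ----> 0"
 shows "(%n. \<integral>x. (B (g x) (f n x) :: 'c::euclidean_space) \<partial>M) ----> (LINT x|M. B (g x) (f' x))"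
proof -
 obtain C where C: "!!a b. norm (B a b) <= norm a * norm b * C" "C > 0"
 using bounded_bilinear.pos_bounded[OF assms(1)] by blast
 have m: "(%x. B (g x) (h x)) : borel_measurable M" if "sq_integrable M h" for h
 proof (rule borel_measurable_continuous_Pair[where H=B])
 show "continuous_on UNIV (%p. B (fst p) (snd p))"
 by (intro bounded_bilinear.continuous_on[OF assms(1)] continuous_intros)
 qed (use that assms(2) in \<open>auto simp: sq_integrable_def\<close>)
 have b: "integrable M (%x. B (g x) (h x))"
 "norm (LINT x|M. B (g x) (h x)) <= C * (L2n M g * L2n M h)" if "sq_integrable M h" for h
 using L2_product_bound[OF assms(2) that m[OF that], of C] C(2)
 AE_I2[of M "%x. norm (B (g x) (h x)) <= C * (norm (g x) * norm (h x))"] C(1)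
 by (simp_all add: mult.commute)
 have "(%n. (LINT x|M. B (g x) (f n x)) - (LINT x|M. B (g x) (f' x))) ----> 0"
 proof (rule Lim_null_comparison)
 show "\<forall>\<^sub>F n in sequentially. norm ((LINT x|M. B (g x) (f n x)) - (LINT x|M. B (g x) (f' x)))
 <= C * (L2n M g * L2n M (%x. f n x - f' x))"
 proof (rule always_eventually, rule allI)
 fix n
 have "(LINT x|M. B (g x) (f n x)) - (LINT x|M. B (g x) (f' x)) = (LINT x|M. B (g x) (f n x - f' x))"
 using b(1)[OF assms(3)[of n]] b(1)[OF assms(4)]
 by (simp add: bounded_bilinear.diff_right[OF assms(1)])
 thus "norm ((LINT x|M. B (g x) (f n x)) - (LINT x|M. B (g x) (f' x)))
 <= C * (L2n M g * L2n M (%x. f n x - f' x))"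
 using b(2)[OF sq_integrable_diff[OF assms(3)[of n] assms(4)]] by simp
 qed
 show "(%n. C * (L2n M g * L2n M (%x. f n x - f' x))) ----> 0"
 using tendsto_mult_left[OF tendsto_mult_left[OF assms(5)], of C "L2n M g"] by simp
 qed
 thus ?thesis by (rule LIM_zero_cancel)
qed

lemma Lp_space_2: "f : Lp_space 2 S \<longleftrightarrow> sq_integrable (lebesgue_on S) f"
 by (simp add: Lp_space_def sq_integrable_def)

lemma LINT_lebesgue_on:
 fixes f :: "'a::euclidean_space => 'b::euclidean_space"
 shows
 "S : sets lebesgue ==> (LINT x:S|lebesgue. f x) = integral\<^sup>L (lebesgue_on S) f"
 by (subst integral_restrict_space) (auto simp: set_lebesgue_integral_def)

lemma set_integrable_lebesgue_on:
 fixes f :: "'a::euclidean_space => 'b::euclidean_space"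
 shows
 "S : sets lebesgue ==> set_integrable lebesgue S f \<longleftrightarrow> integrable (lebesgue_on S) f"
 by (subst integrable_restrict_space) (auto simp: set_integrable_def)

lemma Lp_norm_2: "S : sets lebesgue ==> Lp_norm 2 S f = L2n (lebesgue_on S) f"
 by (simp add: Lp_norm_def L2n_def LINT_lebesgue_on sqrt_def)

section \<open>Test functions and weak derivatives\<close>

lemma test_functionsI:
 assumes "smooth ph" "compact K" "K <= S" "!!x. x ~: K ==> ph x = 0"
 shows "ph : test_functions S"
proof -
 have "closure {x. ph x ~= 0} <= K"
 by (rule closure_minimal) (use assms in \<open>auto simp: compact_imp_closed\<close>)
 moreover from this have "compact (closure {x. ph x ~= 0})"
 using assms(2) by (meson bounded_subset closed_closure compact_eq_bounded_closed)
 ultimately show ?thesis using assms by (auto simp: test_functions_def)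
qed

lemma test_functionsE:
 assumes "ph : test_functions S"
 obtains K where "smooth ph" "compact K" "K <= S" "!!x. x ~: K ==> ph x = 0"
proof
 show "ph x = 0" if "x ~: closure {x. ph x ~= 0}" for x
 using that closure_subset[of "{x. ph x ~= 0}"] by auto
qed (use assms in \<open>auto simp: test_functions_def\<close>)

lemma test_functions_smooth: "ph : test_functions S ==> smooth ph"
 by (simp add: test_functions_def)

lemma test_functions_diff:
 assumes "ph : test_functions S" "ps : test_functions S"
 shows "(%x. ph x - ps x) : test_functions S"
proof -
 obtain K where K: "smooth ph" "compact K" "K <= S" "!!x. x ~: K ==> ph x = 0"
 using test_functionsE[OF assms(1)] by metis
 obtain K' where K': "smooth ps" "compact K'" "K' <= S" "!!x. x ~: K' ==> ps x = 0"
 using test_functionsE[OF assms(2)] by metis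
 show ?thesis
 by (rule test_functionsI[of _ "K \<union> K'"]) (use K K' in auto)
qed

lemma test_functions_bilinear:
 assumes "ph : test_functions S" "bounded_bilinear B" "smooth f"
 shows "(%x. B (ph x) (f x)) : test_functions S"
proof -
 obtain K where K: "smooth ph" "compact K" "K <= S" "!!x. x ~: K ==> ph x = 0"
 using test_functionsE[OF assms(1)] by metis
 show ?thesis
 proof (rule test_functionsI[of _ K])
 show "smooth (%x. B (ph x) (f x))"
 using K(1) assms(3) by (simp add: smooth_def cont_diff_bilinear[OF assms(2)])
 show "B (ph x) (f x) = 0" if "x ~: K" for x
 using K(4)[OF that] by (simp add: bounded_bilinear.zero_left[OF assms(2)])
 qed (use K in auto)
qed

lemma frechet_derivative_outside_support:
 assumes "closed K" "!!x. x ~: K ==> f x = 0" "x ~: K"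
 shows "fd f x h = 0"
proof -
 have "((%x. 0) has_derivative (%h. 0)) (at x)" by simp
 hence "(f has_derivative (%h. 0)) (at x)"
 by (rule has_derivative_transform_within_open[where s="- K"]) (use assms in auto)
 thus ?thesis using frechet_derivative_at by metis
qed

lemma test_functions_frechet:
 assumes "ph : test_functions S"
 shows "(%x. fd ph x h) : test_functions S"
proof -
 obtain K where K: "smooth ph" "compact K" "K <= S" "!!x. x ~: K ==> ph x = 0"
 using test_functionsE[OF assms(1)] by metis
 show ?thesis
 by (rule test_functionsI[of _ K])
 (use K frechet_derivative_outside_support compact_imp_closed smooth_frechet in blast)+
qed

lemma integrable_compact_support:
 fixes f :: "'a::euclidean_space => 'b::euclidean_space"
 assumes "continuous_on UNIV f" "compact K" "!!x. x ~: K ==> f x = 0"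
 shows "integrable lborel f" "integrable lebesgue f"
proof -
 have "integrable lborel (%x. indicator K x *R f x)"
 using borel_integrable_compact[OF assms(2)] continuous_on_subset[OF assms(1)] by blast
 moreover have "(%x. indicator K x *R f x) = f"
 using assms(3) by (auto simp: indicator_def)
 ultimately show "integrable lborel f" by simp
 thus "integrable lebesgue f"
 using integrable_completion[of f lborel] by (simp add: borel_measurable_integrable)
qed

lemma bounded_compact_support:
 fixes f :: "'a::euclidean_space => 'b::real_normed_vector"
 assumes "continuous_on UNIV f" "compact K" "!!x. x ~: K ==> f x = 0"
 obtains C where "C > 0" "!!x. norm (f x) <= C"
proof -
 have "bounded (f ` K)"
 using compact_continuous_image continuous_on_subset assms compact_imp_bounded by (metis subset_UNIV)
 then obtain C where "C > 0" "!!x. x : K ==> norm (f x) <= C"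
 by (auto simp: bounded_pos)
 thus ?thesis using that assms(3) by (metis less_imp_le norm_zero)
qed

lemma lborel_integral_translate:
 fixes f :: "'a::euclidean_space => 'b::euclidean_space"
 assumes "f : borel_measurable borel"
 shows "(LINT x|lborel. f (c + x)) = (LINT x|lborel. f x)"
proof -
 have "(LINT x|lborel. f x) = (\<integral>x. f x \<partial>distr lborel borel ((+) c))"
 by (simp add: lborel_distr_plus)
 also have "... = (LINT x|lborel. f (c + x))"
 by (rule integral_distr) (use assms in auto)
 finally show ?thesis by simp
qed

lemma derivative_along_line:
 assumes "(f has_derivative f') (at (x + t *R b))"
 shows "((%s. f (x + s *R b)) has_derivative (%s. f' (s *R b))) (at t)"
proof -
 have "((%s. x + s *R b) has_derivative (%s. s *R b)) (at t)"
 by (auto intro!: derivative_eq_intros)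
 from has_derivative_compose[OF this assms] show ?thesis .
qed

lemma difference_quotient_tendsto:
 assumes "(f has_derivative f') (at x)"
 shows "(%n. real (Suc n) *R (f (x + (1 / real (Suc n)) *R b) - f x)) ----> f' b"
proof (cases "b = 0")
 case True
 thus ?thesis
 using linear_0[OF bounded_linear.linear[OF has_derivative_bounded_linear[OF assms]]] by simp
next
 case False
 interpret bounded_linear f' using has_derivative_bounded_linear[OF assms] .
 define h where "h n = (1 / real (Suc n)) *R b" for n
 have 0: "(%n. 1 / real (Suc n)) ----> 0"
 using LIMSEQ_Suc[OF lim_1_over_n] by simp
 have "h ----> 0 *R b"
 unfolding h_def[abs_def] by (intro tendsto_scaleR 0 tendsto_const)
 hence "filterlim h (at 0) sequentially"
 using False by (auto simp: filterlim_at h_def)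
 moreover have "((%h. norm (f (x + h) - f x - f' h) / norm h) \<longlongrightarrow> 0) (at 0)"
 using assms by (simp add: has_derivative_at)
 ultimately have "(%n. norm (f (x + h n) - f x - f' (h n)) / norm (h n)) ----> 0"
 by (rule filterlim_compose[rotated])
 hence "(%n. norm (f (x + h n) - f x - f' (h n)) / norm (h n) * norm b) ----> 0 * norm b"
 by (intro tendsto_mult tendsto_const)
 moreover have "norm (f (x + h n) - f x - f' (h n)) / norm (h n) * norm b =
 norm (real (Suc n) *R (f (x + h n) - f x) - f' b)" for n
 proof -
 have "f' b = real (Suc n) *R f' (h n)"
 unfolding h_def by (simp add: scaleR)
 hence "norm (real (Suc n) *R (f (x + h n) - f x) - f' b)
 = real (Suc n) * norm (f (x + h n) - f x - f' (h n))"
 by (simp add: scaleR_right_diff_distrib[symmetric] del: of_nat_Suc)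
 thus ?thesis using False by (simp add: h_def field_simps)
 qed
 ultimately have "(%n. norm (real (Suc n) *R (f (x + h n) - f x) - f' b)) ----> 0" by simp
 thus ?thesis unfolding h_def by (simp add: tendsto_norm_zero_iff LIM_zero_iff)
qed

text \<open>Difference quotients have integral 0 by translation invariance of \<open>lborel\<close>.
  They are bounded by the supremum of the derivative and supported in one common ball, since no step
  is longer than \<open>norm b\<close>, so dominated convergence carries the value 0 over to the
  derivative.\<close>

lemma integral_derivative_compact_support:
 fixes f :: "'a::euclidean_space => 'b::euclidean_space"
 assumes "smooth f" "compact K" "!!x. x ~: K ==> f x = 0"
 shows "(LINT x|lebesgue. fd f x b) = 0"
proof -
 let ?D = "%x. fd f x b"
 have cont: "continuous_on UNIV f" "continuous_on UNIV ?D"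
 using smooth_continuous_on assms(1) smooth_frechet by blast+
 have meas [measurable]: "f : borel_measurable borel" "?D : borel_measurable borel"
 using cont by (auto intro: borel_measurable_continuous_onI)
 have D0: "?D x = 0" if "x ~: K" for x
 using frechet_derivative_outside_support[OF compact_imp_closed[OF assms(2)], of f] assms(3) that by blast
 obtain C where C: "C > 0" "!!x. norm (?D x) <= C"
 using bounded_compact_support[OF cont(2) assms(2) D0] by metis
 obtain R where R: "!!x. x : K ==> norm x <= R"
 using compact_imp_bounded[OF assms(2)] by (auto simp: bounded_iff)
 define F where "F n x = real (Suc n) *R (f (x + (1 / real (Suc n)) *R b) - f x)" for n x
 have f_int: "integrable lborel f"
 using integrable_compact_support[OF cont(1) assms(2,3)] by blast
 have f_tr: "integrable lborel (%x. f (x + c))" "(LINT x|lborel. f (x + c)) = (LINT x|lborel. f x)" for c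
 proof -
 have "integrable (distr lborel borel ((+) c)) f" using f_int by (simp add: lborel_distr_plus)
 thus "integrable lborel (%x. f (x + c))"
 by (subst (asm) integrable_distr_eq) (auto simp: add.commute)
 show "(LINT x|lborel. f (x + c)) = (LINT x|lborel. f x)"
 using lborel_integral_translate[of f c] by (simp add: add.commute)
 qed
 have F0: "(LINT x|lborel. F n x) = 0" for n
 unfolding F_def using f_tr f_int by simp
 have Fb: "norm (F n x) <= C" for n x
 proof -
 let ?h = "1 / real (Suc n)"
 have hpos: "0 < ?h" by simp
 have "\<exists>s\<in>{0<..<?h}. norm (f (x + ?h *R b) - f (x + 0 *R b)) <=
 norm (fd f (x + s *R b) ((?h - 0) *R b))"
 proof (rule mvt_general[OF hpos])
 show "continuous_on {0..?h} (%s. f (x + s *R b))"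
 by (intro continuous_on_compose2[OF cont(1)] continuous_intros) auto
 show "((%s. f (x + s *R b)) has_derivative
 (%t. fd f (x + s *R b) (t *R b))) (at s)" for s
 by (rule derivative_along_line[OF smooth_has_derivative[OF assms(1)]])
 qed
 then obtain s where "norm (f (x + ?h *R b) - f x) <=
 norm (fd f (x + s *R b) (?h *R b))" by auto
 also have "... = ?h * norm (?D (x + s *R b))"
 using linear_scale[OF has_derivative_linear[OF smooth_has_derivative[OF assms(1)]]] by simp
 also have "... <= ?h * C"
 using C(2) by (intro mult_left_mono) auto
 finally show ?thesis
 unfolding F_def norm_scaleR by (simp add: field_simps del: of_nat_Suc)
 qed
 have Fs: "F n x = 0" if "x ~: cball 0 (R + norm b)" for n x
 proof -
 have "norm ((1 / real (Suc n)) *R b) <= norm b"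
 by (simp add: field_simps mult_le_cancel_left1)
 moreover have "norm x <= norm (x + (1 / real (Suc n)) *R b) + norm ((1 / real (Suc n)) *R b)"
 by (metis add_diff_cancel_right' norm_triangle_ineq4)
 ultimately have "R < norm (x + (1 / real (Suc n)) *R b)"
 using that unfolding mem_cball_0 by linarith
 moreover have "R < norm x"
 using that norm_ge_zero[of b] unfolding mem_cball_0 by linarith
 ultimately have "x + (1 / real (Suc n)) *R b ~: K" "x ~: K"
 using R by force+
 thus ?thesis using assms(3) by (simp add: F_def)
 qed
 have "(%n. \<integral>x. F n x \<partial>lborel) ----> (LINT x|lborel. ?D x)"
 proof (rule integral_dominated_convergence)
 show "integrable lborel (%x. indicator (cball 0 (R + norm b)) x *R C)"
 by (rule borel_integrable_compact) auto
 show "AE x in lborel. (%n. F n x) ----> ?D x"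
 unfolding F_def by (intro AE_I2 difference_quotient_tendsto smooth_has_derivative assms(1))
 show "AE x in lborel. norm (F n x) <= indicator (cball 0 (R + norm b)) x *R C" for n
 using Fb Fs by (intro AE_I2) (auto simp: indicator_def)
 show "F n : borel_measurable lborel" for n
 unfolding F_def by measurable
 qed simp
 hence "(LINT x|lborel. ?D x) = 0"
 using F0 LIMSEQ_unique[OF _ tendsto_const] by force
 thus ?thesis
 by (subst integral_completion) auto
qed

lemma LINT_eq_UNIV:
 assumes "!!x. x ~: S ==> f x = 0"
 shows "(LINT x:S|lebesgue. f x) = (LINT x|lebesgue. f x)"
proof -
 have "(%x. indicator S x *R f x) = f"
 using assms by (auto simp: indicator_def)
 thus ?thesis by (simp add: set_lebesgue_integral_def)
qed

lemma locally_integrable_continuous: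
 fixes f :: "'a::euclidean_space => 'b::euclidean_space"
 assumes "continuous_on UNIV f"
 shows "locally_integrable S f"
 unfolding locally_integrable_def
proof (intro allI impI)
 fix K assume K: "compact K & K <= S"
 hence "integrable lborel (%x. indicator K x *R f x)"
 using borel_integrable_compact continuous_on_subset[OF assms] by blast
 thus "set_integrable lebesgue K f"
 unfolding set_integrable_def by (subst integrable_completion) (auto dest: borel_measurable_integrable)
qed

text \<open>Integration by parts: the product of \<open>f\<close> with a test function has compact
  support, so its derivative integrates to 0.\<close>

lemma smooth_has_weak_deriv:
 fixes f :: "'a::euclidean_space => 'b::euclidean_space"
 assumes "smooth f"
 shows "has_weak_deriv S b f (%x. fd f x b)"
 unfolding has_weak_deriv_def
proof (intro conjI allI impI)
 show "locally_integrable S f" "locally_integrable S (%x. fd f x b)"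
 by (intro locally_integrable_continuous smooth_continuous_on smooth_frechet assms)+
 fix ph :: "'a => real" assume ph: "ph : test_functions S"
 obtain K where K: "smooth ph" "compact K" "K <= S" "!!x. x ~: K ==> ph x = 0"
 using test_functionsE[OF ph] by metis
 let ?Dph = "%x. fd ph x b"
 let ?Df = "%x. fd f x b"
 have Dph0: "?Dph x = 0" if "x ~: K" for x
 using frechet_derivative_outside_support[OF compact_imp_closed[OF K(2)], of ph] K(4) that by blast
 have d: "((%x. ph x *R f x) has_derivative
 (%h. ph x *R fd f x h + fd ph x h *R f x)) (at x)" for x
 by (intro bounded_bilinear.FDERIV[OF bounded_bilinear_scaleR] smooth_has_derivative K(1) assms)
 have "(LINT x|lebesgue. fd (%x. ph x *R f x) x b) = 0"
 by (rule integral_derivative_compact_support[OF _ K(2)]) (use K assms in auto)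
 hence *: "(LINT x|lebesgue. ph x *R ?Df x + ?Dph x *R f x) = 0"
 by (simp add: frechet_derivative_at[OF d, symmetric])
 have "integrable lebesgue (%x. ph x *R ?Df x)"
 by (rule integrable_compact_support[OF _ K(2)])
 (auto intro!: smooth_continuous_on smooth_scaleR K(1) assms smooth_frechet simp: K(4))
 moreover have "integrable lebesgue (%x. ?Dph x *R f x)"
 by (rule integrable_compact_support[OF _ K(2)])
 (auto intro!: smooth_continuous_on smooth_scaleR K(1) assms smooth_frechet simp: Dph0)
 ultimately have "(LINT x|lebesgue. ?Dph x *R f x) = - (LINT x|lebesgue. ph x *R ?Df x)"
 using * by (simp add: eq_neg_iff_add_eq_0 add.commute)
 moreover have "(LINT x:S|lebesgue. ?Dph x *R f x) = (LINT x|lebesgue. ?Dph x *R f x)"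
 "(LINT x:S|lebesgue. ph x *R ?Df x) = (LINT x|lebesgue. ph x *R ?Df x)"
 by (rule LINT_eq_UNIV, use K(3,4) Dph0 in \<open>metis scaleR_zero_left subsetD\<close>)+
 ultimately show "(LINT x:S|lebesgue. ?Dph x *R f x) = - (LINT x:S|lebesgue. ph x *R ?Df x)"
 by simp
qed

lemma set_integrable_test_function_scaleR:
 fixes f :: "'a::euclidean_space => 'b::euclidean_space"
 assumes "ph : test_functions S" "locally_integrable S f"
 shows "set_integrable lebesgue S (%x. ph x *R f x)"
proof -
 obtain K where K: "smooth ph" "compact K" "K <= S" "!!x. x ~: K ==> ph x = 0"
 using test_functionsE[OF assms(1)] by metis
 obtain C where C: "C > 0" "!!x. norm (ph x) <= C"
 using bounded_compact_support[OF smooth_continuous_on[OF K(1)] K(2,4)] by metis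
 have i: "integrable lebesgue (%x. indicator K x *R f x)"
 using assms(2) K by (auto simp: locally_integrable_def set_integrable_def)
 have m: "ph : borel_measurable lebesgue"
 using borel_measurable_continuous_onI[OF smooth_continuous_on[OF K(1)]]
 by (intro measurable_completion) simp
 have "integrable lebesgue (%x. ph x *R (indicator K x *R f x))"
 proof (rule Bochner_Integration.integrable_bound)
 show "integrable lebesgue (%x. C *R (indicator K x *R f x))"
 using i by (rule integrable_scaleR_right)
 show "(%x. ph x *R indicator K x *R f x) : borel_measurable lebesgue"
 using m borel_measurable_integrable[OF i] by (rule borel_measurable_scaleR)
 show "AE x in lebesgue. norm (ph x *R indicator K x *R f x) <= norm (C *R indicat_real K x *R f x)"
 using C by (intro AE_I2) (auto simp: indicator_def intro!: mult_right_mono)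
 qed
 moreover have "(%x. ph x *R (indicator K x *R f x)) = (%x. indicator S x *R (ph x *R f x))"
 using K(3,4) by (auto simp: indicator_def fun_eq_iff)
 ultimately show ?thesis by (simp add: set_integrable_def)
qed

lemma locally_integrable_add:
 fixes f g :: "'a::euclidean_space => 'b::euclidean_space"
 shows "locally_integrable S f ==> locally_integrable S g ==> locally_integrable S (%x. f x + g x)"
 by (auto simp: locally_integrable_def intro: set_integral_add)

lemma locally_integrable_bounded_linear:
 fixes f :: "'a::euclidean_space => 'b::euclidean_space" and L :: "'b => 'c::euclidean_space"
 assumes "bounded_linear L" "locally_integrable S f"
 shows "locally_integrable S (%x. L (f x))"
 unfolding locally_integrable_def
proof (intro allI impI)
 fix K assume "compact K & K <= S"
 hence "integrable lebesgue (%x. L (indicator K x *R f x))"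
 using assms(2) integrable_bounded_linear[OF assms(1)] by (auto simp: locally_integrable_def set_integrable_def)
 thus "set_integrable lebesgue K (%x. L (f x))"
 by (simp add: set_integrable_def bounded_linear.linear[OF assms(1)] linear_scale)
qed

lemma has_weak_deriv_add:
 fixes f g :: "'a::euclidean_space => 'b::euclidean_space"
 assumes "has_weak_deriv S b f f'" "has_weak_deriv S b g g'"
 shows "has_weak_deriv S b (%x. f x + g x) (%x. f' x + g' x)"
 using assms unfolding has_weak_deriv_def
 by (auto simp: scaleR_add_right set_integral_add set_integrable_test_function_scaleR
 test_functions_frechet locally_integrable_add)

lemma has_weak_deriv_bounded_linear:
 fixes f :: "'a::euclidean_space => 'b::euclidean_space" and L :: "'b => 'c::euclidean_space"
 assumes "bounded_linear L" "has_weak_deriv S b f f'"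
 shows "has_weak_deriv S b (%x. L (f x)) (%x. L (f' x))"
proof -
 have *: "(LINT x:S|lebesgue. ph x *R L (h x)) = L (LINT x:S|lebesgue. ph x *R h x)"
 if "ph : test_functions S" "locally_integrable S h" for ph h
 proof -
 have "(LINT x|lebesgue. L (indicator S x *R ph x *R h x)) = L (LINT x|lebesgue. indicator S x *R ph x *R h x)"
 using set_integrable_test_function_scaleR[OF that]
 by (intro integral_bounded_linear[OF assms(1)]) (simp add: set_integrable_def)
 thus ?thesis
 by (simp add: set_lebesgue_integral_def bounded_linear.linear[OF assms(1)] linear_scale)
 qed
 have "L (- x) = - L x" for x
 by (simp add: bounded_linear.linear[OF assms(1)] linear_neg)
 with assms show ?thesis unfolding has_weak_deriv_def
 by (auto simp: * test_functions_frechet locally_integrable_bounded_linear)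
qed

lemma has_weak_deriv_diff:
 fixes f g :: "'a::euclidean_space => 'b::euclidean_space"
 assumes "has_weak_deriv S b f f'" "has_weak_deriv S b g g'"
 shows "has_weak_deriv S b (%x. f x - g x) (%x. f' x - g' x)"
 using has_weak_deriv_add[OF assms(1)
 has_weak_deriv_bounded_linear[OF bounded_linear_minus[OF bounded_linear_ident] assms(2)]] by simp

subsection \<open>The fundamental lemma of the calculus of variations\<close>

text \<open>A measurable function is an a.e. limit of continuous ones; clipping at \<open>C\<close>
  keeps the limit and makes them bounded, and Stone-Weierstrass replaces them on \<open>K\<close>
  with error \<open>1 / (n + 1)\<close>. Polynomials are wanted because they are smooth everywhere
  and, in one variable, have polynomial antiderivatives.\<close>

lemma AE_polynomial_approximation:
 fixes f :: "'a::euclidean_space => real"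
 assumes "compact K" "f : borel_measurable lebesgue" "!!x. (abs (f x)) <= C"
 obtains q N where "!!n. real_polynomial_function (q n)" "!!n x. x : K ==> (abs (q n x)) <= C + 1"
 "negligible N" "!!x. x : K ==> x ~: N ==> (%n::nat. q n x) ----> f x"
proof -
 have "f : borel_measurable (lebesgue_on UNIV)"
 using assms(2) by simp
 hence "f measurable_on UNIV"
 by (simp add: measurable_on_iff_borel_measurable)
 then obtain N g where N: "negligible N" and g: "!!n::nat. continuous_on UNIV (g n)"
 and lim: "!!x. x ~: N ==> (%n. g n x) ----> f x"
 by (auto simp: measurable_on_def)
 define h where "h n x = max (- C) (min C (g n x))" for n x
 have C: "C >= 0" using assms(3) order_trans[OF abs_ge_zero] by blast
 have h: "continuous_on K (h n)" for n
 unfolding h_def by (intro continuous_intros continuous_on_subset[OF g]) auto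
 have hb: "(abs (h n x)) <= C" for n x
 using C by (auto simp: h_def)
 have hlim: "(%n. h n x) ----> f x" if "x ~: N" for x
 proof -
 have "(%n. h n x) ----> max (- C) (min C (f x))"
 unfolding h_def by (intro tendsto_intros lim that)
 moreover have "max (- C) (min C (f x)) = f x" using assms(3)[of x] by auto
 ultimately show ?thesis by simp
 qed
 have "\<exists>q. real_polynomial_function q & (\<forall>x\<in>K. (abs (h n x - q x)) < 1 / real (Suc n))" for n
 using Stone_Weierstrass_real_polynomial_function[OF assms(1) h[of n], of "1 / real (Suc n)"]
 by (metis of_nat_0_less_iff zero_less_Suc zero_less_divide_1_iff)
 then obtain q where q: "!!n. real_polynomial_function (q n)"
 "!!n x. x : K ==> (abs (h n x - q n x)) < 1 / real (Suc n)"
 by metis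
 show ?thesis
 proof (rule that[of q N])
 show "(abs (q n x)) <= C + 1" if "x : K" for n x
 proof -
 have "1 / real (Suc n) <= 1" by (simp add: field_simps)
 thus ?thesis using q(2)[OF that, of n] hb[of n x] by linarith
 qed
 show "(%n. q n x) ----> f x" if "x : K" "x ~: N" for x
 proof -
 have "(%n. h n x - q n x) ----> 0"
 proof (rule Lim_null_comparison)
 show "\<forall>\<^sub>F n in sequentially. norm (h n x - q n x) <= 1 / real (Suc n)"
 using q(2)[OF that(1)] by (auto intro!: always_eventually less_imp_le)
 show "(%n. 1 / real (Suc n)) ----> 0"
 using LIMSEQ_Suc[OF lim_1_over_n] by simp
 qed
 from tendsto_diff[OF hlim[OF that(2)] this] show ?thesis by simp
 qed
 qed (use q N in auto)
qed

lemma exists_bump: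
 fixes x :: "'a::euclidean_space"
 assumes "open S" "x : S"
 obtains et :: "'a => real" where "et : test_functions S" "!!y. et y >= 0" "et x > 0"
proof -
 obtain a b where ab: "cbox a b <= S" "x : box a b"
 using open_contains_cbox[OF assms] by (metis (no_types, lifting))
 define et where "et y = (\<Prod>i\<in>Basis. flat 1 (y \<bullet> i - a \<bullet> i) * flat 1 (b \<bullet> i - y \<bullet> i))" for y
 have "smooth et"
 unfolding et_def[abs_def]
 proof (intro smooth_prod smooth_mult)
 fix i :: 'a
 show "smooth (%y. flat 1 (y \<bullet> i - a \<bullet> i))"
 using smooth_compose_inner[OF smooth_flat[of 1], of "- (a \<bullet> i)" i] by (simp add: algebra_simps)
 show "smooth (%y. flat 1 (b \<bullet> i - y \<bullet> i))"
 using smooth_compose_inner[OF smooth_flat[of 1], of "b \<bullet> i" "- i"] by simp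
 qed
 moreover have "et y = 0" if "y ~: cbox a b" for y
 proof -
 have "\<exists>i\<in>Basis. y \<bullet> i < a \<bullet> i \<or> b \<bullet> i < y \<bullet> i"
 using that unfolding mem_box by (meson linorder_not_le)
 then obtain i where "i : Basis" "y \<bullet> i < a \<bullet> i \<or> b \<bullet> i < y \<bullet> i"
 by blast
 thus ?thesis unfolding et_def by (intro prod_zero) (auto simp: flat_def intro!: bexI[of _ i])
 qed
 ultimately have "et : test_functions S"
 using ab(1) by (intro test_functionsI[of _ "cbox a b"]) auto
 moreover have "et y >= 0" for y
 unfolding et_def by (intro prod_nonneg) (auto simp: flat_def)
 moreover have "et x > 0"
 unfolding et_def using ab(2) by (intro prod_pos) (auto simp: flat_def mem_box)
 ultimately show ?thesis using that by blast
qed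

text \<open>Testing with \<open>et\<close> times polynomials that converge boundedly to the sign of
  \<open>g\<close> shows in the limit that \<open>et * abs g\<close> has integral 0; being
  nonnegative it vanishes a.e.\<close>

lemma fundamental_lemma_local:
 fixes g :: "'a::euclidean_space => real" and et :: "'a => real"
 assumes "locally_integrable S g"
 and 0: "!!ph. ph : test_functions S ==> (LINT x:S|lebesgue. ph x *R g x) = 0"
 and et: "et : test_functions S" "!!y. et y >= 0"
 shows "AE y in lebesgue. et y > 0 --> g y = 0"
proof -
 obtain K where K: "smooth et" "compact K" "K <= S" "!!x. x ~: K ==> et x = 0"
 using test_functionsE[OF et(1)] by metis
 obtain C where C: "C > 0" "!!x. norm (et x) <= C"
 using bounded_compact_support[OF smooth_continuous_on[OF K(1)] K(2,4)] by metis
 define G where "G x = indicator K x *R g x" for x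
 have G: "integrable lebesgue G"
 using assms(1) K unfolding G_def by (auto simp: locally_integrable_def set_integrable_def)
 hence Gm [measurable]: "G : borel_measurable lebesgue" by auto
 have "(%x. sgn (G x)) : borel_measurable lebesgue" by measurable
 moreover have "(abs (sgn (G x))) <= 1" for x by (simp add: sgn_if)
 ultimately obtain q N where q: "!!n. real_polynomial_function (q n)"
 "!!n x. x : K ==> (abs (q n x)) <= 1 + 1" "negligible N"
 "!!x. x : K ==> x ~: N ==> (%n::nat. q n x) ----> sgn (G x)"
 using AE_polynomial_approximation[OF K(2)] by metis
 have sm: "smooth (%x. et x * q n x)" for n
 using K(1) smooth_real_polynomial_function[OF q(1)] by blast
 have m [measurable]: "et : borel_measurable lebesgue" "q n : borel_measurable lebesgue" for n
 using smooth_continuous_on[OF K(1)] smooth_continuous_on[OF smooth_real_polynomial_function[OF q(1)]]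
 by (auto intro!: measurable_completion borel_measurable_continuous_onI)
 have "(%n. \<integral>x. et x * q n x * G x \<partial>lebesgue) ----> (LINT x|lebesgue. et x * (abs (G x)))"
 proof (rule integral_dominated_convergence)
 show "integrable lebesgue (%x. 2 * C * (abs (G x)))" using G by auto
 have "AE x in lebesgue. x ~: N"
 using q(3) by (metis AE_not_in negligible_iff_null_sets)
 thus "AE x in lebesgue. (%n. et x * q n x * G x) ----> et x * (abs (G x))"
 proof eventually_elim
 case (elim x)
 show ?case
 proof (cases "x : K")
 case True
 have "(%n. et x * q n x * G x) ----> et x * sgn (G x) * G x"
 by (intro tendsto_intros q(4) True elim)
 thus ?thesis by (simp add: abs_sgn mult_ac)
 qed (simp add: K(4))
 qed
 show "AE x in lebesgue. norm (et x * q n x * G x) <= 2 * C * (abs (G x))" for n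
 proof (rule AE_I2)
 fix x
 show "norm (et x * q n x * G x) <= 2 * C * (abs (G x))"
 proof (cases "x : K")
 case True
 have "(abs (et x)) * (abs (q n x)) <= C * 2"
 using C q(2)[OF True, of n] by (intro mult_mono) auto
 hence "(abs (et x)) * (abs (q n x)) * (abs (G x)) <= C * 2 * (abs (G x))"
 by (rule mult_right_mono) simp
 thus ?thesis by (simp add: abs_mult)
 qed (use C in \<open>simp add: K(4)\<close>)
 qed
 qed measurable
 moreover have "(LINT x|lebesgue. et x * q n x * G x) = 0" for n
 proof -
 have "(LINT x:S|lebesgue. (et x * q n x) *R g x) = 0"
 by (intro 0 test_functionsI[OF sm K(2,3)]) (simp add: K(4))
 also have "(LINT x:S|lebesgue. (et x * q n x) *R g x) = (LINT x|lebesgue. (et x * q n x) *R g x)"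
 by (rule LINT_eq_UNIV) (use K in auto)
 also have "(%x. (et x * q n x) *R g x) = (%x. et x * q n x * G x)"
 using K(4) by (auto simp: G_def indicator_def fun_eq_iff)
 finally show ?thesis .
 qed
 ultimately have "(LINT x|lebesgue. et x * (abs (G x))) = 0"
 using LIMSEQ_unique[OF _ tendsto_const] by force
 moreover have "integrable lebesgue (%x. et x * (abs (G x)))"
 proof (rule Bochner_Integration.integrable_bound)
 show "integrable lebesgue (%x. C * (abs (G x)))" using G by auto
 show "AE x in lebesgue. norm (et x * (abs (G x))) <= norm (C * (abs (G x)))"
 using C by (intro AE_I2) (auto simp: abs_mult intro!: mult_right_mono)
 qed measurable
 ultimately have "AE x in lebesgue. et x * (abs (G x)) = 0"
 using et(2) by (subst (asm) integral_nonneg_eq_0_iff_AE) auto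
 thus ?thesis
 proof eventually_elim
 case (elim x)
 thus ?case using K(4)[of x] by (cases "x : K") (auto simp: G_def)
 qed
qed

lemma fundamental_lemma_real:
 fixes g :: "'a::euclidean_space => real"
 assumes "open S" "locally_integrable S g"
 and "!!ph. ph : test_functions S ==> (LINT x:S|lebesgue. ph x *R g x) = 0"
 shows "AE x in lebesgue. x : S --> g x = 0"
proof -
 have "\<exists>N. open N & x : N & (AE y in lebesgue. y : N --> g y = 0)" if x: "x : S" for x
 proof -
 obtain et :: "'a => real" where et: "et : test_functions S" "!!y. et y >= 0" "et x > 0"
 using exists_bump[OF assms(1) x] by metis
 have "open {y. 0 < et y}"
 using smooth_continuous_on[OF test_functions_smooth[OF et(1)], of UNIV]
 by (intro open_Collect_less) auto
 moreover have "AE y in lebesgue. y : {y. 0 < et y} --> g y = 0"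
 using fundamental_lemma_local[OF assms(2,3) et(1,2)] by simp
 ultimately show ?thesis using et(3) by blast
 qed
 then obtain N where N: "!!x. x : S ==> open (N x) & x : N x & (AE y in lebesgue. y : N x --> g y = 0)"
 by metis
 \<comment> \<open>There is one exceptional null set for each point of \<open>S\<close>; Lindelof
   reduces them to countably many.\<close>
 obtain F where F: "F <= N ` S" "countable F" "\<Union>F = \<Union>(N ` S)"
 using Lindelof[of "N ` S"] N by blast
 have "AE y in lebesgue. \<forall>A\<in>F. y : A --> g y = 0"
 using N F(1) by (subst AE_ball_countable[OF F(2)]) blast
 thus ?thesis
 proof eventually_elim
 case (elim y)
 show ?case
 proof
 assume "y : S"
 hence "y : \<Union>F" using N F(3) by blast
 thus "g y = 0" using elim by blast
 qed
 qed
qed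

lemma weak_deriv_unique:
 fixes f :: "'a::euclidean_space => 'b::euclidean_space"
 assumes "open S" "has_weak_deriv S b f g" "has_weak_deriv S b f g'"
 shows "AE x in lebesgue_on S. g x = g' x"
proof -
 have "AE x in lebesgue. \<forall>i\<in>Basis. x : S --> (g x - g' x) \<bullet> i = 0"
 proof (subst AE_ball_countable, simp add: countable_finite, rule ballI)
 fix i :: 'b
 have d: "has_weak_deriv S b (%x. 0) (%x. (g x - g' x) \<bullet> i)"
 using has_weak_deriv_bounded_linear[OF bounded_linear_inner_left has_weak_deriv_diff[OF assms(2,3)], of i]
 by simp
 show "AE x in lebesgue. x : S --> (g x - g' x) \<bullet> i = 0"
 by (rule fundamental_lemma_real[OF assms(1)]) (use d in \<open>auto simp: has_weak_deriv_def\<close>)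
 qed
 hence "AE x in lebesgue. x : S --> g x = g' x"
 by eventually_elim (auto simp: euclidean_eq_iff[of "g _"] inner_diff_left)
 thus ?thesis
 using assms(1) by (subst AE_restrict_space_iff) (auto simp: lborelD)
qed

lemma has_weak_deriv_weak_deriv:
 "has_weak_deriv S b f g ==> has_weak_deriv S b f (weak_deriv S b f)"
 unfolding weak_deriv_def by (rule someI[of "has_weak_deriv S b f" g])

lemma weak_deriv_eq_AE:
 fixes f :: "'a::euclidean_space => 'b::euclidean_space"
 assumes "open S" "has_weak_deriv S b f g"
 shows "AE x in lebesgue_on S. weak_deriv S b f x = g x"
 using weak_deriv_unique[OF assms(1) has_weak_deriv_weak_deriv[OF assms(2)] assms(2)] .

section \<open>The Sobolev space\<close>

text \<open>\<open>weak_deriv\<close> is an arbitrary representative. Carrying the derivatives as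
  explicit data \<open>D\<close> allows sums, limits and closed formulas to be used as functions;
  \<open>weak_deriv\<close> is compared with \<open>D\<close> only a.e., when a norm or a gradient
  has to be evaluated.\<close>

definition W12 :: "'a::euclidean_space set => ('a => 'b::euclidean_space) => ('a => 'a => 'b) => bool" where
 "W12 S f D \<longleftrightarrow> sq_integrable (lebesgue_on S) f &
 (\<forall>b\<in>Basis. has_weak_deriv S b f (D b) & sq_integrable (lebesgue_on S) (D b))"

lemma open_sets_lebesgue [simp]: "open S ==> S : sets lebesgue"
 by (simp add: lborelD)

lemma W12_sq_integrable: "W12 S f D ==> sq_integrable (lebesgue_on S) f"
 and W12_deriv_sq_integrable: "W12 S f D ==> b : Basis ==> sq_integrable (lebesgue_on S) (D b)"
 and W12_has_weak_deriv: "W12 S f D ==> b : Basis ==> has_weak_deriv S b f (D b)"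
 by (auto simp: W12_def)

lemma borel_measurable_lebesgue_on_AE:
 fixes f g :: "'a::euclidean_space => 'b::euclidean_space"
 assumes "f : borel_measurable (lebesgue_on S)" "AE x in lebesgue_on S. f x = g x" "S : sets lebesgue"
 shows "g : borel_measurable (lebesgue_on S)"
proof -
 have "(%x. if x : S then f x else 0) : borel_measurable lebesgue"
 using assms(1,3) by (subst borel_measurable_if)
 moreover have "AE x in lebesgue. x : S --> f x = g x"
 using assms(2,3) by (subst (asm) AE_restrict_space_iff) auto
 hence "AE x in lebesgue. (if x : S then f x else 0) = (if x : S then g x else 0)"
 by eventually_elim auto
 ultimately have "(%x. if x : S then g x else 0) : borel_measurable lebesgue"
 by (rule borel_measurable_AE)
 thus ?thesis
 using assms(3) by (subst (asm) borel_measurable_if)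
qed

lemma sq_integrable_cong_AE:
 fixes f g :: "'a::euclidean_space => 'b::euclidean_space"
 assumes "sq_integrable (lebesgue_on S) f" "AE x in lebesgue_on S. f x = g x" "S : sets lebesgue"
 shows "sq_integrable (lebesgue_on S) g"
proof (rule sq_integrable_bound[OF assms(1), where C=1])
 show "g : borel_measurable (lebesgue_on S)"
 by (rule borel_measurable_lebesgue_on_AE[OF _ assms(2,3)])
 (use assms(1) in \<open>simp add: sq_integrable_def\<close>)
 show "AE x in lebesgue_on S. norm (g x) <= 1 * norm (f x)"
 using assms(2) by eventually_elim simp
qed

lemma H1_iff: "f : H1 S \<longleftrightarrow> (\<exists>D. W12 S f D)"
proof
 assume "f : H1 S"
 hence "\<forall>b\<in>Basis. \<exists>g. has_weak_deriv S b f g & sq_integrable (lebesgue_on S) g"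
 and "sq_integrable (lebesgue_on S) f"
 by (auto simp: H1_def Lp_space_2)
 thus "\<exists>D. W12 S f D" unfolding W12_def by (metis (no_types, lifting))
next
 show "\<exists>D. W12 S f D ==> f : H1 S"
 by (auto simp: H1_def Lp_space_2 W12_def)
qed

lemma W12_AE: "open S ==> W12 S f D ==> b : Basis ==> AE x in lebesgue_on S. weak_deriv S b f x = D b x"
 using weak_deriv_eq_AE W12_has_weak_deriv by blast

lemma W12_weak_deriv:
 assumes "open S" "W12 S f D"
 shows "W12 S f (%b. weak_deriv S b f)"
 unfolding W12_def
proof (intro conjI ballI)
 fix b :: 'a assume b: "b : Basis"
 show "has_weak_deriv S b f (weak_deriv S b f)"
 by (rule has_weak_deriv_weak_deriv[OF W12_has_weak_deriv[OF assms(2) b]])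
 have "AE x in lebesgue_on S. D b x = weak_deriv S b f x"
 using W12_AE[OF assms b] by eventually_elim simp
 thus "sq_integrable (lebesgue_on S) (weak_deriv S b f)"
 by (rule sq_integrable_cong_AE[OF W12_deriv_sq_integrable[OF assms(2) b]]) (simp add: assms(1))
qed (use assms in \<open>simp add: W12_def\<close>)

lemma sq_integrable_measurable: "sq_integrable M f ==> f : borel_measurable M"
 by (simp add: sq_integrable_def)

lemma H1_norm_W12:
 assumes "open S" "W12 S f D"
 shows "H1_norm S f = sqrt ((L2n (lebesgue_on S) f)^2 + (\<Sum>b\<in>Basis. (L2n (lebesgue_on S) (D b))^2))"
proof -
 have "Lp_norm 2 S (weak_deriv S b f) = L2n (lebesgue_on S) (D b)" if b: "b : Basis" for b
 unfolding Lp_norm_2[OF open_sets_lebesgue[OF assms(1)]]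
 by (rule L2n_cong_AE[OF W12_AE[OF assms b]])
 (use W12_deriv_sq_integrable[OF W12_weak_deriv[OF assms] b] W12_deriv_sq_integrable[OF assms(2) b]
 in \<open>auto simp: sq_integrable_def\<close>)
 thus ?thesis
 unfolding H1_norm_def by (simp add: Lp_norm_2 assms(1))
qed

lemma H1_norm_bounds:
 assumes "open S" "W12 S f D"
 shows "L2n (lebesgue_on S) f <= H1_norm S f"
 and "b : Basis ==> L2n (lebesgue_on S) (D b) <= H1_norm S f"
 and "H1_norm S f <= L2n (lebesgue_on S) f + (\<Sum>b\<in>Basis. L2n (lebesgue_on S) (D b))"
proof -
 let ?M = "lebesgue_on S"
 have s: "0 <= (\<Sum>b\<in>Basis. (L2n ?M (D b))^2)" by (intro sum_nonneg) auto
 show "L2n ?M f <= H1_norm S f"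
 unfolding H1_norm_W12[OF assms] by (rule real_le_rsqrt) (use s in simp)
 show "L2n ?M (D b) <= H1_norm S f" if "b : Basis"
 proof -
 have "(L2n ?M (D b))^2 <= (\<Sum>b\<in>Basis. (L2n ?M (D b))^2)"
 by (rule member_le_sum) (use that in auto)
 thus ?thesis unfolding H1_norm_W12[OF assms]
 by (intro real_le_rsqrt) (smt (verit) zero_le_power2)
 qed
 have "sqrt (\<Sum>b\<in>Basis. (L2n ?M (D b))^2) <= (\<Sum>b\<in>Basis. L2n ?M (D b))"
 using L2_set_le_sum[of Basis "%b. L2n ?M (D b)"] by (simp add: L2_set_def)
 moreover have "H1_norm S f <= sqrt ((L2n ?M f)^2) + sqrt (\<Sum>b\<in>Basis. (L2n ?M (D b))^2)"
 unfolding H1_norm_W12[OF assms] by (rule sqrt_add_le_add_sqrt) (use s in auto)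
 ultimately show "H1_norm S f <= L2n ?M f + (\<Sum>b\<in>Basis. L2n ?M (D b))" by simp
qed

lemma H1_norm_tendsto_0_iff:
 assumes "open S" "!!n. W12 S (f n) (D n)"
 shows "(%n. H1_norm S (f n)) ----> 0 \<longleftrightarrow>
 (%n. L2n (lebesgue_on S) (f n)) ----> 0 & (\<forall>b\<in>Basis. (%n. L2n (lebesgue_on S) (D n b)) ----> 0)"
 (is "?l \<longleftrightarrow> ?r")
proof
 assume l: ?l
 show ?r
 proof (intro conjI ballI)
 show "(%n. L2n (lebesgue_on S) (f n)) ----> 0"
 by (rule Lim_null_comparison[OF _ l]) (simp add: H1_norm_bounds[OF assms])
 show "(%n. L2n (lebesgue_on S) (D n b)) ----> 0" if "b : Basis" for b
 by (rule Lim_null_comparison[OF _ l]) (simp add: H1_norm_bounds(2)[OF assms that])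
 qed
next
 assume r: ?r
 have "(%n. L2n (lebesgue_on S) (f n) + (\<Sum>b\<in>Basis. L2n (lebesgue_on S) (D n b))) ----> 0 + (\<Sum>b\<in>(Basis::'a set). 0)"
 using r by (intro tendsto_add tendsto_sum) auto
 hence "(%n. L2n (lebesgue_on S) (f n) + (\<Sum>b\<in>Basis. L2n (lebesgue_on S) (D n b))) ----> 0" by simp
 moreover have "0 <= H1_norm S (f n)" for n
 using H1_norm_bounds(1)[OF assms] L2n_nonneg order_trans by blast
 ultimately show ?l
 by (intro Lim_null_comparison[where f="%n. H1_norm S (f n)"]) (simp_all add: H1_norm_bounds(3)[OF assms])
qed

lemma W12_add:
 assumes "W12 S f D" "W12 S g E"
 shows "W12 S (%x. f x + g x) (%b x. D b x + E b x)"
 using assms by (auto simp: W12_def intro: sq_integrable_add has_weak_deriv_add)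

lemma W12_diff:
 assumes "W12 S f D" "W12 S g E"
 shows "W12 S (%x. f x - g x) (%b x. D b x - E b x)"
 using assms by (auto simp: W12_def intro: sq_integrable_diff has_weak_deriv_diff)

lemma finite_measure_bounded_lebesgue_on:
 assumes "bounded S" "S : sets lebesgue" shows "finite_measure (lebesgue_on S)"
 using assms by (intro finite_measure_lebesgue_on bounded_set_imp_lmeasurable)

lemma sq_integrable_continuous:
 fixes f :: "'a::euclidean_space => 'b::euclidean_space"
 assumes "continuous_on UNIV f" "bounded S" "S : sets lebesgue"
 shows "sq_integrable (lebesgue_on S) f"
proof -
 have "bounded (f ` closure S)"
 by (intro compact_imp_bounded compact_continuous_image continuous_on_subset[OF assms(1)])
 (use assms(2) in auto)
 then obtain C where C: "!!x. x : closure S ==> norm (f x) <= C"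
 by (auto simp: bounded_iff)
 show ?thesis
 proof (rule sq_integrable_bounded(1)[OF finite_measure_bounded_lebesgue_on[OF assms(2,3)]])
 show "f : borel_measurable (lebesgue_on S)"
 using continuous_imp_measurable_on_sets_lebesgue[OF continuous_on_subset[OF assms(1)] assms(3)] by simp
 show "AE x in lebesgue_on S. norm (f x) <= C"
 using C closure_subset[of S] by (intro AE_I2) (auto simp: space_restrict_space)
 qed
qed

lemma W12_smooth:
 fixes f :: "'a::euclidean_space => 'b::euclidean_space"
 assumes "smooth f" "bounded S" "S : sets lebesgue"
 shows "W12 S f (%b x. fd f x b)"
 unfolding W12_def using assms
 by (auto intro!: sq_integrable_continuous smooth_has_weak_deriv smooth_continuous_on smooth_frechet)

text \<open>The weak derivative is a closed operator: its defining identity survives L2 limits of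
  functions and derivatives. This supplies the weak derivatives of fields whose profiles are merely
  Lipschitz.\<close>

lemma W12_limit:
 fixes f :: "'a::euclidean_space => 'b::euclidean_space"
 assumes "open S" "bounded S" "!!n. W12 S (v n) (E n)"
 and "sq_integrable (lebesgue_on S) f" "!!b. b : Basis ==> sq_integrable (lebesgue_on S) (D b)"
 and lim: "(%n. L2n (lebesgue_on S) (%x. v n x - f x)) ----> 0"
 "!!b. b : Basis ==> (%n. L2n (lebesgue_on S) (%x. E n b x - D b x)) ----> 0"
 shows "W12 S f D"
proof -
 have S: "S : sets lebesgue" using assms(1) by simp
 have loc: "locally_integrable S h" if h: "sq_integrable (lebesgue_on S) h" for h :: "'a => 'b"
 unfolding locally_integrable_def
 proof (intro allI impI)
 fix K assume K: "compact K & K <= S"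
 have "set_integrable lebesgue S h"
 using sq_integrable_imp_integrable[OF finite_measure_bounded_lebesgue_on[OF assms(2) S] h]
 by (simp add: set_integrable_lebesgue_on S)
 thus "set_integrable lebesgue K h"
 by (rule set_integrable_subset) (use K in \<open>auto simp: compact_imp_closed lborelD\<close>)
 qed
 have "has_weak_deriv S b f (D b)" if b: "b : Basis" for b
 unfolding has_weak_deriv_def
 proof (intro conjI allI impI)
 show "locally_integrable S f" "locally_integrable S (D b)"
 using loc assms(4,5) b by blast+
 fix ph :: "'a => real" assume ph: "ph : test_functions S"
 have sq: "sq_integrable (lebesgue_on S) ph"
 "sq_integrable (lebesgue_on S) (%x. fd ph x b)"
 using test_functions_smooth[OF ph] assms(2) S
 by (auto intro!: sq_integrable_continuous smooth_continuous_on smooth_frechet)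
 have 1: "(%n. \<integral>x. fd ph x b *R v n x \<partial>lebesgue_on S)
 ----> (LINT x|lebesgue_on S. fd ph x b *R f x)"
 by (rule tendsto_integral_L2[OF bounded_bilinear_scaleR sq(2) W12_sq_integrable[OF assms(3)] assms(4) lim(1)])
 have 2: "(%n. \<integral>x. ph x *R E n b x \<partial>lebesgue_on S) ----> (LINT x|lebesgue_on S. ph x *R D b x)"
 by (rule tendsto_integral_L2[OF bounded_bilinear_scaleR sq(1) W12_deriv_sq_integrable[OF assms(3) b]
 assms(5)[OF b] lim(2)[OF b]])
 have "(LINT x|lebesgue_on S. fd ph x b *R v n x) = - (LINT x|lebesgue_on S. ph x *R E n b x)" for n
 using W12_has_weak_deriv[OF assms(3) b, of n] ph unfolding has_weak_deriv_def
 by (simp add: LINT_lebesgue_on S)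
 thus "(LINT x:S|lebesgue. fd ph x b *R f x) = - (LINT x:S|lebesgue. ph x *R D b x)"
 using LIMSEQ_unique[OF 1] tendsto_minus[OF 2] by (simp add: LINT_lebesgue_on S)
 qed
 thus ?thesis using assms(4,5) by (simp add: W12_def)
qed

lemma test_function_H10:
 fixes ph :: "'a::euclidean_space => 'b::euclidean_space"
 assumes "ph : test_functions S" "open S" "bounded S"
 shows "ph : H10 S"
proof -
 have W: "W12 S ph (%b x. fd ph x b)"
 using W12_smooth test_functions_smooth assms by (metis open_sets_lebesgue)
 have "H1_norm S (%x. ph x - ph x) = 0"
 unfolding H1_norm_W12[OF assms(2) W12_diff[OF W W]] by (simp add: L2n_def)
 hence "(%n::nat. H1_norm S (%x. ph x - ph x)) ----> 0" by simp
 thus ?thesis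
 unfolding H10_def using W H1_iff assms(1) by (intro CollectI conjI exI[of _ "%n. ph"]) blast+
qed

section \<open>One-dimensional Hausdorff measure\<close>

definition hausdorff1_covers :: "real => 'a::euclidean_space set => (nat => 'a set) set" where
 "hausdorff1_covers de A = {C. A <= (\<Union>i. C i) & (\<forall>i. bounded (C i) & diameter (C i) <= de)}"

definition hausdorff1_pre :: "real => 'a::euclidean_space set => ennreal" where
 "hausdorff1_pre de A = (INF C\<in>hausdorff1_covers de A. \<Sum>i. ennreal (diameter (C i)))"

lemma hausdorff1_outer_alt: "hausdorff1_outer A = (SUP de\<in>{0<..}. hausdorff1_pre de A)"
 by (simp add: hausdorff1_outer_def hausdorff1_pre_def hausdorff1_covers_def)

lemma hausdorff1_pre_le_outer: "de > 0 ==> hausdorff1_pre de A <= hausdorff1_outer A"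
 unfolding hausdorff1_outer_alt by (rule SUP_upper) simp

lemma hausdorff1_pre_le: "C : hausdorff1_covers de A ==> hausdorff1_pre de A <= (\<Sum>i. ennreal (diameter (C i)))"
 unfolding hausdorff1_pre_def by (rule INF_lower)

lemma hausdorff1_pre_antimono: "de <= de' ==> hausdorff1_pre de' A <= hausdorff1_pre de A"
 unfolding hausdorff1_pre_def by (rule INF_superset_mono) (auto simp: hausdorff1_covers_def intro: order_trans)

lemma hausdorff1_pre_approx:
 assumes "hausdorff1_pre de A < top" "e > 0"
 obtains C where "C : hausdorff1_covers de A" "(\<Sum>i. ennreal (diameter (C i))) <= hausdorff1_pre de A + ennreal e"
 using INF_approx_ennreal[OF _ hausdorff1_pre_def[of de A], of e] assms
 by (metis less_imp_le less_irrefl infinity_ennreal_def)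

lemma hausdorff1_outer_empty: "hausdorff1_outer {} = 0"
proof -
 have "hausdorff1_pre de {} = 0" if "de > 0" for de
 using hausdorff1_pre_le[of "%_. {}" de "{}"] that by (simp add: hausdorff1_covers_def)
 thus ?thesis unfolding hausdorff1_outer_alt by (intro antisym SUP_least) auto
qed

lemma hausdorff1_outer_mono: "A <= B ==> hausdorff1_outer A <= hausdorff1_outer B"
 unfolding hausdorff1_outer_alt hausdorff1_pre_def
 by (intro SUP_mono' INF_superset_mono) (auto simp: hausdorff1_covers_def)

lemma hausdorff1_outer_subadditive:
 fixes A :: "nat => 'a::euclidean_space set"
 shows "hausdorff1_outer (\<Union>n. A n) <= (\<Sum>n. hausdorff1_outer (A n))"
 unfolding hausdorff1_outer_alt[of "\<Union>n. A n"]
proof (rule SUP_least)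
 fix de :: real assume de: "de : {0<..}"
 show "hausdorff1_pre de (\<Union>n. A n) <= (\<Sum>n. hausdorff1_outer (A n))"
 proof (rule ennreal_le_epsilon)
 fix e :: real assume e: "0 < e" and fin: "(\<Sum>n. hausdorff1_outer (A n)) < top"
 have "\<exists>C. C : hausdorff1_covers de (A n) &
 (\<Sum>i. ennreal (diameter (C i))) <= hausdorff1_outer (A n) + ennreal (e * (1/2) ^ Suc n)" for n
 proof -
 have "hausdorff1_outer (A n) < top"
 using fin by (metis ennreal_suminf_lessD top_greatest)
 hence "hausdorff1_pre de (A n) < top"
 using hausdorff1_pre_le_outer[of de "A n"] de by (auto intro: le_less_trans)
 moreover have "0 < e * (1/2) ^ Suc n" using e by simp
 ultimately obtain C where "C : hausdorff1_covers de (A n)"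
 "(\<Sum>i. ennreal (diameter (C i))) <= hausdorff1_pre de (A n) + ennreal (e * (1/2) ^ Suc n)"
 by (rule hausdorff1_pre_approx)
 moreover have "hausdorff1_pre de (A n) <= hausdorff1_outer (A n)"
 using de by (intro hausdorff1_pre_le_outer) simp
 ultimately show ?thesis by (meson add_right_mono order_trans)
 qed
 then obtain C where C: "!!n. C n : hausdorff1_covers de (A n)"
 "!!n. (\<Sum>i. ennreal (diameter (C n i))) <= hausdorff1_outer (A n) + ennreal (e * (1/2) ^ Suc n)"
 by metis
 define E where "E k = (case prod_decode k of (n, i) => C n i)" for k
 have "E : hausdorff1_covers de (\<Union>n. A n)"
 unfolding hausdorff1_covers_def
 proof (intro CollectI conjI allI subsetI)
 fix x assume "x : (\<Union>n. A n)"
 then obtain n i where "x : C n i" using C(1) by (fastforce simp: hausdorff1_covers_def)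
 hence "x : E (prod_encode (n, i))" by (simp add: E_def)
 thus "x : (\<Union>k. E k)" by blast
 qed (use C(1) in \<open>auto simp: E_def hausdorff1_covers_def split: prod.split\<close>)
 hence "hausdorff1_pre de (\<Union>n. A n) <= (\<Sum>k. ennreal (diameter (E k)))"
 by (rule hausdorff1_pre_le)
 also have "... = (\<Sum>k. (%p. ennreal (diameter (C (fst p) (snd p)))) (prod_decode k))"
 by (simp add: E_def case_prod_unfold)
 also have "... = (\<Sum>n. \<Sum>i. ennreal (diameter (C n i)))"
 by (rule suminf_ennreal_2dimen) simp
 also have "... <= (\<Sum>n. hausdorff1_outer (A n) + ennreal (e * (1/2) ^ Suc n))"
 by (intro suminf_le C(2)) auto
 also have "... = (\<Sum>n. hausdorff1_outer (A n)) + (\<Sum>n. ennreal (e * (1/2) ^ Suc n))"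
 by (rule suminf_add[symmetric]) auto
 also have "(\<Sum>n. ennreal (e * (1/2) ^ Suc n)) = ennreal (e * 1)"
 using sums_mult[OF power_half_series, of e] e by (intro suminf_ennreal_eq) auto
 finally show "hausdorff1_pre de (\<Union>n. A n) <= (\<Sum>n. hausdorff1_outer (A n)) + ennreal e" by simp
 qed
qed

lemma hausdorff1_outer_subadditive_2: "hausdorff1_outer (A \<union> B) <= hausdorff1_outer A + hausdorff1_outer B"
proof -
 have "hausdorff1_outer (\<Union>n. binaryset A B n) <= (\<Sum>n. hausdorff1_outer (binaryset A B n))"
 by (rule hausdorff1_outer_subadditive)
 also have "... = hausdorff1_outer A + hausdorff1_outer B"
 using binaryset_sums[of hausdorff1_outer A B] hausdorff1_outer_empty by (simp add: sums_iff)
 finally show ?thesis by (simp add: UN_binaryset_eq)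
qed

text \<open>A set of diameter below \<open>r\<close> cannot meet both \<open>A\<close> and
  \<open>B\<close>, so a fine cover of the union splits into a cover of each without using any
  member twice.\<close>

lemma hausdorff1_outer_metric:
 fixes A B :: "'a::euclidean_space set"
 assumes "r > 0" "!!a b. a : A ==> b : B ==> r <= dist a b"
 shows "hausdorff1_outer A + hausdorff1_outer B <= hausdorff1_outer (A \<union> B)"
proof -
 have small: "hausdorff1_pre de A + hausdorff1_pre de B <= hausdorff1_pre de (A \<union> B)" if de: "0 < de" "de < r" for de
 unfolding hausdorff1_pre_def[of de "A \<union> B"]
 proof (rule INF_greatest)
 fix C assume C: "C : hausdorff1_covers de (A \<union> B)"
 define CA CB where "CA i = (if C i \<inter> A ~= {} then C i else {})"
 and "CB i = (if C i \<inter> B ~= {} then C i else {})" for i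
 have "CA : hausdorff1_covers de A" "CB : hausdorff1_covers de B"
 using C de by (auto simp: hausdorff1_covers_def CA_def CB_def) blast+
 hence "hausdorff1_pre de A + hausdorff1_pre de B <=
 (\<Sum>i. ennreal (diameter (CA i))) + (\<Sum>i. ennreal (diameter (CB i)))"
 by (intro add_mono hausdorff1_pre_le)
 also have "... = (\<Sum>i. ennreal (diameter (CA i)) + ennreal (diameter (CB i)))"
 by (rule suminf_add) auto
 also have "... <= (\<Sum>i. ennreal (diameter (C i)))"
 proof (rule suminf_le)
 fix i
 have "\<not> (C i \<inter> A ~= {} & C i \<inter> B ~= {})"
 proof
 assume "C i \<inter> A ~= {} & C i \<inter> B ~= {}"
 then obtain a b where ab: "a : C i" "a : A" "b : C i" "b : B" by blast
 have "dist a b <= diameter (C i)" "diameter (C i) <= de"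
 using C ab by (auto simp: hausdorff1_covers_def intro: diameter_bounded_bound)
 thus False using assms(2)[OF ab(2,4)] de by linarith
 qed
 thus "ennreal (diameter (CA i)) + ennreal (diameter (CB i)) <= ennreal (diameter (C i))"
 by (auto simp: CA_def CB_def)
 qed auto
 finally show "hausdorff1_pre de A + hausdorff1_pre de B <= (\<Sum>i. ennreal (diameter (C i)))" .
 qed
 have *: "hausdorff1_pre de1 A + hausdorff1_pre de2 B <= hausdorff1_outer (A \<union> B)" if "de1 > 0" "de2 > 0" for de1 de2
 proof -
 \<comment> \<open>The two suprema run over independent sizes; both premeasures only grow when their
   sizes shrink to a common one below \<open>r\<close>.\<close>
 define de where "de = min (min de1 de2) (r / 2)"
 have d: "0 < de" "de < r" "de <= de1" "de <= de2" using that assms(1) by (auto simp: de_def)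
 have "hausdorff1_pre de1 A + hausdorff1_pre de2 B <= hausdorff1_pre de A + hausdorff1_pre de B"
 by (intro add_mono hausdorff1_pre_antimono d)
 also have "... <= hausdorff1_pre de (A \<union> B)" by (rule small[OF d(1,2)])
 also have "... <= hausdorff1_outer (A \<union> B)" by (rule hausdorff1_pre_le_outer[OF d(1)])
 finally show ?thesis .
 qed
 have ne: "{0::real<..} ~= {}" by (auto intro: exI[of _ 1])
 have "hausdorff1_pre de1 A + hausdorff1_outer B <= hausdorff1_outer (A \<union> B)" if "de1 > 0" for de1
 unfolding hausdorff1_outer_alt[of B] ennreal_SUP_add_right[OF ne]
 by (rule SUP_least) (use * that in auto)
 thus ?thesis
 unfolding hausdorff1_outer_alt[of A] ennreal_SUP_add_left[OF ne, symmetric]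
 by (intro SUP_least) auto
qed

text \<open>The annuli around a closed set at distances \<open>1/(k+1)\<close>, every second of which are separated,
 show that the outer measure of their tails tends to zero.\<close>

lemma closed_in_hausdorff1_lambda_system:
 fixes F :: "'a::euclidean_space set"
 assumes "closed F"
 shows "hausdorff1_outer (X \<inter> F) + hausdorff1_outer (X - F) <= hausdorff1_outer X"
proof (cases "F = {} \<or> hausdorff1_outer X = top")
 case True
 thus ?thesis by (auto simp: hausdorff1_outer_empty)
next
 case False
 hence ne: "F ~= {}" and fin: "hausdorff1_outer X < top" by (auto simp: less_top)
 let ?d = "%x. infdist x F"
 have sep: "s - t <= dist x y" if "s <= ?d x" "?d y <= t" for x y s t
 using that infdist_triangle[of x F y] by linarith
 define Y where "Y n = {x : X. 1 / real (Suc n) <= ?d x}" for n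
 define R where "R k = {x : X. 1 / real (Suc (Suc k)) <= ?d x & ?d x < 1 / real (Suc k)}" for k
 have inv_mono: "1 / real (Suc m) <= 1 / real (Suc k)" if "k <= m" for k m
 using that by (intro divide_left_mono) auto
 have inv_less: "1 / real (Suc (Suc m)) < 1 / real (Suc m)" for m
 by (intro divide_strict_left_mono) auto
 have alt: "(\<Sum>k<n. hausdorff1_outer (R (2 * k + j))) <= hausdorff1_outer X" for n j
 proof -
 have "(\<Sum>k<n. hausdorff1_outer (R (2 * k + j))) <= hausdorff1_outer (\<Union>k<n. R (2 * k + j))"
 proof (induction n)
 case (Suc n)
 let ?r = "1 / real (Suc (2 * n + j)) "
 have "hausdorff1_outer (\<Union>k<n. R (2 * k + j)) + hausdorff1_outer (R (2 * n + j))
 <= hausdorff1_outer ((\<Union>k<n. R (2 * k + j)) \<union> R (2 * n + j))"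
 proof (cases n)
 case 0
 thus ?thesis by (simp add: hausdorff1_outer_empty)
 next
 case (Suc m)
 \<comment> \<open>The skipped annulus \<open>R (2 * m + j + 1)\<close> provides the gap: earlier
   annuli of the same parity stay at distance at least \<open>s\<close> from \<open>F\<close>, the
   new one at most \<open>t\<close>.\<close>
 define s t where "s = 1 / real (Suc (2 * m + j + 1))" and "t = 1 / real (Suc (2 * m + j + 2))"
 have "s - t > 0" using inv_less[of "2 * m + j + 1"] by (simp add: s_def t_def)
 thus ?thesis
 proof (rule hausdorff1_outer_metric)
 fix a b assume a: "a : (\<Union>k<n. R (2 * k + j))" and b: "b : R (2 * n + j)"
 from a obtain k where k: "k <= m" "a : R (2 * k + j)"
 unfolding Suc by (auto simp: less_Suc_eq_le)
 have "s <= 1 / real (Suc (Suc (2 * k + j)))"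
 using inv_mono[of "Suc (2 * k + j)" "2 * m + j + 1"] k(1) by (simp add: s_def)
 also have "... <= ?d a" using k(2) by (simp add: R_def)
 finally have "s <= ?d a" .
 moreover have "?d b <= t" using b Suc by (simp add: R_def t_def)
 ultimately show "s - t <= dist a b" by (rule sep)
 qed
 qed
 also have "(\<Union>k<n. R (2 * k + j)) \<union> R (2 * n + j) = (\<Union>k<Suc n. R (2 * k + j))"
 by (auto simp: less_Suc_eq)
 finally show ?case using Suc.IH by (simp add: add_right_mono order_trans[OF add_right_mono])
 qed (simp add: hausdorff1_outer_empty)
 also have "... <= hausdorff1_outer X"
 by (rule hausdorff1_outer_mono) (auto simp: R_def)
 finally show ?thesis .
 qed
 have "(\<Sum>k. hausdorff1_outer (R k)) <= 2 * hausdorff1_outer X"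
 proof (rule suminf_le_const)
 fix n
 have "(\<Sum>k<n. hausdorff1_outer (R k)) <= (\<Sum>k<2 * n. hausdorff1_outer (R k))"
 by (rule sum_mono2) auto
 also have "... = (\<Sum>k<n. hausdorff1_outer (R (2 * k + 0))) + (\<Sum>k<n. hausdorff1_outer (R (2 * k + 1)))"
 by (induction n) (auto simp: algebra_simps)
 also have "... <= hausdorff1_outer X + hausdorff1_outer X"
 by (intro add_mono alt)
 finally show "(\<Sum>k<n. hausdorff1_outer (R k)) <= 2 * hausdorff1_outer X" by (simp add: mult_2)
 qed auto
 hence sumfin: "(\<Sum>k. hausdorff1_outer (R k)) ~= top"
 using fin by (auto simp: ennreal_mult_eq_top_iff top_unique)
 have tail: "(%n. \<Sum>k. hausdorff1_outer (R (k + n))) ----> 0"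
 proof -
 define h where "h k = enn2real (hausdorff1_outer (R k))" for k
 have "hausdorff1_outer (R k) < top" for k
 using sumfin by (metis ennreal_suminf_lessD less_top)
 hence h: "hausdorff1_outer (R k) = ennreal (h k)" for k
 by (simp add: h_def)
 have h0: "0 <= h k" for k by (simp add: h_def)
 have "summable h"
 using sumfin unfolding h by (intro summable_suminf_not_top h0)
 hence "(%n. \<Sum>k. h (k + n)) ----> 0" "!!n. summable (%k. h (k + n))"
 by (simp_all add: suminf_exist_split2 summable_iff_shift)
 thus ?thesis
 using tendsto_ennrealI[of "%n. \<Sum>k. h (k + n)" 0] by (simp add: h suminf_ennreal2 h0)
 qed
 \<comment> \<open>Off \<open>F\<close> a point lies in \<open>Y n\<close> or in an annulus of index
   at least \<open>n\<close>. Since \<open>Y n\<close> keeps distance \<open>1 / (n + 1)\<close>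
   from \<open>F\<close>, additivity on separated sets applies and only the tail of annuli is left
   as an error.\<close>
 have main: "hausdorff1_outer (X \<inter> F) + hausdorff1_outer (X - F) <=
 hausdorff1_outer X + (\<Sum>k. hausdorff1_outer (R (k + n)))" for n
 proof -
 have "X - F <= Y n \<union> (\<Union>k. R (k + n))"
 proof
 fix x assume x: "x : X - F"
 hence pos: "0 < ?d x"
 using assms ne by (metis DiffD2 in_closed_iff_infdist_zero infdist_nonneg less_eq_real_def)
 show "x : Y n \<union> (\<Union>k. R (k + n))"
 proof (cases "1 / real (Suc n) <= ?d x")
 case False
 define m where "m = (LEAST m. 1 / real (Suc m) <= ?d x)"
 obtain m0 where "1 / real (Suc m0) < ?d x"
 using nat_approx_posE[OF pos] by metis
 hence m: "1 / real (Suc m) <= ?d x"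
 unfolding m_def by (rule LeastI[where P="%m. 1 / real (Suc m) <= ?d x", OF less_imp_le])
 have "m > n"
 using False m inv_mono[of m n] by (meson not_le order_trans)
 then obtain k where k: "m = Suc (k + n)"
 by (metis add.commute less_iff_Suc_add)
 have "\<not> 1 / real (Suc (k + n)) <= ?d x"
 using not_less_Least[of "k + n" "%m. 1 / real (Suc m) <= ?d x"] k by (simp add: m_def)
 hence "x : R (k + n)" using m x k by (simp add: R_def)
 thus ?thesis by blast
 qed (use x in \<open>simp add: Y_def\<close>)
 qed
 hence "hausdorff1_outer (X - F) <= hausdorff1_outer (Y n) + hausdorff1_outer (\<Union>k. R (k + n))"
 using hausdorff1_outer_mono hausdorff1_outer_subadditive_2 order_trans by metis
 also have "... <= hausdorff1_outer (Y n) + (\<Sum>k. hausdorff1_outer (R (k + n)))"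
 by (intro add_left_mono hausdorff1_outer_subadditive)
 finally have "hausdorff1_outer (X \<inter> F) + hausdorff1_outer (X - F) <=
 (hausdorff1_outer (X \<inter> F) + hausdorff1_outer (Y n)) + (\<Sum>k. hausdorff1_outer (R (k + n)))"
 by (simp add: add.assoc add_left_mono)
 also have "hausdorff1_outer (X \<inter> F) + hausdorff1_outer (Y n) <= hausdorff1_outer (X \<inter> F \<union> Y n)"
 proof (rule hausdorff1_outer_metric[of "1 / real (Suc n)"])
 fix a b assume "a : X \<inter> F" "b : Y n"
 hence "1 / real (Suc n) - 0 <= dist b a" by (intro sep) (auto simp: Y_def)
 thus "1 / real (Suc n) <= dist a b" by (simp add: dist_commute)
 qed simp
 also have "... <= hausdorff1_outer X" by (rule hausdorff1_outer_mono) (auto simp: Y_def)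
 finally show ?thesis by (simp add: add_right_mono)
 qed
 have "(%n. hausdorff1_outer X + (\<Sum>k. hausdorff1_outer (R (k + n)))) ----> hausdorff1_outer X + 0"
 by (intro tendsto_add tendsto_const tail)
 thus ?thesis
 using main by (intro LIMSEQ_le_const[of _ "hausdorff1_outer X"]) auto
qed

lemma outer_measure_space_hausdorff1: "outer_measure_space (Pow UNIV) hausdorff1_outer"
 unfolding outer_measure_space_def
proof (intro conjI)
 show "positive (Pow UNIV) hausdorff1_outer"
 by (simp add: positive_def hausdorff1_outer_empty)
 show "increasing (Pow UNIV) hausdorff1_outer"
 by (simp add: increasing_def hausdorff1_outer_mono)
 show "countably_subadditive (Pow UNIV) hausdorff1_outer"
 by (simp add: countably_subadditive_def hausdorff1_outer_subadditive)
qed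

lemma borel_subset_hausdorff1_lambda_system:
 "sets borel <= lambda_system UNIV (Pow UNIV) (hausdorff1_outer :: 'a::euclidean_space set => ennreal)"
proof -
 let ?L = "lambda_system UNIV (Pow UNIV) (hausdorff1_outer :: 'a set => ennreal)"
 have "measure_space UNIV ?L hausdorff1_outer"
 by (rule sigma_algebra.caratheodory_lemma[OF sigma_algebra_Pow outer_measure_space_hausdorff1])
 then interpret sigma_algebra UNIV ?L by (simp add: measure_space_def)
 have "F : ?L" if "closed F" for F
 proof -
 have "hausdorff1_outer (F \<inter> X) + hausdorff1_outer ((UNIV - F) \<inter> X) = hausdorff1_outer X" for X
 proof (rule antisym)
 show "hausdorff1_outer (F \<inter> X) + hausdorff1_outer ((UNIV - F) \<inter> X) <= hausdorff1_outer X"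
 using closed_in_hausdorff1_lambda_system[OF that, of X]
 by (simp add: Int_commute Diff_eq)
 have "X = (F \<inter> X) \<union> ((UNIV - F) \<inter> X)" by blast
 thus "hausdorff1_outer X <= hausdorff1_outer (F \<inter> X) + hausdorff1_outer ((UNIV - F) \<inter> X)"
 using hausdorff1_outer_subadditive_2 by metis
 qed
 thus ?thesis by (simp add: lambda_system_def)
 qed
 hence "sigma_sets UNIV (Collect closed) <= ?L"
 by (intro sigma_sets_subset) auto
 thus ?thesis by (simp add: borel_eq_closed)
qed

lemma sets_hausdorff1 [simp, measurable_cong]: "sets hausdorff1 = sets borel"
 and space_hausdorff1 [simp]: "space hausdorff1 = UNIV"
 unfolding hausdorff1_def by (simp_all add: sets.sigma_sets_eq[of borel, simplified])

text \<open>\<open>measure_of\<close> collapses to the zero measure unless its argument is countably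
  additive on the sigma-algebra; Caratheodory's theorem provides this, because the Borel sets lie in
  the lambda system.\<close>

lemma emeasure_hausdorff1:
 fixes A :: "'a::euclidean_space set"
 assumes "A : sets borel" shows "emeasure hausdorff1 A = hausdorff1_outer A"
proof -
 let ?L = "lambda_system UNIV (Pow UNIV) (hausdorff1_outer :: 'a set => ennreal)"
 have L: "measure_space UNIV ?L hausdorff1_outer"
 by (rule sigma_algebra.caratheodory_lemma[OF sigma_algebra_Pow outer_measure_space_hausdorff1])
 show ?thesis
 unfolding hausdorff1_def
 proof (rule emeasure_measure_of_sigma[OF _ _ _ assms])
 show "sigma_algebra UNIV (sets (borel :: 'a measure))"
 using sets.sigma_algebra_axioms[of "borel :: 'a measure"] by simp
 show "positive (sets borel) (hausdorff1_outer :: 'a set => ennreal)"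
 by (simp add: positive_def hausdorff1_outer_empty)
 show "countably_additive (sets borel) (hausdorff1_outer :: 'a set => ennreal)"
 unfolding countably_additive_def
 proof (intro allI impI)
 fix A :: "nat => 'a set"
 assume A: "range A <= sets borel" "disjoint_family A" "\<Union> (range A) \<in> sets borel"
 hence "range A <= ?L" "\<Union> (range A) \<in> ?L"
 using borel_subset_hausdorff1_lambda_system by blast+
 thus "(\<Sum>i. hausdorff1_outer (A i)) = hausdorff1_outer (\<Union> (range A))"
 using L A(2) unfolding measure_space_def countably_additive_def by blast
 qed
 qed
qed

section \<open>Functions with vanishing trace\<close>

lemma emeasure_lborel_square:
 fixes c :: "real^2"
 assumes "t >= 0"
 shows "emeasure lborel (cbox (c - t *R One) (c + t *R One)) = ennreal (4 * t\<^sup>2)"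
proof -
 have "emeasure lborel (cbox (c - t *R One) (c + t *R One)) =
 ennreal (\<Prod>b\<in>Basis. ((c + t *R One) - (c - t *R One)) \<bullet> b)"
 by (rule emeasure_lborel_cbox) (use assms in \<open>auto simp: inner_diff_left inner_add_left\<close>)
 also have "(c + t *R One) - (c - t *R One) = (2 * t) *R (One :: real^2)"
 by (simp only: mult_2 scaleR_left.add) (simp add: algebra_simps)
 also have "(\<Prod>b\<in>Basis. ((2 * t) *R (One :: real^2)) \<bullet> b) = (\<Prod>b\<in>(Basis::(real^2) set). 2 * t)"
 by (intro prod.cong) auto
 also have "... = 4 * t\<^sup>2" by (simp add: power2_eq_square)
 finally show ?thesis .
qed

lemma mem_square:
 fixes c :: "real^2"
 assumes "dist c x <= t" shows "x : cbox (c - t *R One) (c + t *R One)"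
proof -
 have "(abs ((x - c) \<bullet> b)) <= t" if "b : Basis" for b
 using Basis_le_norm[OF that, of "x - c"] assms by (simp add: dist_norm norm_minus_commute)
 thus ?thesis
 by (force simp: mem_box inner_diff_left inner_add_left abs_le_iff)
qed

text \<open>A set of diameter \<open>r\<close>, translated along a segment of length \<open>lea\<close>, is covered by about \<open>lea/r\<close>
 squares of size comparable to \<open>r\<close>.\<close>

lemma emeasure_swept_small:
 fixes d :: "real^2"
 assumes "norm d = 1" "0 < r" "r <= l" "bounded S" "diameter S <= r"
 obtains Q where "Q : sets borel" "emeasure lborel Q <= ennreal (32 * l * r)"
 "!!x s. s : {0..l} ==> x + s *R d : S ==> x : Q"
proof (cases "S = {}")
 case True
 thus ?thesis using that[of "{}"] by auto
next
 case False
 then obtain c where c: "c : S" by blast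
 \<comment> \<open>There are \<open>m + 1 <= l / r + 1 <= 2 * (l / r)\<close> squares, because
   \<open>r <= l\<close>, and each has side \<open>4 * r\<close>; this is the origin of
   \<open>32 * l * r\<close>.\<close>
 define m where "m = nat \<lfloor>l / r\<rfloor>"
 define q where "q k = (let y = c - (real k * r) *R d in cbox (y - (2 * r) *R One) (y + (2 * r) *R One))" for k
 have q: "emeasure lborel (q k) = ennreal (16 * r\<^sup>2)" for k
 using assms emeasure_lborel_square[of "2 * r"] by (simp add: q_def Let_def power_mult_distrib)
 have m: "real m <= l / r" "l / r < real m + 1"
 using assms by (auto simp: m_def)
 show ?thesis
 proof (rule that[of "\<Union>k\<le>m. q k"])
 show "(\<Union>k\<le>m. q k) : sets borel" by (auto simp: q_def Let_def)
 have "emeasure lborel (\<Union>k\<le>m. q k) <= (\<Sum>k\<le>m. emeasure lborel (q k))"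
 by (rule emeasure_subadditive_finite) (auto simp: q_def Let_def)
 also have "... = ennreal (real (Suc m) * (16 * r\<^sup>2))"
 by (simp add: q ennreal_mult' ennreal_of_nat_eq_real_of_nat)
 also have "... <= ennreal (32 * l * r)"
 proof (rule ennreal_leI)
 have "real (Suc m) <= 2 * (l / r)"
 using m(1) assms by (auto simp: field_simps) 
 hence "real (Suc m) * (16 * r\<^sup>2) <= 2 * (l / r) * (16 * r\<^sup>2)"
 by (rule mult_right_mono) simp
 also have "... = 32 * l * r" using assms by (simp add: power2_eq_square)
 finally show "real (Suc m) * (16 * r\<^sup>2) <= 32 * l * r" .
 qed
 finally show "emeasure lborel (\<Union>k\<le>m. q k) <= ennreal (32 * l * r)" .
 fix x s assume s: "s : {0..l}" and x: "x + s *R d : S"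
 define k where "k = nat \<lfloor>s / r\<rfloor>"
 have k: "real k <= s / r" "s / r < real k + 1"
 using assms s by (auto simp: k_def)
 have "k <= m" unfolding k_def m_def
 using s assms by (intro nat_mono floor_mono divide_right_mono) auto
 moreover have "x : q k"
 proof -
 have "dist (x + s *R d) c <= r"
 using diameter_bounded_bound[OF assms(4) x c] assms(5) by simp
 moreover have "(abs (s - real k * r)) <= r"
 using k assms by (auto simp: field_simps)
 hence "norm ((s - real k * r) *R d) <= r"
 using assms(1) by simp
 moreover have "c - (real k * r) *R d - x = - ((x + s *R d) - c) + (s - real k * r) *R d"
 by (simp add: algebra_simps)
 ultimately have "dist (c - (real k * r) *R d) x <= 2 * r"
 unfolding dist_norm
 by (smt (verit) norm_minus_cancel norm_triangle_ineq)
 thus ?thesis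
 unfolding q_def Let_def by (rule mem_square)
 qed
 ultimately show "x : (\<Union>k\<le>m. q k)" by blast
 qed
qed

text \<open>A cover of \<open>A\<close> by sets of diameter about \<open>r i\<close> becomes a cover
  of \<open>E\<close> by Borel sets of area at most \<open>32 * l * r i\<close>, so area is
  controlled by length. No parametrisation of the frontier enters.\<close>

lemma emeasure_swept_le_hausdorff1:
 fixes d :: "real^2"
 assumes "norm d = 1" "l > 0" "E : sets borel"
 and "!!x. x : E ==> \<exists>s\<in>{0..l}. x + s *R d : A"
 shows "emeasure lborel E <= ennreal (32 * l) * hausdorff1_outer A"
proof (cases "hausdorff1_outer A = top")
 case True
 thus ?thesis using assms(2) by (simp add: ennreal_mult_top)
next
 case False
 hence fin: "hausdorff1_pre (l / 2) A < top"
 using hausdorff1_pre_le_outer[of "l / 2" A] assms(2) by (auto simp: less_top[symmetric] top_unique)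
 have bound: "emeasure lborel E <= ennreal (32 * l) * (hausdorff1_outer A + ennreal e)" if e: "0 < e" "e <= l / 2" for e
 proof -
 have "e / 2 > 0" using e by simp
 then obtain C where C: "C : hausdorff1_covers (l / 2) A"
 "(\<Sum>i. ennreal (diameter (C i))) <= hausdorff1_pre (l / 2) A + ennreal (e / 2)"
 using hausdorff1_pre_approx[OF fin] by metis
 \<comment> \<open>The extra summand makes \<open>r i\<close> positive even for sets of diameter 0
   and adds up to \<open>e / 2\<close>. Covers of size \<open>l / 2\<close> and
   \<open>e <= l / 2\<close> together keep \<open>r i\<close> below \<open>l\<close>, as
   \<open>emeasure_swept_small\<close> requires.\<close>
 define r where "r i = diameter (C i) + e / 2 * (1/2) ^ Suc i" for i
 have Ci: "bounded (C i)" "diameter (C i) <= l / 2" "0 <= diameter (C i)" for i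
 using C(1) by (auto simp: hausdorff1_covers_def diameter_ge_0)
 have pw: "(1/2::real) ^ Suc i <= 1" for i by (rule power_le_one) auto
 have r: "0 < r i" "r i <= l" "diameter (C i) <= r i" for i
 proof -
 have "0 < e / 2 * (1/2) ^ Suc i" using e by simp
 moreover have "e / 2 * (1/2) ^ Suc i <= e / 2 * 1"
 using pw[of i] e by (intro mult_left_mono) auto
 ultimately show "0 < r i" "r i <= l" "diameter (C i) <= r i"
 using Ci(2,3)[of i] e unfolding r_def by linarith+
 qed
 have "\<exists>Q. Q : sets borel & emeasure lborel Q <= ennreal (32 * l * r i) &
 (\<forall>x s. s : {0..l} --> x + s *R d : C i --> x : Q)" for i
 using emeasure_swept_small[OF assms(1) r(1,2) Ci(1) r(3), of i] by metis
 then obtain Q where Q: "!!i. Q i : sets borel" "!!i. emeasure lborel (Q i) <= ennreal (32 * l * r i)"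
 "!!i x s. s : {0..l} ==> x + s *R d : C i ==> x : Q i"
 by metis
 have "E <= (\<Union>i. Q i)"
 proof
 fix x assume "x : E"
 then obtain s where s: "s : {0..l}" "x + s *R d : A" using assms(4) by blast
 then obtain i where "x + s *R d : C i" using C(1) by (auto simp: hausdorff1_covers_def)
 thus "x : (\<Union>i. Q i)" using Q(3)[OF s(1)] by blast
 qed
 hence "emeasure lborel E <= emeasure lborel (\<Union>i. Q i)"
 using Q(1) by (intro emeasure_mono) auto
 also have "... <= (\<Sum>i. emeasure lborel (Q i))"
 using Q(1) by (intro emeasure_subadditive_countably) auto
 also have "... <= (\<Sum>i. ennreal (32 * l * r i))"
 by (intro suminf_le Q(2)) auto
 also have "... = (\<Sum>i. ennreal (32 * l) * (ennreal (diameter (C i)) + ennreal (e / 2 * (1/2) ^ Suc i)))"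
 using Ci(3) e assms(2) by (intro suminf_cong) (simp add: r_def ennreal_mult' ennreal_plus)
 also have "... = ennreal (32 * l) * ((\<Sum>i. ennreal (diameter (C i))) + (\<Sum>i. ennreal (e / 2 * (1/2) ^ Suc i)))"
 by (simp add: ennreal_suminf_cmult suminf_add)
 also have "(\<Sum>i. ennreal (e / 2 * (1/2) ^ Suc i)) = ennreal (e / 2 * 1)"
 using sums_mult[OF power_half_series, of "e / 2"] e by (intro suminf_ennreal_eq) auto
 also have "ennreal (32 * l) * ((\<Sum>i. ennreal (diameter (C i))) + ennreal (e / 2 * 1)) <=
 ennreal (32 * l) * (hausdorff1_outer A + ennreal e)"
 proof (rule mult_left_mono)
 have "(\<Sum>i. ennreal (diameter (C i))) + ennreal (e / 2 * 1) <= (hausdorff1_pre (l / 2) A + ennreal (e / 2)) + ennreal (e / 2)"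
 using C(2) by (simp add: add_right_mono)
 also have "... = hausdorff1_pre (l / 2) A + ennreal e"
 using e by (simp add: add.assoc ennreal_plus[symmetric] del: ennreal_plus)
 also have "... <= hausdorff1_outer A + ennreal e"
 using assms(2) by (intro add_right_mono hausdorff1_pre_le_outer) simp
 finally show "(\<Sum>i. ennreal (diameter (C i))) + ennreal (e / 2 * 1) <= hausdorff1_outer A + ennreal e" .
 qed simp
 finally show ?thesis .
 qed
 have lim0: "(%n. 1 / real (Suc n)) ----> 0"
 by (rule LIMSEQ_Suc[OF lim_1_over_n])
 have "(%n. ennreal (32 * l) * (hausdorff1_outer A + ennreal (l / 2 * (1 / real (Suc n)))))
 ----> ennreal (32 * l) * (hausdorff1_outer A + ennreal (l / 2 * 0))"
 by (intro tendsto_mult_ennreal tendsto_const tendsto_add tendsto_ennrealI tendsto_mult lim0)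
 (use False assms(2) in auto)
 hence "(%n. ennreal (32 * l) * (hausdorff1_outer A + ennreal (l / 2 * (1 / real (Suc n)))))
 ----> ennreal (32 * l) * hausdorff1_outer A" by simp
 thus ?thesis
 proof (rule LIMSEQ_le_const, intro exI[of _ 0] allI impI)
 fix n :: nat
 have "1 / real (Suc n) <= 1" by (simp add: field_simps)
 hence "l / 2 * (1 / real (Suc n)) <= l / 2"
 using assms(2) by (intro mult_left_le) auto
 thus "emeasure lborel E <= ennreal (32 * l) * (hausdorff1_outer A + ennreal (l / 2 * (1 / real (Suc n))))"
 using assms(2) by (intro bound) auto
 qed
qed

subsection \<open>Estimate along lines that leave the domain\<close>

definition exit_set :: "(real^2) set => real^2 => real => (real^2) set" where
 "exit_set S d l = {x : S. \<exists>s\<in>{0..l}. x + s *R d ~: S}"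

text \<open>The value 0 off \<open>exit_set\<close> is a convention that keeps the function Borel on
  the whole plane.\<close>

definition exit_time :: "(real^2) set => real^2 => real => real^2 => real" where
 "exit_time S d l x = (if x : exit_set S d l then Inf {s : {0..l}. x + s *R d ~: S} else 0)"

text \<open>The points whose segment meets the complement of \<open>S\<close> form the difference of
  a closed and a compact set, which is closed.\<close>

lemma borel_exit_set:
 assumes "open S" shows "exit_set S d l : sets borel"
proof -
 have "compact ((%s. s *R d) ` {0..l})"
 by (intro compact_continuous_image continuous_intros) auto
 hence "closed (\<Union>x\<in>- S. \<Union>y\<in>(%s. s *R d) ` {0..l}. {x - y})"
 using assms by (intro closed_compact_differences) auto
 moreover have "exit_set S d l = S \<inter> (\<Union>x\<in>- S. \<Union>y\<in>(%s. s *R d) ` {0..l}. {x - y})"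
 by (force simp: exit_set_def algebra_simps)
 ultimately show ?thesis using assms by auto
qed

text \<open>The exit parameters form a closed set, so the infimum is attained, at a frontier point.
  By the last clause the points before the exit are still in \<open>exit_set\<close>, which allows
  the gradient to be integrated over \<open>exit_set\<close> alone.\<close>

lemma exit_time:
 assumes "open S" "x : exit_set S d l"
 defines "s \<equiv> exit_time S d l x"
 shows "0 < s" "s <= l" "x + s *R d : frontier S"
 and "!!t. 0 <= t ==> t < s ==> x + t *R d : exit_set S d l"
proof -
 let ?A = "{s : {0..l}. x + s *R d ~: S}"
 have ne: "?A ~= {}" and x: "x : S" using assms(2) by (auto simp: exit_set_def)
 have "closed ((%s. x + s *R d) -` (- S) \<inter> {0..l})"
 by (intro closed_Int closed_vimage) (use assms(1) in \<open>auto intro!: continuous_intros\<close>)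
 moreover have "(%s. x + s *R d) -` (- S) \<inter> {0..l} = ?A" by auto
 ultimately have "closed ?A" by simp
 moreover have bd: "bdd_below ?A" by (auto intro: bdd_belowI[of _ 0])
 ultimately have s: "s : ?A"
 using closed_contains_Inf[OF ne] assms(2) by (simp add: s_def exit_time_def)
 thus "s <= l" by simp
 have "s ~= 0" using s x by auto
 thus s0: "0 < s" using s by simp
 have le: "s <= t" if "t : ?A" for t
 using cInf_lower[OF that bd] assms(2) by (simp add: s_def exit_time_def)
 have inS: "x + t *R d : S" if "0 <= t" "t < s" for t
 using le[of t] that s by force
 show "x + t *R d : exit_set S d l" if "0 <= t" "t < s" for t
 proof -
 have "x + t *R d + (s - t) *R d ~: S" "s - t : {0..l}"
 using s that by (auto simp: scaleR_left.diff)
 thus ?thesis using inS[OF that] unfolding exit_set_def by blast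
 qed
 have "x + s *R d : closure S"
 proof (rule Lim_in_closed_set[of "closure S" _ "at_left s"])
 show "\<forall>\<^sub>F t in at_left s. x + t *R d : closure S"
 using eventually_at_left_real[OF s0]
 by eventually_elim (rule subsetD[OF closure_subset inS], auto)
 show "((%t. x + t *R d) \<longlongrightarrow> x + s *R d) (at_left s)"
 by (intro tendsto_intros)
 qed auto
 thus "x + s *R d : frontier S"
 using s assms(1) by (simp add: frontier_def interior_open)
qed

text \<open>For \<open>a >= 0\<close> the sublevel set is the exit set of the shorter length
  \<open>min a l\<close> together with the complement of \<open>exit_set S d l\<close>, where the
  value is 0.\<close>

lemma borel_measurable_exit_time:
 assumes "open S" shows "exit_time S d l : borel_measurable borel"
proof (rule borel_measurableI_le)
 fix a
 show "{x : space borel. exit_time S d l x <= a} : sets borel"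
 proof (cases "a < 0")
 case True
 have "0 <= exit_time S d l x" for x
 using exit_time(1)[OF assms, of x d l] by (cases "x : exit_set S d l") (auto simp: exit_time_def)
 hence "{x : space borel. exit_time S d l x <= a} = {}"
 using True by (auto simp: not_le intro: less_le_trans)
 thus ?thesis by (simp only: sets.empty_sets)
 next
 case False
 have "{x : space borel. exit_time S d l x <= a} = exit_set S d (min a l) \<union> - exit_set S d l"
 proof (intro set_eqI iffI)
 fix x assume x: "x : {x : space borel. exit_time S d l x <= a}"
 show "x : exit_set S d (min a l) \<union> - exit_set S d l"
 proof (cases "x : exit_set S d l")
 case True
 note e = exit_time[OF assms True]
 have "x + exit_time S d l x *R d ~: S" using e(3) assms by (simp add: frontier_def interior_open)
 hence "x : exit_set S d (min a l)"
 using e(1,2) x True by (auto simp: exit_set_def intro!: bexI[of _ "exit_time S d l x"])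
 thus ?thesis by simp
 qed simp
 next
 fix x assume "x : exit_set S d (min a l) \<union> - exit_set S d l"
 thus "x : {x : space borel. exit_time S d l x <= a}"
 proof
 assume "x : exit_set S d (min a l)"
 then obtain s where s: "x : S" "0 <= s" "s <= a" "s <= l" "x + s *R d ~: S"
 by (auto simp: exit_set_def)
 hence "x : exit_set S d l" by (auto simp: exit_set_def)
 moreover have "Inf {s : {0..l}. x + s *R d ~: S} <= s"
 by (rule cInf_lower) (use s in \<open>auto intro: bdd_belowI[of _ 0]\<close>)
 ultimately show ?thesis using s by (simp add: exit_time_def)
 qed (use False in \<open>simp add: exit_time_def\<close>)
 qed
 thus ?thesis using borel_exit_set[OF assms] by auto
 qed
qed

text \<open>The image of planar measure under the map to the exit point is dominated, set by set, by
  \<open>32 * l\<close> times arc length on the frontier; the inequality of measures is then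
  integrated.\<close>

lemma nn_integral_exit_point_le:
 fixes f :: "real^2 => ennreal"
 assumes "open S" "norm d = 1" "l > 0" "f : borel_measurable borel"
 shows "(\<integral>\<^sup>+x\<in>exit_set S d l. f (x + exit_time S d l x *R d) \<partial>lborel) <=
 ennreal (32 * l) * (\<integral>\<^sup>+x\<in>frontier S. f x \<partial>hausdorff1)"
proof -
 let ?E = "exit_set S d l"
 let ?h = "%x. x + exit_time S d l x *R d"
 note [measurable] = borel_exit_set[OF assms(1)] borel_measurable_exit_time[OF assms(1)] assms(4)
 have h [measurable]: "?h : borel_measurable borel" by measurable
 have fr [measurable]: "frontier S : sets borel" by (simp add: borel_closed frontier_closed)
 define N where "N = distr (density lborel (indicator ?E)) borel ?h"
 define P where "P = scale_measure (ennreal (32 * l)) (density hausdorff1 (indicator (frontier S)))"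
 have "(\<integral>\<^sup>+x\<in>?E. f (?h x) \<partial>lborel) = (nn_integral N (%x. f x))"
 unfolding N_def by (simp add: nn_integral_distr nn_integral_density mult.commute)
 also have "... <= (nn_integral P (%x. f x))"
 proof (rule nn_integral_mono_measure)
 show sets: "sets N = sets P" by (simp add: N_def P_def)
 have "emeasure N A <= emeasure P A" for A
 proof (cases "A : sets borel")
 case True
 have hA: "?h -` A : sets borel" using measurable_sets[OF h True] by simp
 have "emeasure N A = emeasure (density lborel (indicator ?E)) (?h -` A)"
 unfolding N_def using True by (subst emeasure_distr) auto
 also have "... = emeasure lborel (?E \<inter> ?h -` A)"
 using hA by (subst emeasure_density)
 (simp_all add: indicator_inter_arith[symmetric] nn_integral_indicator)
 also have "... <= ennreal (32 * l) * hausdorff1_outer (A \<inter> frontier S)"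
 proof (rule emeasure_swept_le_hausdorff1[OF assms(2,3)])
 show "?E \<inter> ?h -` A : sets borel" using hA by measurable
 fix x assume "x : ?E \<inter> ?h -` A"
 thus "\<exists>s\<in>{0..l}. x + s *R d : A \<inter> frontier S"
 using exit_time[OF assms(1), of x d l] by (intro bexI[of _ "exit_time S d l x"]) auto
 qed
 also have "hausdorff1_outer (A \<inter> frontier S) = emeasure hausdorff1 (A \<inter> frontier S)"
 using True by (intro emeasure_hausdorff1[symmetric]) auto
 also have "ennreal (32 * l) * ... = emeasure P A"
 unfolding P_def using True
 by (simp add: emeasure_density indicator_inter_arith[symmetric] Int_commute)
 finally show ?thesis .
 qed (simp add: emeasure_notin_sets N_def)
 thus "N <= P"
 by (simp add: le_measure_iff sets sets_eq_imp_space_eq[OF sets] le_fun_def)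
 qed
 also have "... = ennreal (32 * l) * (\<integral>\<^sup>+x\<in>frontier S. f x \<partial>hausdorff1)"
 unfolding P_def by (simp add: nn_integral_scale_measure nn_integral_density mult.commute)
 finally show ?thesis .
qed

text \<open>The fundamental theorem of calculus on the segment, followed by Cauchy-Schwarz, which
  produces the factor \<open>s\<close>.\<close>

lemma nn_integral_line_bound:
 fixes v :: "real^2 => real^2"
 assumes "smooth v" "0 <= s"
 shows "ennreal ((norm (v (x + s *R d) - v x))^2) <=
 ennreal s * (\<integral>\<^sup>+t\<in>{0..s}. ennreal ((norm (fd v (x + t *R d) d))^2) \<partial>lborel)"
proof -
 define g where "g t = fd v (x + t *R d) d" for t
 have gc: "continuous_on UNIV g"
 unfolding g_def
 by (intro continuous_on_compose2[OF smooth_continuous_on[OF smooth_frechet[OF assms(1)], of UNIV]] continuous_intros) auto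
 hence [measurable]: "g : borel_measurable borel" by (rule borel_measurable_continuous_onI)
 have D: "((%t. v (x + t *R d)) has_vector_derivative g t) (at t within T)" for t T
 proof -
 have "fd v y (r *R d) = r *R fd v y d" for y r
 by (rule linear_scale[OF has_derivative_linear[OF smooth_has_derivative[OF assms(1)]]])
 thus ?thesis
 using has_derivative_at_withinI[OF derivative_along_line[OF smooth_has_derivative[OF assms(1)]], of x d t T]
 by (simp add: has_vector_derivative_def g_def)
 qed
 have "norm (v (x + s *R d) - v x) = norm (LINT t|lborel. indicator {0..s} t *R g t)"
 using integral_FTC_atLeastAtMost[OF assms(2), of "%t. v (x + t *R d)" g] D
 continuous_on_subset[OF gc] by simp
 hence "ennreal (norm (v (x + s *R d) - v x)) <= (nn_integral lborel (%t. ennreal (norm (indicator {0..s} t *R g t))))"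
 using integral_norm_bound_ennreal[of lborel "%t. indicator {0..s} t *R g t"]
 borel_integrable_compact[of "{0..s}" g] continuous_on_subset[OF gc] by simp
 also have "... = (nn_integral lborel (%t. indicator {0..s} t * (indicator {0..s} t * ennreal (norm (g t)))))"
 by (intro nn_integral_cong) (simp add: indicator_def)
 finally have "(ennreal (norm (v (x + s *R d) - v x)))^2 <=
 (nn_integral lborel (%t. indicator {0..s} t * (indicator {0..s} t * ennreal (norm (g t)))))^2"
 by (rule power_mono) simp
 also have "... <= (nn_integral lborel (%t. (indicator {0..s} t)^2)) * (nn_integral lborel (%t. (indicator {0..s} t * ennreal (norm (g t)))^2))"
 by (rule Cauchy_Schwarz_nn_integral) measurable
 also have "(nn_integral lborel (%t. (indicator {0..s} t)^2)) = (nn_integral lborel (%t. indicator {0..s} t))"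
 by (intro nn_integral_cong) (simp add: indicator_def)
 also have "... = ennreal s" using assms(2) by simp
 also have "(nn_integral lborel (%t. (indicator {0..s} t * ennreal (norm (g t)))^2)) =
 (\<integral>\<^sup>+t\<in>{0..s}. ennreal ((norm (g t))^2) \<partial>lborel)"
 by (intro nn_integral_cong) (simp add: indicator_def ennreal_power)
 finally show ?thesis by (simp add: ennreal_power g_def)
qed

lemma power2_norm_le_twice: "(norm (a::'a::real_normed_vector))^2 <= 2 * (norm b)^2 + 2 * (norm (b - a))^2"
proof -
 have "norm a <= norm b + norm (b - a)"
 by (metis add.commute diff_add_cancel norm_minus_commute norm_triangle_ineq)
 hence "(norm a)^2 <= (norm b + norm (b - a))^2" by (rule power_mono) simp
 moreover have "2 * (norm b * norm (b - a)) <= (norm b)^2 + (norm (b - a))^2"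
 using sum_squares_bound[of "norm b" "norm (b - a)"] by simp
 ultimately show ?thesis by (simp add: power2_sum)
qed

text \<open>A Poincare inequality with boundary term. The value at \<open>x\<close> is the value at
  the exit point plus the integral of the derivative along the segment. Squares of the former are
  integrated by \<open>nn_integral_exit_point_le\<close>; for the latter Fubini and translation
  invariance yield a second factor \<open>l\<close>.\<close>

lemma exit_strip_estimate:
 fixes v :: "real^2 => real^2"
 assumes "open S" "norm d = 1" "l > 0" "smooth v"
 shows "(\<integral>\<^sup>+x\<in>exit_set S d l. ennreal ((norm (v x))^2) \<partial>lborel) <=
 ennreal (64 * l) * (\<integral>\<^sup>+x\<in>frontier S. ennreal ((norm (v x))^2) \<partial>hausdorff1) +
 ennreal (2 * l\<^sup>2) * (\<integral>\<^sup>+x\<in>exit_set S d l. ennreal ((norm (fd v x d))^2) \<partial>lborel)"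
proof -
 let ?E = "exit_set S d l"
 let ?h = "%x. x + exit_time S d l x *R d"
 define G where "G y = ennreal ((norm (fd v y d))^2) * indicator ?E y" for y
 have vm [measurable]: "v : borel_measurable borel" "(%y. fd v y d) : borel_measurable borel"
 using smooth_continuous_on[OF assms(4)] smooth_continuous_on[OF smooth_frechet[OF assms(4)]]
 by (auto intro: borel_measurable_continuous_onI)
 note [measurable] = borel_exit_set[OF assms(1)] borel_measurable_exit_time[OF assms(1)]
 have Gm [measurable]: "G : borel_measurable borel"
 unfolding G_def by measurable
 have pw: "ennreal ((norm (v x))^2) * indicator ?E x <= 2 * (ennreal ((norm (v (?h x)))^2) * indicator ?E x) +
 ennreal (2 * l) * (nn_integral lborel (%t. indicator {0..l} t * G (x + t *R d)))" for x
 proof (cases "x : ?E")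
 case True
 let ?s = "exit_time S d l x"
 note e = exit_time[OF assms(1) True]
 have "ennreal ((norm (v x))^2) <= ennreal (2 * (norm (v (?h x)))^2 + 2 * (norm (v (?h x) - v x))^2)"
 by (intro ennreal_leI power2_norm_le_twice)
 also have "... = 2 * ennreal ((norm (v (?h x)))^2) + 2 * ennreal ((norm (v (?h x) - v x))^2)"
 by (simp add: ennreal_plus ennreal_mult')
 also have "ennreal ((norm (v (?h x) - v x))^2) <=
 ennreal ?s * (\<integral>\<^sup>+t\<in>{0..?s}. ennreal ((norm (fd v (x + t *R d) d))^2) \<partial>lborel)"
 using e(1) by (intro nn_integral_line_bound assms(4)) simp
 also have "... <= ennreal l * (nn_integral lborel (%t. indicator {0..l} t * G (x + t *R d)))"
 proof (intro mult_mono ennreal_leI e(2) nn_integral_mono_AE)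
 \<comment> \<open>At the end point \<open>t = ?s\<close> the segment has already left
   \<open>S\<close>; this single parameter is discarded as a null set.\<close>
 show "AE t in lborel. ennreal ((norm (fd v (x + t *R d) d))^2) * indicator {0..?s} t
 <= indicator {0..l} t * G (x + t *R d)"
 using AE_lborel_singleton[of ?s]
 proof eventually_elim
 case (elim t)
 show ?case
 proof (cases "t : {0..?s}")
 case True
 hence "x + t *R d : ?E" using e(4)[of t] elim by simp
 thus ?thesis using True e(2) by (simp add: G_def)
 qed simp
 qed
 qed auto
 finally have "ennreal ((norm (v x))^2) <= 2 * ennreal ((norm (v (?h x)))^2) +
 2 * (ennreal l * (nn_integral lborel (%t. indicator {0..l} t * G (x + t *R d))))"
 by (simp add: mult_left_mono add_left_mono)
 thus ?thesis using True assms(3) by (simp add: ennreal_mult' mult.assoc)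
 qed simp
 have trans: "(nn_integral lborel (%x. G (x + c))) = (nn_integral lborel (%x. G x))" for c
 proof -
 have "(nn_integral lborel (%x. G x)) = (\<integral>\<^sup>+x. G x \<partial>distr lborel borel ((+) c))" by (simp add: lborel_distr_plus)
 also have "... = (nn_integral lborel (%x. G (c + x)))" by (subst nn_integral_distr) auto
 finally show ?thesis by (simp add: add.commute)
 qed
 have m2: "(%(x, t). indicator {0..l} t * G (x + t *R d)) : borel_measurable (lborel \<Otimes>\<^sub>M lborel)"
 by (simp add: case_prod_unfold) measurable
 have "(nn_integral lborel (%x. \<integral>\<^sup>+t. indicator {0..l} t * G (x + t *R d) \<partial>lborel)) =
 (nn_integral lborel (%t. \<integral>\<^sup>+x. indicator {0..l} t * G (x + t *R d) \<partial>lborel))"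
 using lborel_pair.Fubini[OF m2] by simp
 also have "... = (nn_integral lborel (%t. indicator {0..l} t * (nn_integral lborel (%x. G x))))"
 by (intro nn_integral_cong) (simp add: nn_integral_cmult trans)
 also have "... = ennreal l * (nn_integral lborel (%x. G x))"
 using assms(3) by (simp add: nn_integral_multc)
 finally have swap: "(nn_integral lborel (%x. \<integral>\<^sup>+t. indicator {0..l} t * G (x + t *R d) \<partial>lborel)) = ennreal l * (nn_integral lborel (%x. G x))" .
 have "(\<integral>\<^sup>+x\<in>?E. ennreal ((norm (v x))^2) \<partial>lborel) <=
 (nn_integral lborel (%x. 2 * (ennreal ((norm (v (?h x)))^2) * indicator ?E x) +
 ennreal (2 * l) * (nn_integral lborel (%t. indicator {0..l} t * G (x + t *R d)))))"
 by (intro nn_integral_mono pw)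
 also have "... = 2 * (\<integral>\<^sup>+x\<in>?E. ennreal ((norm (v (?h x)))^2) \<partial>lborel) +
 ennreal (2 * l) * (ennreal l * (nn_integral lborel (%x. G x)))"
 proof -
 have [measurable]: "(%x. \<integral>\<^sup>+t. indicator {0..l} t * G (x + t *R d) \<partial>lborel) : borel_measurable lborel"
 using lborel.borel_measurable_nn_integral[OF m2] by simp
 have [measurable]: "(%x. ennreal ((norm (v (?h x)))^2)) : borel_measurable borel" by measurable
 show ?thesis
 by (subst nn_integral_add) (simp_all add: nn_integral_cmult swap)
 qed
 also have "2 * (\<integral>\<^sup>+x\<in>?E. ennreal ((norm (v (?h x)))^2) \<partial>lborel) <=
 2 * (ennreal (32 * l) * (\<integral>\<^sup>+x\<in>frontier S. ennreal ((norm (v x))^2) \<partial>hausdorff1))"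
 by (intro mult_left_mono nn_integral_exit_point_le assms) auto
 also have "... = ennreal (64 * l) * (\<integral>\<^sup>+x\<in>frontier S. ennreal ((norm (v x))^2) \<partial>hausdorff1)"
 proof -
 have "ennreal (64 * l) = 2 * ennreal (32 * l)"
 using assms(3) ennreal_mult'[of "32 * l" 2] by (simp add: mult.commute)
 thus ?thesis by (simp add: mult.assoc)
 qed
 also have "ennreal (2 * l) * (ennreal l * (nn_integral lborel (%x. G x))) = ennreal (2 * l\<^sup>2) * (nn_integral lborel (%x. G x))"
 proof -
 have "ennreal (2 * l) * ennreal l = ennreal (2 * l\<^sup>2)"
 using assms(3) ennreal_mult[of "2 * l" l] by (simp add: power2_eq_square mult.assoc)
 thus ?thesis by (simp add: mult.assoc[symmetric])
 qed
 finally show ?thesis unfolding G_def by (simp add: add_right_mono)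
qed

subsection \<open>Cutoff functions\<close>

text \<open>A smooth variant of the tent function: its integer translates form a partition of unity
  (\<open>hat_partition\<close>), each one supported in an interval of length 2.\<close>

definition hat :: "real => real" where
 "hat t = step (1 + t) - step t"

lemma smooth_hat: "smooth hat"
 unfolding hat_def[abs_def] using smooth_real_affine[OF smooth_step, of 1 1] smooth_step by auto

lemma hat_outside: "(abs t) >= 1 ==> hat t = 0"
 by (cases "t >= 1") (auto simp: hat_def)

lemma hat_le_1: "(abs (hat t)) <= 1"
 using step_bounds[of "1 + t"] step_bounds[of t] by (auto simp: hat_def)

lemma hat_partition: "hat (a - of_int \<lfloor>a\<rfloor>) + hat (a - of_int (\<lfloor>a\<rfloor> + 1)) = 1"
proof -
 have "0 <= a - of_int \<lfloor>a\<rfloor>" "a - of_int \<lfloor>a\<rfloor> < 1" by linarith+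
 thus ?thesis by (simp add: hat_def algebra_simps)
qed

definition hat_node :: "real => int \<times> int => real^2 => real" where
 "hat_node de p x = hat (x$1 / de - of_int (fst p)) * hat (x$2 / de - of_int (snd p))"

lemma smooth_hat_node: "smooth (hat_node de p)"
proof -
 have *: "smooth (%x::real^2. hat (x$k / de - of_int i))" for k i
 using smooth_compose_inner[OF smooth_hat, of "- of_int i" "axis k (1 / de)"]
 by (simp add: inner_axis algebra_simps)
 show ?thesis unfolding hat_node_def[abs_def] by (intro smooth_mult *)
qed

definition hat_cell :: "real => int \<times> int => (real^2) set" where
 "hat_cell de p = {x. (abs (x$1 / de - of_int (fst p))) <= 1 & (abs (x$2 / de - of_int (snd p))) <= 1}"

lemma hat_node_outside: "x ~: hat_cell de p ==> hat_node de p x = 0"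
 by (auto simp: hat_cell_def hat_node_def hat_outside not_le less_imp_le)

lemma closed_hat_cell: "closed (hat_cell de p)"
 unfolding hat_cell_def divide_inverse by (intro closed_Collect_conj closed_Collect_le continuous_intros)

lemma norm_real2_le: "norm (x::real^2) <= (abs (x$1)) + (abs (x$2))"
 using norm_le_l1_cart[of x] by (simp add: sum_2)

lemma compact_hat_cell:
 assumes "de > 0" shows "compact (hat_cell de p)"
proof -
 have "norm x <= de * ((abs (of_int (fst p))) + 1) + de * ((abs (of_int (snd p))) + 1)" if "x : hat_cell de p" for x
 proof -
 have *: "(abs (x$1 / de)) <= (abs (of_int (fst p))) + 1" "(abs (x$2 / de)) <= (abs (of_int (snd p))) + 1"
 using that by (auto simp: hat_cell_def)
 have "(abs (x$1)) <= de * ((abs (of_int (fst p))) + 1)" "(abs (x$2)) <= de * ((abs (of_int (snd p))) + 1)"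
 using * assms by (simp_all add: abs_div pos_divide_le_eq mult.commute)
 thus ?thesis using norm_real2_le[of x] by linarith
 qed
 hence "bounded (hat_cell de p)" by (auto simp: bounded_iff)
 thus ?thesis using closed_hat_cell compact_eq_bounded_closed by blast
qed

lemma hat_node_derivative_bound:
 obtains C where "C > 0" "!!de p x h. de > 0 ==> (abs (fd (hat_node de p) x h)) <= C / de * norm h"
proof -
 let ?h' = "%t. fd hat t 1"
 have "?h' t = 0" if "t ~: {-1..1}" for t
 by (rule frechet_derivative_outside_support[of "{-1..1}"]) (use that hat_outside in auto)
 then obtain C where C: "C > 0" "!!t. (abs (?h' t)) <= C"
 using bounded_compact_support[OF smooth_continuous_on[OF smooth_frechet[OF smooth_hat, of 1]], of "{-1..1}"]
 by (metis compact_Icc real_norm_def)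
 have D: "((%x::real^2. hat (x$k / de - of_int i)) has_derivative (%h. h$k / de * ?h' (x$k / de - of_int i))) (at x)"
 for k i de and x :: "real^2"
 proof -
 have "((%x::real^2. x$k / de - of_int i) has_derivative (%h. h$k / de)) (at x)"
 unfolding divide_inverse
 by (auto intro!: derivative_eq_intros bounded_linear_imp_has_derivative bounded_linear_vec_nth)
 from has_derivative_compose[OF this smooth_has_derivative[OF smooth_hat]]
 have A: "((%x::real^2. hat (x$k / de - of_int i)) has_derivative
 (%h. fd hat (x$k / de - of_int i) (h$k / de))) (at x)" .
 have lin: "fd hat t s = s * ?h' t" for s t
 proof -
 have "fd hat t (s *R 1) = s *R ?h' t"
 by (rule linear_scale[OF has_derivative_linear[OF smooth_has_derivative[OF smooth_hat]]])
 thus ?thesis unfolding real_scaleR_def mult_1_right .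
 qed
 have "(%h::real^2. fd hat (x$k / de - of_int i) (h$k / de)) =
 (%h. h$k / de * ?h' (x$k / de - of_int i))"
 by (rule ext) (rule lin)
 thus ?thesis by (rule has_derivative_eq_rhs[OF A])
 qed
 show ?thesis
 proof (rule that[of "2 * C"])
 fix de :: real and p :: "int \<times> int" and x h :: "real^2"
 assume de: "de > 0"
 let ?a = "x$1 / de - of_int (fst p)" and ?b = "x$2 / de - of_int (snd p)"
 have HD: "(hat_node de p has_derivative
 (%h. hat ?a * (h$2 / de * ?h' ?b) + (h$1 / de * ?h' ?a) * hat ?b)) (at x)"
 unfolding hat_node_def[abs_def] by (rule has_derivative_mult[OF D D])
 have "(abs (fd (hat_node de p) x h)) = (abs (hat ?a * (h$2 / de * ?h' ?b) + (h$1 / de * ?h' ?a) * hat ?b))"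
 by (subst frechet_derivative_at[OF HD, symmetric]) (rule refl)
 also have "... <= (abs (hat ?a)) * ((abs (h$2 / de)) * (abs (?h' ?b))) + ((abs (h$1 / de)) * (abs (?h' ?a))) * (abs (hat ?b))"
 by (rule order_trans[OF abs_triangle_ineq]) (simp add: abs_mult)
 also have "... <= 1 * (norm h / de * C) + (norm h / de * C) * 1"
 using C de hat_le_1 component_le_norm_cart[of h] 
 by (intro add_mono mult_mono) (auto simp: abs_div intro!: divide_right_mono mult_nonneg_nonneg divide_nonneg_pos)
 finally show "(abs (fd (hat_node de p) x h)) <= 2 * C / de * norm h"
 by (simp add: mult_ac)
 qed (use C in simp)
qed

lemma hat_nodes_sum_eq_1:
 fixes x :: "real^2"
 assumes "finite I" "{\<lfloor>x$1 / de\<rfloor>, \<lfloor>x$1 / de\<rfloor> + 1} \<times> {\<lfloor>x$2 / de\<rfloor>, \<lfloor>x$2 / de\<rfloor> + 1} <= I"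
 shows "(\<Sum>p\<in>I. hat_node de p x) = 1"
proof -
 let ?A = "%k. {\<lfloor>x$k / de\<rfloor>, \<lfloor>x$k / de\<rfloor> + 1}"
 have far: "i = \<lfloor>a\<rfloor> \<or> i = \<lfloor>a\<rfloor> + 1" if "hat (a - of_int i) ~= 0" for a :: real and i
 proof -
 have "(abs (a - of_int i)) < 1" using that hat_outside not_le by blast
 thus ?thesis by linarith
 qed
 have "(\<Sum>p\<in>I. hat_node de p x) = (\<Sum>p\<in>?A 1 \<times> ?A 2. hat_node de p x)"
 by (rule sum.mono_neutral_right[OF assms]) (auto simp: hat_node_def dest: far)
 also have "... = (\<Sum>i\<in>?A 1. hat (x$1 / de - of_int i)) * (\<Sum>j\<in>?A 2. hat (x$2 / de - of_int j))"
 by (simp only: sum_product sum.cartesian_product hat_node_def case_prod_unfold)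
 also have "... = 1 * 1"
 using hat_partition[of "x$1 / de"] hat_partition[of "x$2 / de"] by (simp add: algebra_simps)
 finally show ?thesis by simp
qed

text \<open>The cutoff is the sum of those members of a partition of unity of mesh \<open>de\<close>
  whose supporting cells lie in \<open>S\<close>. It plays the role of a mollified function of the
  distance to the complement; as a bounded number of cells overlap at each point, the constants
  depend neither on \<open>S\<close> nor on \<open>de\<close>.\<close>

lemma exists_cutoff:
 obtains C where "C >= 1" "!!(S::(real^2) set) de. open S ==> bounded S ==> de > 0 ==>
 \<exists>et::real^2 => real. et : test_functions S & (\<forall>x. (abs (et x)) <= C) &
 (\<forall>x h. (abs (fd et x h)) <= C / de * norm h) &
 (\<forall>x. ball x (5 * de) <= S --> et x = 1 & (\<forall>h. fd et x h = 0))"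
proof -
 obtain C where C: "C > 0"
 "!!de p x h. de > 0 ==> (abs (fd (hat_node de p) x h)) <= C / de * norm h"
 using hat_node_derivative_bound by metis
 show ?thesis
 proof (rule that[of "16 * C + 16"])
 show "16 * C + 16 >= 1" using C(1) by simp
 fix S :: "(real^2) set" and de :: real
 assume S: "open S" "bounded S" and de: "de > 0"
 define I where "I = {p. hat_cell de p <= S}"
 obtain R where R: "!!x. x : S ==> norm x <= R" using S(2) by (auto simp: bounded_iff)
 have "finite I"
 proof -
 define m where "m = \<lceil>R / de\<rceil>"
 have "I <= {-m..m} \<times> {-m..m}"
 proof
 fix p assume p: "p : I"
 define y :: "real^2" where "y = vector [de * of_int (fst p), de * of_int (snd p)]"
 have y: "y$1 = de * of_int (fst p)" "y$2 = de * of_int (snd p)" by (simp_all add: y_def)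
 hence "y : hat_cell de p" using de by (simp add: hat_cell_def)
 hence "norm y <= R" using p R by (auto simp: I_def)
 hence "(abs (de * of_int (fst p))) <= R" "(abs (de * of_int (snd p))) <= R"
 using component_le_norm_cart[of y] y by (metis order_trans)+
 hence "(abs (of_int (fst p))) <= R / de" "(abs (of_int (snd p))) <= R / de"
 using de by (simp_all add: abs_mult pos_le_divide_eq mult.commute)
 hence "of_int (abs (fst p)) <= (of_int m :: real)" "of_int (abs (snd p)) <= (of_int m :: real)"
 unfolding m_def by (simp_all add: le_of_int_ceiling order_trans[OF _ le_of_int_ceiling])
 hence "(abs (fst p)) <= m" "(abs (snd p)) <= m" by (simp_all only: of_int_le_iff)
 thus "p : {-m..m} \<times> {-m..m}" by (cases p) auto
 qed
 thus ?thesis by (rule finite_subset) auto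
 qed
 define et where "et x = (\<Sum>p\<in>I. hat_node de p x)" for x
 have sm: "smooth et" unfolding et_def[abs_def] by (intro smooth_sum smooth_hat_node)
 have test: "et : test_functions S"
 proof (rule test_functionsI[OF sm, of "\<Union>p\<in>I. hat_cell de p"])
 show "compact (\<Union>p\<in>I. hat_cell de p)" using \<open>finite I\<close> compact_hat_cell[OF de] by auto
 show "(\<Union>p\<in>I. hat_cell de p) <= S" by (auto simp: I_def)
 show "et x = 0" if "x ~: (\<Union>p\<in>I. hat_cell de p)" for x
 unfolding et_def by (intro sum.neutral ballI hat_node_outside) (use that in auto)
 qed
 \<comment> \<open>Only nodes in \<open>J x\<close> can have a cell containing \<open>x\<close>:
   four indices per coordinate, whence the factor 16 in both bounds.\<close>
 define J :: "real^2 => (int \<times> int) set"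
 where "J x = {\<lfloor>x$1 / de\<rfloor> - 1..\<lfloor>x$1 / de\<rfloor> + 2} \<times> {\<lfloor>x$2 / de\<rfloor> - 1..\<lfloor>x$2 / de\<rfloor> + 2}" for x
 have cardJ: "card (I \<inter> J x) <= 16" for x
 proof -
 have "card (I \<inter> J x) <= card (J x)" by (intro card_mono) (auto simp: J_def)
 also have "... = 16" by (simp add: J_def card_cartesian_product)
 finally show ?thesis .
 qed
 have far: "x ~: hat_cell de p" if "p ~: J x" for x p
 proof
 assume x: "x : hat_cell de p"
 have *: "i : {\<lfloor>a\<rfloor> - 1..\<lfloor>a\<rfloor> + 2}" if "(abs (a - of_int i)) <= 1" for a :: real and i
 using that by simp linarith
 show False using that x * by (cases p) (auto simp: J_def hat_cell_def)
 qed
 have frh: "fd et x h = (\<Sum>p\<in>I. fd (hat_node de p) x h)" for x h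
 proof -
 have "(et has_derivative (%h. \<Sum>p\<in>I. fd (hat_node de p) x h)) (at x)"
 unfolding et_def[abs_def] by (intro has_derivative_sum smooth_has_derivative smooth_hat_node)
 from frechet_derivative_at[OF this] show ?thesis by metis
 qed
 have b1: "(abs (et x)) <= 16 * C + 16" for x
 proof -
 have "et x = (\<Sum>p\<in>I \<inter> J x. hat_node de p x)"
 unfolding et_def by (rule sum.mono_neutral_right) (use \<open>finite I\<close> far hat_node_outside in auto)
 also have "(abs (...)) <= (\<Sum>p\<in>I \<inter> J x. (abs (hat_node de p x)))" by (rule sum_abs)
 also have "... <= real (card (I \<inter> J x)) * 1"
 by (intro sum_bounded_above) (auto simp: hat_node_def abs_mult intro!: mult_le_one hat_le_1)
 also have "... <= 16" using cardJ[of x] by simp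
 finally show ?thesis using C(1) by simp
 qed
 have b2: "(abs (fd et x h)) <= (16 * C + 16) / de * norm h" for x h
 proof -
 have "fd et x h = (\<Sum>p\<in>I \<inter> J x. fd (hat_node de p) x h)"
 unfolding frh
 proof (rule sum.mono_neutral_right)
 show "\<forall>p\<in>I - I \<inter> J x. fd (hat_node de p) x h = 0"
 using far by (intro ballI frechet_derivative_outside_support[OF closed_hat_cell hat_node_outside]) auto
 qed (use \<open>finite I\<close> in auto)
 also have "(abs (...)) <= (\<Sum>p\<in>I \<inter> J x. (abs (fd (hat_node de p) x h)))" by (rule sum_abs)
 also have "... <= real (card (I \<inter> J x)) * (C / de * norm h)"
 by (intro sum_bounded_above C(2) de)
 also have "... <= 16 * (C / de * norm h)"
 using cardJ[of x] C(1) de by (intro mult_right_mono) auto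
 also have "... <= (16 * C + 16) / de * norm h"
 using de by (simp add: field_simps)
 finally show ?thesis .
 qed
 \<comment> \<open>The cells of the four nodes adjacent to \<open>y\<close> stay within
   \<open>2 * de\<close> of \<open>y\<close> in each coordinate, so room of radius
   \<open>4 * de\<close> puts all four nodes into \<open>I\<close>, and they already sum to
   1.\<close>
 have one: "et y = 1" if y: "!!z. dist y z <= 4 * de ==> z : S" for y
 unfolding et_def
 proof (rule hat_nodes_sum_eq_1[OF \<open>finite I\<close>], rule subsetI)
 fix p assume p: "p : {\<lfloor>y$1 / de\<rfloor>, \<lfloor>y$1 / de\<rfloor> + 1} \<times> {\<lfloor>y$2 / de\<rfloor>, \<lfloor>y$2 / de\<rfloor> + 1}"
 have pp: "(abs (y$1 / de - of_int (fst p))) <= 1" "(abs (y$2 / de - of_int (snd p))) <= 1"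
 using p by (auto, linarith+)
 have "z : S" if z: "z : hat_cell de p" for z
 proof (rule y)
 have "(abs (y$1 / de - z$1 / de)) <= 2" "(abs (y$2 / de - z$2 / de)) <= 2"
 using z pp by (auto simp: hat_cell_def)
 hence "(abs (y$1 - z$1)) <= 2 * de" "(abs (y$2 - z$2)) <= 2 * de"
 using de by (simp_all add: diff_divide_distrib[symmetric] abs_div pos_divide_le_eq)
 thus "dist y z <= 4 * de"
 using norm_real2_le[of "y - z"] by (simp add: dist_norm)
 qed
 thus "p : I" by (auto simp: I_def)
 qed
 \<comment> \<open>One further \<open>de\<close> gives a whole neighbourhood on which the cutoff is
   constant, so its derivative vanishes too.\<close>
 have inner: "et x = 1 & (\<forall>h. fd et x h = 0)" if x: "ball x (5 * de) <= S" for x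
 proof -
 have near: "et y = 1" if "y : ball x de" for y
 proof (rule one)
 fix z assume "dist y z <= 4 * de"
 hence "dist x z < 5 * de" using that dist_triangle[of x z y] by simp
 thus "z : S" using x by auto
 qed
 have "((%y. 1) has_derivative (%h. 0)) (at x)" by simp
 hence "(et has_derivative (%h. 0)) (at x)"
 by (rule has_derivative_transform_within_open[where s="ball x de"]) (use near de in auto)
 from frechet_derivative_at[OF this] have "fd et x = (%h. 0)" by simp
 thus ?thesis using near[of x] de by simp
 qed
 show "\<exists>et::real^2 => real. et : test_functions S & (\<forall>x. (abs (et x)) <= 16 * C + 16) &
 (\<forall>x h. (abs (fd et x h)) <= (16 * C + 16) / de * norm h) &
 (\<forall>x. ball x (5 * de) <= S --> et x = 1 & (\<forall>h. fd et x h = 0))"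
 using test b1 b2 inner by blast
 qed
qed

subsection \<open>Zero trace\<close>

definition boundary_strip :: "(real^2) set => real => (real^2) set" where
 "boundary_strip S r = {x : S. infdist x (- S) < r}"

text \<open>A quantitative exterior cone condition with finitely many directions.\<close>

definition exit_directions :: "(real^2) set => (real^2) set => real => real => bool" where
 "exit_directions S Ds K rh \<longleftrightarrow> finite Ds & (\<forall>d\<in>Ds. norm d = 1) & K > 0 & rh > 0 &
 (\<forall>de. 0 < de --> de < rh --> boundary_strip S de <= (\<Union>d\<in>Ds. exit_set S d (K * de)))"

lemma open_boundary_strip:
 assumes "open S" shows "open (boundary_strip S r)"
proof -
 have "boundary_strip S r = S \<inter> {x. infdist x (- S) < r}" by (auto simp: boundary_strip_def)
 moreover have "open {x. infdist x (- S) < r}"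
 by (intro open_Collect_less continuous_intros)
 ultimately show ?thesis using assms by auto
qed

lemma ball_subset_outside_strip: "x : S ==> x ~: boundary_strip S r ==> ball x r <= S"
proof
 fix y assume *: "x : S" "x ~: boundary_strip S r" "y : ball x r"
 show "y : S"
 proof (rule ccontr)
 assume "y ~: S"
 hence "infdist x (- S) <= dist x y" by (intro infdist_le) simp
 thus False using * by (simp add: boundary_strip_def)
 qed
qed

lemma exit_set_subset_strip:
 assumes "norm d = 1" "l < r" shows "exit_set S d l <= boundary_strip S r"
proof
 fix x assume "x : exit_set S d l"
 then obtain s where s: "x : S" "s : {0..l}" "x + s *R d ~: S" by (auto simp: exit_set_def)
 have "infdist x (- S) <= dist x (x + s *R d)" using s by (intro infdist_le) simp
 also have "... <= l" using s assms by (simp add: dist_norm)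
 finally show "x : boundary_strip S r" using s assms by (simp add: boundary_strip_def)
qed

lemma norm_frechet_direction_le:
 fixes v :: "real^2 => real^2"
 assumes "smooth v" "norm d = 1"
 shows "(norm (fd v x d))^2 <= 2 * (\<Sum>b\<in>Basis. (norm (fd v x b))^2)"
proof -
 interpret bounded_linear "fd v x"
 using smooth_has_derivative[OF assms(1)] has_derivative_bounded_linear by blast
 have "fd v x d = fd v x (\<Sum>b\<in>Basis. (d \<bullet> b) *R b)"
 by (simp add: euclidean_representation)
 also have "... = (\<Sum>b\<in>Basis. (d \<bullet> b) *R fd v x b)"
 by (simp add: sum scaleR)
 also have "norm ... <= (\<Sum>b\<in>Basis. norm (fd v x b))"
 proof (rule sum_norm_le)
 fix b :: "real^2" assume "b : Basis"
 hence "(abs (d \<bullet> b)) <= 1" using Basis_le_norm assms(2) by metis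
 thus "norm ((d \<bullet> b) *R fd v x b) <= norm (fd v x b)"
 by (simp add: mult_left_le_one_le)
 qed
 finally have "(norm (fd v x d))^2 <= (\<Sum>b\<in>Basis. norm (fd v x b))^2"
 by (rule power_mono) simp
 also have "... <= (\<Sum>b\<in>Basis. (norm (fd v x b))^2) * (\<Sum>b\<in>(Basis::(real^2) set). 1\<^sup>2)"
 using Cauchy_Schwarz_ineq_sum[of "%b. norm (fd v x b)" "%b. 1" Basis] by simp
 finally show ?thesis by (simp add: mult.commute)
qed

text \<open>Sums the estimate for one direction over the finitely many directions. The gradient
  appears on a wider strip, one that contains all the exit sets of length
  \<open>K * de\<close>.\<close>

lemma strip_estimate:
 assumes "open S" "exit_directions S Ds K rh"
 obtains C where "C > 0" "!!(v :: real^2 => real^2) de. smooth v ==> 0 < de ==> de < rh ==>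
 (\<integral>\<^sup>+x\<in>boundary_strip S de. ennreal ((norm (v x))^2) \<partial>lborel) <=
 ennreal (C * de) * (\<integral>\<^sup>+x\<in>frontier S. ennreal ((norm (v x))^2) \<partial>hausdorff1) +
 ennreal (C * de\<^sup>2) * (\<integral>\<^sup>+x\<in>boundary_strip S (2 * K * de). ennreal (\<Sum>b\<in>Basis. (norm (fd v x b))^2) \<partial>lborel)"
proof -
 have Ds: "finite Ds" "!!d. d : Ds ==> norm d = 1" and K: "K > 0" and rh: "rh > 0"
 and cov: "!!de. 0 < de ==> de < rh ==> boundary_strip S de <= (\<Union>d\<in>Ds. exit_set S d (K * de))"
 using assms(2) by (auto simp: exit_directions_def)
 define C where "C = (real (card Ds) + 1) * (64 * K + 4 * K\<^sup>2)"
 show ?thesis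
 proof (rule that[of C])
 show "C > 0" unfolding C_def using K by (intro mult_pos_pos add_pos_pos add_nonneg_pos) auto
 fix v :: "real^2 => real^2" and de :: real
 assume v: "smooth v" and de: "0 < de" "de < rh"
 let ?B = "\<integral>\<^sup>+x\<in>frontier S. ennreal ((norm (v x))^2) \<partial>hausdorff1"
 let ?g = "%x. \<Sum>b\<in>Basis. (norm (fd v x b))^2"
 let ?G = "\<integral>\<^sup>+x\<in>boundary_strip S (2 * K * de). ennreal (?g x) \<partial>lborel"
 have [measurable]: "v : borel_measurable borel" "(%y. fd v y h) : borel_measurable borel" for h
 using smooth_continuous_on[OF v] smooth_continuous_on[OF smooth_frechet[OF v]]
 by (auto intro: borel_measurable_continuous_onI)
 note [measurable] = borel_exit_set[OF assms(1)]
 have [measurable]: "boundary_strip S r : sets borel" for r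
 using open_boundary_strip[OF assms(1)] by auto
 have one: "(\<integral>\<^sup>+x\<in>exit_set S d (K * de). ennreal ((norm (v x))^2) \<partial>lborel) <=
 ennreal (64 * K * de) * ?B + ennreal (4 * K\<^sup>2 * de\<^sup>2) * ?G" if d: "d : Ds" for d
 proof -
 have "(\<integral>\<^sup>+x\<in>exit_set S d (K * de). ennreal ((norm (v x))^2) \<partial>lborel) <=
 ennreal (64 * (K * de)) * ?B + ennreal (2 * (K * de)^2) *
 (\<integral>\<^sup>+x\<in>exit_set S d (K * de). ennreal ((norm (fd v x d))^2) \<partial>lborel)"
 by (rule exit_strip_estimate) (use assms Ds d K de v in auto)
 also have "(\<integral>\<^sup>+x\<in>exit_set S d (K * de). ennreal ((norm (fd v x d))^2) \<partial>lborel) <=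
 (nn_integral lborel (%x. 2 * (ennreal (?g x) * indicator (boundary_strip S (2 * K * de)) x)))"
 proof (rule nn_integral_mono)
 fix x
 \<comment> \<open>\<open>exit_set_subset_strip\<close> asks for a strictly larger width, hence the
   factor 2.\<close>
 have "exit_set S d (K * de) <= boundary_strip S (2 * K * de)"
 by (rule exit_set_subset_strip[OF Ds(2)[OF d]]) (use K de in simp)
 moreover have "ennreal ((norm (fd v x d))^2) <= 2 * ennreal (?g x)"
 proof -
 have "ennreal ((norm (fd v x d))^2) <= ennreal (2 * ?g x)"
 by (intro ennreal_leI norm_frechet_direction_le v Ds(2) d)
 thus ?thesis by (simp add: ennreal_mult')
 qed
 ultimately show "ennreal ((norm (fd v x d))^2) * indicator (exit_set S d (K * de)) x
 <= 2 * (ennreal (?g x) * indicator (boundary_strip S (2 * K * de)) x)"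
 by (auto simp: indicator_def)
 qed
 also have "... = 2 * ?G" by (rule nn_integral_cmult) measurable
 also have "ennreal (2 * (K * de)^2) * (2 * ?G) = ennreal (4 * K\<^sup>2 * de\<^sup>2) * ?G"
 proof -
 have "ennreal (2 * (K * de)^2 * 2) = ennreal (2 * (K * de)^2) * ennreal 2"
 by (rule ennreal_mult'') simp
 moreover have "2 * (K * de)^2 * 2 = 4 * K\<^sup>2 * de\<^sup>2" by (simp add: power_mult_distrib)
 ultimately have "ennreal (2 * (K * de)^2) * 2 = ennreal (4 * K\<^sup>2 * de\<^sup>2)"
 by (metis ennreal_numeral)
 thus ?thesis by (simp add: mult.assoc[symmetric])
 qed
 finally show ?thesis by (simp add: mult.assoc add_left_mono mult_left_mono)
 qed
 have "(\<integral>\<^sup>+x\<in>boundary_strip S de. ennreal ((norm (v x))^2) \<partial>lborel) <=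
 (nn_integral lborel (%x. (\<Sum>d\<in>Ds. ennreal ((norm (v x))^2) * indicator (exit_set S d (K * de)) x)))"
 proof (rule nn_integral_mono)
 fix x
 show "ennreal ((norm (v x))^2) * indicator (boundary_strip S de) x <=
 (\<Sum>d\<in>Ds. ennreal ((norm (v x))^2) * indicator (exit_set S d (K * de)) x)"
 proof (cases "x : boundary_strip S de")
 case True
 then obtain d where d: "d : Ds" "x : exit_set S d (K * de)"
 using subsetD[OF cov[OF de] True] by auto
 hence "ennreal ((norm (v x))^2) * indicator (boundary_strip S de) x =
 ennreal ((norm (v x))^2) * indicator (exit_set S d (K * de)) x" using True by simp
 also have "... <= (\<Sum>d\<in>Ds. ennreal ((norm (v x))^2) * indicator (exit_set S d (K * de)) x)"
 by (rule member_le_sum[OF d(1)]) (use Ds(1) in auto)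
 finally show ?thesis .
 qed simp
 qed
 also have "... = (\<Sum>d\<in>Ds. \<integral>\<^sup>+x\<in>exit_set S d (K * de). ennreal ((norm (v x))^2) \<partial>lborel)"
 by (rule nn_integral_sum) measurable
 also have "... <= (\<Sum>d\<in>Ds. ennreal (64 * K * de) * ?B + ennreal (4 * K\<^sup>2 * de\<^sup>2) * ?G)"
 by (intro sum_mono one)
 also have "... = (ennreal (real (card Ds)) * ennreal (64 * K * de)) * ?B + (ennreal (real (card Ds)) * ennreal (4 * K\<^sup>2 * de\<^sup>2)) * ?G"
 by (simp add: ennreal_of_nat_eq_real_of_nat distrib_left mult.assoc)
 also have "... = ennreal (real (card Ds) * (64 * K * de)) * ?B + ennreal (real (card Ds) * (4 * K\<^sup>2 * de\<^sup>2)) * ?G"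
 by (simp add: ennreal_mult')
 also have "... <= ennreal (C * de) * ?B + ennreal (C * de\<^sup>2) * ?G"
 proof -
 have c: "real (card Ds) * (64 * K) <= C" "real (card Ds) * (4 * K\<^sup>2) <= C"
 unfolding C_def using K by (intro mult_mono; simp)+
 have "real (card Ds) * (64 * K * de) <= C * de" "real (card Ds) * (4 * K\<^sup>2 * de\<^sup>2) <= C * de\<^sup>2"
 using mult_right_mono[OF c(1), of de] mult_right_mono[OF c(2), of "de\<^sup>2"] de by (simp_all add: mult.assoc)
 thus ?thesis by (intro add_mono mult_right_mono ennreal_leI) auto
 qed
 finally show "(\<integral>\<^sup>+x\<in>boundary_strip S de. ennreal ((norm (v x))^2) \<partial>lborel) <= ennreal (C * de) * ?B + ennreal (C * de\<^sup>2) * ?G" .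
 qed
qed

lemma nn_integral_lebesgue_on_open:
 assumes "open S" "f : borel_measurable borel"
 shows "(nn_integral (lebesgue_on S) (%x. f x)) = (\<integral>\<^sup>+x\<in>S. f x \<partial>lborel)"
proof -
 have "(nn_integral (lebesgue_on S) (%x. f x)) = (\<integral>\<^sup>+x\<in>S. f x \<partial>lebesgue)"
 by (rule nn_integral_restrict_space) (simp add: assms(1))
 thus ?thesis by (simp only: nn_integral_completion)
qed

lemma ennreal_L2n_sq:
 "sq_integrable M f ==> ennreal ((L2n M f)^2) = (nn_integral M (%x. ennreal ((norm (f x))^2)))"
 by (subst nn_integral_eq_integral) (auto simp: sq_integrable_def L2n_sq)

lemma boundary_strip_mono: "r <= r' ==> boundary_strip S r <= boundary_strip S r'"
 by (auto simp: boundary_strip_def)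

lemma borel_boundary_strip: "open S ==> boundary_strip S r : sets borel"
 by (intro borel_open open_boundary_strip)

text \<open>The cutoff has a gradient of order \<open>1 / de\<close> on a strip of width of order
  \<open>de\<close>. There \<open>strip_estimate\<close> bounds the square integral of
  \<open>v\<close> by \<open>de^2\<close> times the energy plus \<open>de\<close> times the boundary
  integral; division by \<open>de^2\<close> leaves the energy of a thin strip and
  \<open>1 / de\<close> times the boundary integral.\<close>

lemma cutoff_error:
 assumes S: "open S" "bounded S" and ext: "exit_directions S Ds K rh"
 obtains C ka rh' where "C > 0" "ka > 0" "rh' > 0"
 "!!(v :: real^2 => real^2) de. smooth v ==> 0 < de ==> de < rh' ==>
 \<exists>ph\<in>test_functions S. ennreal ((H1_norm S (%x. v x - ph x))^2) <=
 ennreal C * (\<integral>\<^sup>+x\<in>boundary_strip S (ka * de). ennreal (\<Sum>b\<in>Basis. (norm (fd v x b))^2) \<partial>lborel) +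
 ennreal (C / de) * (\<integral>\<^sup>+x\<in>frontier S. ennreal ((norm (v x))^2) \<partial>hausdorff1)"
proof -
 have K: "K > 0" "rh > 0" using ext by (auto simp: exit_directions_def)
 obtain C0 where C0: "C0 >= 1" and cut: "!!(S::(real^2) set) de. open S ==> bounded S ==> de > 0 ==>
 \<exists>et::real^2 => real. et : test_functions S & (\<forall>x. (abs (et x)) <= C0) &
 (\<forall>x h. (abs (fd et x h)) <= C0 / de * norm h) &
 (\<forall>x. ball x (5 * de) <= S --> et x = 1 & (\<forall>h. fd et x h = 0))"
 using exists_cutoff by blast
 obtain C1 where C1: "C1 > 0" and strip: "!!(v :: real^2 => real^2) de. smooth v ==> 0 < de ==> de < rh ==>
 (\<integral>\<^sup>+x\<in>boundary_strip S de. ennreal ((norm (v x))^2) \<partial>lborel) <=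
 ennreal (C1 * de) * (\<integral>\<^sup>+x\<in>frontier S. ennreal ((norm (v x))^2) \<partial>hausdorff1) +
 ennreal (C1 * de\<^sup>2) * (\<integral>\<^sup>+x\<in>boundary_strip S (2 * K * de). ennreal (\<Sum>b\<in>Basis. (norm (fd v x b))^2) \<partial>lborel)"
 using strip_estimate[OF S(1) ext] by blast
 \<comment> \<open>The cutoff equals 1 off the strip of width \<open>5 * de\<close>, so
   \<open>strip_estimate\<close> is applied at \<open>5 * de\<close>: this gives
   \<open>8 * 5 = 40\<close> and \<open>8 * 25 = 200\<close>, and \<open>ka\<close> has to dominate
   both \<open>5\<close> and \<open>2 * K * 5\<close>. The restriction \<open>de < 1\<close> below
   lets the undifferentiated part of the norm be absorbed by the term with
   \<open>1 / de^2\<close>.\<close>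
 define C where "C = 8 * C0\<^sup>2 + 200 * C0\<^sup>2 * C1"
 define ka where "ka = max 5 (10 * K)"
 have Cpos: "C > 0" unfolding C_def using C0 C1 by (intro add_pos_pos mult_pos_pos) auto
 show ?thesis
 proof (rule that[of C ka "min 1 (rh / 5)"])
 show "C > 0" by fact
 show "ka > 0" "min 1 (rh / 5) > 0" using K by (auto simp: ka_def)
 fix v :: "real^2 => real^2" and de :: real
 assume v: "smooth v" and de: "0 < de" "de < min 1 (rh / 5)"
 obtain et :: "real^2 => real" where et: "et : test_functions S" "!!x. (abs (et x)) <= C0"
 "!!x h. (abs (fd et x h)) <= C0 / de * norm h"
 "!!x. ball x (5 * de) <= S ==> et x = 1"
 "!!x h. ball x (5 * de) <= S ==> fd et x h = 0"
 using cut[OF S de(1)] by blast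
 define ph where "ph x = et x *R v x" for x
 have ph: "ph : test_functions S"
 unfolding ph_def[abs_def] by (rule test_functions_bilinear[OF et(1) bounded_bilinear_scaleR v])
 define w where "w x = v x - ph x" for x
 have wsm: "smooth w" unfolding w_def[abs_def] using v test_functions_smooth[OF ph] by (rule smooth_diff)
 let ?E = "%b x. fd w x b"
 have W: "W12 S w ?E" using W12_smooth[OF wsm S(2)] S(1) by simp
 have E: "?E b x = fd v x b - (et x *R fd v x b + fd et x b *R v x)" for b x
 proof -
 have "(w has_derivative (%b. fd v x b - (et x *R fd v x b + fd et x b *R v x))) (at x)"
 unfolding w_def[abs_def] ph_def
 by (intro has_derivative_diff bounded_bilinear.FDERIV[OF bounded_bilinear_scaleR] smooth_has_derivative
 v test_functions_smooth[OF et(1)])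
 from frechet_derivative_at[OF this, symmetric] show ?thesis by (rule fun_cong)
 qed
 let ?g = "%x. \<Sum>b\<in>Basis. (norm (fd v x b))^2"
 let ?T = "boundary_strip S"
 let ?B = "\<integral>\<^sup>+x\<in>frontier S. ennreal ((norm (v x))^2) \<partial>hausdorff1"
 have vm [measurable]: "v : borel_measurable borel" "(%y. fd v y h) : borel_measurable borel" for h
 using smooth_continuous_on[OF v] smooth_continuous_on[OF smooth_frechet[OF v]]
 by (auto intro: borel_measurable_continuous_onI)
 have wm [measurable]: "w : borel_measurable borel" "(%y. fd w y h) : borel_measurable borel" for h
 using smooth_continuous_on[OF wsm] smooth_continuous_on[OF smooth_frechet[OF wsm]]
 by (auto intro: borel_measurable_continuous_onI)
 note [measurable] = borel_boundary_strip[OF S(1)]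
 have S_borel [measurable]: "S : sets borel" using S(1) by simp
 have pw: "(norm (w x))^2 + (\<Sum>b\<in>Basis. (norm (?E b x))^2) <=
 8 * C0\<^sup>2 * ?g x + 8 * C0\<^sup>2 / de\<^sup>2 * (norm (v x))^2" for x
 proof -
 have "norm (w x) <= 2 * C0 * norm (v x)"
 proof -
 have "norm (w x) <= norm (v x) + (abs (et x)) * norm (v x)"
 unfolding w_def ph_def by (metis norm_scaleR norm_triangle_ineq4)
 also have "... <= C0 * norm (v x) + C0 * norm (v x)"
 using et(2)[of x] C0 by (intro add_mono mult_right_mono) (auto simp: mult_le_cancel_right1)
 finally show ?thesis by simp
 qed
 hence "(norm (w x))^2 <= (2 * C0 * norm (v x))^2" by (rule power_mono) simp
 also have "... = 4 * C0\<^sup>2 * 1 * (norm (v x))^2" by (simp add: power_mult_distrib)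
 also have "... <= 4 * C0\<^sup>2 * (1 / de\<^sup>2) * (norm (v x))^2"
 using de by (intro mult_right_mono mult_left_mono) (auto simp: power_le_one)
 finally have 1: "(norm (w x))^2 <= 4 * C0\<^sup>2 / de\<^sup>2 * (norm (v x))^2" by simp
 have 2: "(norm (?E b x))^2 <= 8 * C0\<^sup>2 * (norm (fd v x b))^2 + 2 * C0\<^sup>2 / de\<^sup>2 * (norm (v x))^2"
 if b: "b : Basis" for b
 proof -
 let ?d = "norm (fd v x b)"
 have "norm (?E b x) <= ?d + ((abs (et x)) * ?d + (abs (fd et x b)) * norm (v x))"
 unfolding E
 by (rule order_trans[OF norm_triangle_ineq4]) (intro add_left_mono order_trans[OF norm_triangle_ineq], simp)
 also have "... <= C0 * ?d + (C0 * ?d + C0 / de * norm (v x))"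
 using et(2)[of x] et(3)[of x b] C0 b
 by (intro add_mono mult_right_mono) (auto simp: mult_le_cancel_right1)
 finally have "norm (?E b x) <= 2 * C0 * ?d + C0 / de * norm (v x)" by simp
 hence "(norm (?E b x))^2 <= (2 * C0 * ?d + C0 / de * norm (v x))^2" by (rule power_mono) simp
 also have "... <= 2 * (2 * C0 * ?d)^2 + 2 * (C0 / de * norm (v x))^2"
 using sum_squares_bound[of "2 * C0 * ?d" "C0 / de * norm (v x)"] by (simp add: power2_sum)
 also have "... = 8 * C0\<^sup>2 * ?d\<^sup>2 + 2 * C0\<^sup>2 / de\<^sup>2 * (norm (v x))^2"
 by (simp add: power_mult_distrib power_divide)
 finally show ?thesis .
 qed
 have "(\<Sum>b\<in>Basis. (norm (?E b x))^2) <= (\<Sum>b\<in>Basis. 8 * C0\<^sup>2 * (norm (fd v x b))^2 + 2 * C0\<^sup>2 / de\<^sup>2 * (norm (v x))^2)"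
 by (intro sum_mono 2)
 also have "... = 8 * C0\<^sup>2 * ?g x + 2 * (2 * C0\<^sup>2 / de\<^sup>2 * (norm (v x))^2)"
 by (simp add: sum.distrib sum_distrib_left)
 finally show ?thesis using 1 by simp
 qed
 have zero: "w x = 0" "?E b x = 0" if "x : S" "x ~: ?T (5 * de)" for x b
 using ball_subset_outside_strip[OF that] et(4,5)[of x] by (simp_all add: w_def ph_def E)
 have "ennreal ((H1_norm S w)^2) = ennreal ((L2n (lebesgue_on S) w)^2 + (\<Sum>b\<in>Basis. (L2n (lebesgue_on S) (?E b))^2))"
 unfolding H1_norm_W12[OF S(1) W] by (subst real_sqrt_pow2) (auto intro!: add_nonneg_nonneg sum_nonneg)
 also have "... = (nn_integral (lebesgue_on S) (%x. ennreal ((norm (w x))^2))) + (\<Sum>b\<in>Basis. \<integral>\<^sup>+x. ennreal ((norm (?E b x))^2) \<partial>lebesgue_on S)"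
 using W12_sq_integrable[OF W] W12_deriv_sq_integrable[OF W]
 by (simp add: ennreal_plus sum_nonneg ennreal_L2n_sq flip: sum_ennreal)
 also have "... = (\<integral>\<^sup>+x\<in>S. ennreal ((norm (w x))^2) \<partial>lborel) + (\<Sum>b\<in>Basis. \<integral>\<^sup>+x\<in>S. ennreal ((norm (?E b x))^2) \<partial>lborel)"
 by (simp add: nn_integral_lebesgue_on_open S(1))
 also have "... = (\<integral>\<^sup>+x\<in>S. ennreal ((norm (w x))^2 + (\<Sum>b\<in>Basis. (norm (?E b x))^2)) \<partial>lborel)"
 by (simp add: nn_integral_add[symmetric] nn_integral_sum[symmetric] ennreal_plus sum_nonneg
 sum_distrib_right distrib_right flip: sum_ennreal)
 also have "... <= (nn_integral lborel (%x. ennreal (8 * C0\<^sup>2) * (ennreal (?g x) * indicator (?T (5 * de)) x) +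
 ennreal (8 * C0\<^sup>2 / de\<^sup>2) * (ennreal ((norm (v x))^2) * indicator (?T (5 * de)) x)))"
 proof (rule nn_integral_mono)
 fix x
 show "ennreal ((norm (w x))^2 + (\<Sum>b\<in>Basis. (norm (?E b x))^2)) * indicator S x <=
 ennreal (8 * C0\<^sup>2) * (ennreal (?g x) * indicator (?T (5 * de)) x) +
 ennreal (8 * C0\<^sup>2 / de\<^sup>2) * (ennreal ((norm (v x))^2) * indicator (?T (5 * de)) x)"
 proof (cases "x : ?T (5 * de)")
 case True
 hence "x : S" by (simp add: boundary_strip_def)
 have "ennreal ((norm (w x))^2 + (\<Sum>b\<in>Basis. (norm (?E b x))^2)) <=
 ennreal (8 * C0\<^sup>2 * ?g x + 8 * C0\<^sup>2 / de\<^sup>2 * (norm (v x))^2)"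
 by (intro ennreal_leI pw)
 also have "... = ennreal (8 * C0\<^sup>2) * ennreal (?g x) + ennreal (8 * C0\<^sup>2 / de\<^sup>2) * ennreal ((norm (v x))^2)"
 by (subst ennreal_plus) (auto simp: sum_nonneg ennreal_mult'[symmetric])
 finally show ?thesis using True \<open>x : S\<close> by simp
 next
 case False
 thus ?thesis using zero[of x] by (cases "x : S") simp_all
 qed
 qed
 also have "... = ennreal (8 * C0\<^sup>2) * (\<integral>\<^sup>+x\<in>?T (5 * de). ennreal (?g x) \<partial>lborel) +
 ennreal (8 * C0\<^sup>2 / de\<^sup>2) * (\<integral>\<^sup>+x\<in>?T (5 * de). ennreal ((norm (v x))^2) \<partial>lborel)"
 by (subst nn_integral_add) (auto simp: nn_integral_cmult)
 also have "... <= ennreal (8 * C0\<^sup>2) * (\<integral>\<^sup>+x\<in>?T (ka * de). ennreal (?g x) \<partial>lborel) +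
 ennreal (8 * C0\<^sup>2 / de\<^sup>2) * (ennreal (C1 * (5 * de)) * ?B + ennreal (C1 * (5 * de)^2) *
 (\<integral>\<^sup>+x\<in>?T (ka * de). ennreal (?g x) \<partial>lborel))"
 proof -
 have m: "(\<integral>\<^sup>+x\<in>?T r. ennreal (?g x) \<partial>lborel) <= (\<integral>\<^sup>+x\<in>?T (ka * de). ennreal (?g x) \<partial>lborel)" if "r <= ka * de" for r
 using boundary_strip_mono[OF that, of S]
 by (intro nn_integral_mono mult_left_mono) (auto simp: indicator_def)
 have r: "5 * de <= ka * de" "2 * K * (5 * de) <= ka * de"
 using de mult_right_mono[of 5 ka de] mult_right_mono[of "10 * K" ka de] by (auto simp: ka_def)
 have "(\<integral>\<^sup>+x\<in>?T (5 * de). ennreal ((norm (v x))^2) \<partial>lborel) <= ennreal (C1 * (5 * de)) * ?B +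
 ennreal (C1 * (5 * de)^2) * (\<integral>\<^sup>+x\<in>?T (2 * K * (5 * de)). ennreal (?g x) \<partial>lborel)"
 by (rule strip[OF v]) (use de in auto)
 also have "... <= ennreal (C1 * (5 * de)) * ?B + ennreal (C1 * (5 * de)^2) * (\<integral>\<^sup>+x\<in>?T (ka * de). ennreal (?g x) \<partial>lborel)"
 by (intro add_left_mono mult_left_mono m r) simp
 finally show ?thesis by (intro add_mono mult_left_mono m r) auto
 qed
 also have "... = ennreal (8 * C0\<^sup>2 + 200 * C0\<^sup>2 * C1) * (\<integral>\<^sup>+x\<in>?T (ka * de). ennreal (?g x) \<partial>lborel) + ennreal (40 * C0\<^sup>2 * C1 / de) * ?B"
 proof -
 have e1: "ennreal (8 * C0\<^sup>2 / de\<^sup>2) * ennreal (C1 * (5 * de)) = ennreal (40 * C0\<^sup>2 * C1 / de)"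
 using de C1 by (subst ennreal_mult[symmetric]) (auto simp: field_simps power2_eq_square)
 have e2: "ennreal (8 * C0\<^sup>2 / de\<^sup>2) * ennreal (C1 * (5 * de)^2) = ennreal (200 * C0\<^sup>2 * C1)"
 using de C1 by (subst ennreal_mult[symmetric]) (auto simp: field_simps power2_eq_square)
 have e3: "ennreal (8 * C0\<^sup>2 + 200 * C0\<^sup>2 * C1) = ennreal (8 * C0\<^sup>2) + ennreal (200 * C0\<^sup>2 * C1)"
 using C1 by (intro ennreal_plus) auto
 have alg: "a * X + b * (c * Y + e * X) = (a + b * e) * X + (b * c) * Y" for a b c e X Y :: ennreal
 by (simp add: distrib_left distrib_right mult.assoc ac_simps)
 show ?thesis by (simp only: alg e1 e2 e3)
 qed
 also have "... <= ennreal C * (\<integral>\<^sup>+x\<in>?T (ka * de). ennreal (?g x) \<partial>lborel) + ennreal (C / de) * ?B"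
 proof -
 have "C - 40 * C0\<^sup>2 * C1 = 8 * C0\<^sup>2 + 160 * (C0\<^sup>2 * C1)"
 unfolding C_def by (simp add: algebra_simps)
 moreover have "0 <= 8 * C0\<^sup>2 + 160 * (C0\<^sup>2 * C1)" using C1 by simp
 ultimately have "40 * C0\<^sup>2 * C1 <= C" by linarith
 hence "40 * C0\<^sup>2 * C1 / de <= C / de" using de by (intro divide_right_mono) auto
 thus ?thesis unfolding C_def by (intro add_mono mult_right_mono ennreal_leI) (use C1 in auto)
 qed
 finally show "\<exists>ph\<in>test_functions S. ennreal ((H1_norm S (%x. v x - ph x))^2) <=
 ennreal C * (\<integral>\<^sup>+x\<in>?T (ka * de). ennreal (?g x) \<partial>lborel) + ennreal (C / de) * ?B"
 using ph unfolding w_def by blast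
 qed
qed

lemma H1_norm_triangle:
 fixes f g :: "'a::euclidean_space => 'b::euclidean_space"
 assumes "open S" "W12 S f D" "W12 S g E"
 shows "H1_norm S (%x. f x + g x) <= (1 + real DIM('a)) * (H1_norm S f + H1_norm S g)"
proof -
 let ?M = "lebesgue_on S"
 have "H1_norm S (%x. f x + g x) <= L2n ?M (%x. f x + g x) + (\<Sum>b\<in>Basis. L2n ?M (%x. D b x + E b x))"
 by (rule H1_norm_bounds(3)[OF assms(1) W12_add[OF assms(2,3)]])
 also have "... <= (H1_norm S f + H1_norm S g) + (\<Sum>b\<in>(Basis::'a set). H1_norm S f + H1_norm S g)"
 proof (intro add_mono sum_mono)
 show "L2n ?M (%x. f x + g x) <= H1_norm S f + H1_norm S g"
 using L2n_triangle[OF W12_sq_integrable[OF assms(2)] W12_sq_integrable[OF assms(3)]]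
 H1_norm_bounds(1)[OF assms(1,2)] H1_norm_bounds(1)[OF assms(1,3)] by linarith
 fix b :: 'a assume b: "b : Basis"
 show "L2n ?M (%x. D b x + E b x) <= H1_norm S f + H1_norm S g"
 using L2n_triangle[OF W12_deriv_sq_integrable[OF assms(2) b] W12_deriv_sq_integrable[OF assms(3) b]]
 H1_norm_bounds(2)[OF assms(1,2) b] H1_norm_bounds(2)[OF assms(1,3) b] by linarith
 qed
 also have "... = (1 + real DIM('a)) * (H1_norm S f + H1_norm S g)"
 by (simp add: distrib_right)
 finally show ?thesis .
qed

lemma tendsto_L2n_boundary_strip:
 fixes f :: "real^2 => real^2"
 assumes "open S" "bounded S" "sq_integrable (lebesgue_on S) f" "r ----> 0"
 shows "(%m. L2n (lebesgue_on S) (%x. indicator (boundary_strip S (r m)) x *R f x)) ----> 0"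
proof (rule tendsto_L2n_dominated[OF _ assms(3)])
 have S: "S : sets lebesgue" using assms(1) by simp
 have f: "f : borel_measurable (lebesgue_on S)" using assms(3) by (simp add: sq_integrable_def)
 show "(%x. indicator (boundary_strip S (r m)) x *R f x) : borel_measurable (lebesgue_on S)" for m
 proof (rule borel_measurable_scaleR[OF _ f])
 have "boundary_strip S (r m) : sets (lebesgue_on S)"
 using open_boundary_strip[OF assms(1), of "r m"] S
 by (auto simp: sets_restrict_space_iff boundary_strip_def)
 thus "(%x. indicat_real (boundary_strip S (r m)) x) : borel_measurable (lebesgue_on S)"
 by (rule borel_measurable_indicator)
 qed
 show "AE x in lebesgue_on S. norm (indicator (boundary_strip S (r m)) x *R f x) <= norm (f x)" for m
 by (intro AE_I2) (simp add: indicator_def)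
 show "AE x in lebesgue_on S. (%m. indicator (boundary_strip S (r m)) x *R f x) ----> 0"
 proof (rule AE_I2)
 fix x assume "x : space (lebesgue_on S)"
 hence x: "x : S" by (simp add: space_restrict_space)
 have "- S ~= {}"
 proof
 assume "- S = {}"
 hence "S = UNIV" by blast
 thus False using assms(2) not_bounded_UNIV[where 'a="real^2"] by simp
 qed
 hence "0 < infdist x (- S)"
 using x assms(1) by (intro infdist_pos_not_in_closed) auto
 hence "eventually (%m. r m < infdist x (- S)) sequentially"
 using order_tendstoD(2)[OF assms(4)] by blast
 hence "eventually (%m. indicator (boundary_strip S (r m)) x *R f x = 0) sequentially"
 by eventually_elim (simp add: boundary_strip_def)
 thus "(%m. indicator (boundary_strip S (r m)) x *R f x) ----> 0"
 by (rule tendsto_eventually)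
 qed
qed

text \<open>Replaces the energy of the approximant on the strip by that of the fixed function
  \<open>z\<close>, so that the width can be chosen independently of the approximant.\<close>

lemma strip_gradient_bound:
 fixes z v :: "real^2 => real^2"
 assumes "open S" "bounded S" "W12 S z D" "smooth v"
 shows "(\<integral>\<^sup>+x\<in>boundary_strip S r. ennreal (\<Sum>b\<in>Basis. (norm (fd v x b))^2) \<partial>lborel) <=
 ennreal (\<Sum>b\<in>Basis. 2 * (L2n (lebesgue_on S) (%x. indicator (boundary_strip S r) x *R D b x))^2 +
 2 * (L2n (lebesgue_on S) (%x. D b x - fd v x b))^2)"
proof -
 let ?M = "lebesgue_on S" and ?T = "boundary_strip S r"
 let ?E = "%b x. fd v x b"
 have S: "S : sets lebesgue" using assms(1) by simp
 have W: "W12 S v ?E" by (rule W12_smooth[OF assms(4,2) S])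
 have vm [measurable]: "(%y. fd v y h) : borel_measurable borel" for h
 using smooth_continuous_on[OF smooth_frechet[OF assms(4)]] by (auto intro: borel_measurable_continuous_onI)
 note [measurable] = borel_boundary_strip[OF assms(1)]
 have TM: "?T : sets ?M"
 using open_boundary_strip[OF assms(1), of r] S by (auto simp: sets_restrict_space_iff boundary_strip_def)
 have sq1: "sq_integrable ?M (%x. indicator ?T x *R D b x)" if b: "b : Basis" for b
 by (rule sq_integrable_bound[OF W12_deriv_sq_integrable[OF assms(3) b], where C=1])
 (use W12_deriv_sq_integrable[OF assms(3) b] TM in
 \<open>auto simp: sq_integrable_def indicator_def intro!: borel_measurable_scaleR borel_measurable_indicator\<close>)
 have sq2: "sq_integrable ?M (%x. D b x - ?E b x)" if b: "b : Basis" for b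
 by (rule W12_deriv_sq_integrable[OF W12_diff[OF assms(3) W] b])
 have "(\<integral>\<^sup>+x\<in>?T. ennreal (\<Sum>b\<in>Basis. (norm (?E b x))^2) \<partial>lborel) =
 (\<integral>\<^sup>+x\<in>S. (ennreal (\<Sum>b\<in>Basis. (norm (?E b x))^2) * indicator ?T x) \<partial>lborel)"
 by (intro nn_integral_cong) (auto simp: indicator_def boundary_strip_def)
 also have "... = (nn_integral ?M (%x. ennreal (\<Sum>b\<in>Basis. (norm (?E b x))^2) * indicator ?T x))"
 by (rule nn_integral_lebesgue_on_open[symmetric]) (use assms(1) in measurable)
 also have "... <= (nn_integral ?M (%x. (\<Sum>b\<in>Basis. ennreal (2 * (norm (indicator ?T x *R D b x))^2 + 2 * (norm (D b x - ?E b x))^2))))"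
 proof (rule nn_integral_mono)
 fix x
 have "(\<Sum>b\<in>Basis. (norm (?E b x))^2) <= (\<Sum>b\<in>Basis. 2 * (norm (D b x))^2 + 2 * (norm (D b x - ?E b x))^2)"
 by (intro sum_mono power2_norm_le_twice)
 hence "ennreal (\<Sum>b\<in>Basis. (norm (?E b x))^2) <= ennreal (\<Sum>b\<in>Basis. 2 * (norm (D b x))^2 + 2 * (norm (D b x - ?E b x))^2)"
 by (rule ennreal_leI)
 also have "... = (\<Sum>b\<in>Basis. ennreal (2 * (norm (D b x))^2 + 2 * (norm (D b x - ?E b x))^2))"
 by (rule sum_ennreal[symmetric]) simp
 finally show "ennreal (\<Sum>b\<in>Basis. (norm (?E b x))^2) * indicator ?T x <=
 (\<Sum>b\<in>Basis. ennreal (2 * (norm (indicator ?T x *R D b x))^2 + 2 * (norm (D b x - ?E b x))^2))"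
 by (auto simp: indicator_def)
 qed
 also have "... = (\<Sum>b\<in>Basis. \<integral>\<^sup>+x. ennreal (2 * (norm (indicator ?T x *R D b x))^2 + 2 * (norm (D b x - ?E b x))^2) \<partial>?M)"
 proof (rule nn_integral_sum)
 fix b :: "real^2" assume b: "b : Basis"
 have bm: "(%x. indicator ?T x *R D b x) : borel_measurable ?M" "(%x. D b x - ?E b x) : borel_measurable ?M"
 using sq1[OF b] sq2[OF b] by (simp_all add: sq_integrable_def)
 have "(%x. 2 * (norm (indicator ?T x *R D b x))^2 + 2 * (norm (D b x - ?E b x))^2) : borel_measurable ?M"
 by (intro borel_measurable_add borel_measurable_times borel_measurable_const borel_measurable_power
 measurable_compose[OF bm(1) borel_measurable_norm] measurable_compose[OF bm(2) borel_measurable_norm])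
 thus "(%x. ennreal (2 * (norm (indicator ?T x *R D b x))^2 + 2 * (norm (D b x - ?E b x))^2)) : borel_measurable ?M"
 by (rule measurable_compose[OF _ measurable_ennreal])
 qed
 also have "... = (\<Sum>b\<in>Basis. ennreal (2 * (L2n ?M (%x. indicator ?T x *R D b x))^2 + 2 * (L2n ?M (%x. D b x - ?E b x))^2))"
 proof (rule sum.cong[OF refl])
 fix b :: "real^2" assume b: "b : Basis"
 have i: "integrable ?M (%x. (norm (indicator ?T x *R D b x))^2)" "integrable ?M (%x. (norm (D b x - ?E b x))^2)"
 using sq1[OF b] sq2[OF b] by (simp_all add: sq_integrable_def del: norm_scaleR)
 have "(nn_integral ?M (%x. ennreal (2 * (norm (indicator ?T x *R D b x))^2 + 2 * (norm (D b x - ?E b x))^2))) =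
 ennreal (LINT x|?M. 2 * (norm (indicator ?T x *R D b x))^2 + 2 * (norm (D b x - ?E b x))^2)"
 by (rule nn_integral_eq_integral) (use i in \<open>auto simp del: norm_scaleR\<close>)
 also have "(LINT x|?M. 2 * (norm (indicator ?T x *R D b x))^2 + 2 * (norm (D b x - ?E b x))^2) =
 2 * (L2n ?M (%x. indicator ?T x *R D b x))^2 + 2 * (L2n ?M (%x. D b x - ?E b x))^2"
 using i by (simp add: L2n_sq del: norm_scaleR)
 finally show "(nn_integral ?M (%x. ennreal (2 * (norm (indicator ?T x *R D b x))^2 + 2 * (norm (D b x - ?E b x))^2))) =
 ennreal (2 * (L2n ?M (%x. indicator ?T x *R D b x))^2 + 2 * (L2n ?M (%x. D b x - ?E b x))^2)" .
 qed
 also have "... = ennreal (\<Sum>b\<in>Basis. 2 * (L2n ?M (%x. indicator ?T x *R D b x))^2 + 2 * (L2n ?M (%x. D b x - ?E b x))^2)"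
 by (rule sum_ennreal) simp
 finally show ?thesis .
qed

text \<open>The strip width is fixed first, from the vanishing energy of \<open>z\<close> on thin
  strips, and the index \<open>n\<close> afterwards: the boundary integral carries the factor
  \<open>C / de\<close>, which is harmless only at a fixed width.\<close>

theorem zero_trace_imp_H10:
 fixes z :: "real^2 => real^2"
 assumes S: "open S" "bounded S" and ext: "exit_directions S Ds K rh"
 and z: "W12 S z D" and v: "!!n. smooth (v n)"
 and lim: "(%n. H1_norm S (%x. z x - v n x)) ----> 0"
 and bd: "(%n. \<integral>\<^sup>+x\<in>frontier S. ennreal ((norm (v n x))^2) \<partial>hausdorff1) ----> 0"
 shows "z : H10 S"
proof -
 let ?M = "lebesgue_on S"
 let ?E = "%n b x. fd (v n) x b"
 let ?B = "%n. \<integral>\<^sup>+x\<in>frontier S. ennreal ((norm (v n x))^2) \<partial>hausdorff1"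
 have Sl: "S : sets lebesgue" using S(1) by simp
 have Wv: "W12 S (v n) (?E n)" for n by (rule W12_smooth[OF v S(2) Sl])
 have Wd: "W12 S (%x. z x - v n x) (%b x. D b x - ?E n b x)" for n by (rule W12_diff[OF z Wv])
 obtain C ka rh' where C: "C > 0" "ka > 0" "rh' > 0" and err:
 "!!(v :: real^2 => real^2) de. smooth v ==> 0 < de ==> de < rh' ==>
 \<exists>ph\<in>test_functions S. ennreal ((H1_norm S (%x. v x - ph x))^2) <=
 ennreal C * (\<integral>\<^sup>+x\<in>boundary_strip S (ka * de). ennreal (\<Sum>b\<in>Basis. (norm (fd v x b))^2) \<partial>lborel) +
 ennreal (C / de) * (\<integral>\<^sup>+x\<in>frontier S. ennreal ((norm (v x))^2) \<partial>hausdorff1)"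
 by (rule cutoff_error[OF S ext]) blast
 have "\<exists>ph\<in>test_functions S. H1_norm S (%x. z x - ph x) < e" if e: "e > 0" for e
 proof -
 \<comment> \<open>In the plane \<open>H1_norm_triangle\<close> has the constant 3, and there are
   two summands, hence \<open>e / 6\<close>.\<close>
 define e' where "e' = (e / 6)^2"
 have e': "e' > 0" using e by (simp add: e'_def)
 define de where "de m = rh' / real (Suc (Suc m))" for m
 have de: "0 < de m" "de m < rh'" for m using C(3) by (simp_all add: de_def field_simps add_pos_nonneg)
 have "de ----> rh' * 0"
 unfolding de_def[abs_def] divide_inverse
 by (intro tendsto_mult tendsto_const LIMSEQ_Suc[OF LIMSEQ_inverse_real_of_nat])
 hence "(%m. ka * de m) ----> ka * (rh' * 0)" by (intro tendsto_mult tendsto_const)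
 hence kade: "(%m. ka * de m) ----> 0" by simp
 have "(%m. C * (\<Sum>b\<in>Basis. 2 * (L2n ?M (%x. indicator (boundary_strip S (ka * de m)) x *R D b x))^2))
 ----> C * (\<Sum>b\<in>(Basis::(real^2) set). 2 * 0\<^sup>2)"
 by (intro tendsto_intros tendsto_L2n_boundary_strip S kade W12_deriv_sq_integrable[OF z])
 hence "\<forall>\<^sub>F m in sequentially. C * (\<Sum>b\<in>Basis. 2 * (L2n ?M (%x. indicator (boundary_strip S (ka * de m)) x *R D b x))^2) < e' / 3"
 using e' by (intro order_tendstoD(2)) auto
 then obtain m where m: "C * (\<Sum>b\<in>Basis. 2 * (L2n ?M (%x. indicator (boundary_strip S (ka * de m)) x *R D b x))^2) < e' / 3"
 by (auto simp: eventually_sequentially)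
 have Ld: "(%n. L2n ?M (%x. D b x - ?E n b x)) ----> 0" if "b : Basis" for b
 using lim that unfolding H1_norm_tendsto_0_iff[OF S(1) Wd] by blast
 have "(%n. C * (\<Sum>b\<in>Basis. 2 * (L2n ?M (%x. D b x - ?E n b x))^2)) ----> C * (\<Sum>b\<in>(Basis::(real^2) set). 2 * 0\<^sup>2)"
 by (intro tendsto_intros Ld)
 hence ev1: "\<forall>\<^sub>F n in sequentially. C * (\<Sum>b\<in>Basis. 2 * (L2n ?M (%x. D b x - ?E n b x))^2) < e' / 3"
 using e' by (intro order_tendstoD(2)) auto
 have "(%n. ennreal (C / de m) * ?B n) ----> ennreal (C / de m) * 0"
 by (intro tendsto_mult_ennreal tendsto_const bd) auto
 hence ev2: "\<forall>\<^sub>F n in sequentially. ennreal (C / de m) * ?B n < ennreal (e' / 3)"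
 using e' by (intro order_tendstoD(2)) (auto simp: ennreal_zero_less_divide)
 have ev3: "\<forall>\<^sub>F n in sequentially. H1_norm S (%x. z x - v n x) < e / 6"
 using lim e by (intro order_tendstoD(2)) auto
 obtain n where n: "C * (\<Sum>b\<in>Basis. 2 * (L2n ?M (%x. D b x - ?E n b x))^2) < e' / 3"
 "ennreal (C / de m) * ?B n < ennreal (e' / 3)" "H1_norm S (%x. z x - v n x) < e / 6"
 using eventually_happens[OF eventually_conj[OF ev1 eventually_conj[OF ev2 ev3]]] by auto
 obtain ph where ph: "ph : test_functions S" and he: "ennreal ((H1_norm S (%x. v n x - ph x))^2) <=
 ennreal C * (\<integral>\<^sup>+x\<in>boundary_strip S (ka * de m). ennreal (\<Sum>b\<in>Basis. (norm (?E n b x))^2) \<partial>lborel) +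
 ennreal (C / de m) * ?B n"
 using err[OF v de(1,2), of n m] by blast
 let ?X = "\<Sum>b\<in>Basis. 2 * (L2n ?M (%x. indicator (boundary_strip S (ka * de m)) x *R D b x))^2 +
 2 * (L2n ?M (%x. D b x - ?E n b x))^2"
 have "ennreal ((H1_norm S (%x. v n x - ph x))^2) <= ennreal C * ennreal ?X + ennreal (e' / 3)"
 by (rule order_trans[OF he])
 (intro add_mono mult_left_mono strip_gradient_bound[OF S z v] less_imp_le[OF n(2)], simp)
 also have "... = ennreal (C * ?X + e' / 3)"
 using C e' by (simp add: ennreal_mult'[symmetric] ennreal_plus[symmetric] sum_nonneg del: ennreal_plus)
 also have "... < ennreal e'"
 proof (rule ennreal_lessI[OF e'])
 have "C * ?X = C * (\<Sum>b\<in>Basis. 2 * (L2n ?M (%x. indicator (boundary_strip S (ka * de m)) x *R D b x))^2) +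
 C * (\<Sum>b\<in>Basis. 2 * (L2n ?M (%x. D b x - ?E n b x))^2)"
 by (simp only: sum.distrib distrib_left)
 thus "C * ?X + e' / 3 < e'" using m n(1) by linarith
 qed
 finally have "(H1_norm S (%x. v n x - ph x))^2 < (e / 6)^2"
 unfolding e'_def by (subst (asm) ennreal_less_iff) auto
 hence small: "H1_norm S (%x. v n x - ph x) < e / 6"
 by (rule power2_less_imp_less) (use e in simp)
 have Wph: "W12 S (%x. v n x - ph x) (%b x. ?E n b x - fd ph x b)"
 by (rule W12_diff[OF Wv W12_smooth[OF test_functions_smooth[OF ph] S(2) Sl]])
 have "H1_norm S (%x. z x - ph x) <= (1 + real DIM(real^2)) * (H1_norm S (%x. z x - v n x) + H1_norm S (%x. v n x - ph x))"
 using H1_norm_triangle[OF S(1) Wd[of n] Wph] by simp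
 also have "... < e" using small n(3) by simp
 finally show ?thesis using ph by blast
 qed
 hence "\<forall>k. \<exists>ph\<in>test_functions S. H1_norm S (%x. z x - ph x) < 1 / real (Suc k)"
 by simp
 then obtain ph where ph: "!!k. ph k : test_functions S" "!!k. H1_norm S (%x. z x - ph k x) < 1 / real (Suc k)"
 by metis
 have "(%k. H1_norm S (%x. z x - ph k x)) ----> 0"
 proof (rule Lim_null_comparison)
 show "(%k. 1 / real (Suc k)) ----> 0" by (rule LIMSEQ_Suc[OF lim_1_over_n])
 have nn: "0 <= H1_norm S (%x. z x - ph k x)" for k
 unfolding H1_norm_def by (intro real_sqrt_ge_zero add_nonneg_nonneg sum_nonneg) auto
 show "\<forall>\<^sub>F k in sequentially. norm (H1_norm S (%x. z x - ph k x)) <= 1 / real (Suc k)"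
 using nn less_imp_le[OF ph(2)] by (intro always_eventually) simp
 qed
 thus ?thesis
 using ph(1) z H1_iff unfolding H10_def by blast
qed

subsection \<open>The fluid domain\<close>

lemma open_channel: "open (channel L H)"
 unfolding channel_def by (intro open_Collect_conj open_Collect_less continuous_intros)

lemma bounded_channel: "bounded (channel L H)"
proof -
 have "norm x <= (abs L) + (abs H)" if "x : channel L H" for x
 using that norm_real2_le[of x] by (auto simp: channel_def)
 thus ?thesis by (auto simp: bounded_iff)
qed

lemma open_fluid: "compact B ==> open (channel L H - B)"
 by (intro open_Diff open_channel compact_imp_closed)

lemma bounded_fluid: "bounded (channel L H - B)"
 using bounded_channel bounded_subset Diff_subset by metis

text \<open>Near \<open>b\<close> a convex set containing \<open>cball c r\<close> contains a cone with axis \<open>c - b\<close>.\<close>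

lemma convex_cone_point:
 fixes b c d y :: "'a::real_normed_vector"
 assumes "convex B" "b : B" "cball c r <= B" "r > 0" "0 < s" "s <= norm (c - b)"
 and "norm (y - (b + (s / norm (c - b)) *R (c - b))) <= r * s / norm (c - b)"
 shows "y : B"
proof -
 define t where "t = norm (c - b)"
 define u where "u = s / t"
 have t: "t > 0" using assms(5,6) unfolding t_def by linarith
 have u: "0 < u" "u <= 1" using assms t by (auto simp: u_def t_def)
 define w where "w = (1 / u) *R (y - (b + u *R (c - b)))"
 have n7: "norm (y - (b + u *R (c - b))) <= r * u"
 using assms(7) by (simp add: u_def t_def)
 have "norm w = (1 / u) * norm (y - (b + u *R (c - b)))" using u by (simp add: w_def)
 also have "... <= (1 / u) * (r * u)"
 using n7 u by (intro mult_left_mono) auto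
 finally have "norm w <= r" using u by simp
 hence "c + w : B" using assms(3) by (auto simp: dist_norm)
 hence "(1 - u) *R b + u *R (c + w) : B"
 using assms(1,2) u by (intro convexD) auto
 moreover have "(1 - u) *R b + u *R (c + w) = y"
 using u by (simp add: w_def algebra_simps)
 ultimately show ?thesis by simp
qed

lemma finite_direction_net:
 assumes "e > 0"
 obtains N :: "(real^2) set" where "finite N" "!!d. d : N ==> norm d = 1"
 "!!nu. norm nu = 1 ==> \<exists>d\<in>N. norm (nu - d) < e"
proof -
 have "compact (sphere (0::real^2) 1)" by simp
 moreover have "sphere (0::real^2) 1 <= (\<Union>d\<in>sphere 0 1. ball d e)" using assms by auto
 ultimately obtain N where N: "N <= sphere (0::real^2) 1" "finite N" "sphere (0::real^2) 1 <= (\<Union>d\<in>N. ball d e)"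
 using compactE_image[of "sphere (0::real^2) 1" "sphere 0 1" "%d. ball d e"] by auto
 show ?thesis
 proof (rule that[OF N(2)])
 show "norm d = 1" if "d : N" for d using N(1) that by auto
 show "\<exists>d\<in>N. norm (nu - d) < e" if "norm nu = 1" for nu
 proof -
 have "nu : sphere 0 1" using that by simp
 hence "nu : (\<Union>d\<in>N. ball d e)" using N(3) by blast
 thus ?thesis by (auto simp: dist_norm norm_minus_commute)
 qed
 qed
qed

text \<open>A point near the body is close to some \<open>y\<close> in \<open>B\<close>, and a short
  move roughly towards the centre \<open>c\<close> enters the cone that
  \<open>convex_cone_point\<close> attaches to \<open>y\<close>; a finite net of directions of
  fineness \<open>r / (2 * M)\<close> is accurate enough for all \<open>y\<close>. A point near the
  outer boundary leaves the channel along one of the four axis directions.\<close>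

lemma exit_directions_fluid:
 assumes "convex B" "compact B" "cball c r <= B" "r > 0"
 obtains Ds K rh where "exit_directions (channel L H - B) Ds K rh"
proof -
 obtain R where R: "!!x. x : B ==> norm x <= R" using compact_imp_bounded[OF assms(2)] by (auto simp: bounded_iff)
 define M where "M = (abs R) + norm c + r"
 have M: "M > 0" "!!y. y : B ==> norm (c - y) <= M"
 proof -
 show "M > 0" unfolding M_def using assms(4) norm_ge_zero[of c] by linarith
 show "norm (c - y) <= M" if "y : B" for y
 using norm_triangle_ineq4[of c y] R[OF that] assms(4) unfolding M_def by linarith
 qed
 have rM: "r / (2 * M) > 0" using M(1) assms(4) by simp
 obtain N :: "(real^2) set" where N: "finite N" "!!d. d : N ==> norm d = 1"
 "!!nu. norm nu = 1 ==> \<exists>d\<in>N. norm (nu - d) < r / (2 * M)"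
 using finite_direction_net[OF rM] by blast
 define Ds where "Ds = N \<union> {axis 1 1, - axis 1 1, axis 2 1, - axis 2 1}"
 define K where "K = max 1 (2 * M / r)"
 \<comment> \<open>The first bound keeps \<open>y\<close> at distance at least \<open>r / 2\<close>
   from \<open>c\<close>, the second keeps the step \<open>s = 2 * M * de / r\<close> below
   \<open>r / 2\<close>; so the step does not pass beyond \<open>c\<close>.\<close>
 define rh where "rh = min (r / 2) (r\<^sup>2 / (4 * M))"
 have "exit_directions (channel L H - B) Ds K rh"
 unfolding exit_directions_def
 proof (intro conjI ballI allI impI subsetI)
 show "finite Ds" using N(1) by (simp add: Ds_def)
 show "norm d = 1" if "d : Ds" for d using that N(2) by (auto simp: Ds_def)
 show "K > 0" by (simp add: K_def)
 show "rh > 0" using M(1) assms(4) by (simp add: rh_def)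
 fix de x assume de: "0 < de" "de < rh" and x: "x : boundary_strip (channel L H - B) de"
 hence xS: "x : channel L H" "x ~: B" and inf: "infdist x (- (channel L H - B)) < de"
 by (auto simp: boundary_strip_def)
 have K1: "de <= K * de" "2 * M * de / r <= K * de"
 using de mult_right_mono[of 1 K de] mult_right_mono[of "2 * M / r" K de] by (auto simp: K_def)
 have "c : - (channel L H - B)" using assms(3,4) by auto
 hence ne: "- (channel L H - B) ~= {}" by blast
 have "\<exists>y\<in>- (channel L H - B). dist x y < de"
 proof (rule ccontr)
 assume "\<not> (\<exists>y\<in>- (channel L H - B). dist x y < de)"
 hence "de <= infdist x (- (channel L H - B))"
 unfolding infdist_notempty[OF ne] by (intro cINF_greatest ne) force
 thus False using inf by simp
 qed
 then obtain y where y: "y ~: channel L H \<or> y : B" "dist x y < de" by auto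
 have ex: "x : (\<Union>d\<in>Ds. exit_set (channel L H - B) d (K * de))"
 if "d : Ds" "0 <= s" "s <= K * de" "x + s *R d ~: channel L H - B" for d s
 using that xS by (auto simp: exit_set_def intro!: bexI[of _ d] bexI[of _ s])
 show "x : (\<Union>d\<in>Ds. exit_set (channel L H - B) d (K * de))"
 proof (cases "y : B")
 case True
 define t where "t = norm (c - y)"
 have t: "r / 2 <= t" "t <= M"
 proof -
 have "x ~: cball c r" using xS assms(3) by blast
 hence "r < norm (c - x)" by (simp add: dist_norm)
 also have "norm (c - x) <= t + norm (y - x)"
 unfolding t_def using norm_triangle_ineq[of "c - y" "y - x"] by simp
 also have "norm (y - x) < de" using y(2) by (simp add: dist_norm norm_minus_commute)
 finally show "r / 2 <= t" using de(2) by (simp add: rh_def)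
 show "t <= M" using M(2)[OF True] by (simp add: t_def)
 qed
 hence t0: "t > 0" using assms(4) by linarith
 \<comment> \<open>Chosen so that the cone has radius at least \<open>r * s / M = 2 * de\<close>
   there: one \<open>de\<close> for the distance from \<open>x\<close> to \<open>y\<close>, one for
   the error of the direction.\<close>
 define s where "s = 2 * M * de / r"
 have s: "0 < s" "s <= t"
 proof -
 show "0 < s" using M(1) de assms(4) by (simp add: s_def)
 have "de <= r\<^sup>2 / (4 * M)" using de by (simp add: rh_def)
 hence "2 * M * de / r <= 2 * M * (r\<^sup>2 / (4 * M)) / r"
 using M(1) assms(4) by (intro divide_right_mono mult_left_mono) auto
 also have "... = r / 2" using M(1) assms(4) by (simp add: power2_eq_square field_simps)
 finally show "s <= t" using t by (simp add: s_def)
 qed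
 have "norm ((1 / t) *R (c - y)) = 1" using t0 by (simp add: t_def)
 then obtain d where d: "d : N" "norm ((1 / t) *R (c - y) - d) < r / (2 * M)" using N(3) by blast
 have "x + s *R d : B"
 proof (rule convex_cone_point[OF assms(1) True assms(3,4) s(1) s(2)[unfolded t_def]])
 have "x + s *R d - (y + (s / t) *R (c - y)) = (x - y) - s *R ((1 / t) *R (c - y) - d)"
 by (simp add: algebra_simps)
 hence "norm (x + s *R d - (y + (s / t) *R (c - y))) <= norm (x - y) + norm (s *R ((1 / t) *R (c - y) - d))"
 by (metis norm_triangle_ineq4)
 also have "norm (s *R ((1 / t) *R (c - y) - d)) = s * norm ((1 / t) *R (c - y) - d)"
 using s by simp
 also have "norm (x - y) + s * norm ((1 / t) *R (c - y) - d) <= de + s * (r / (2 * M))"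
 using y(2) d(2) s by (intro add_mono mult_left_mono) (auto simp: dist_norm)
 also have "... = 2 * de" using M(1) assms(4) by (simp add: s_def field_simps)
 also have "... = r * s / M" using M(1) assms(4) by (simp add: s_def field_simps)
 also have "... <= r * s / t" using t t0 s assms(4) M(1) by (intro divide_left_mono) auto
 finally show "norm (x + s *R d - (y + (s / norm (c - y)) *R (c - y))) <= r * s / norm (c - y)"
 by (simp add: t_def)
 qed
 thus ?thesis
 using s K1(2) d(1) by (intro ex[of d s]) (auto simp: s_def Ds_def)
 next
 case False
 hence y': "y ~: channel L H" using y(1) by blast
 have near: "(abs (x$1 - y$1)) < de" "(abs (x$2 - y$2)) < de"
 using component_le_norm_cart[of "x - y"] y(2) by (auto simp: dist_norm intro: le_less_trans)
 have "x + de *R axis 1 1 ~: channel L H \<or> x + de *R (- axis 1 1) ~: channel L H \<or>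
 x + de *R axis 2 1 ~: channel L H \<or> x + de *R (- axis 2 1) ~: channel L H"
 using y' near xS(1) unfolding channel_def by (auto simp: axis_def)
 hence "\<exists>d\<in>Ds. x + de *R d ~: channel L H" unfolding Ds_def by blast
 then obtain d where "d : Ds" "x + de *R d ~: channel L H" by blast
 thus ?thesis
 using de(1) K1(1) by (intro ex[of d de]) auto
 qed
 qed
 thus ?thesis by (rule that)
qed

lemma convex_interior_cball:
 fixes B :: "(real^2) set"
 assumes "convex B" "measure lebesgue B > 0"
 obtains c r where "r > 0" "cball c r <= B"
proof -
 have "interior B ~= {}"
 proof
 assume "interior B = {}"
 hence "negligible B" using negligible_convex_interior[OF assms(1)] by simp
 thus False using assms(2) by (simp add: negligible_imp_measure0)
 qed
 thus ?thesis using that mem_interior_cball by blast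
qed

lemma frontier_fluid_subset:
 assumes "compact B" "B <= channel L H"
 shows "frontier (channel L H - B) <= frontier B \<union> side_b L H \<union> side_t L H \<union> side_l L H \<union> side_r L H"
proof
 fix x assume "x : frontier (channel L H - B)"
 hence cl: "x : closure (channel L H - B)" and nin: "x ~: channel L H - B"
 using open_fluid[OF assms(1), of L H] by (auto simp: frontier_def interior_open)
 have "closed {x::real^2. -L <= x$1 & x$1 <= L & -H <= x$2 & x$2 <= H}"
 by (intro closed_Collect_conj closed_Collect_le continuous_intros)
 hence "closure (channel L H - B) <= {x. -L <= x$1 & x$1 <= L & -H <= x$2 & x$2 <= H}"
 by (intro closure_minimal) (auto simp: channel_def)
 with cl have b: "-L <= x$1" "x$1 <= L" "-H <= x$2" "x$2 <= H" by auto
 show "x : frontier B \<union> side_b L H \<union> side_t L H \<union> side_l L H \<union> side_r L H"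
 proof (cases "x : B")
 case True
 have "x ~: interior B"
 proof
 assume "x : interior B"
 hence "interior B \<inter> closure (channel L H - B) ~= {}" using cl by blast
 hence "interior B \<inter> (channel L H - B) ~= {}"
 using open_Int_closure_eq_empty[OF open_interior] by blast
 thus False using interior_subset by blast
 qed
 thus ?thesis using True closure_subset by (auto simp: frontier_def)
 next
 case False
 hence "x ~: channel L H" using nin by blast
 thus ?thesis using b by (auto simp: channel_def side_b_def side_t_def side_l_def side_r_def)
 qed
qed

section \<open>One-dimensional profiles\<close>

lemma smooth_has_real_derivative:
 fixes f :: "real => real"
 assumes "smooth f"
 shows "(f has_real_derivative fd f x 1) (at x)"
proof -
 have "fd f x (h *R 1) = h *R fd f x 1" for h
 by (rule linear_scale[OF has_derivative_linear[OF smooth_has_derivative[OF assms]]])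
 hence "fd f x = (*) (fd f x 1)"
 unfolding real_scaleR_def mult_1_right by (intro ext) (metis mult.commute)
 thus ?thesis
 unfolding has_field_derivative_def by (metis smooth_has_derivative[OF assms])
qed

lemma smooth_antiderivative:
 fixes P q :: "real => real"
 assumes "!!x. (P has_real_derivative q x) (at x)" "smooth q"
 shows "smooth P"
 unfolding smooth_def
proof
 fix k
 have "cont_diff (Suc k) P"
 proof (rule cont_diff_SucI)
 show "(P has_derivative (*) (q x)) (at x)" for x
 using assms(1) by (simp add: has_field_derivative_def)
 show "cont_diff k (%x. q x * b)" for b
 using assms(2) by (intro cont_diff_bilinear[OF bounded_bilinear_mult] cont_diff_const) (simp add: smooth_def)
 qed
 thus "cont_diff k P" by (rule cont_diff_Suc_imp)
qed

lemma polynomial_antiderivative: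
 fixes q :: "real => real"
 assumes "real_polynomial_function q"
 obtains P where "real_polynomial_function P" "!!x. (P has_real_derivative q x) (at x)" "P a = 0"
proof -
 obtain c n where q: "q = (%x. \<Sum>i\<le>n. c i * x ^ i)"
 using assms real_polynomial_function_iff_sum[of q] by auto
 define P where "P x = (\<Sum>i\<le>n. c i / real (Suc i) * x ^ Suc i)" for x
 have Pp: "real_polynomial_function P"
 unfolding P_def
 by (intro real_polynomial_function_sum real_polynomial_function.intros(4)[OF real_polynomial_function.intros(2)
 real_polynomial_function_power[OF real_polynomial_function.intros(1)[OF bounded_linear_ident]]]) auto
 have "(P has_real_derivative (\<Sum>i\<le>n. c i / real (Suc i) * (real (Suc i) * x ^ i))) (at x)" for x
 proof -
 have "((%x. x ^ Suc i) has_real_derivative real (Suc i) * x ^ i) (at x)" for i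
 using DERIV_pow[of "Suc i" x UNIV] by (simp del: power_Suc of_nat_Suc)
 thus ?thesis unfolding P_def by (intro DERIV_sum DERIV_cmult)
 qed
 hence D: "(P has_real_derivative q x) (at x)" for x
 by (simp add: q del: of_nat_Suc)
 show ?thesis
 proof (rule that[of "%x. P x + - P a"])
 show "real_polynomial_function (%x. P x + - P a)"
 by (intro real_polynomial_function.intros(3) Pp real_polynomial_function.intros(2))
 show "((%x. P x + - P a) has_real_derivative q x) (at x)" for x
 using DERIV_add[OF D[of x] DERIV_const[of "- P a"]] by simp
 qed simp
qed

text \<open>A Lipschitz function on \<open>{-H..H}\<close> that vanishes at \<open>-H\<close>,
  presented by a density bounded everywhere and not just a.e.; the density enters the derivatives of
  stream-function fields pointwise. Outside \<open>{-H..H}\<close> nothing is said about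
  \<open>V\<close>.\<close>

definition profile :: "real => real => (real => real) => (real => real) => bool" where
 "profile H G V g \<longleftrightarrow> g : borel_measurable lebesgue & (\<forall>t. (abs (g t)) <= G) &
 (\<forall>x\<in>{-H..H}. V x = (LINT t:{-H..x}|lebesgue. g t))"

lemma integrable_const_interval: "integrable lebesgue (%t. indicator {a..b::real} t *R (c::real))"
proof -
 have "integrable lborel (%t. indicator {a..b} t *R c)"
 by (rule borel_integrable_compact) auto
 thus ?thesis by (subst integrable_completion) auto
qed

lemma set_integrable_bounded_interval:
 fixes g :: "real => real"
 assumes "g : borel_measurable lebesgue" "!!t. (abs (g t)) <= G"
 shows "set_integrable lebesgue {a..b} g"
 unfolding set_integrable_def
proof (rule Bochner_Integration.integrable_bound)
 show "integrable lebesgue (%t. indicator {a..b} t *R G)"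
 by (rule integrable_const_interval)
 show "(%t. indicat_real {a..b} t *R g t) : borel_measurable lebesgue"
 using assms(1) by (intro borel_measurable_scaleR borel_measurable_indicator) (auto simp: lborelD)
 show "AE t in lebesgue. norm (indicat_real {a..b} t *R g t) <= norm (indicat_real {a..b} t *R G)"
 using order_trans[OF assms(2) abs_ge_self[of G]] by (intro AE_I2) (simp add: indicator_def)
qed

lemma profile_diff:
 assumes "profile H G V g" "profile H G' V' g'"
 shows "profile H ((abs a) * G + (abs a') * G') (%x. a * V x - a' * V' x) (%x. a * g x - a' * g' x)"
 unfolding profile_def
proof (intro conjI allI ballI)
 have m: "g : borel_measurable lebesgue" "g' : borel_measurable lebesgue"
 and b: "!!t. (abs (g t)) <= G" "!!t. (abs (g' t)) <= G'" using assms by (auto simp: profile_def)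
 show "(%x. a * g x - a' * g' x) : borel_measurable lebesgue"
 using m by (intro borel_measurable_diff borel_measurable_times borel_measurable_const)
 show "(abs (a * g t - a' * g' t)) <= (abs a) * G + (abs a') * G'" for t
 proof -
 have "(abs (a * g t - a' * g' t)) <= (abs a) * (abs (g t)) + (abs a') * (abs (g' t))"
 by (rule order_trans[OF abs_triangle_ineq4]) (simp add: abs_mult)
 also have "... <= (abs a) * G + (abs a') * G'" using b by (intro add_mono mult_left_mono) auto
 finally show ?thesis .
 qed
 fix x assume x: "x : {-H..H}"
 have i: "set_integrable lebesgue {-H..x} g" "set_integrable lebesgue {-H..x} g'"
 using set_integrable_bounded_interval m b by blast+
 have "(LINT t:{-H..x}|lebesgue. a * g t - a' * g' t) = a * (LINT t:{-H..x}|lebesgue. g t) - a' * (LINT t:{-H..x}|lebesgue. g' t)"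
 using i by (simp add: set_integral_diff)
 thus "a * V x - a' * V' x = (LINT t:{-H..x}|lebesgue. a * g t - a' * g' t)"
 using assms x by (simp add: profile_def)
qed

lemma set_lebesgue_integral_interval_diff:
 fixes g :: "real => real"
 assumes "g : borel_measurable lebesgue" "!!t. (abs (g t)) <= G" "a <= x" "x <= y"
 shows "(abs ((LINT t:{a..y}|lebesgue. g t) - (LINT t:{a..x}|lebesgue. g t))) <= G * (y - x)"
proof -
 have i: "set_integrable lebesgue {u..v} g" for u v
 using set_integrable_bounded_interval assms(1,2) by blast
 have G: "G >= 0" using assms(2)[of 0] by linarith
 have c: "integrable lebesgue (%t. indicator {x..y} t *R G)"
 by (rule integrable_const_interval)
 have "(LINT t:{a..y}|lebesgue. g t) - (LINT t:{a..x}|lebesgue. g t) =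
 (LINT t|lebesgue. indicator {a..y} t *R g t - indicator {a..x} t *R g t)"
 using i by (simp add: set_lebesgue_integral_def set_integrable_def)
 also have "(abs (...)) <= (LINT t|lebesgue. (abs (indicator {a..y} t *R g t - indicator {a..x} t *R g t)))"
 by (rule integral_abs_bound)
 also have "... <= (LINT t|lebesgue. indicator {x..y} t *R G)"
 proof (rule integral_mono)
 show "integrable lebesgue (%t. (abs (indicator {a..y} t *R g t - indicator {a..x} t *R g t)))"
 using i by (auto simp: set_integrable_def)
 show "(abs (indicator {a..y} t *R g t - indicator {a..x} t *R g t)) <= indicator {x..y} t *R G" for t
 using assms(2)[of t] assms(3,4) G by (auto simp: indicator_def)
 qed (rule c)
 also have "... = G * (y - x)"
 using assms(4) by (subst integral_completion) (auto simp: measure_def)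
 finally show ?thesis .
qed

lemma profile_Lipschitz:
 assumes "profile H G V g" "x : {-H..H}" "y : {-H..H}"
 shows "(abs (V x - V y)) <= G * (abs (x - y))"
 using assms
proof (induction x y rule: linorder_wlog)
 case (le x y)
 have "(abs ((LINT t:{-H..y}|lebesgue. g t) - (LINT t:{-H..x}|lebesgue. g t))) <= G * (y - x)"
 using le by (intro set_lebesgue_integral_interval_diff) (auto simp: profile_def)
 thus ?case using le by (simp add: profile_def abs_minus_commute)
qed (simp add: abs_minus_commute)

lemma integral_FTC_lebesgue:
 fixes P q :: "real => real"
 assumes "!!x. (P has_real_derivative q x) (at x)" "continuous_on UNIV q" "a <= x"
 shows "(LINT t:{a..x}|lebesgue. q t) = P x - P a"
proof -
 have "(LINT t|lborel. indicator {a..x} t *R q t) = P x - P a"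
 using assms by (intro integral_FTC_atLeastAtMost)
 (auto intro: continuous_on_subset has_field_derivative_at_within simp flip: has_real_derivative_iff_has_vector_derivative)
 moreover have "(%t. indicator {a..x} t *R q t) : borel_measurable lborel"
 using borel_measurable_continuous_onI[OF assms(2)] by measurable
 ultimately show ?thesis
 unfolding set_lebesgue_integral_def by (subst integral_completion) auto
qed

lemma profile_smooth:
 fixes P q :: "real => real"
 assumes "smooth P" "P (-H) = 0"
 obtains G g where "profile H G P g" "!!t. t : {-H..H} ==> g t = fd P t 1"
proof -
 let ?q = "%t. fd P t 1"
 have c: "continuous_on UNIV ?q" by (rule smooth_continuous_on[OF smooth_frechet[OF assms(1)]])
 have "bounded (?q ` {-H..H})"
 by (intro compact_imp_bounded compact_continuous_image continuous_on_subset[OF c]) auto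
 then obtain G where G: "G > 0" "!!t. t : {-H..H} ==> (abs (?q t)) <= G" by (auto simp: bounded_pos)
 define g where "g t = indicator {-H..H} t *R ?q t" for t
 have "profile H G P g"
 unfolding profile_def
 proof (intro conjI allI ballI)
 have "?q : borel_measurable borel" by (rule borel_measurable_continuous_onI[OF c])
 hence "g : borel_measurable borel" unfolding g_def by measurable
 thus "g : borel_measurable lebesgue" by (intro measurable_completion) simp
 show "(abs (g t)) <= G" for t using G by (auto simp: g_def indicator_def)
 fix x assume x: "x : {-H..H}"
 have "(LINT t:{-H..x}|lebesgue. g t) = (LINT t:{-H..x}|lebesgue. ?q t)"
 using x by (intro set_lebesgue_integral_cong) (auto simp: g_def)
 also have "... = P x - P (-H)"
 using x by (intro integral_FTC_lebesgue smooth_has_real_derivative assms c) auto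
 finally show "P x = (LINT t:{-H..x}|lebesgue. g t)" using assms(2) by simp
 qed
 thus ?thesis using that by (simp add: g_def)
qed

text \<open>The density is approximated by polynomials, boundedly and a.e., hence in L1; integrating
  twice turns this into uniform convergence of the profile and of its primitive. Since
  \<open>P\<close> and \<open>Q\<close> are exact antiderivatives, the approximating fields stay
  exactly solenoidal.\<close>

lemma profile_smooth_approximation:
 assumes "profile H G V g" "H > 0" and F: "!!x. x : {-H..H} ==> F x = (LINT t:{-H..x}|lebesgue. V t)"
 obtains q P Q N where "!!n. smooth (q n)" "!!n x. (P n has_real_derivative q n x) (at x)"
 "!!n x. (Q n has_real_derivative P n x) (at x)"
 "negligible N" "!!x. x : {-H..H} ==> x ~: N ==> (%n. q n x) ----> g x"
 "!!n x. x : {-H..H} ==> (abs (q n x)) <= G + 1"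
 "uniform_limit {-H..H} P V sequentially" "uniform_limit {-H..H} Q F sequentially"
proof -
 have g: "g : borel_measurable lebesgue" "!!t. (abs (g t)) <= G" and V: "!!x. x : {-H..H} ==> V x = (LINT t:{-H..x}|lebesgue. g t)"
 using assms(1) by (auto simp: profile_def)
 obtain q N where q: "!!n. real_polynomial_function (q n)" "!!n x. x : {-H..H} ==> (abs (q n x)) <= G + 1"
 "negligible N" "!!x. x : {-H..H} ==> x ~: N ==> (%n::nat. q n x) ----> g x"
 using AE_polynomial_approximation[OF compact_Icc g] by metis
 have "\<exists>P. real_polynomial_function P & (\<forall>x. (P has_real_derivative q n x) (at x)) & P (-H) = 0" for n
 using polynomial_antiderivative[OF q(1)[of n]] by metis
 then obtain P where P: "!!n. real_polynomial_function (P n)" "!!n x. (P n has_real_derivative q n x) (at x)" "!!n. P n (-H) = 0"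
 by metis
 have "\<exists>Q. real_polynomial_function Q & (\<forall>x. (Q has_real_derivative P n x) (at x)) & Q (-H) = 0" for n
 using polynomial_antiderivative[OF P(1)[of n]] by metis
 then obtain Q where Q: "!!n x. (Q n has_real_derivative P n x) (at x)" "!!n. Q n (-H) = 0"
 by metis
 have sm: "smooth (q n)" "smooth (P n)" for n
 using smooth_real_polynomial_function q(1) P(1) by blast+
 let ?M = "lebesgue_on {-H..H}"
 have qm: "q n : borel_measurable ?M" for n
 by (intro continuous_imp_measurable_on_sets_lebesgue smooth_continuous_on sm) auto
 have gm: "g : borel_measurable ?M"
 using g(1) by (rule measurable_restrict_space1)
 have fin: "finite_measure ?M" by (rule finite_measure_bounded_lebesgue_on) auto
 then interpret finite_measure ?M .
 have "(%n. \<integral>t. (abs (q n t - g t)) \<partial>?M) ----> (LINT t|?M. 0)"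
 proof (rule integral_dominated_convergence)
 show "integrable ?M (%t. 2 * G + 1)" by simp
 have "AE t in lebesgue. t ~: N" using q(3) by (metis AE_not_in negligible_iff_null_sets)
 hence "AE t in ?M. t ~: N" by (subst AE_restrict_space_iff) auto
 thus "AE t in ?M. (%n. (abs (q n t - g t))) ----> 0"
 proof (rule AE_mp, intro AE_I2 impI)
 fix t assume t: "t : space ?M" "t ~: N"
 hence "(%n. q n t) ----> g t" by (intro q(4)) (auto simp: space_restrict_space)
 thus "(%n. (abs (q n t - g t))) ----> 0"
 by (intro tendsto_rabs_zero) (simp add: LIM_zero)
 qed
 show "AE t in ?M. norm (abs (q n t - g t)) <= 2 * G + 1" for n
 proof (rule AE_I2)
 fix t assume "t : space ?M"
 hence "(abs (q n t)) <= G + 1" by (intro q(2)) (auto simp: space_restrict_space)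
 thus "norm (abs (q n t - g t)) <= 2 * G + 1" using g(2)[of t] by simp
 qed
 qed (use qm gm in auto)
 hence L1: "(%n. \<integral>t. (abs (q n t - g t)) \<partial>?M) ----> 0" by simp
 define e where "e n = (LINT t|?M. (abs (q n t - g t)))" for n
 have iq: "integrable ?M (%t. (abs (q n t - g t)))" for n
 proof (rule integrable_const_bound[where B="2 * G + 1"])
 show "AE t in ?M. norm (abs (q n t - g t)) <= 2 * G + 1"
 proof (rule AE_I2)
 fix t assume "t : space ?M"
 hence "(abs (q n t)) <= G + 1" by (intro q(2)) (auto simp: space_restrict_space)
 thus "norm (abs (q n t - g t)) <= 2 * G + 1" using g(2)[of t] by simp
 qed
 qed (use qm gm in auto)
 have PV: "(abs (P n x - V x)) <= e n" if x: "x : {-H..H}" for n x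
 proof -
 have sub: "{-H..x} \<inter> space ?M : sets ?M" using x by (auto simp: sets_restrict_space_iff space_restrict_space)
 have i1: "set_integrable lebesgue {-H..x} (q n)"
 using absolutely_integrable_continuous_real[OF smooth_continuous_on[OF sm(1)]] by blast
 have "P n x - V x = (LINT t:{-H..x}|lebesgue. q n t) - (LINT t:{-H..x}|lebesgue. g t)"
 using x P(3) V[OF x] integral_FTC_lebesgue[OF P(2) smooth_continuous_on[OF sm(1)], of "-H" x n] by simp
 also have "... = (LINT t|lebesgue. indicator {-H..x} t *R (q n t - g t))"
 using i1 set_integrable_bounded_interval[OF g, of "-H" x]
 by (simp add: set_lebesgue_integral_def set_integrable_def right_diff_distrib)
 also have "(abs (...)) <= (LINT t|lebesgue. (abs (indicator {-H..x} t *R (q n t - g t))))"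
 by (rule integral_abs_bound)
 also have "... <= (LINT t|lebesgue. indicator {-H..H} t *R (abs (q n t - g t)))"
 proof (rule integral_mono_AE')
 show "integrable lebesgue (%t. indicator {-H..H} t *R (abs (q n t - g t)))"
 using iq[of n] by (subst (asm) integrable_restrict_space) auto
 qed (use x in \<open>auto simp: indicator_def\<close>)
 also have "... = e n" unfolding e_def by (subst integral_restrict_space) auto
 finally show ?thesis .
 qed
 have Vint: "set_integrable lebesgue {-H..x} V" if x: "x : {-H..H}" for x
 proof -
 have "continuous_on {-H..H} V"
 proof (rule lipschitz_on_continuous_on[of G], rule lipschitz_onI)
 show "dist (V x) (V y) <= G * dist x y" if "x : {-H..H}" "y : {-H..H}" for x y
 using profile_Lipschitz[OF assms(1) that] by (simp add: dist_real_def)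
 show "0 <= G" using g(2)[of 0] by linarith
 qed
 thus ?thesis
 using absolutely_integrable_continuous_real[of "-H" x V] continuous_on_subset[of "{-H..H}" V "{-H..x}"] x by auto
 qed
 have QF: "(abs (Q n x - F x)) <= 2 * H * e n" if x: "x : {-H..H}" for n x
 proof -
 have i1: "set_integrable lebesgue {-H..x} (P n)"
 using absolutely_integrable_continuous_real[OF smooth_continuous_on[OF sm(2)]] by blast
 have e0: "0 <= e n" unfolding e_def by (rule integral_nonneg_AE) auto
 have "Q n x - F x = (LINT t:{-H..x}|lebesgue. P n t) - (LINT t:{-H..x}|lebesgue. V t)"
 using x Q(2) F[OF x] integral_FTC_lebesgue[OF Q(1) smooth_continuous_on[OF sm(2)], of "-H" x n] by simp
 also have "... = (LINT t|lebesgue. indicator {-H..x} t *R (P n t - V t))"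
 using i1 Vint[OF x] by (simp add: set_lebesgue_integral_def set_integrable_def right_diff_distrib)
 also have "(abs (...)) <= (LINT t|lebesgue. (abs (indicator {-H..x} t *R (P n t - V t))))"
 by (rule integral_abs_bound)
 also have "... <= (LINT t|lebesgue. indicator {-H..H} t *R e n)"
 proof (rule integral_mono_AE')
 show "integrable lebesgue (%t. indicator {-H..H} t *R e n)"
 by (rule integrable_const_interval)
 qed (use x PV e0 in \<open>auto simp: indicator_def\<close>)
 also have "... = 2 * H * e n" using assms(2) by (subst integral_completion) (auto simp: measure_def)
 finally show ?thesis .
 qed
 have "e ----> 0" using L1 by (simp add: e_def[abs_def])
 hence ul: "uniform_limit {-H..H} R W sequentially"
 if "!!n x. x : {-H..H} ==> (abs (R n x - W x)) <= c * e n" "c > 0" for R W c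
 proof -
 have ce: "(%n. c * e n) ----> 0" using tendsto_mult_left[OF \<open>e ----> 0\<close>, of c] by simp
 show ?thesis
 proof (rule uniform_limitI)
 fix d :: real assume "d > 0"
 hence "\<forall>\<^sub>F n in sequentially. c * e n < d" using order_tendstoD(2)[OF ce] by blast
 thus "\<forall>\<^sub>F n in sequentially. \<forall>x\<in>{-H..H}. dist (R n x) (W x) < d"
 by eventually_elim (auto simp: dist_real_def intro!: le_less_trans[OF that(1)])
 qed
 qed
 show ?thesis
 by (rule that[OF sm(1) P(2) Q(1) q(3,4,2)]) (use ul[of P V 1] ul[of Q F "2 * H"] PV QF assms(2) in auto)
qed

section \<open>Functions with bounded weak derivative on an interval, and their weak-star
  convergence\<close>

lemma locally_integrable_interval_measurable:
 fixes g :: "real => real"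
 assumes "locally_integrable {a<..<b} g"
 shows "g : borel_measurable (lebesgue_on {a<..<b})"
proof -
 define K where "K n = {a + 1 / real (Suc n)..b - 1 / real (Suc n)}" for n
 have lim0: "(%n. 1 / real (Suc n)) ----> 0" by (rule LIMSEQ_Suc[OF lim_1_over_n])
 have m: "(%x. indicator (K n) x *R g x) : borel_measurable lebesgue" for n
 proof -
 have p: "0 < 1 / real (Suc n)" by simp
 have "K n <= {a<..<b}"
 proof
 fix x assume "x : K n"
 thus "x : {a<..<b}" using p unfolding K_def by (simp only: atLeastAtMost_iff greaterThanLessThan_iff) linarith
 qed
 hence "set_integrable lebesgue (K n) g"
 using assms by (auto simp: locally_integrable_def K_def)
 thus ?thesis unfolding set_integrable_def by (rule borel_measurable_integrable)
 qed
 have "(%x. if x : {a<..<b} then g x else 0) : borel_measurable lebesgue"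
 proof (rule borel_measurable_LIMSEQ_real[OF _ m])
 fix x
 show "(%n. indicator (K n) x *R g x) ----> (if x : {a<..<b} then g x else 0)"
 proof (cases "x : {a<..<b}")
 case True
 have "\<forall>\<^sub>F n in sequentially. 1 / real (Suc n) < min (x - a) (b - x)"
 using eventually_conj[OF order_tendstoD(2)[OF lim0, of "x - a"] order_tendstoD(2)[OF lim0, of "b - x"]] True
 by simp
 hence "\<forall>\<^sub>F n in sequentially. indicator (K n) x *R g x = g x"
 by eventually_elim (simp add: K_def)
 thus ?thesis using True by (simp add: tendsto_eventually)
 next
 case False
 have "x ~: K n" for n
 proof
 assume "x : K n"
 moreover have "0 < 1 / real (Suc n)" by simp
 ultimately show False using False unfolding K_def
 by (simp only: atLeastAtMost_iff greaterThanLessThan_iff) linarith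
 qed
 thus ?thesis unfolding if_not_P[OF False] by simp
 qed
 qed
 thus ?thesis by (subst (asm) borel_measurable_if) auto
qed

definition step' :: "real => real" where
 "step' t = fd step t 1"

lemma step'_outside: "t < 0 \<or> t > 1 ==> step' t = 0"
proof -
 assume t: "t < 0 \<or> t > 1"
 have "((%s. step t) has_derivative (%h. 0)) (at t)" by simp
 hence "(step has_derivative (%h. 0)) (at t)"
 by (rule has_derivative_transform_within_open[where s="if t < 0 then {..<0} else {1<..}"]) (use t in auto)
 from frechet_derivative_at[OF this, symmetric] show ?thesis by (simp add: step'_def)
qed

lemma continuous_step': "continuous_on A step'"
 unfolding step'_def[abs_def] by (intro smooth_continuous_on smooth_frechet smooth_step)

lemma step'_bound: obtains C where "C > 0" "!!t. (abs (step' t)) <= C"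
proof -
 have "step' t = 0" if "t ~: {0..1}" for t
 using that by (intro step'_outside) auto
 then obtain C where "C > 0" "!!t. norm (step' t) <= C"
 using bounded_compact_support[OF continuous_step' compact_Icc[of 0 1]] by blast
 thus ?thesis using that by simp
qed

lemma continuous_step'_scaled: "h ~= 0 ==> continuous_on A (%t. step' ((t - x) / h) / h)"
proof -
 assume h: "h ~= 0"
 have "continuous_on A (%t. (t - x) / h)" by (intro continuous_intros) (use h in auto)
 hence "continuous_on A (%t. step' ((t - x) / h))"
 by (rule continuous_on_compose2[OF continuous_step'[of UNIV]]) simp
 thus ?thesis by (rule continuous_on_divide[OF _ continuous_on_const]) (use h in simp)
qed

lemma step_scaled_derivative:
 "((%t. step ((t - x) / h)) has_real_derivative step' ((t - x) / h) / h) (at t)"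
proof -
 have "((%t. (t - x) / h) has_real_derivative 1 / h) (at t)"
 unfolding divide_inverse by (auto intro!: derivative_eq_intros)
 from DERIV_chain2[OF smooth_has_real_derivative[OF smooth_step] this] show ?thesis
 by (simp add: step'_def)
qed

lemma smooth_step_scaled: "smooth (%t. step ((t - x) / h))"
 using smooth_real_affine[OF smooth_step, of "- x / h" "1 / h"] by (simp add: diff_divide_distrib)

text \<open>The scaled derivative of \<open>step\<close> is a one-sided approximate identity: it is
  supported in \<open>{x..x + h n}\<close> and has integral 1. It may change sign, so the bound
  \<open>C\<close> of \<open>step'\<close> enters.\<close>

lemma step_kernel_limit:
 assumes V: "continuous_on {x..x + h0} V" and h: "!!n. 0 < h n" "!!n. h n <= h0" "h ----> 0"
 and sub: "{x..x + h0} <= S"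
 shows "(%n. LINT t:S|lebesgue. step' ((t - x) / h n) / h n * V t) ----> V x"
proof (rule LIMSEQ_I)
 fix e :: real assume e: "e > 0"
 obtain C where C: "C > 0" "!!t. (abs (step' t)) <= C" using step'_bound by metis
 have "x : {x..x + h0}" using h(1,2)[of 0] by simp
 then obtain d where d: "d > 0" "!!t. t : {x..x + h0} ==> (abs (t - x)) < d ==> (abs (V t - V x)) < e / (2 * C)"
 using V e C(1) unfolding continuous_on_iff dist_real_def
 by (metis divide_pos_pos mult_pos_pos zero_less_numeral)
 have "\<forall>\<^sub>F n in sequentially. h n < d" using order_tendstoD(2)[OF h(3)] d(1) by blast
 then obtain N where N: "!!n. n >= N ==> h n < d" by (auto simp: eventually_sequentially)
 have "(abs ((LINT t:S|lebesgue. step' ((t - x) / h n) / h n * V t) - V x)) < e" if n: "n >= N" for n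
 proof -
 let ?k = "%t. step' ((t - x) / h n) / h n"
 have kc: "continuous_on A ?k" for A
 by (rule continuous_step'_scaled) (use h(1)[of n] in simp)
 have sub': "{x..x + h n} <= {x..x + h0}" using h(2)[of n] by auto
 have Vc: "continuous_on {x..x + h n} V" by (rule continuous_on_subset[OF V sub'])
 have k0: "?k t = 0" if "t ~: {x..x + h n}" for t
 proof -
 have "(t - x) / h n < 0 \<or> (t - x) / h n > 1"
 using that h(1)[of n] by (auto simp: divide_less_0_iff pos_less_divide_eq)
 thus ?thesis using step'_outside by simp
 qed
 have "(LINT t:S|lebesgue. ?k t * V t) = (LINT t:{x..x + h n}|lebesgue. ?k t * V t)"
 unfolding set_lebesgue_integral_def
 proof (rule Bochner_Integration.integral_cong[OF refl])
 fix t
 show "indicator S t *R (?k t * V t) = indicator {x..x + h n} t *R (?k t * V t)"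
 proof (cases "t : {x..x + h n}")
 case True
 hence "t : S" using sub sub' by blast
 thus ?thesis using True by simp
 next
 case False
 show ?thesis unfolding k0[OF False] by simp
 qed
 qed
 also have "... = integral {x..x + h n} (%t. ?k t * V t)"
 by (intro set_lebesgue_integral_eq_integral absolutely_integrable_continuous_real continuous_on_mult kc Vc)
 finally have 1: "(LINT t:S|lebesgue. ?k t * V t) = integral {x..x + h n} (%t. ?k t * V t)" .
 have "(?k has_integral (step ((x + h n - x) / h n) - step ((x - x) / h n))) {x..x + h n}"
 using h(1)[of n] by (intro fundamental_theorem_of_calculus)
 (auto intro!: has_field_derivative_at_within step_scaled_derivative
 simp flip: has_real_derivative_iff_has_vector_derivative)
 hence k1: "(?k has_integral 1) {x..x + h n}" using h(1)[of n] by simp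
 have "integral {x..x + h n} (%t. ?k t * (V t - V x)) = integral {x..x + h n} (%t. ?k t * V t - ?k t * V x)"
 by (simp add: right_diff_distrib)
 also have "... = integral {x..x + h n} (%t. ?k t * V t) - integral {x..x + h n} (%t. ?k t * V x)"
 by (intro Henstock_Kurzweil_Integration.integral_diff integrable_continuous_real continuous_on_mult kc Vc continuous_on_const)
 also have "integral {x..x + h n} (%t. ?k t * V x) = V x"
 using integral_unique[OF has_integral_mult_left[OF k1, of "V x"]] by (simp only: mult_1_left)
 finally have 2: "integral {x..x + h n} (%t. ?k t * V t) - V x = integral {x..x + h n} (%t. ?k t * (V t - V x))" by simp
 have "norm (integral {x..x + h n} (%t. ?k t * (V t - V x))) <= (C / h n * (e / (2 * C))) * (x + h n - x)"
 proof (rule integral_bound)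
 show "continuous_on {x..x + h n} (%t. ?k t * (V t - V x))"
 by (intro continuous_on_mult kc continuous_on_diff Vc continuous_on_const)
 fix t assume t: "t : {x..x + h n}"
 show "norm (?k t * (V t - V x)) <= C / h n * (e / (2 * C))"
 proof -
 have "(abs (V t - V x)) <= e / (2 * C)"
 using d(2)[of t] t sub' N[OF n] by (intro less_imp_le) auto
 moreover have "(abs (?k t)) <= C / h n" using C(2) h(1)[of n] by (auto intro!: divide_right_mono simp: abs_div)
 ultimately show ?thesis
 unfolding real_norm_def abs_mult by (intro mult_mono) (use C h(1)[of n] in auto)
 qed
 qed (use h(1)[of n] in simp)
 also have "... = e / 2" using C(1) h(1)[of n] by (simp add: field_simps)
 also have "... < e" using e by simp
 finally show ?thesis unfolding 1 2 by simp
 qed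
 thus "\<exists>N. \<forall>n\<ge>N. norm ((LINT t:S|lebesgue. step' ((t - x) / h n) / h n * V t) - V x) < e" by auto
qed

text \<open>Testing with the difference of two smooth steps that rise just after \<open>x\<close>
  and just after \<open>y\<close>: the derivative concentrates to \<open>V x - V y\<close>, while
  the test function itself tends to the indicator of \<open>{x<..y}\<close>.\<close>

lemma weak_deriv_FTC:
 fixes V g :: "real => real"
 assumes wd: "has_weak_deriv {a<..<b} 1 V g" and V: "continuous_on {a..b} V"
 and g: "AE t in lebesgue_on {a<..<b}. (abs (g t)) <= G" and xy: "a < x" "x < y" "y < b"
 shows "V y - V x = (LINT t:{x<..y}|lebesgue. g t)"
proof -
 let ?I = "{a<..<b}" and ?M = "lebesgue_on {a<..<b}"
 \<comment> \<open>Half the remaining distance to \<open>b\<close>, so that the supports of all test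
   functions stay inside the interval.\<close>
 define h0 where "h0 = (b - y) / 2"
 define h where "h n = h0 * (1 / real (Suc n))" for n
 have h0: "h0 > 0" using xy by (simp add: h0_def)
 have le1: "1 / real (Suc n) <= 1" for n by (simp add: field_simps)
 have hpos: "0 < h n" for n using h0 by (simp add: h_def)
 have hle: "h n <= h0" for n unfolding h_def using h0 le1[of n] by (intro mult_left_le) auto
 have "h ----> h0 * 0"
 unfolding h_def[abs_def] by (intro tendsto_mult tendsto_const LIMSEQ_Suc[OF lim_1_over_n])
 hence hlim: "h ----> 0" by simp
 define ph where "ph n t = step ((t - x) / h n) - step ((t - y) / h n)" for n t
 have sub: "{x..y + h0} <= ?I" "{x..x + h0} <= ?I" "{y..y + h0} <= ?I"
 proof -
 have "y + h0 < b" using xy by (simp add: h0_def field_simps)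
 thus "{x..y + h0} <= ?I" "{x..x + h0} <= ?I" "{y..y + h0} <= ?I" using xy by auto
 qed
 have test: "ph n : test_functions ?I" for n
 proof (rule test_functionsI[of _ "{x..y + h0}"])
 show "smooth (ph n)" unfolding ph_def[abs_def] by (intro smooth_diff smooth_step_scaled)
 show "ph n t = 0" if "t ~: {x..y + h0}" for t
 proof (cases "t < x")
 case True
 thus ?thesis using xy hpos[of n] by (simp add: ph_def divide_le_0_iff)
 next
 case False
 hence "t > y + h n" using that hle[of n] by auto
 hence "1 <= (t - y) / h n" "1 <= (t - x) / h n" using hpos[of n] xy by (simp_all add: pos_le_divide_eq)
 thus ?thesis by (simp add: ph_def)
 qed
 qed (use sub in auto)
 have D: "fd (ph n) t 1 = step' ((t - x) / h n) / h n - step' ((t - y) / h n) / h n" for n t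
 proof -
 have "(ph n has_real_derivative (step' ((t - x) / h n) / h n - step' ((t - y) / h n) / h n)) (at t)"
 unfolding ph_def[abs_def] by (intro DERIV_diff step_scaled_derivative)
 hence "(ph n has_derivative (*) (step' ((t - x) / h n) / h n - step' ((t - y) / h n) / h n)) (at t)"
 by (simp add: has_field_derivative_def)
 from frechet_derivative_at[OF this, symmetric] show ?thesis by simp
 qed
 have intV: "set_integrable lebesgue ?I (%t. step' ((t - z) / h n) / h n * V t)" if z: "z : {x, y}" for z n
 proof -
 have kc: "continuous_on {z..z + h0} (%t. step' ((t - z) / h n) / h n)"
 by (rule continuous_step'_scaled) (use hpos[of n] in simp)
 have "set_integrable lebesgue {z..z + h0} (%t. step' ((t - z) / h n) / h n * V t)"
 by (intro absolutely_integrable_continuous_real continuous_on_mult kc continuous_on_subset[OF V])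
 (use z sub in force)
 moreover have "step' ((t - z) / h n) = 0" if "t ~: {z..z + h0}" for t
 proof -
 have "(t - z) / h n < 0 \<or> (t - z) / h n > 1"
 using that hpos[of n] hle[of n] by (auto simp: divide_less_0_iff pos_less_divide_eq)
 thus ?thesis using step'_outside by simp
 qed
 hence "(%t. indicator {z..z + h0} t *R (step' ((t - z) / h n) / h n * V t)) = (%t. indicator ?I t *R (step' ((t - z) / h n) / h n * V t))"
 using sub z by (fastforce simp: indicator_def fun_eq_iff)
 ultimately show ?thesis by (simp add: set_integrable_def)
 qed
 have eq: "(LINT t:?I|lebesgue. step' ((t - x) / h n) / h n * V t) - (LINT t:?I|lebesgue. step' ((t - y) / h n) / h n * V t) =
 - (LINT t:?I|lebesgue. ph n t * g t)" for n
 proof -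
 have "(LINT t:?I|lebesgue. fd (ph n) t 1 *R V t) = - (LINT t:?I|lebesgue. ph n t *R g t)"
 using wd test[of n] unfolding has_weak_deriv_def by blast
 moreover have "(LINT t:?I|lebesgue. fd (ph n) t 1 *R V t) =
 (LINT t:?I|lebesgue. step' ((t - x) / h n) / h n * V t) - (LINT t:?I|lebesgue. step' ((t - y) / h n) / h n * V t)"
 unfolding D real_scaleR_def left_diff_distrib using intV by (intro set_integral_diff) auto
 ultimately show ?thesis by simp
 qed
 have gm: "g : borel_measurable ?M"
 using wd by (intro locally_integrable_interval_measurable) (simp add: has_weak_deriv_def)
 have fin: "finite_measure ?M" by (rule finite_measure_bounded_lebesgue_on) auto
 have "(%n. LINT t|?M. ph n t * g t) ----> (LINT t|?M. indicator {x<..y} t * g t)"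
 proof (rule integral_dominated_convergence)
 show "integrable ?M (%t. 2 * (abs G))" by (rule finite_measure.integrable_const[OF fin])
 show "(%t. indicat_real {x<..y} t * g t) : borel_measurable ?M"
 using gm by (intro borel_measurable_times borel_measurable_indicator) (use xy in \<open>auto simp: sets_restrict_space_iff\<close>)
 show "(%t. ph n t * g t) : borel_measurable ?M" for n
 by (rule borel_measurable_times[OF _ gm],
 rule continuous_imp_measurable_on_sets_lebesgue[OF smooth_continuous_on[OF test_functions_smooth[OF test]]]) auto
 show "AE t in ?M. norm (ph n t * g t) <= 2 * (abs G)" for n
 using g
 proof eventually_elim
 case (elim t)
 have "(abs (ph n t)) <= 2"
 using step_bounds[of "(t - x) / h n"] step_bounds[of "(t - y) / h n"] by (auto simp: ph_def)
 thus ?case unfolding real_norm_def abs_mult using elim by (intro mult_mono) auto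
 qed
 show "AE t in ?M. (%n. ph n t * g t) ----> indicat_real {x<..y} t * g t"
 proof (rule AE_I2)
 fix t
 have st: "(%n. step ((t - z) / h n)) ----> indicator {z<..} t" for z
 proof (cases "t > z")
 case True
 have "\<forall>\<^sub>F n in sequentially. h n < t - z" using order_tendstoD(2)[OF hlim] True by simp
 hence "\<forall>\<^sub>F n in sequentially. step ((t - z) / h n) = 1"
 by eventually_elim (use hpos in \<open>simp add: pos_le_divide_eq\<close>)
 thus ?thesis using True by (simp add: tendsto_eventually)
 next
 case False
 have "(t - z) / h n <= 0" for n using False hpos[of n] by (simp add: divide_le_0_iff)
 hence "(%n. step ((t - z) / h n)) = (%n. 0)" by simp
 thus ?thesis using False by simp
 qed
 have "(%n. ph n t * g t) ----> (indicator {x<..} t - indicator {y<..} t) * g t"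
 unfolding ph_def by (intro tendsto_intros st)
 moreover have "indicator {x<..} t - indicator {y<..} t = indicat_real {x<..y} t"
 using xy by (auto simp: indicator_def)
 ultimately show "(%n. ph n t * g t) ----> indicat_real {x<..y} t * g t" by simp
 qed
 qed
 hence R: "(%n. - (LINT t:?I|lebesgue. ph n t * g t)) ----> - (LINT t|?M. indicator {x<..y} t * g t)"
 by (intro tendsto_minus) (simp add: LINT_lebesgue_on)
 have Vs: "continuous_on {x..x + h0} V" "continuous_on {y..y + h0} V"
 using sub by (auto intro!: continuous_on_subset[OF V] intro: less_imp_le)
 have "(%n. (LINT t:?I|lebesgue. step' ((t - x) / h n) / h n * V t) - (LINT t:?I|lebesgue. step' ((t - y) / h n) / h n * V t)) ----> V x - V y"
 by (intro tendsto_diff step_kernel_limit[OF Vs(1) hpos hle hlim sub(2)] step_kernel_limit[OF Vs(2) hpos hle hlim sub(3)])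
 hence "V x - V y = - (LINT t|?M. indicator {x<..y} t * g t)"
 unfolding eq using R by (rule LIMSEQ_unique)
 moreover have "(LINT t|?M. indicator {x<..y} t * g t) = (LINT t:{x<..y}|lebesgue. g t)"
 proof -
 have "(LINT t|?M. indicator {x<..y} t * g t) = (LINT t|lebesgue. indicator ?I t *R (indicator {x<..y} t * g t))"
 by (subst integral_restrict_space) auto
 also have "(%t. indicator ?I t *R (indicator {x<..y} t * g t)) = (%t. indicator {x<..y} t *R g t)"
 using xy by (auto simp: indicator_def fun_eq_iff)
 finally show ?thesis by (simp add: set_lebesgue_integral_def)
 qed
 ultimately show ?thesis by simp
qed

text \<open>\<open>weak_deriv_FTC\<close> determines \<open>V\<close> in the open interval up to a
  constant, which continuity and the value at \<open>-H\<close> fix. The second conclusion speaks of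
  the given \<open>g\<close>, and not of its modification \<open>g'\<close>, because weak-star
  convergence is stated for the given weak derivatives.\<close>

lemma weak_deriv_profile:
 assumes H: "H > 0" and wd: "has_weak_deriv {-H<..<H} 1 V g" and V: "continuous_on {-H..H} V" "V (-H) = 0"
 and g: "AE t in lebesgue_on {-H<..<H}. (abs (g t)) <= G" and G: "G >= 0"
 obtains g' where "profile H G V g'"
 "!!y. y : {-H..H} ==> V y = (LINT t:{-H<..<H}|lebesgue. g t * indicator {-H..y} t)"
proof -
 let ?I = "{-H<..<H}"
 \<comment> \<open>Clipping turns the a.e. bound into an everywhere bound and changes
   \<open>g\<close> only on a null set of the interval.\<close>
 define g' where "g' t = (if t : ?I then max (- G) (min G (g t)) else 0)" for t
 have gm: "g : borel_measurable (lebesgue_on ?I)"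
 using wd by (intro locally_integrable_interval_measurable) (simp add: has_weak_deriv_def)
 have g'm: "g' : borel_measurable lebesgue"
 unfolding g'_def using gm by (subst borel_measurable_if) (auto intro!: borel_measurable_max borel_measurable_min)
 have g'b: "(abs (g' t)) <= G" for t using G by (auto simp: g'_def)
 have "AE t in lebesgue. t : ?I --> (abs (g t)) <= G"
 using g by (subst (asm) AE_restrict_space_iff) auto
 hence eqAE: "AE t in lebesgue. t : ?I --> g t = g' t"
 by eventually_elim (auto simp: g'_def)
 have nullpt: "AE t in lebesgue. t ~= c" for c :: real
 using AE_completion[OF AE_lborel_singleton[of c]] by simp
 define W where "W x = (LINT t:{-H..x}|lebesgue. g' t)" for x
 have Wprof: "profile H G W g'" unfolding profile_def W_def using g'm g'b by simp
 have seteq: "(LINT t:{x<..y}|lebesgue. g t) = W y - W x" if xy: "-H < x" "x < y" "y < H" for x y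
 proof -
 have i: "set_integrable lebesgue {u..v} g'" for u v by (rule set_integrable_bounded_interval[OF g'm g'b])
 have mm: "(%t. indicator {x<..y} t *R g' t) : borel_measurable lebesgue"
 using g'm by (intro borel_measurable_scaleR borel_measurable_indicator) (auto simp: lborelD)
 have "(LINT t:{x<..y}|lebesgue. g t) = (LINT t:{x<..y}|lebesgue. g' t)"
 unfolding set_lebesgue_integral_def
 proof (rule Bochner_Integration.integral_cong_AE)
 have "AE t in lebesgue. indicator {x<..y} t *R g' t = indicator {x<..y} t *R g t"
 using eqAE by eventually_elim (use xy in \<open>auto simp: indicator_def\<close>)
 thus "(%t. indicator {x<..y} t *R g t) : borel_measurable lebesgue"
 by (rule borel_measurable_AE[OF mm])
 show "AE t in lebesgue. indicator {x<..y} t *R g t = indicator {x<..y} t *R g' t"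
 using eqAE by eventually_elim (use xy in \<open>auto simp: indicator_def\<close>)
 qed (rule mm)
 also have "... = (LINT t|lebesgue. indicator {-H..y} t *R g' t - indicator {-H..x} t *R g' t)"
 unfolding set_lebesgue_integral_def
 by (rule Bochner_Integration.integral_cong) (use xy in \<open>auto simp: indicator_def\<close>)
 also have "... = W y - W x"
 using i unfolding W_def set_lebesgue_integral_def set_integrable_def
 by (intro Bochner_Integration.integral_diff)
 finally show ?thesis .
 qed
 have Wc: "continuous_on {-H..H} W"
 by (rule lipschitz_on_continuous_on[of G], rule lipschitz_onI)
 (use profile_Lipschitz[OF Wprof] G in \<open>auto simp: dist_real_def\<close>)
 have const: "V x - W x = V 0 - W 0" if x: "x : ?I" for x
 proof -
 consider "x < 0" | "x = 0" | "x > 0" by linarith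
 thus ?thesis
 proof cases
 case 1
 thus ?thesis using weak_deriv_FTC[OF wd V(1) g, of x 0] seteq[of x 0] x H by simp
 next
 case 3
 thus ?thesis using weak_deriv_FTC[OF wd V(1) g, of 0 x] seteq[of 0 x] x H by simp
 qed simp
 qed
 have cl: "closure ?I = {-H..H}" using H by simp
 have const': "V x - W x = V 0 - W 0" if x: "x : {-H..H}" for x
 proof (rule continuous_constant_on_closure[of ?I "%x. V x - W x"])
 show "continuous_on (closure ?I) (%x. V x - W x)"
 unfolding cl by (intro continuous_on_diff V Wc)
 show "V y - W y = V 0 - W 0" if "y : ?I" for y by (rule const[OF that])
 show "x : closure ?I" unfolding cl by (rule x)
 qed
 have "W (-H) = 0"
 proof -
 have "W (-H) = (\<integral>t. 0 \<partial>(lebesgue :: real measure))"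
 unfolding W_def set_lebesgue_integral_def atLeastAtMost_singleton
 proof (rule Bochner_Integration.integral_cong[OF refl])
 fix t show "indicat_real {-H} t *R g' t = 0"
 proof (cases "t = -H")
 case True
 hence t: "t ~: ?I" by simp
 show ?thesis unfolding g'_def if_not_P[OF t] by simp
 qed simp
 qed
 thus ?thesis by simp
 qed
 moreover have "V (-H) - W (-H) = V 0 - W 0" by (rule const') (use H in simp)
 ultimately have VW: "V x = W x" if "x : {-H..H}" for x
 using const'[OF that] V(2) by linarith
 show ?thesis
 proof (rule that[of g'])
 show "profile H G V g'" using Wprof VW by (simp add: profile_def)
 fix y assume y: "y : {-H..H}"
 have mm: "(%t. indicator {-H..y} t *R g' t) : borel_measurable lebesgue"
 using g'm by (intro borel_measurable_scaleR borel_measurable_indicator) (auto simp: lborelD)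
 have ae: "AE t in lebesgue. indicator {-H..y} t *R g' t = indicator ?I t *R (g t * indicator {-H..y} t)"
 using eqAE by eventually_elim (auto simp: indicator_def g'_def)
 have "W y = (LINT t:?I|lebesgue. g t * indicator {-H..y} t)"
 unfolding W_def set_lebesgue_integral_def
 by (rule Bochner_Integration.integral_cong_AE[OF mm borel_measurable_AE[OF mm ae] ae])
 thus "V y = (LINT t:?I|lebesgue. g t * indicator {-H..y} t)" using VW[OF y] by simp
 qed
qed

lemma Linf_norm_AE: "AE x in lebesgue_on S. ereal (norm (f x)) <= Linf_norm S f"
 unfolding Linf_norm_def by (rule esssup_AE)

text \<open>An essential supremum is negative for a nonnegative function only over a null space; the
  positive length of the interval excludes this. It allows each summand of a
  \<open>W1inf_norm\<close> to be bounded by the sum.\<close>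

lemma Linf_norm_nonneg:
 fixes H :: real and f :: "real => 'b::euclidean_space"
 assumes "H > 0" shows "0 <= Linf_norm {-H<..<H} f"
proof (rule ccontr)
 let ?M = "lebesgue_on {-H<..<H}"
 assume "\<not> 0 <= Linf_norm {-H<..<H} f"
 hence "AE x in ?M. False"
 using Linf_norm_AE[where S="{-H<..<H}" and f=f]
 by (auto elim!: eventually_mono dest: order_trans[of 0, rotated])
 hence "emeasure ?M (space ?M) = 0" by (metis ae_filter_eq_bot_iff trivial_limit_def)
 hence "emeasure lebesgue {-H<..<H} = 0"
 using emeasure_restrict_space[of "{-H<..<H}" lebesgue "{-H<..<H}"]
 open_sets_lebesgue[OF open_greaterThanLessThan[of "-H" H]]
 by (simp add: space_restrict_space)
 thus False using assms by simp
qed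

text \<open>The bound on the sum of the two norms gives the density bound \<open>r\<close> for each
  of the two shapes separately. The representation of \<open>V y\<close> pairs the weak derivative
  with an indicator, the test function used for weak-star convergence.\<close>

lemma flow_shapes_profile:
 assumes "H > 0" "(Vin, Vout) : flow_shapes H r U" "V : {Vin, Vout}" "r > 0"
 obtains g where "profile H r V g" "V H = U" "(LINT y:{-H<..<H}|lebesgue. V y) = 1" "continuous_on {-H..H} V"
 "!!y. y : {-H..H} ==> V y = (LINT t:{-H<..<H}|lebesgue. weak_deriv {-H<..<H} 1 V t * indicator {-H..y} t)"
proof -
 let ?I = "{-H<..<H}"
 have V: "V : W1inf H" "V (-H) = 0" "V H = U" "(LINT y:?I|lebesgue. V y) = 1"
 and sum: "W1inf_norm H Vin + W1inf_norm H Vout <= ereal r"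
 using assms(2,3) by (auto simp: flow_shapes_def)
 have nn: "0 <= W1inf_norm H W" for W
 unfolding W1inf_norm_def by (intro add_nonneg_nonneg Linf_norm_nonneg assms(1))
 have "W1inf_norm H V <= W1inf_norm H Vin + W1inf_norm H Vout"
 using assms(3) nn[of Vin] nn[of Vout] by (auto simp: add_increasing2 add_increasing)
 hence "W1inf_norm H V <= ereal r" using sum by (rule order_trans)
 moreover have "Linf_norm ?I (weak_deriv ?I 1 V) <= W1inf_norm H V"
 unfolding W1inf_norm_def by (simp add: add_increasing Linf_norm_nonneg[OF assms(1)])
 ultimately have "Linf_norm ?I (weak_deriv ?I 1 V) <= ereal r" by (rule order_trans[rotated])
 hence ae: "AE t in lebesgue_on ?I. (abs (weak_deriv ?I 1 V t)) <= r"
 using Linf_norm_AE[where S="?I" and f="weak_deriv ?I 1 V"] by (auto elim!: eventually_mono dest: order_trans)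
 obtain g0 where "has_weak_deriv ?I 1 V g0" using V(1) by (auto simp: W1inf_def)
 hence wd: "has_weak_deriv ?I 1 V (weak_deriv ?I 1 V)" by (rule has_weak_deriv_weak_deriv)
 have c: "continuous_on {-H..H} V" using V(1) by (simp add: W1inf_def)
 show ?thesis
 by (rule weak_deriv_profile[OF assms(1) wd c V(2) ae]) (use assms(4) V c that in auto)
qed

text \<open>Testing the derivatives against the indicator of \<open>{-H..y}\<close> gives
  convergence at \<open>y\<close>. The common Lipschitz constant \<open>r\<close> then spreads it
  from a finite net of spacing \<open>e / (3 * r)\<close> to the whole interval.\<close>

lemma weak_star_imp_uniform:
 assumes H: "H > 0" and r: "r > 0"
 and ws: "weak_star_W1inf H Ve V F"
 and prof: "profile H r V g" "!!y. y : {-H..H} ==> V y = (LINT t:{-H<..<H}|lebesgue. weak_deriv {-H<..<H} 1 V t * indicator {-H..y} t)"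
 and prof': "\<forall>\<^sub>F i in F. (\<exists>g. profile H r (Ve i) g) &
 (\<forall>y\<in>{-H..H}. Ve i y = (LINT t:{-H<..<H}|lebesgue. weak_deriv {-H<..<H} 1 (Ve i) t * indicator {-H..y} t))"
 and e: "e > 0"
 shows "\<forall>\<^sub>F i in F. \<forall>y\<in>{-H..H}. (abs (Ve i y - V y)) < e"
proof -
 have pt: "\<forall>\<^sub>F i in F. (abs (Ve i y - V y)) < e / 3" if y: "y : {-H..H}" for y
 proof -
 have "set_integrable lebesgue {-H<..<H} (%t. indicat_real {-H..y} t)"
 proof -
 have "set_integrable lebesgue {-H<..<H} (%t. 1::real)"
 by (rule set_integrable_subset[of _ "{-H..H}"])
 (use integrable_const_interval[of "-H" H 1] in \<open>auto simp: set_integrable_def lborelD\<close>)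
 thus ?thesis
 unfolding set_integrable_def
 proof (rule Bochner_Integration.integrable_bound)
 show "(%t. indicat_real {-H<..<H} t *R indicat_real {-H..y} t) : borel_measurable lebesgue"
 by (intro borel_measurable_scaleR borel_measurable_indicator) (simp_all add: lborelD)
 show "AE t in lebesgue. norm (indicat_real {-H<..<H} t *R indicat_real {-H..y} t) <= norm (indicat_real {-H<..<H} t *R (1::real))"
 by (intro AE_I2) (simp add: indicator_def)
 qed
 qed
 hence "((%i. LINT t:{-H<..<H}|lebesgue. weak_deriv {-H<..<H} 1 (Ve i) t * indicator {-H..y} t)
 \<longlongrightarrow> (LINT t:{-H<..<H}|lebesgue. weak_deriv {-H<..<H} 1 V t * indicator {-H..y} t)) F"
 using ws unfolding weak_star_W1inf_def weak_star_Linf_def by blast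
 hence "\<forall>\<^sub>F i in F. dist (LINT t:{-H<..<H}|lebesgue. weak_deriv {-H<..<H} 1 (Ve i) t * indicator {-H..y} t) (V y) < e / 3"
 using e unfolding prof(2)[OF y, symmetric] by (intro tendstoD) auto
 thus ?thesis using prof' by eventually_elim (use y in \<open>simp add: dist_real_def\<close>)
 qed
 define d where "d = e / (3 * r)"
 have d: "d > 0" using e r by (simp add: d_def)
 obtain T where T: "T <= {-H..H}" "finite T" "{-H..H} <= (\<Union>t\<in>T. ball t d)"
 using compactE_image[of "{-H..H}" "{-H..H}" "%t. ball t d"] d by (metis centre_in_ball compact_Icc open_ball subsetI UN_I)
 have "\<forall>\<^sub>F i in F. \<forall>t\<in>T. (abs (Ve i t - V t)) < e / 3"
 using T(1) pt by (intro eventually_ball_finite T(2)) auto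
 thus ?thesis using prof'
 proof eventually_elim
 case (elim i)
 then obtain g' where g': "profile H r (Ve i) g'" by blast
 show ?case
 proof
 fix y assume y: "y : {-H..H}"
 then obtain t where t: "t : T" "y : ball t d" using T(3) by blast
 hence tI: "t : {-H..H}" using T(1) by blast
 have "r * (abs (y - t)) <= r * d" using t r by (intro mult_left_mono) (auto simp: dist_real_def abs_minus_commute)
 hence "r * (abs (y - t)) <= e / 3" using r by (simp add: d_def)
 hence "(abs (V y - V t)) <= e / 3" "(abs (Ve i y - Ve i t)) <= e / 3"
 using profile_Lipschitz[OF prof(1) y tI] profile_Lipschitz[OF g' y tI] by linarith+
 moreover have "(abs (Ve i t - V t)) < e / 3" using elim(1) t(1) by blast
 ultimately show "(abs (Ve i y - V y)) < e" by linarith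
 qed
 qed
qed

section \<open>Solenoidal extensions of boundary data\<close>

lemma measurable_real2: "(%p. fst p *R axis 1 1 + snd p *R axis 2 1 :: real^2) : borel_measurable (lborel \<Otimes>\<^sub>M lborel)"
proof -
 have "(%p. fst p *R axis 1 1 + snd p *R axis 2 1 :: real^2) : borel_measurable borel"
 by (intro borel_measurable_continuous_onI continuous_intros)
 thus ?thesis by (simp add: lborel_prod)
qed

text \<open>Identifies \<open>lborel\<close> on the vector type with a product measure through its
  values on boxes, so that the rule for measures of rectangles becomes available.\<close>

lemma lborel_real2:
 "distr (lborel \<Otimes>\<^sub>M lborel) borel (%p. fst p *R axis 1 1 + snd p *R axis 2 1 :: real^2) = lborel"
proof (rule lborel_eqI[symmetric])
 let ?T = "%p. fst p *R axis 1 1 + snd p *R axis 2 1 :: real^2"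
 fix l u :: "real^2"
 assume lu: "!!b. b : Basis ==> l \<bullet> b <= u \<bullet> b"
 have B: "(Basis :: (real^2) set) = {axis 1 1, axis 2 1}"
 by (auto simp: Basis_vec_def UNIV_2)
 have ne: "axis 1 1 ~= (axis 2 1 :: real^2)" by (simp add: axis_eq_axis)
 have pre: "?T -` box l u = {l$1<..<u$1} \<times> {l$2<..<u$2}"
 by (auto simp: box_def B inner_axis) (auto simp: axis_def)
 have le: "l$1 <= u$1" "l$2 <= u$2" using lu[of "axis 1 1"] lu[of "axis 2 1"] by (simp_all add: B inner_axis)
 have "emeasure (distr (lborel \<Otimes>\<^sub>M lborel) borel ?T) (box l u) = emeasure (lborel \<Otimes>\<^sub>M lborel) (?T -` box l u \<inter> space (lborel \<Otimes>\<^sub>M lborel))"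
 by (rule emeasure_distr[OF measurable_real2]) simp
 also have "... = emeasure (lborel \<Otimes>\<^sub>M lborel) ({l$1<..<u$1} \<times> {l$2<..<u$2})"
 by (simp only: pre) (simp add: space_pair_measure)
 also have "... = emeasure lborel {l$1<..<u$1} * emeasure lborel {l$2<..<u$2}"
 by (rule lborel.emeasure_pair_measure_Times) auto
 also have "... = ennreal (u$1 - l$1) * ennreal (u$2 - l$2)" using le by simp
 also have "... = ennreal (prod ((\<bullet>) (u - l)) Basis)"
 using le ne by (simp add: B inner_axis ennreal_mult)
 finally show "emeasure (distr (lborel \<Otimes>\<^sub>M lborel) borel ?T) (box l u) = ennreal (prod ((\<bullet>) (u - l)) Basis)" .
qed simp

lemma negligible_second_component:
 assumes "negligible N" shows "negligible {x::real^2. x$2 : N}"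
proof -
 have "N : null_sets (completion lborel)" using assms by (simp add: negligible_iff_null_sets)
 then obtain B where B: "B : null_sets lborel" "N <= B"
 unfolding null_sets_completion_iff2 by auto
 let ?A = "{x::real^2. x$2 : B}"
 have Bb: "B : sets borel" "emeasure lborel B = 0" using B(1) by (auto simp: null_sets_def)
 have "?A = (%x::real^2. x$2) -` B \<inter> space borel" by auto
 moreover have "(%x::real^2. x$2) : borel_measurable borel"
 by (intro borel_measurable_continuous_onI continuous_intros)
 ultimately have A: "?A : sets borel" using Bb(1) by (metis measurable_sets)
 let ?T = "%p. fst p *R axis 1 1 + snd p *R axis 2 1 :: real^2"
 have "emeasure lborel ?A = emeasure (distr (lborel \<Otimes>\<^sub>M lborel) borel ?T) ?A" by (simp only: lborel_real2)
 also have "... = emeasure (lborel \<Otimes>\<^sub>M lborel) (?T -` ?A \<inter> space (lborel \<Otimes>\<^sub>M lborel))"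
 using measurable_real2 A by (rule emeasure_distr)
 also have "?T -` ?A \<inter> space (lborel \<Otimes>\<^sub>M lborel) = (UNIV :: real set) \<times> B"
 by (auto simp: space_pair_measure axis_def)
 also have "emeasure (lborel \<Otimes>\<^sub>M lborel) ((UNIV :: real set) \<times> B) = emeasure lborel (UNIV :: real set) * emeasure lborel B"
 by (rule lborel.emeasure_pair_measure_Times) (use Bb(1) in auto)
 also have "... = 0" by (simp add: Bb(2))
 finally have "?A : null_sets lborel" using A by (simp add: null_sets_def)
 hence "negligible ?A" by (simp add: negligible_iff_null_sets null_sets_completionI)
 thus ?thesis by (rule negligible_subset) (use B(2) in auto)
qed

section \<open>Fields with a stream function of product form\<close>

abbreviation dd :: "(real => real) => real => real" where
 "dd f t \<equiv> fd f t 1"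

lemma dd_eqI: "(f has_real_derivative D) (at t) ==> dd f t = D"
 unfolding has_field_derivative_def by (drule frechet_derivative_at) (metis mult.right_neutral)

lemma dd_local:
 assumes "open T" "t : T" "!!s. s : T ==> f s = g s" "(g has_real_derivative D) (at t)"
 shows "dd f t = D"
 by (rule dd_eqI, rule has_field_derivative_transform_within_open[OF assms(4,1,2)]) (simp add: assms(3))

text \<open>The field with stream function \<open>a x\<^sub>1 * F x\<^sub>2\<close>, where \<open>V\<close> is the derivative of \<open>F\<close>.\<close>

definition sfield :: "(real => real) => (real => real) => (real => real) => real^2 => real^2" where
 "sfield a V F x = (a (x$1) * V (x$2)) *R e1 - (dd a (x$1) * F (x$2)) *R e2"

text \<open>The Jacobian of \<open>sfield a V F\<close> applied to \<open>b\<close>, with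
  \<open>g\<close> standing for the derivative of \<open>V\<close>. No relation among
  \<open>g\<close>, \<open>V\<close>, \<open>F\<close> is built in, so the formula also makes sense
  for a bounded density \<open>g\<close>, and the vanishing divergence is an algebraic
  identity.\<close>

definition sfield_deriv :: "(real => real) => (real => real) => (real => real) => (real => real) => real^2 => real^2 => real^2" where
 "sfield_deriv a g V F b x =
 (b$1) *R ((dd a (x$1) * V (x$2)) *R e1 - (dd (dd a) (x$1) * F (x$2)) *R e2) +
 (b$2) *R ((a (x$1) * g (x$2)) *R e1 - (dd a (x$1) * V (x$2)) *R e2)"

lemma smooth_dd: "smooth f ==> smooth (dd f)"
 by (rule smooth_frechet)

lemma smooth_sfield: "smooth a ==> smooth V ==> smooth F ==> smooth (sfield a V F)"
 unfolding sfield_def[abs_def]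
 by (intro smooth_diff smooth_scaleR smooth_mult smooth_const smooth_compose_component smooth_dd)

lemma component_has_derivative:
 fixes f :: "real => real"
 assumes "!!t. (f has_real_derivative f' t) (at t)"
 shows "((%x::real^2. f (x$k)) has_derivative (%h. f' (x$k) * h$k)) (at x)"
proof -
 have "((%x::real^2. x$k) has_derivative (%h. h$k)) (at x)"
 by (intro bounded_linear_imp_has_derivative bounded_linear_vec_nth)
 from has_derivative_compose[OF this assms[unfolded has_field_derivative_def]] show ?thesis .
qed

lemma sfield_frechet_derivative:
 assumes "smooth a" "!!t. (V has_real_derivative g t) (at t)" "!!t. (F has_real_derivative V t) (at t)"
 shows "fd (sfield a V F) x b = sfield_deriv a g V F b x"
proof -
 note da = component_has_derivative[OF smooth_has_real_derivative[OF assms(1)]]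
 note dda = component_has_derivative[OF smooth_has_real_derivative[OF smooth_dd[OF assms(1)]]]
 note dV = component_has_derivative[OF assms(2)]
 note dF = component_has_derivative[OF assms(3)]
 have "(sfield a V F has_derivative (%b.
 (a (x$1) * (g (x$2) * b$2) + (dd a (x$1) * b$1) * V (x$2)) *R e1 -
 (dd a (x$1) * (V (x$2) * b$2) + (dd (dd a) (x$1) * b$1) * F (x$2)) *R e2)) (at x)"
 unfolding sfield_def[abs_def]
 by (intro has_derivative_diff has_derivative_scaleR_left has_derivative_mult da dda dV dF)
 from fun_cong[OF frechet_derivative_at[OF this, symmetric], of b] show ?thesis
 by (simp add: sfield_deriv_def vec_eq_iff forall_2 axis_def algebra_simps)
qed

lemma sfield_divergence: "sfield_deriv a g V F e1 x $ 1 + sfield_deriv a g V F e2 x $ 2 = 0"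
 by (simp add: sfield_deriv_def axis_def)

definition crect :: "real => real => (real^2) set" where
 "crect L H = {x. -L <= x$1 & x$1 <= L & -H <= x$2 & x$2 <= H}"

lemma channel_subset_crect: "channel L H <= crect L H"
 by (auto simp: channel_def crect_def)

lemma bounded_on_interval:
 assumes "smooth (f :: real => real)" obtains C where "C >= 0" "!!t. t : {-L..L} ==> (abs (f t)) <= C"
proof -
 have "bounded (f ` {-L..L})"
 by (intro compact_imp_bounded compact_continuous_image smooth_continuous_on assms) auto
 then obtain b where "b > 0" "\<forall>y\<in>f ` {-L..L}. norm y <= b" unfolding bounded_pos by blast
 thus ?thesis by (intro that[of b]) auto
qed

lemma sfield_norm_le:
 "norm (sfield a V F x) <= (abs (a (x$1))) * (abs (V (x$2))) + (abs (dd a (x$1))) * (abs (F (x$2)))"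
 unfolding sfield_def by (rule order_trans[OF norm_triangle_ineq4]) (simp add: abs_mult)

lemma sfield_deriv_norm_le:
 assumes "norm b = 1"
 shows "norm (sfield_deriv a g V F b x) <=
 2 * ((abs (dd a (x$1))) * (abs (V (x$2)))) + (abs (dd (dd a) (x$1))) * (abs (F (x$2))) + (abs (a (x$1))) * (abs (g (x$2)))"
proof -
 have b: "(abs (b$1)) <= 1" "(abs (b$2)) <= 1" using component_le_norm_cart[of b] assms by auto
 let ?p = "(dd a (x$1) * V (x$2)) *R e1 - (dd (dd a) (x$1) * F (x$2)) *R e2"
 let ?q = "(a (x$1) * g (x$2)) *R e1 - (dd a (x$1) * V (x$2)) *R e2"
 have "norm ?p <= (abs (dd a (x$1))) * (abs (V (x$2))) + (abs (dd (dd a) (x$1))) * (abs (F (x$2)))"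
 by (rule order_trans[OF norm_triangle_ineq4]) (simp add: abs_mult)
 moreover have "norm ?q <= (abs (a (x$1))) * (abs (g (x$2))) + (abs (dd a (x$1))) * (abs (V (x$2)))"
 by (rule order_trans[OF norm_triangle_ineq4]) (simp add: abs_mult)
 moreover have "norm (sfield_deriv a g V F b x) <= norm ?p + norm ?q"
 proof -
 have "norm (sfield_deriv a g V F b x) <= (abs (b$1)) * norm ?p + (abs (b$2)) * norm ?q"
 unfolding sfield_deriv_def by (rule order_trans[OF norm_triangle_ineq]) simp
 also have "... <= 1 * norm ?p + 1 * norm ?q" using b by (intro add_mono mult_right_mono) auto
 finally show ?thesis by simp
 qed
 ultimately show ?thesis by linarith
qed

definition primitive :: "real => (real => real) => real => real" where
 "primitive H V x = (LINT t:{-H..x}|lebesgue. V t)"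

lemma profile_bounded:
 assumes "profile H G V g" "x : {-H..H}" shows "(abs (V x)) <= G * (2 * H)"
proof -
 have H: "-H : {-H..H}" using assms(2) by auto
 have "V (-H) = 0"
 proof -
 have "V (-H) = (LINT t:{-H}|lebesgue. g t)" using assms(1) H by (simp add: profile_def)
 also have "... = 0"
 unfolding set_lebesgue_integral_def
 proof (rule integral_eq_zero_AE)
 have "AE t in lebesgue. t ~= -H" using AE_completion[OF AE_lborel_singleton[of "-H"]] by simp
 thus "AE t in lebesgue. indicat_real {-H} t *R g t = 0" by eventually_elim simp
 qed
 finally show ?thesis .
 qed
 moreover have "G >= 0" using assms(1) abs_ge_zero order_trans unfolding profile_def by blast
 hence "G * (abs (x - (-H))) <= G * (2 * H)" using assms(2) by (intro mult_left_mono) auto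
 ultimately show ?thesis using profile_Lipschitz[OF assms(1,2) H] by simp
qed

lemma profile_continuous:
 assumes "profile H G V g" shows "continuous_on {-H..H} V"
proof (rule lipschitz_on_continuous_on[of G], rule lipschitz_onI)
 show "dist (V x) (V y) <= G * dist x y" if "x : {-H..H}" "y : {-H..H}" for x y
 using profile_Lipschitz[OF assms that] by (simp add: dist_real_def)
 show "0 <= G" using assms abs_ge_zero order_trans unfolding profile_def by blast
qed

lemma profile_set_integrable:
 assumes "profile H G V g" "x : {-H..H}" shows "set_integrable lebesgue {-H..x} V"
 using absolutely_integrable_continuous_real[of "-H" x V]
 continuous_on_subset[OF profile_continuous[OF assms(1)], of "{-H..x}"] assms(2) by auto

lemma primitive_bound:
 assumes "profile H G V g" "H > 0" "!!y. y : {-H..H} ==> (abs (V y)) <= s" "x : {-H..H}"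
 shows "(abs (primitive H V x)) <= 2 * H * s"
proof -
 have s: "s >= 0" using assms(3)[OF assms(4)] by linarith
 have "(abs (primitive H V x)) <= (LINT t|lebesgue. (abs (indicator {-H..x} t *R V t)))"
 unfolding primitive_def set_lebesgue_integral_def by (rule integral_abs_bound)
 also have "... <= (LINT t|lebesgue. indicator {-H..H} t *R s)"
 by (rule integral_mono_AE'[OF integrable_const_interval]) (use assms(3,4) s in \<open>auto simp: indicator_def\<close>)
 also have "... = 2 * H * s" using assms(2) by (subst integral_completion) (auto simp: measure_def)
 finally show ?thesis .
qed

lemma primitive_continuous:
 assumes "profile H G V g" shows "continuous_on {-H..H} (primitive H V)"
proof -
 have "V integrable_on {-H..H}" by (rule integrable_continuous_real[OF profile_continuous[OF assms]])
 hence "continuous_on {-H..H} (%x. integral {-H..x} V)" by (rule indefinite_integral_continuous_1)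
 moreover have "integral {-H..x} V = primitive H V x" if "x : {-H..H}" for x
 unfolding primitive_def by (rule set_lebesgue_integral_eq_integral(2)[symmetric, OF profile_set_integrable[OF assms that]])
 ultimately show ?thesis by (rule continuous_on_eq)
qed

lemma continuous_on_sfield:
 assumes "smooth a" "profile H G V g" "S <= crect L H"
 shows "continuous_on S (sfield a V (primitive H V))"
proof -
 have c: "continuous_on S (%x. f (x$1))" if "smooth f" for f :: "real => real"
 by (rule smooth_continuous_on[OF smooth_compose_component[OF that]])
 have d: "continuous_on S (%x. f (x$2))" if "continuous_on {-H..H} f" for f :: "real => real"
 by (rule continuous_on_compose2[OF that]) (use assms(3) in \<open>auto simp: crect_def intro!: continuous_intros\<close>)
 show ?thesis
 unfolding sfield_def
 by (intro continuous_on_diff continuous_on_scaleR continuous_on_mult continuous_on_const c d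
 assms(1) smooth_dd profile_continuous[OF assms(2)] primitive_continuous[OF assms(2)])
qed

text \<open>The field is in general only Lipschitz. Replacing the profile by its polynomial
  approximations gives smooth fields that converge in \<open>H1_norm\<close> and uniformly on the
  closed rectangle, the latter being what identifies the trace. By the last clause they vanish
  wherever \<open>a\<close> and its derivative do, so they can be kept away from the body.\<close>

lemma sfield_approximation:
 assumes S: "open S" "S <= channel L H" and L: "L > 0" "H > 0" and a: "smooth a" and V: "profile H G V g"
 obtains v where "!!n::nat. smooth (v n)" "W12 S (sfield a V (primitive H V)) (sfield_deriv a g V (primitive H V))"
 "(%n. H1_norm S (%x. sfield a V (primitive H V) x - v n x)) ----> 0"
 "uniform_limit (crect L H) v (sfield a V (primitive H V)) sequentially"
 "!!n x. a (x$1) = 0 ==> dd a (x$1) = 0 ==> v n x = 0"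
proof -
 let ?F = "primitive H V" and ?M = "lebesgue_on S"
 let ?s = "sfield a V ?F" and ?D = "sfield_deriv a g V ?F"
 have Sb: "bounded S" using bounded_subset[OF bounded_channel S(2)] .
 have Sl: "S : sets lebesgue" using S(1) by simp
 have Sc: "S <= crect L H" using S(2) channel_subset_crect by blast
 obtain q P Q N where ap: "!!n. smooth (q n)" "!!n x. (P n has_real_derivative q n x) (at x)"
 "!!n x. (Q n has_real_derivative P n x) (at x)"
 "negligible N" "!!x. x : {-H..H} ==> x ~: N ==> (%n::nat. q n x) ----> g x"
 "!!n x. x : {-H..H} ==> (abs (q n x)) <= G + 1"
 "uniform_limit {-H..H} P V sequentially" "uniform_limit {-H..H} Q ?F sequentially"
 using profile_smooth_approximation[OF V L(2), of ?F] by (metis primitive_def)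
 have sm: "smooth (P n)" "smooth (Q n)" for n
 using smooth_antiderivative[OF ap(2,1)] smooth_antiderivative[OF ap(3)] by blast+
 define v where "v n = sfield a (P n) (Q n)" for n
 let ?E = "%n. sfield_deriv a (q n) (P n) (Q n)"
 have vs: "smooth (v n)" for n unfolding v_def by (intro smooth_sfield a sm)
 have vfr: "fd (v n) x b = ?E n b x" for n b x
 unfolding v_def by (rule sfield_frechet_derivative[OF a ap(2,3)])
 have Wv: "W12 S (v n) (?E n)" for n
 using W12_smooth[OF vs Sb Sl, of n] unfolding vfr by (simp add: W12_def)
 obtain A0 where A0: "A0 >= 0" "!!t. t : {-L..L} ==> (abs (a t)) <= A0" using bounded_on_interval[OF a] by metis
 obtain A1 where A1: "A1 >= 0" "!!t. t : {-L..L} ==> (abs (dd a t)) <= A1" using bounded_on_interval[OF smooth_dd[OF a]] by metis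
 obtain A2 where A2: "A2 >= 0" "!!t. t : {-L..L} ==> (abs (dd (dd a) t)) <= A2" using bounded_on_interval[OF smooth_dd[OF smooth_dd[OF a]]] by metis
 have inS: "x$1 : {-L..L}" "x$2 : {-H..H}" if "x : crect L H" for x using that by (auto simp: crect_def)
 have lin: "sfield a V1 F1 x - sfield a V2 F2 x = sfield a (%t. V1 t - V2 t) (%t. F1 t - F2 t) x" for V1 V2 F1 F2 x
 by (simp add: sfield_def algebra_simps)
 have linD: "sfield_deriv a g1 V1 F1 b x - sfield_deriv a g2 V2 F2 b x = sfield_deriv a (%t. g1 t - g2 t) (%t. V1 t - V2 t) (%t. F1 t - F2 t) b x" for g1 g2 V1 V2 F1 F2 b x
 by (simp add: sfield_deriv_def algebra_simps)
 have ul: "uniform_limit (crect L H) v ?s sequentially"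
 proof (rule uniform_limitI)
 fix e :: real assume e: "e > 0"
 define d where "d = e / (2 * (A0 + A1 + 1))"
 have d: "d > 0" unfolding d_def using e A0 A1 by (intro divide_pos_pos) auto
 have "\<forall>\<^sub>F n in sequentially. \<forall>y\<in>{-H..H}. dist (P n y) (V y) < d" "\<forall>\<^sub>F n in sequentially. \<forall>y\<in>{-H..H}. dist (Q n y) (?F y) < d"
 using uniform_limitD[OF ap(7) d] uniform_limitD[OF ap(8) d] by auto
 thus "\<forall>\<^sub>F n in sequentially. \<forall>x\<in>crect L H. dist (v n x) (?s x) < e"
 proof eventually_elim
 case (elim n)
 show ?case
 proof
 fix x assume x: "x : crect L H"
 have "(abs (P n (x$2) - V (x$2))) <= d" "(abs (Q n (x$2) - ?F (x$2))) <= d"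
 using elim inS(2)[OF x] by (auto simp: dist_real_def intro: less_imp_le)
 hence "norm (v n x - ?s x) <= A0 * d + A1 * d"
 unfolding v_def lin
 using A0 A1 inS(1)[OF x] d
 by (intro order_trans[OF sfield_norm_le] add_mono mult_mono) auto
 also have "... < e"
 proof -
 have "A0 * d + A1 * d <= (A0 + A1 + 1) * d" using d by (simp add: algebra_simps)
 also have "... = e / 2" using A0(1) A1(1) by (simp add: d_def field_simps)
 finally show ?thesis using e by simp
 qed
 finally show "dist (v n x) (?s x) < e" by (simp add: dist_norm)
 qed
 qed
 qed
 have pq: "(%n. P n y) ----> V y" "(%n. Q n y) ----> ?F y" if "y : {-H..H}" for y
 using tendsto_uniform_limitI[OF ap(7) that] tendsto_uniform_limitI[OF ap(8) that] by auto
 have sm_meas: "(%x. sfield a V ?F x) : borel_measurable ?M"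
 by (rule continuous_imp_measurable_on_sets_lebesgue[OF continuous_on_sfield[OF a V Sc] Sl])
 have Enm: "?E n b : borel_measurable ?M" if "b : Basis" for n b
 using W12_deriv_sq_integrable[OF Wv that] by (simp add: sq_integrable_def)
 have negl: "AE x in ?M. x$2 ~: N"
 proof -
 have "AE x in lebesgue. x ~: {x::real^2. x$2 : N}"
 using negligible_second_component[OF ap(4)] by (metis AE_not_in negligible_iff_null_sets)
 thus ?thesis by (subst AE_restrict_space_iff) (use Sl in auto)
 qed
 have Elim: "AE x in ?M. (%n. ?E n b x) ----> ?D b x" for b
 using negl
 proof (rule AE_mp, intro AE_I2 impI)
 fix x assume "x : space ?M" "x$2 ~: N"
 hence "x$2 : {-H..H}" "x$2 ~: N" using Sc by (auto simp: crect_def space_restrict_space)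
 thus "(%n. ?E n b x) ----> ?D b x"
 unfolding sfield_deriv_def by (intro tendsto_intros ap(5) pq)
 qed
 have Dm: "?D b : borel_measurable ?M" if b: "b : Basis" for b
 proof -
 \<comment> \<open>Pointwise convergence holds off \<open>N\<close> only; setting the functions to 0
   there gives a measurable limit, equal to the derivative a.e.\<close>
 define h where "h x = (if x$2 : N then 0 else ?D b x)" for x
 have "h : borel_measurable ?M"
 proof (rule borel_measurable_LIMSEQ_metric)
 have Nm: "{x::real^2. x$2 : N} : sets lebesgue"
 using negligible_second_component[OF ap(4)] by (rule negligible_imp_sets)
 have "{x : space ?M. x$2 : N} = S \<inter> {x. x$2 : N}" by (auto simp: space_restrict_space)
 hence Nm': "{x : space ?M. x$2 : N} : sets ?M" using Nm Sl by (simp add: sets_restrict_space_iff sets.Int)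
 show "(%x. if x$2 : N then 0 else ?E n b x) : borel_measurable ?M" for n
 by (rule measurable_If[OF _ Enm[OF b] Nm']) simp
 show "(%n. if x$2 : N then 0 else ?E n b x) ----> h x" if "x : space ?M" for x
 proof (cases "x$2 : N")
 case False
 hence "x$2 : {-H..H}" "x$2 ~: N" using Sc that by (auto simp: crect_def space_restrict_space)
 hence "(%n. ?E n b x) ----> ?D b x"
 unfolding sfield_deriv_def by (intro tendsto_intros ap(5) pq)
 thus ?thesis using False by (simp add: h_def)
 qed (simp add: h_def)
 qed
 moreover have "AE x in ?M. h x = ?D b x" using negl by eventually_elim (simp add: h_def)
 ultimately show ?thesis by (rule borel_measurable_lebesgue_on_AE[OF _ _ Sl])
 qed
 have fin: "finite_measure ?M" by (rule finite_measure_bounded_lebesgue_on[OF Sb Sl])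
 have Vb: "(abs (V y)) <= G * (2 * H)" if "y : {-H..H}" for y by (rule profile_bounded[OF V that])
 have Fb: "(abs (?F y)) <= 2 * H * (G * (2 * H))" if "y : {-H..H}" for y by (rule primitive_bound[OF V L(2) Vb that])
 have gb: "(abs (g y)) <= G" for y using V by (simp add: profile_def)
 have G0: "G >= 0" using gb[of 0] by linarith
 have sq_s: "sq_integrable ?M ?s"
 proof (rule sq_integrable_bounded(1)[OF fin sm_meas])
 show "AE x in ?M. norm (?s x) <= A0 * (G * (2 * H)) + A1 * (2 * H * (G * (2 * H)))"
 proof (rule AE_I2)
 fix x assume "x : space ?M"
 hence "x : crect L H" using Sc by (auto simp: space_restrict_space)
 thus "norm (?s x) <= A0 * (G * (2 * H)) + A1 * (2 * H * (G * (2 * H)))"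
 using A0 A1 inS[of x] Vb Fb by (intro order_trans[OF sfield_norm_le] add_mono mult_mono) auto
 qed
 qed
 have sq_D: "sq_integrable ?M (?D b)" if b: "b : Basis" for b
 proof (rule sq_integrable_bounded(1)[OF fin Dm[OF b]])
 show "AE x in ?M. norm (?D b x) <= 2 * (A1 * (G * (2 * H))) + A2 * (2 * H * (G * (2 * H))) + A0 * G"
 proof (rule AE_I2)
 fix x assume "x : space ?M"
 hence "x : crect L H" using Sc by (auto simp: space_restrict_space)
 thus "norm (?D b x) <= 2 * (A1 * (G * (2 * H))) + A2 * (2 * H * (G * (2 * H))) + A0 * G"
 using A0 A1 A2 inS[of x] Vb Fb gb b
 by (intro order_trans[OF sfield_deriv_norm_le] add_mono mult_mono) auto
 qed
 qed
 have limv: "(%n. L2n ?M (%x. v n x - ?s x)) ----> 0"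
 proof (rule LIMSEQ_I)
 fix e :: real assume e: "e > 0"
 define m where "m = measure ?M (space ?M)"
 have m: "m >= 0" by (simp add: m_def)
 have "e / (sqrt m + 1) > 0" using e m by (intro divide_pos_pos add_nonneg_pos) auto
 from uniform_limitD[OF ul this] obtain n0 where n0: "!!n x. n >= n0 ==> x : crect L H ==> dist (v n x) (?s x) < e / (sqrt m + 1)"
 by (auto simp: eventually_sequentially)
 have "norm (L2n ?M (%x. v n x - ?s x) - 0) < e" if n: "n >= n0" for n
 proof -
 have "(L2n ?M (%x. v n x - ?s x))^2 <= (e / (sqrt m + 1))^2 * m"
 unfolding m_def[symmetric]
 proof (rule sq_integrable_bounded(2)[OF fin, folded m_def])
 show "(%x. v n x - ?s x) : borel_measurable ?M"
 using W12_sq_integrable[OF Wv, of n] sq_s by (auto simp: sq_integrable_def)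
 show "AE x in ?M. norm (v n x - ?s x) <= e / (sqrt m + 1)"
 using n0[OF n] Sc by (intro AE_I2) (auto simp: space_restrict_space dist_norm intro!: less_imp_le)
 qed
 also have "... = (e / (sqrt m + 1) * sqrt m)^2" unfolding power_mult_distrib real_sqrt_pow2[OF m] ..
 finally have "L2n ?M (%x. v n x - ?s x) <= e / (sqrt m + 1) * sqrt m"
 by (rule power2_le_imp_le) (use e m in simp)
 also have "... < e"
 proof -
 have s: "sqrt m / (sqrt m + 1) < 1" using m by (subst divide_less_eq_1_pos) (auto intro: add_nonneg_pos)
 have "e / (sqrt m + 1) * sqrt m = e * (sqrt m / (sqrt m + 1))" by simp
 also have "... < e * 1" using s e by (rule mult_strict_left_mono)
 finally show ?thesis by simp
 qed
 finally show ?thesis by simp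
 qed
 thus "\<exists>n0. \<forall>n\<ge>n0. norm (L2n ?M (%x. v n x - ?s x) - 0) < e" by blast
 qed
 \<comment> \<open>The uniform errors are at most 1 from some index \<open>k\<close> on; shifting
   the sequence by \<open>k\<close> gives the constant majorant for dominated convergence.\<close>
 have "\<forall>\<^sub>F n in sequentially. (\<forall>y\<in>{-H..H}. dist (P n y) (V y) < 1) & (\<forall>y\<in>{-H..H}. dist (Q n y) (?F y) < 1)"
 by (intro eventually_conj uniform_limitD[OF ap(7)] uniform_limitD[OF ap(8)]) simp_all
 then obtain k where k': "!!n. n >= k ==> (\<forall>y\<in>{-H..H}. dist (P n y) (V y) < 1) & (\<forall>y\<in>{-H..H}. dist (Q n y) (?F y) < 1)"
 unfolding eventually_sequentially by blast
 have k: "(abs (P n y - V y)) <= 1 & (abs (Q n y - ?F y)) <= 1" if "n >= k" "y : {-H..H}" for n y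
 using k'[OF that(1)] that(2) unfolding dist_real_def by (meson less_imp_le)
 have limD: "(%n. L2n ?M (%x. ?E n b x - ?D b x)) ----> 0" if b: "b : Basis" for b
 proof (rule LIMSEQ_offset[where k=k], rule tendsto_L2n_dominated)
 let ?c = "2 * (A1 * 1) + A2 * 1 + A0 * (2 * G + 1)"
 show "sq_integrable ?M (%x. ?c)"
 by (rule sq_integrable_bounded(1)[OF fin, where C="(abs ?c)"]) auto
 show "(%x. ?E (n + k) b x - ?D b x) : borel_measurable ?M" for n
 using Enm[OF b] Dm[OF b] by (rule borel_measurable_diff)
 show "AE x in ?M. norm (?E (n + k) b x - ?D b x) <= norm ?c" for n
 proof (rule AE_I2)
 fix x assume "x : space ?M"
 hence x: "x$1 : {-L..L}" "x$2 : {-H..H}" using Sc by (auto simp: crect_def space_restrict_space)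
 have gq: "(abs (q (n + k) (x$2) - g (x$2))) <= 2 * G + 1" using ap(6)[OF x(2), of "n + k"] gb[of "x$2"] by linarith
 have "norm (?E (n + k) b x - ?D b x) <= ?c"
 unfolding linD
 using A0 A1 A2 x k[of "n + k" "x$2"] gq b
 by (intro order_trans[OF sfield_deriv_norm_le] add_mono mult_mono) auto
 thus "norm (?E (n + k) b x - ?D b x) <= norm ?c" by simp
 qed
 show "AE x in ?M. (%n. ?E (n + k) b x - ?D b x) ----> 0"
 using Elim[of b] by eventually_elim (intro LIM_zero LIMSEQ_ignore_initial_segment)
 qed
 have W: "W12 S ?s ?D" by (rule W12_limit[OF S(1) Sb Wv sq_s sq_D limv limD])
 have "(%n. H1_norm S (%x. ?s x - v n x)) ----> 0"
 unfolding H1_norm_tendsto_0_iff[OF S(1) W12_diff[OF W Wv]]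
 using limv limD by (simp add: L2n_minus_commute)
 thus ?thesis
 by (rule that[OF vs W _ ul]) (simp add: v_def sfield_def)
qed

section \<open>Trilinear estimates\<close>

definition L4_integrable :: "'a measure => ('a => 'b::euclidean_space) => bool" where
 "L4_integrable M f \<longleftrightarrow> f : borel_measurable M & sq_integrable M (%x. (norm (f x))^2)"

text \<open>Written through the L2 norm of the squared length, so that Hoelder's inequality with
  exponents 2, 4, 4 reduces to two applications of Cauchy-Schwarz.\<close>

definition L4n :: "'a measure => ('a => 'b::euclidean_space) => real" where
 "L4n M f = sqrt (L2n M (%x. (norm (f x))^2))"

lemma L4n_nonneg [simp]: "0 <= L4n M f"
 by (simp add: L4n_def)

lemma L4n_sq: "(L4n M f)^2 = L2n M (%x. (norm (f x))^2)"
 by (simp add: L4n_def)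

lemma L4_mult:
 assumes "L4_integrable M f" "L4_integrable M h"
 shows "sq_integrable M (%x. norm (f x) * norm (h x))"
 and "L2n M (%x. norm (f x) * norm (h x)) <= L4n M f * L4n M h"
proof -
 have m[measurable]: "f : borel_measurable M" "h : borel_measurable M"
 and q: "sq_integrable M (%x. (norm (f x))^2)" "sq_integrable M (%x. (norm (h x))^2)"
 using assms by (auto simp: L4_integrable_def)
 have mm: "(%x. (norm (f x) * norm (h x))^2) : borel_measurable M" by measurable
 have bd: "AE x in M. norm ((norm (f x) * norm (h x))^2) <= 1 * (norm ((norm (f x))^2) * norm ((norm (h x))^2))"
 by (simp add: power_mult_distrib)
 note * = L2_product_bound[OF q mm bd zero_le_one]
 show "sq_integrable M (%x. norm (f x) * norm (h x))"
 unfolding sq_integrable_def using *(1) by (auto simp: power_mult_distrib)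
 have "(L2n M (%x. norm (f x) * norm (h x)))^2 = (LINT x|M. (norm (f x) * norm (h x))^2)"
 by (simp add: L2n_sq)
 also have "... <= (L4n M f)^2 * (L4n M h)^2" using *(2) by (simp add: L4n_sq)
 finally have "(L2n M (%x. norm (f x) * norm (h x)))^2 <= (L4n M f * L4n M h)^2" by (simp only: power_mult_distrib)
 thus "L2n M (%x. norm (f x) * norm (h x)) <= L4n M f * L4n M h"
 by (rule power2_le_imp_le) simp
qed

lemma norm_matrix_vector_mult_le:
 fixes A :: "real^2^2"
 shows "norm (A *v x) <= norm A * norm x"
proof (rule power2_le_imp_le)
 have c: "(A$i \<bullet> x)^2 <= (norm (A$i))^2 * (norm x)^2" for i
 by (metis Cauchy_Schwarz_ineq power2_norm_eq_inner)
 have "(norm (A *v x))^2 = (A$1 \<bullet> x)^2 + (A$2 \<bullet> x)^2"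
 unfolding power2_norm_eq_inner by (subst inner_vec_def) (simp add: sum_2 matrix_vector_mul_component power2_eq_square)
 also have "... <= (norm (A$1))^2 * (norm x)^2 + (norm (A$2))^2 * (norm x)^2"
 by (intro add_mono c)
 also have "... = ((norm (A$1))^2 + (norm (A$2))^2) * (norm x)^2" by (simp add: distrib_right)
 also have "(norm (A$1))^2 + (norm (A$2))^2 = (norm A)^2"
 unfolding power2_norm_eq_inner by (subst (3) inner_vec_def) (simp add: sum_2)
 also have "(norm A)^2 * (norm x)^2 = (norm A * norm x)^2" by (simp add: power_mult_distrib)
 finally show "(norm (A *v x))^2 <= (norm A * norm x)^2" .
qed simp

lemma bounded_bilinear_matrix_vector_mult: "bounded_bilinear ((*v) :: real^2^2 => real^2 => real^2)"
proof (rule bounded_bilinear.intro)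
 show "\<exists>K. \<forall>A x. norm ((A :: real^2^2) *v x) <= norm A * norm x * K"
 by (rule exI[of _ 1]) (simp add: norm_matrix_vector_mult_le)
qed (simp_all add: matrix_vector_mult_def vec_eq_iff sum_2 algebra_simps)

lemma borel_measurable_matrix_vector_mult [measurable]:
 fixes A :: "'a => real^2^2"
 assumes "A : borel_measurable M" "f : borel_measurable M"
 shows "(%x. A x *v f x) : borel_measurable M"
 by (rule borel_measurable_continuous_Pair[OF assms])
 (intro bounded_bilinear.continuous_on[OF bounded_bilinear_matrix_vector_mult] continuous_intros)

lemma trilinear_bound:
 fixes A :: "'a => real^2^2"
 assumes "sq_integrable M A" "L4_integrable M f" "L4_integrable M h"
 shows "integrable M (%x. (A x *v f x) \<bullet> h x)"
 and "(abs (\<integral>x. (A x *v f x) \<bullet> h x \<partial>M)) <= L2n M A * (L4n M f * L4n M h)"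
proof -
 have [measurable]: "A : borel_measurable M" "f : borel_measurable M" "h : borel_measurable M"
 using assms by (auto simp: L4_integrable_def sq_integrable_def)
 have m: "(%x. (A x *v f x) \<bullet> h x) : borel_measurable M" by measurable
 have bd: "AE x in M. norm ((A x *v f x) \<bullet> h x) <= 1 * (norm (A x) * norm (norm (f x) * norm (h x)))"
 proof (rule AE_I2)
 fix x
 have "norm ((A x *v f x) \<bullet> h x) <= norm (A x *v f x) * norm (h x)"
 by (simp add: Cauchy_Schwarz_ineq2)
 also have "... <= norm (A x) * norm (f x) * norm (h x)"
 by (intro mult_right_mono norm_matrix_vector_mult_le) simp
 finally show "norm ((A x *v f x) \<bullet> h x) <= 1 * (norm (A x) * norm (norm (f x) * norm (h x)))"
 by (simp add: mult.assoc)
 qed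
 note * = L2_product_bound[OF assms(1) L4_mult(1)[OF assms(2,3)] m bd zero_le_one]
 show "integrable M (%x. (A x *v f x) \<bullet> h x)" by (rule *(1))
 have "(abs (\<integral>x. (A x *v f x) \<bullet> h x \<partial>M)) <= L2n M A * L2n M (%x. norm (f x) * norm (h x))"
 using *(2) by simp
 also have "... <= L2n M A * (L4n M f * L4n M h)"
 by (intro mult_left_mono L4_mult(2) assms) simp
 finally show "(abs (\<integral>x. (A x *v f x) \<bullet> h x \<partial>M)) <= L2n M A * (L4n M f * L4n M h)" .
qed

lemma convection_bounded_bound:
 fixes A :: "'a => real^2^2"
 assumes "sq_integrable M A" "sq_integrable M f" "h : borel_measurable M" "!!x. x : space M ==> norm (h x) <= C"
 and C: "C >= 0"
 shows "integrable M (%x. (A x *v f x) \<bullet> h x)"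
 and "(abs (\<integral>x. (A x *v f x) \<bullet> h x \<partial>M)) <= C * (L2n M A * L2n M f)"
proof -
 have [measurable]: "A : borel_measurable M" "f : borel_measurable M" "h : borel_measurable M"
 using assms by (auto simp: sq_integrable_def)
 have m: "(%x. (A x *v f x) \<bullet> h x) : borel_measurable M" by measurable
 have bd: "AE x in M. norm ((A x *v f x) \<bullet> h x) <= C * (norm (A x) * norm (f x))"
 proof (rule AE_I2)
 fix x assume x: "x : space M"
 have "norm ((A x *v f x) \<bullet> h x) <= norm (A x *v f x) * norm (h x)"
 by (simp add: Cauchy_Schwarz_ineq2)
 also have "... <= norm (A x) * norm (f x) * C"
 by (intro mult_mono norm_matrix_vector_mult_le assms(4) x) simp_all
 finally show "norm ((A x *v f x) \<bullet> h x) <= C * (norm (A x) * norm (f x))"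
 by (simp add: mult.commute)
 qed
 show "integrable M (%x. (A x *v f x) \<bullet> h x)" "(abs (\<integral>x. (A x *v f x) \<bullet> h x \<partial>M)) <= C * (L2n M A * L2n M f)"
 using L2_product_bound[OF assms(1,2) m bd C] by simp_all
qed

lemma L4_bounded:
 assumes "finite_measure M" "f : borel_measurable M" "!!x. x : space M ==> norm (f x) <= s" "s >= 0"
 shows "L4_integrable M f" "L4n M f <= s * sqrt (sqrt (measure M (space M)))"
proof -
 have m: "(%x. (norm (f x))^2) : borel_measurable M" using assms(2) by measurable
 have b: "AE x in M. norm ((norm (f x))^2) <= s\<^sup>2" using assms(3) by (intro AE_I2) (simp add: power_mono)
 note * = sq_integrable_bounded[OF assms(1) m b]
 show "L4_integrable M f" using *(1) assms(2) by (simp add: L4_integrable_def)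
 have "L2n M (%x. (norm (f x))^2) <= sqrt ((s\<^sup>2)^2 * measure M (space M))"
 by (rule real_le_rsqrt[OF *(2)])
 also have "... = s\<^sup>2 * sqrt (measure M (space M))" unfolding real_sqrt_mult real_sqrt_abs by simp
 finally have "L4n M f <= sqrt (s\<^sup>2 * sqrt (measure M (space M)))" unfolding L4n_def by (rule real_sqrt_le_mono)
 also have "... = s * sqrt (sqrt (measure M (space M)))" using assms(4) by (simp add: real_sqrt_mult)
 finally show "L4n M f <= s * sqrt (sqrt (measure M (space M)))" .
qed

lemma L2n_le_L4n:
 assumes "finite_measure M" "L4_integrable M f"
 shows "sq_integrable M f" "L2n M f <= L4n M f * sqrt (sqrt (measure M (space M)))"
proof -
 have m: "f : borel_measurable M" and q: "sq_integrable M (%x. (norm (f x))^2)"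
 using assms(2) by (auto simp: L4_integrable_def)
 have o: "sq_integrable M (%x. 1::real)" "(L2n M (%x. 1::real))^2 <= 1\<^sup>2 * measure M (space M)"
 using sq_integrable_bounded[OF assms(1), of "%x. 1::real" 1] by simp_all
 have mm: "(%x. (norm (f x))^2) : borel_measurable M" using m by measurable
 note * = L2_product_bound[OF q o(1) mm, of 1]
 show "sq_integrable M f" using *(1) m by (simp add: sq_integrable_def)
 have "(L2n M f)^2 <= L2n M (%x. (norm (f x))^2) * L2n M (%x. 1::real)" using *(2) by (simp add: L2n_sq)
 also have "... <= (L4n M f)^2 * sqrt (measure M (space M))"
 unfolding L4n_sq using o(2) by (intro mult_left_mono real_le_rsqrt) simp_all
 also have "... = (L4n M f * sqrt (sqrt (measure M (space M))))^2" by (simp add: power_mult_distrib)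
 finally show "L2n M f <= L4n M f * sqrt (sqrt (measure M (space M)))"
 by (rule power2_le_imp_le) simp
qed

lemma L4_add:
 assumes "L4_integrable M f" "L4_integrable M g" shows "L4_integrable M (%x. f x + g x)"
proof -
 have m[measurable]: "f : borel_measurable M" "g : borel_measurable M"
 and q: "sq_integrable M (%x. (norm (f x))^2)" "sq_integrable M (%x. (norm (g x))^2)"
 using assms by (auto simp: L4_integrable_def)
 have "sq_integrable M (%x. (norm (f x + g x))^2)"
 proof (rule sq_integrable_bound[OF sq_integrable_add[OF q]])
 show "(%x. (norm (f x + g x))^2) : borel_measurable M" by measurable
 have "norm ((norm (f x + g x))^2) <= 2 * norm ((norm (f x))^2 + (norm (g x))^2)" for x
 proof -
 have "(norm (f x + g x))^2 <= (norm (f x) + norm (g x))^2" by (intro power_mono norm_triangle_ineq) simp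
 also have "... <= 2 * ((norm (f x))^2 + (norm (g x))^2)"
 using sum_squares_bound[of "norm (f x)" "norm (g x)"] by (simp add: power2_sum)
 finally show ?thesis by simp
 qed
 thus "AE x in M. norm ((norm (f x + g x))^2) <= 2 * norm ((norm (f x))^2 + (norm (g x))^2)" by simp
 qed
 thus ?thesis by (simp add: L4_integrable_def)
qed

section \<open>Gradients\<close>

lemma matrix2_expand:
 "(A :: real^2^2) = (A$1$1) *R axis 1 (axis 1 1) + (A$1$2) *R axis 1 (axis 2 1) +
 (A$2$1) *R axis 2 (axis 1 1) + (A$2$2) *R axis 2 (axis 2 1)"
 by (simp add: vec_eq_iff forall_2 axis_def)

lemma borel_measurable_component:
 fixes f :: "'a => real^2"
 assumes "f : borel_measurable M" shows "(%x. f x $ i) : borel_measurable M"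
proof -
 have "(%x. f x \<bullet> axis i 1) : borel_measurable M" using assms by measurable
 thus ?thesis by (simp add: inner_axis)
qed

lemma Basis_real2: "(Basis :: (real^2) set) = {e1, e2}"
 by (auto simp: Basis_vec_def UNIV_2)

lemma e1_neq_e2: "e1 ~= e2"
 by (simp add: axis_eq_axis)

lemma axis_Basis: "axis j 1 : (Basis :: (real^2) set)"
 by (auto simp: Basis_vec_def)

lemma grad_AE:
 assumes "open S" "W12 S u D"
 shows "AE x in lebesgue_on S. grad S u x = (\<chi> i j. D (axis j 1) x $ i)"
proof -
 have "AE x in lebesgue_on S. weak_deriv S e1 u x = D e1 x" "AE x in lebesgue_on S. weak_deriv S e2 u x = D e2 x"
 using W12_AE[OF assms] axis_Basis by auto
 thus ?thesis by eventually_elim (simp add: grad_def vec_eq_iff forall_2)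
qed

lemma grad_sq_integrable:
 assumes "open S" "W12 S u D"
 shows "sq_integrable (lebesgue_on S) (grad S u)"
 and "(L2n (lebesgue_on S) (grad S u))^2 = (\<Sum>b\<in>Basis. (L2n (lebesgue_on S) (D b))^2)"
proof -
 let ?M = "lebesgue_on S"
 have W: "W12 S u (%b. weak_deriv S b u)" by (rule W12_weak_deriv[OF assms])
 have q: "sq_integrable ?M (weak_deriv S e1 u)" "sq_integrable ?M (weak_deriv S e2 u)"
 using W12_deriv_sq_integrable[OF W] axis_Basis by auto
 have n: "(norm (grad S u x))^2 = (norm (weak_deriv S e1 u x))^2 + (norm (weak_deriv S e2 u x))^2" for x
 unfolding power2_norm_eq_inner by (simp add: grad_def inner_vec_def sum_2)
 have m: "grad S u : borel_measurable ?M"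
 by (subst matrix2_expand[of "grad S u _", abs_def])
 (use borel_measurable_component[OF sq_integrable_measurable[OF q(1)]]
 borel_measurable_component[OF sq_integrable_measurable[OF q(2)]] in \<open>simp add: grad_def\<close>)
 have i: "integrable ?M (%x. (norm (weak_deriv S e1 u x))^2)" "integrable ?M (%x. (norm (weak_deriv S e2 u x))^2)"
 using q by (auto simp: sq_integrable_def)
 show "sq_integrable ?M (grad S u)" unfolding sq_integrable_def n using m i by simp
 have ae: "L2n ?M (weak_deriv S b u) = L2n ?M (D b)" if "b : Basis" for b
 using W12_AE[OF assms that] W12_deriv_sq_integrable[OF W that] W12_deriv_sq_integrable[OF assms(2) that]
 by (intro L2n_cong_AE) (auto simp: sq_integrable_def)
 show "(L2n ?M (grad S u))^2 = (\<Sum>b\<in>Basis. (L2n ?M (D b))^2)"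
 proof -
 have "(L2n ?M (grad S u))^2 = (L2n ?M (weak_deriv S e1 u))^2 + (L2n ?M (weak_deriv S e2 u))^2"
 unfolding L2n_sq n by (rule Bochner_Integration.integral_add[OF i])
 also have "... = (L2n ?M (D e1))^2 + (L2n ?M (D e2))^2"
 by (simp only: ae[OF axis_Basis])
 also have "... = (\<Sum>b\<in>Basis. (L2n ?M (D b))^2)"
 unfolding Basis_real2 using e1_neq_e2 by simp
 finally show ?thesis .
 qed
qed

lemma H1_W12: "u : H1 S ==> open S ==> W12 S u (%b. weak_deriv S b u)"
 using H1_iff W12_weak_deriv by blast

lemma H1_grad_sq_integrable: "open S ==> u : H1 S ==> sq_integrable (lebesgue_on S) (grad S u)"
 using H1_W12 grad_sq_integrable(1) by blast

lemma H1_sq_integrable: "u : H1 S ==> sq_integrable (lebesgue_on S) u"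
 using H1_iff W12_sq_integrable by blast

lemma H1_norm_grad:
 assumes "open S" "u : H1 S"
 shows "H1_norm S u = sqrt ((L2n (lebesgue_on S) u)^2 + (L2n (lebesgue_on S) (grad S u))^2)"
 using H1_norm_W12[OF assms(1) H1_W12[OF assms(2,1)]] grad_sq_integrable(2)[OF assms(1) H1_W12[OF assms(2,1)]] by simp

lemma L2n_grad_le_H1_norm:
 assumes "open S" "u : H1 S"
 shows "L2n (lebesgue_on S) (grad S u) <= H1_norm S u"
 unfolding H1_norm_grad[OF assms] by (rule real_le_rsqrt) simp

lemma H1_add: "u : H1 S ==> v : H1 S ==> (%x. u x + v x) : H1 S"
 unfolding H1_iff using W12_add by blast

lemma H1_diff: "u : H1 S ==> v : H1 S ==> (%x. u x - v x) : H1 S"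
 unfolding H1_iff using W12_diff by blast

lemma grad_add_AE:
 assumes "open S" "u : H1 S" "v : H1 S"
 shows "AE x in lebesgue_on S. grad S (%x. u x + v x) x = grad S u x + grad S v x"
 using grad_AE[OF assms(1) W12_add[OF H1_W12[OF assms(2,1)] H1_W12[OF assms(3,1)]]]
 by eventually_elim (simp add: grad_def vec_eq_iff)

lemma grad_diff_AE:
 assumes "open S" "u : H1 S" "v : H1 S"
 shows "AE x in lebesgue_on S. grad S (%x. u x - v x) x = grad S u x - grad S v x"
 using grad_AE[OF assms(1) W12_diff[OF H1_W12[OF assms(2,1)] H1_W12[OF assms(3,1)]]]
 by eventually_elim (simp add: grad_def vec_eq_iff)

lemma divergence_component: "divergence S u x = weak_deriv S e1 u x $ 1 + weak_deriv S e2 u x $ 2"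
 by (simp add: divergence_def trace_def grad_def sum_2)

lemma divergence_W12_AE:
 assumes "open S" "W12 S u D"
 shows "AE x in lebesgue_on S. divergence S u x = D e1 x $ 1 + D e2 x $ 2"
 using grad_AE[OF assms] by eventually_elim (simp add: divergence_def trace_def sum_2)

lemma H10_imp_H1: "z : H10 S ==> z : H1 S"
 by (simp add: H10_def)

lemma H10_diff_test:
 fixes ph :: "'a::euclidean_space => 'b::euclidean_space"
 assumes "open S" "bounded S" "z : H10 S" "ph : test_functions S"
 shows "(%x. z x - ph x) : H10 S"
proof -
 obtain f where f: "!!n. f n : test_functions S" "(%n. H1_norm S (%x. z x - f n x)) ----> 0"
 using assms(3) by (auto simp: H10_def)
 have "(%x. z x - ph x) : H1 S"
 by (rule H1_diff) (use H10_imp_H1 assms test_function_H10 in blast)+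
 moreover have "(%x. f n x - ph x) : test_functions S" for n by (intro test_functions_diff f assms)
 moreover have "(%n. H1_norm S (%x. z x - ph x - (f n x - ph x))) ----> 0" using f(2) by simp
 ultimately show ?thesis unfolding H10_def by (intro CollectI conjI exI[of _ "%n x. f n x - ph x"]) auto
qed

text \<open>The embedding into fourth-power integrable functions is read off from the positivity of
  \<open>S0\<close>, both qualitatively and with its constant.\<close>

lemma S0_bound:
 assumes S: "open S" "S0 S > 0" and z: "z : H10 S"
 shows "L4_integrable (lebesgue_on S) z"
 and "S0 S * (L4n (lebesgue_on S) z)^2 <= (L2n (lebesgue_on S) (grad S z))^2"
proof -
 let ?M = "lebesgue_on S"
 have Sl: "S : sets lebesgue" using S by simp
 have zm: "z : borel_measurable ?M"
 using H1_sq_integrable[OF H10_imp_H1[OF z]] by (rule sq_integrable_measurable)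
 have zm4: "(%x. norm (z x) ^ 4) : borel_measurable ?M" and zm2: "(%x. (norm (z x))^2) : borel_measurable ?M"
 using zm by measurable
 define I where "I = (LINT x|?M. norm (z x) ^ 4)"
 have sq4: "(norm ((norm (z x))^2))^2 = norm (z x) ^ 4" for x by simp
 have "L4_integrable ?M z & S0 S * (L4n ?M z)^2 <= (L2n ?M (grad S z))^2"
 proof (cases "AE x in ?M. z x = 0")
 case True
 hence ae: "AE x in ?M. norm (z x) ^ 4 = 0" by eventually_elim simp
 have ae': "AE x in ?M. 0 = norm (z x) ^ 4" using ae by eventually_elim (rule sym)
 have "integrable ?M (%x. norm (z x) ^ 4)"
 by (rule integrable_cong_AE_imp[OF integrable_zero zm4 ae'])
 hence "L4_integrable ?M z" using zm zm2 unfolding L4_integrable_def sq_integrable_def sq4 by blast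
 moreover have "I = 0" unfolding I_def by (rule integral_eq_zero_AE[OF ae])
 hence "(L4n ?M z)^2 = 0" unfolding L4n_sq L2n_def sq4 I_def by simp
 ultimately show ?thesis by simp
 next
 case False
 have Lp4: "(Lp_norm 4 S z)^2 = sqrt I"
 proof -
 have I0: "I >= 0" unfolding I_def by (rule integral_nonneg_AE) simp
 have "Lp_norm 4 S z = root (2 * 2) I" unfolding Lp_norm_def I_def LINT_lebesgue_on[OF Sl] by simp
 also have "... = sqrt (sqrt I)" unfolding sqrt_def by (rule real_root_mult_exp)
 finally show ?thesis using I0 by simp
 qed
 have "S0 S <= (Lp_norm 2 S (grad S z))^2 / (Lp_norm 4 S z)^2"
 unfolding S0_def
 proof (rule cINF_lower)
 show "bdd_below ((%u. (Lp_norm 2 S (grad S u))^2 / (Lp_norm 4 S u)^2) ` {u : H10 S. \<not> (AE x in ?M. u x = 0)})"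
 by (rule bdd_belowI[of _ 0]) auto
 qed (use z False in simp)
 hence le: "S0 S <= (L2n ?M (grad S z))^2 / sqrt I" unfolding Lp4 Lp_norm_2[OF Sl] .
 \<comment> \<open>If \<open>z\<close> were not fourth-power integrable, \<open>I\<close> would be 0
   by the convention for the integral, and the quotient would be 0 by the convention for division;
   this contradicts \<open>S0 S > 0\<close>. Integrability follows.\<close>
 hence "sqrt I ~= 0" using S(2) by auto
 hence "I ~= 0" by auto
 hence "integrable ?M (%x. norm (z x) ^ 4)" unfolding I_def by (metis not_integrable_integral_eq)
 hence q: "L4_integrable ?M z" using zm zm2 unfolding L4_integrable_def sq_integrable_def sq4 by blast
 have "I >= 0" unfolding I_def by (rule integral_nonneg_AE) simp
 with \<open>I ~= 0\<close> have "sqrt I > 0" by simp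
 with le have "S0 S * sqrt I <= (L2n ?M (grad S z))^2" by (simp add: pos_le_divide_eq)
 moreover have "(L4n ?M z)^2 = sqrt I" unfolding L4n_sq L2n_def sq4 I_def ..
 ultimately show ?thesis using q by simp
 qed
 thus "L4_integrable ?M z" "S0 S * (L4n ?M z)^2 <= (L2n ?M (grad S z))^2" by blast+
qed

lemma L4n_le_grad:
 assumes S: "open S" "S0 S > 0" and z: "z : H10 S"
 shows "L4n (lebesgue_on S) z <= L2n (lebesgue_on S) (grad S z) / sqrt (S0 S)"
proof (rule power2_le_imp_le)
 show "(L4n (lebesgue_on S) z)^2 <= (L2n (lebesgue_on S) (grad S z) / sqrt (S0 S))^2"
 using S0_bound(2)[OF assms] S(2) by (simp add: power_divide field_simps)
qed (use S(2) in simp)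

section \<open>Solenoidal fields and skew-symmetry of the convection term\<close>

lemma divergence_free_test:
 fixes ze :: "real^2 => real"
 assumes S: "open S" and u: "u : H1 S" and dv: "AE x in lebesgue_on S. divergence S u x = 0" and ze: "ze : test_functions S"
 shows "integrable (lebesgue_on S) (%x. fd ze x e1 * u x $ 1 + fd ze x e2 * u x $ 2)"
 and "(LINT x|lebesgue_on S. fd ze x e1 * u x $ 1 + fd ze x e2 * u x $ 2) = 0"
proof -
 let ?M = "lebesgue_on S"
 have Sl: "S : sets lebesgue" using S by simp
 have h: "has_weak_deriv S (axis j 1) (%x. u x $ i) (%x. weak_deriv S (axis j 1) u x $ i)" for i j
 by (rule has_weak_deriv_bounded_linear[OF bounded_linear_vec_nth W12_has_weak_deriv[OF H1_W12[OF u S] axis_Basis]])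
 have i1: "integrable ?M (%x. fd ze x b * u x $ i)" for b i
 proof -
 have "locally_integrable S (%x. u x $ i)" using h[of 1 i] by (simp add: has_weak_deriv_def)
 from set_integrable_test_function_scaleR[OF test_functions_frechet[OF ze] this]
 show ?thesis by (simp add: set_integrable_lebesgue_on[OF Sl])
 qed
 have i2: "integrable ?M (%x. ze x * weak_deriv S (axis j 1) u x $ i)" for i j
 proof -
 have "locally_integrable S (%x. weak_deriv S (axis j 1) u x $ i)" using h[of j i] by (simp add: has_weak_deriv_def)
 from set_integrable_test_function_scaleR[OF ze this]
 show ?thesis by (simp add: set_integrable_lebesgue_on[OF Sl])
 qed
 have e: "(LINT x|?M. fd ze x (axis j 1) * u x $ i) = - (LINT x|?M. ze x * weak_deriv S (axis j 1) u x $ i)" for i j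
 using h[of j i] ze unfolding has_weak_deriv_def by (simp add: LINT_lebesgue_on[OF Sl])
 show "integrable ?M (%x. fd ze x e1 * u x $ 1 + fd ze x e2 * u x $ 2)"
 by (intro Bochner_Integration.integrable_add i1)
 have "(LINT x|?M. fd ze x e1 * u x $ 1 + fd ze x e2 * u x $ 2) =
 - (LINT x|?M. ze x * weak_deriv S e1 u x $ 1) - (LINT x|?M. ze x * weak_deriv S e2 u x $ 2)"
 by (simp add: i1 e)
 also have "... = - (LINT x|?M. ze x * weak_deriv S e1 u x $ 1 + ze x * weak_deriv S e2 u x $ 2)"
 by (simp add: i2)
 also have "(LINT x|?M. ze x * weak_deriv S e1 u x $ 1 + ze x * weak_deriv S e2 u x $ 2) = 0"
 proof (rule integral_eq_zero_AE)
 show "AE x in ?M. ze x * weak_deriv S e1 u x $ 1 + ze x * weak_deriv S e2 u x $ 2 = 0"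
 using dv by eventually_elim (simp add: divergence_component flip: distrib_left)
 qed
 finally show "(LINT x|?M. fd ze x e1 * u x $ 1 + fd ze x e2 * u x $ 2) = 0" by simp
qed

text \<open>Twice the integrand is \<open>u\<close> applied to the gradient of
  \<open>ph \<bullet> ph\<close>, which is again a test function, and a divergence-free field is
  orthogonal to such gradients.\<close>

lemma convection_skew_test:
 assumes S: "open S" "bounded S" and u: "u : H1 S" and dv: "AE x in lebesgue_on S. divergence S u x = 0"
 and ph: "ph : test_functions S"
 shows "(LINT x|lebesgue_on S. (grad S ph x *v u x) \<bullet> ph x) = 0"
proof -
 let ?M = "lebesgue_on S"
 have Sl: "S : sets lebesgue" using S by simp
 have sm: "smooth ph" by (rule test_functions_smooth[OF ph])
 have W: "W12 S ph (%b x. fd ph x b)" by (rule W12_smooth[OF sm S(2) Sl])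
 define ze where "ze x = ph x \<bullet> ph x" for x
 have ze: "ze : test_functions S"
 unfolding ze_def[abs_def] by (rule test_functions_bilinear[OF ph bounded_bilinear_inner sm])
 have dze: "fd ze x b = 2 * (fd ph x b \<bullet> ph x)" for x b
 proof -
 note d = smooth_has_derivative[OF sm, of x]
 have "(ze has_derivative (%b. ph x \<bullet> fd ph x b + fd ph x b \<bullet> ph x)) (at x)"
 unfolding ze_def[abs_def] by (rule has_derivative_inner[OF d d])
 from fun_cong[OF frechet_derivative_at[OF this, symmetric], of b] show ?thesis by (simp add: inner_commute)
 qed
 have "AE x in ?M. 2 * ((grad S ph x *v u x) \<bullet> ph x) = fd ze x e1 * u x $ 1 + fd ze x e2 * u x $ 2"
 using grad_AE[OF S(1) W]
 proof eventually_elim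
 case (elim x)
 show ?case unfolding elim dze by (simp add: matrix_vector_mult_def inner_vec_def sum_2 algebra_simps)
 qed
 moreover have "(%x. 2 * ((grad S ph x *v u x) \<bullet> ph x)) : borel_measurable ?M"
 proof -
 have [measurable]: "grad S ph : borel_measurable ?M" "u : borel_measurable ?M" "ph : borel_measurable ?M"
 using grad_sq_integrable(1)[OF S(1) W] H1_sq_integrable[OF u] W12_sq_integrable[OF W]
 by (auto simp: sq_integrable_def)
 show ?thesis by measurable
 qed
 ultimately have "(LINT x|?M. 2 * ((grad S ph x *v u x) \<bullet> ph x)) = 0"
 using divergence_free_test[OF S(1) u dv ze]
 by (subst integral_cong_AE[where g="%x. fd ze x e1 * u x $ 1 + fd ze x e2 * u x $ 2"]) auto
 thus ?thesis by simp
qed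

text \<open>Density of the test functions in \<open>H10\<close>, with the errors controlled by
  \<open>trilinear_bound\<close>; the L4 norm of \<open>z - f n\<close> is controlled by its
  gradient through \<open>S0\<close>. The boundary term disappears because of \<open>z\<close>, so
  \<open>u\<close> may carry inhomogeneous data.\<close>

lemma convection_skew:
 assumes S: "open S" "bounded S" "S0 S > 0" and u: "u : H1 S" and dv: "AE x in lebesgue_on S. divergence S u x = 0"
 and u4: "L4_integrable (lebesgue_on S) u" and z: "z : H10 S"
 shows "(LINT x|lebesgue_on S. (grad S z x *v u x) \<bullet> z x) = 0"
proof -
 let ?M = "lebesgue_on S" and ?g = "grad S"
 obtain f where f: "!!n. f n : test_functions S" "(%n. H1_norm S (%x. z x - f n x)) ----> 0"
 using z by (auto simp: H10_def)
 have fH: "f n : H10 S" for n by (rule test_function_H10[OF f(1) S(1,2)])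
 have df: "(%x. z x - f n x) : H10 S" for n by (rule H10_diff_test[OF S(1,2) z f(1)])
 let ?h = "%n. H1_norm S (%x. z x - f n x)"
 let ?I = "\<integral>x. (?g z x *v u x) \<bullet> z x \<partial>?M"
 define k where "k = 1 / sqrt (S0 S)"
 have h0: "?h n >= 0" for n unfolding H1_norm_def by (intro real_sqrt_ge_zero add_nonneg_nonneg sum_nonneg) auto
 have gq: "sq_integrable ?M (?g v)" if "v : H10 S" for v by (rule H1_grad_sq_integrable[OF S(1) H10_imp_H1[OF that]])
 have bound: "(abs ?I) <= ?h n * (L4n ?M u * L4n ?M z) + (L2n ?M (?g z) + ?h n) * (L4n ?M u * (?h n * k))" for n
 proof -
 let ?d = "%x. z x - f n x"
 have gd: "AE x in ?M. ?g ?d x = ?g z x - ?g (f n) x"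
 by (rule grad_diff_AE[OF S(1) H10_imp_H1[OF z] H10_imp_H1[OF fH]])
 have d4: "L4_integrable ?M ?d" by (rule S0_bound(1)[OF S(1,3) df])
 have z4: "L4_integrable ?M z" by (rule S0_bound(1)[OF S(1,3) z])
 have f4: "L4_integrable ?M (f n)" by (rule S0_bound(1)[OF S(1,3) fH])
 note t1 = trilinear_bound[OF gq[OF df[of n]] u4 z4]
 note t2 = trilinear_bound[OF gq[OF fH[of n]] u4 d4]
 note t3 = trilinear_bound[OF gq[OF fH[of n]] u4 f4]
 note t4 = trilinear_bound[OF gq[OF z] u4 z4]
 have "?I = (LINT x|?M. (?g ?d x *v u x) \<bullet> z x + (?g (f n) x *v u x) \<bullet> ?d x + (?g (f n) x *v u x) \<bullet> f n x)"
 proof (rule integral_cong_AE)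
 show "AE x in ?M. (?g z x *v u x) \<bullet> z x = (?g ?d x *v u x) \<bullet> z x + (?g (f n) x *v u x) \<bullet> ?d x + (?g (f n) x *v u x) \<bullet> f n x"
 using gd by eventually_elim (simp add: matrix_vector_mult_diff_rdistrib inner_diff_left inner_diff_right)
 qed (use t1(1) t2(1) t3(1) t4(1) in auto)
 also have "... = (LINT x|?M. (?g ?d x *v u x) \<bullet> z x) + (LINT x|?M. (?g (f n) x *v u x) \<bullet> ?d x)"
 using t1(1) t2(1) t3(1) convection_skew_test[OF S(1,2) u dv f(1)] by simp
 finally have I: "(abs ?I) <= L2n ?M (?g ?d) * (L4n ?M u * L4n ?M z) + L2n ?M (?g (f n)) * (L4n ?M u * L4n ?M ?d)"
 using t1(2) t2(2) by linarith
 moreover have g1: "L2n ?M (?g ?d) <= ?h n" by (rule L2n_grad_le_H1_norm[OF S(1) H10_imp_H1[OF df]])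
 moreover have "L2n ?M (?g (f n)) <= L2n ?M (?g z) + ?h n"
 proof -
 have "L2n ?M (?g (f n)) = L2n ?M (%x. ?g z x - ?g ?d x)"
 by (rule L2n_cong_AE) (use gd gq[OF z] gq[OF df[of n]] gq[OF fH[of n]] in \<open>auto simp: sq_integrable_def\<close>)
 also have "... <= L2n ?M (?g z) + L2n ?M (?g ?d)" by (rule L2n_triangle_diff[OF gq[OF z] gq[OF df]])
 finally show ?thesis using g1 by linarith
 qed
 moreover have "L4n ?M ?d <= ?h n * k"
 proof -
 have "L4n ?M ?d <= L2n ?M (?g ?d) / sqrt (S0 S)" by (rule L4n_le_grad[OF S(1,3) df])
 also have "... <= ?h n / sqrt (S0 S)" using g1 S(3) by (intro divide_right_mono) auto
 finally show ?thesis by (simp add: k_def)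
 qed
 ultimately have "L2n ?M (?g ?d) * (L4n ?M u * L4n ?M z) + L2n ?M (?g (f n)) * (L4n ?M u * L4n ?M ?d)
 <= ?h n * (L4n ?M u * L4n ?M z) + (L2n ?M (?g z) + ?h n) * (L4n ?M u * (?h n * k))"
 using h0[of n] by (intro add_mono mult_mono) auto
 thus ?thesis using I by linarith
 qed
 have "(%n. ?h n * (L4n ?M u * L4n ?M z) + (L2n ?M (?g z) + ?h n) * (L4n ?M u * (?h n * k))) \<longlonglongrightarrow>
 0 * (L4n ?M u * L4n ?M z) + (L2n ?M (?g z) + 0) * (L4n ?M u * (0 * k))"
 by (intro tendsto_intros f(2))
 hence "(abs ?I) <= 0 * (L4n ?M u * L4n ?M z) + (L2n ?M (?g z) + 0) * (L4n ?M u * (0 * k))"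
 by (rule LIMSEQ_le_const) (use bound in blast)
 thus ?thesis by simp
qed

text \<open>The convection term of \<open>u'\<close> is expanded so that \<open>grad z\<close> keeps
  the full factor \<open>u'\<close> and drops out by \<open>convection_skew\<close>. All other terms
  contain \<open>w\<close>, apart from \<open>t * (y * y)\<close>, which comes from
  \<open>grad u0\<close> with \<open>z\<close> twice and is the one to be absorbed.\<close>

theorem energy_estimate:
 assumes S: "open S" "bounded S" "S0 S > 0"
 and u0: "u0 : H1 S" "L4_integrable (lebesgue_on S) u0"
 and u': "u' : H1 S" "AE x in lebesgue_on S. divergence S u' x = 0"
 and z: "z : H10 S" and w: "w : H1 S" "L4_integrable (lebesgue_on S) w"
 and eq: "!!x. u' x = u0 x + (z x + w x)"
 and weak0: "(LINT x|lebesgue_on S. grad S u0 x \<bullet> grad S z x) + (LINT x|lebesgue_on S. (grad S u0 x *v u0 x) \<bullet> z x) = 0"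
 and weak': "(LINT x|lebesgue_on S. grad S u' x \<bullet> grad S z x) + (LINT x|lebesgue_on S. (grad S u' x *v u' x) \<bullet> z x) = 0"
 defines "X \<equiv> L2n (lebesgue_on S) (grad S z)" and "a \<equiv> L2n (lebesgue_on S) (grad S w)"
 and "t \<equiv> L2n (lebesgue_on S) (grad S u0)"
 and "y \<equiv> L4n (lebesgue_on S) z" and "b \<equiv> L4n (lebesgue_on S) w" and "N \<equiv> L4n (lebesgue_on S) u0"
 shows "X\<^sup>2 <= a * X + a * (N * y) + a * (y * y) + a * (b * y) + t * (y * y) + t * (b * y)"
proof -
 let ?M = "lebesgue_on S" and ?g = "grad S"
 have z1: "z : H1 S" by (rule H10_imp_H1[OF z])
 have z4: "L4_integrable ?M z" by (rule S0_bound(1)[OF S(1,3) z])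
 have u'4: "L4_integrable ?M u'" unfolding eq[abs_def] by (intro L4_add u0 w z4)
 note G = H1_grad_sq_integrable[OF S(1)]
 have zw: "(%x. z x + w x) : H1 S" by (rule H1_add[OF z1 w(1)])
 have "AE x in ?M. ?g u' x = ?g u0 x + ?g (%x. z x + w x) x" unfolding eq[abs_def] by (rule grad_add_AE[OF S(1) u0(1) zw])
 moreover have "AE x in ?M. ?g (%x. z x + w x) x = ?g z x + ?g w x" by (rule grad_add_AE[OF S(1) z1 w(1)])
 ultimately have gu: "AE x in ?M. ?g u' x = ?g u0 x + (?g z x + ?g w x)" by eventually_elim simp
 note Tz = trilinear_bound[OF G[OF z1] u'4 z4]
 note T1 = trilinear_bound[OF G[OF w(1)] u0(2) z4]
 note T2 = trilinear_bound[OF G[OF w(1)] z4 z4]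
 note T3 = trilinear_bound[OF G[OF w(1)] w(2) z4]
 note T4 = trilinear_bound[OF G[OF u0(1)] z4 z4]
 note T5 = trilinear_bound[OF G[OF u0(1)] w(2) z4]
 note T6 = trilinear_bound[OF G[OF u0(1)] u0(2) z4]
 note T7 = trilinear_bound[OF G[OF u'(1)] u'4 z4]
 note I1 = L2_inner_bound[OF G[OF u0(1)] G[OF z1]]
 note I2 = L2_inner_bound[OF G[OF z1] G[OF z1]]
 note I3 = L2_inner_bound[OF G[OF w(1)] G[OF z1]]
 note I4 = L2_inner_bound[OF G[OF u'(1)] G[OF z1]]
 have "(LINT x|?M. ?g u' x \<bullet> ?g z x) = (LINT x|?M. ?g u0 x \<bullet> ?g z x + (?g z x \<bullet> ?g z x + ?g w x \<bullet> ?g z x))"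
 by (rule integral_cong_AE) (use gu I1(1) I2(1) I3(1) I4(1) in \<open>auto simp: inner_add_left\<close>)
 hence e1: "(LINT x|?M. ?g u' x \<bullet> ?g z x) = (LINT x|?M. ?g u0 x \<bullet> ?g z x) + ((LINT x|?M. ?g z x \<bullet> ?g z x) + (LINT x|?M. ?g w x \<bullet> ?g z x))"
 using I1(1) I2(1) I3(1) by simp
 have "(LINT x|?M. (?g u' x *v u' x) \<bullet> z x) = (LINT x|?M. (?g u0 x *v u0 x) \<bullet> z x + ((?g z x *v u' x) \<bullet> z x + ((?g w x *v u0 x) \<bullet> z x
 + ((?g w x *v z x) \<bullet> z x + ((?g w x *v w x) \<bullet> z x + ((?g u0 x *v z x) \<bullet> z x + (?g u0 x *v w x) \<bullet> z x))))))"
 proof (rule integral_cong_AE)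
 show "AE x in ?M. (?g u' x *v u' x) \<bullet> z x = (?g u0 x *v u0 x) \<bullet> z x + ((?g z x *v u' x) \<bullet> z x + ((?g w x *v u0 x) \<bullet> z x
 + ((?g w x *v z x) \<bullet> z x + ((?g w x *v w x) \<bullet> z x + ((?g u0 x *v z x) \<bullet> z x + (?g u0 x *v w x) \<bullet> z x)))))"
 using gu by eventually_elim
 (simp add: eq matrix_vector_mult_add_rdistrib matrix_vector_right_distrib inner_add_left)
 qed (use Tz(1) T1(1) T2(1) T3(1) T4(1) T5(1) T6(1) T7(1) in auto)
 hence e2: "(LINT x|?M. (?g u' x *v u' x) \<bullet> z x) = (LINT x|?M. (?g u0 x *v u0 x) \<bullet> z x) + ((LINT x|?M. (?g z x *v u' x) \<bullet> z x)
 + ((LINT x|?M. (?g w x *v u0 x) \<bullet> z x) + ((LINT x|?M. (?g w x *v z x) \<bullet> z x) + ((LINT x|?M. (?g w x *v w x) \<bullet> z x)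
 + ((LINT x|?M. (?g u0 x *v z x) \<bullet> z x) + (LINT x|?M. (?g u0 x *v w x) \<bullet> z x))))))"
 using Tz(1) T1(1) T2(1) T3(1) T4(1) T5(1) T6(1) by simp
 have skew: "(LINT x|?M. (?g z x *v u' x) \<bullet> z x) = 0" by (rule convection_skew[OF S u' u'4 z])
 have X: "(LINT x|?M. ?g z x \<bullet> ?g z x) = X\<^sup>2" unfolding X_def L2n_sq by (simp add: power2_norm_eq_inner)
 show ?thesis
 using weak0 weak' e1 e2 skew X T1(2) T2(2) T3(2) T4(2) T5(2) I3(2)
 unfolding X_def[symmetric] a_def[symmetric] t_def[symmetric] y_def[symmetric] b_def[symmetric] N_def[symmetric]
 by linarith
qed

text \<open>With \<open>y <= k * X\<close> the dangerous term is at most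
  \<open>t * k^2 * X^2\<close>, which leaves the fraction \<open>th = 1 - t * k^2\<close> of the
  left side. Half of it absorbs the quadratic term with the small factor \<open>a\<close>; the other
  half yields \<open>X <= et\<close> after division by \<open>X\<close>.\<close>

lemma small_energy:
 fixes k t N et :: real
 assumes "k >= 0" "t >= 0" "N >= 0" "t * k\<^sup>2 < 1" "et > 0"
 obtains de where "de > 0" "de <= et"
 "!!X y a b. 0 <= X ==> 0 <= y ==> 0 <= a ==> 0 <= b ==> a <= de ==> b <= de ==> y <= k * X ==>
 X\<^sup>2 <= a * X + a * (N * y) + a * (y * y) + a * (b * y) + t * (y * y) + t * (b * y) ==> X <= et"
proof -
 define th where "th = 1 - t * k\<^sup>2"
 have th: "th > 0" using assms by (simp add: th_def)
 \<comment> \<open>Sum of the coefficients of \<open>de * X\<close> in the terms that are linear in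
   \<open>X\<close>; the third summand uses \<open>b <= 1\<close>.\<close>
 define P where "P = 1 + N * k + k + t * k"
 have P: "P > 0" unfolding P_def using assms by (intro add_pos_nonneg) auto
 define de where "de = min (min 1 et) (min (th / (2 * (k\<^sup>2 + 1))) (th * et / (2 * P)))"
 have k1: "k\<^sup>2 + 1 > 0" by (intro add_nonneg_pos) auto
 have de: "de > 0" unfolding de_def using assms th P k1 by simp
 have de1: "de <= 1" and deet: "de <= et" unfolding de_def by linarith+
 have "de <= th / (2 * (k\<^sup>2 + 1))" "de <= th * et / (2 * P)" unfolding de_def by linarith+
 hence de2: "de * (k\<^sup>2 + 1) <= th / 2" and de3: "de * P <= th * et / 2" using k1 P by (simp_all add: field_simps)
 show ?thesis
 proof (rule that[OF de deet])
 fix X y a b :: real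
 assume h: "0 <= X" "0 <= y" "0 <= a" "0 <= b" "a <= de" "b <= de" "y <= k * X"
 and le: "X\<^sup>2 <= a * X + a * (N * y) + a * (y * y) + a * (b * y) + t * (y * y) + t * (b * y)"
 have kX: "0 <= k * X" using assms h by simp
 have yy: "y * y <= (k * X) * (k * X)" using h kX by (intro mult_mono) auto
 have "a * X <= de * X" using h by (intro mult_right_mono) auto
 moreover have "a * (N * y) <= de * (N * (k * X))" using h assms de by (intro mult_mono mult_left_mono) auto
 moreover have "a * (y * y) <= de * ((k * X) * (k * X))" using h yy de by (intro mult_mono) auto
 moreover have "a * (b * y) <= de * (1 * (k * X))" using h de de1 kX by (intro mult_mono) auto
 moreover have "t * (y * y) <= t * ((k * X) * (k * X))" using yy assms by (intro mult_left_mono) auto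
 moreover have "t * (b * y) <= t * (de * (k * X))" using h assms de by (intro mult_left_mono mult_mono) auto
 ultimately have "X\<^sup>2 <= de * X + de * (N * (k * X)) + de * ((k * X) * (k * X)) + de * (1 * (k * X)) + t * ((k * X) * (k * X)) + t * (de * (k * X))"
 using le by linarith
 also have "... = X * (de * P) + X\<^sup>2 * (t * k\<^sup>2) + X\<^sup>2 * (de * k\<^sup>2)"
 unfolding P_def by (simp add: algebra_simps power2_eq_square)
 also have "... <= X * (th * et / 2) + X\<^sup>2 * (t * k\<^sup>2) + X\<^sup>2 * (th / 2)"
 proof -
 have "de * k\<^sup>2 <= th / 2" using de2 de by (simp add: distrib_left)
 thus ?thesis using de3 h by (intro add_mono mult_left_mono order_refl) auto
 qed
 finally have "X\<^sup>2 <= X * (th * et / 2) + X\<^sup>2 * (t * k\<^sup>2) + X\<^sup>2 * (th / 2)" .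
 moreover have "X\<^sup>2 - X\<^sup>2 * (t * k\<^sup>2) = X\<^sup>2 * (th / 2) + X\<^sup>2 * (th / 2)"
 by (simp add: th_def algebra_simps flip: distrib_left)
 moreover have "X * (th * et / 2) = X * (et * (th / 2))" by simp
 ultimately have "X\<^sup>2 * (th / 2) <= X * (et * (th / 2))" by linarith
 hence "(X * X) * (th / 2) <= (X * et) * (th / 2)" by (simp add: power2_eq_square mult.assoc)
 hence "X * X <= X * et" by (rule mult_right_le_imp_le) (use th in simp)
 thus "X <= et" using h(1) assms(5) by (cases "X = 0") auto
 qed
qed

section \<open>Extension of the boundary data\<close>

lemma profile_left:
 assumes "profile H G V g" "H > 0" shows "V (-H) = 0"
proof -
 have "V (-H) = (LINT t:{-H}|lebesgue. g t)" using assms by (simp add: profile_def)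
 also have "... = 0"
 unfolding set_lebesgue_integral_def
 proof (rule integral_eq_zero_AE)
 have "AE t in lebesgue. t ~= -H" using AE_completion[OF AE_lborel_singleton[of "-H"]] by simp
 thus "AE t in lebesgue. indicat_real {-H} t *R g t = 0" by eventually_elim simp
 qed
 finally show ?thesis .
qed

lemma primitive_right:
 assumes "profile H G V g" "H > 0" shows "primitive H V H = (LINT t:{-H<..<H}|lebesgue. V t)"
proof -
 have i: "set_integrable lebesgue {-H..H} V" using profile_set_integrable[OF assms(1)] assms(2) by simp
 have j: "set_integrable lebesgue {-H<..<H} V" by (rule set_integrable_subset[OF i]) auto
 show ?thesis
 unfolding primitive_def set_lebesgue_integral_eq_integral(2)[OF i] set_lebesgue_integral_eq_integral(2)[OF j]
 by (rule integral_open_interval_real)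
qed

text \<open>A fixed point of the open channel lies outside the strips once they are thin enough, so
  dominated convergence applies to their indicators.\<close>

lemma thin_sides:
 assumes S: "open S" "S <= channel L H" and e: "e > 0" "ta0 > 0"
 obtains ta where "0 < ta" "ta < ta0" "L2n (lebesgue_on S) (indicat_real {x. x$1 < -L + ta \<or> x$1 > L - ta}) < e"
proof -
 let ?M = "lebesgue_on S"
 have Sl: "S : sets lebesgue" using S by simp
 have fin: "finite_measure ?M" by (rule finite_measure_bounded_lebesgue_on[OF bounded_subset[OF bounded_channel S(2)] Sl])
 define ta where "ta n = ta0 / (real n + 2)" for n
 have t: "0 < ta n" "ta n < ta0" for n unfolding ta_def using e(2) by (simp_all add: divide_less_eq)
 let ?A = "%n. {x::real^2. x$1 < -L + ta n \<or> x$1 > L - ta n}"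
 have op: "open (?A n)" for n by (intro open_Collect_disj open_Collect_less continuous_intros)
 have m: "indicat_real (?A n) : borel_measurable ?M" for n
 by (intro measurable_restrict_space1 borel_measurable_indicator open_sets_lebesgue op)
 have tl: "ta ----> 0" unfolding ta_def by real_asymp
 have "(%n. L2n ?M (indicat_real (?A n))) ----> 0"
 proof (rule tendsto_L2n_dominated[OF m])
 show "sq_integrable ?M (%x. 1::real)" by (rule sq_integrable_bounded(1)[OF fin, of _ 1]) auto
 show "AE x in ?M. norm (indicat_real (?A n) x) <= norm (1::real)" for n by (simp add: indicator_def)
 show "AE x in ?M. (%n. indicat_real (?A n) x) ----> 0"
 proof (rule AE_I2)
 fix x assume "x : space ?M"
 hence "x : channel L H" using S by (auto simp: space_restrict_space)
 hence d: "x$1 + L > 0" "L - x$1 > 0" by (auto simp: channel_def)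
 have "\<forall>\<^sub>F n in sequentially. ta n < x$1 + L & ta n < L - x$1"
 using order_tendstoD(2)[OF tl d(1)] order_tendstoD(2)[OF tl d(2)] by eventually_elim simp
 hence "\<forall>\<^sub>F n in sequentially. indicat_real (?A n) x = 0" by eventually_elim auto
 thus "(%n. indicat_real (?A n) x) ----> 0" by (rule tendsto_eventually)
 qed
 qed
 from order_tendstoD(2)[OF this e(1)] obtain n where "L2n ?M (indicat_real (?A n)) < e"
 by (auto simp: eventually_sequentially)
 thus ?thesis using that t by blast
qed

lemma dd_const [simp]: "dd (%t. c) t = 0"
 by (rule dd_eqI) auto

lemma H1_norm_tendsto_add:
 fixes f g :: "nat => real^2 => real^2"
 assumes "open S" "!!n. W12 S (f n) (D n)" "!!n. W12 S (g n) (E n)"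
 "(%n. H1_norm S (f n)) ----> 0" "(%n. H1_norm S (g n)) ----> 0"
 shows "(%n. H1_norm S (%x. f n x + g n x)) ----> 0"
proof (rule tendsto_sandwich[OF _ _ tendsto_const])
 have "(%n. (1 + real DIM(real^2)) * (H1_norm S (f n) + H1_norm S (g n))) ----> (1 + real DIM(real^2)) * (0 + 0)"
 by (intro tendsto_intros assms(4,5))
 thus "(%n. (1 + real DIM(real^2)) * (H1_norm S (f n) + H1_norm S (g n))) ----> 0" by simp
 show "\<forall>\<^sub>F n in sequentially. H1_norm S (%x. f n x + g n x) <= (1 + real DIM(real^2)) * (H1_norm S (f n) + H1_norm S (g n))"
 using H1_norm_triangle[OF assms(1-3)] by (intro always_eventually allI)
 show "\<forall>\<^sub>F n in sequentially. 0 <= H1_norm S (%x. f n x + g n x)"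
 unfolding H1_norm_def by (intro always_eventually allI real_sqrt_ge_zero add_nonneg_nonneg sum_nonneg) auto
qed

text \<open>Modelled on the difference of two boundary data with parameters \<open>lam'\<close> and
  \<open>lam\<close>: \<open>c\<close> stands for \<open>lam' - lam\<close>, which is the common
  flux and also scales the value on the top. \<open>G\<close> only bounds the densities, while
  \<open>s\<close> is the quantity that will be small.\<close>

definition boundary_profiles :: "real => real => real => real => real => (real => real) => (real => real) => bool" where
 "boundary_profiles H G U s c Vin Vout \<longleftrightarrow> (\<forall>V\<in>{Vin, Vout}. (\<exists>g. profile H G V g) & V H = c * U &
 (LINT y:{-H<..<H}|lebesgue. V y) = c & (\<forall>y\<in>{-H..H}. (abs (V y)) <= s))"

text \<open>The bounds on the field and on its derivatives differ by \<open>et\<close>, which pays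
  for the density of the profiles on the thin strips. The approximants \<open>v\<close> vanish on a
  box around the body, and with their uniform convergence they serve to identify the trace of
  \<open>w\<close>.\<close>

definition extendable :: "(real^2) set => real => real => real => real => real => real => real => (real => real) => (real => real) => bool" where
 "extendable S L H a0 b0 k et V0 Vin Vout \<longleftrightarrow> (\<exists>w D v. W12 S w D & (\<forall>x\<in>crect L H. norm (w x) <= k) &
 (\<forall>b\<in>Basis. L2n (lebesgue_on S) (D b) <= k + et) & (\<forall>x. D e1 x $ 1 + D e2 x $ 2 = 0) &
 (\<forall>n::nat. smooth (v n)) & (%n. H1_norm S (%x. w x - v n x)) ----> 0 &
 uniform_limit (crect L H) v w sequentially &
 (\<forall>n x. (abs (x$1)) < a0 & (abs (x$2)) < b0 --> v n x = 0) &
 (\<forall>x\<in>side_b L H. w x = 0) & (\<forall>x\<in>side_t L H. w x = V0 *R e1) &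
 (\<forall>x\<in>side_l L H. w x = Vin (x$2) *R e1) & (\<forall>x\<in>side_r L H. w x = Vout (x$2) *R e1))"

text \<open>The field is the parallel flow \<open>c * m\<close> plus one correction per vertical
  side with profile \<open>V - c * m\<close>. The corrections have zero flux and vanish at both
  ends, so their stream functions do not disturb bottom and top. Their derivatives are of order
  \<open>s\<close> except for the density, which lives on the strips.\<close>

lemma solenoidal_extension:
 assumes LH: "0 < a0" "a0 < L" "0 < b0" "b0 < H" and S: "open S" "S <= channel L H" and G: "G >= 0" and et: "et > 0"
 obtains K where "K >= 0"
 "!!Vin Vout c s. boundary_profiles H G U s c Vin Vout ==> extendable S L H a0 b0 (K * s) et (c * U) Vin Vout"
proof -
 let ?M = "lebesgue_on S"
 have L: "L > 0" and H: "H > 0" using LH by auto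
 have Sl: "S : sets lebesgue" using S by simp
 have Sb: "bounded S" using bounded_subset[OF bounded_channel S(2)] .
 have Sc: "S <= crect L H" using S(2) channel_subset_crect by blast
 have fin: "finite_measure ?M" by (rule finite_measure_bounded_lebesgue_on[OF Sb Sl])
 define h where "h = (H - b0) / 2"
 have h: "h > 0" using LH by (simp add: h_def)
 \<comment> \<open>Stream function of the parallel flow for unit flux: \<open>M\<close> rises from 0
   to 1 with slope \<open>U\<close> at \<open>H\<close>, and it is 0 below height \<open>b0\<close>,
   so the flow passes above the body.\<close>
 define M where "M t = step ((t - b0) / h) * (1 + U * (t - H))" for t
 define m where "m = dd M"
 have Ms: "smooth M" unfolding M_def[abs_def]
 by (intro smooth_mult smooth_step_scaled smooth_add smooth_const smooth_diff smooth_ident)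
 have ms: "smooth m" unfolding m_def by (rule smooth_dd[OF Ms])
 have dM: "(M has_real_derivative m t) (at t)" for t unfolding m_def by (rule smooth_has_real_derivative[OF Ms])
 have dm: "(m has_real_derivative dd m t) (at t)" for t by (rule smooth_has_real_derivative[OF ms])
 have m0: "m t = 0" if "t < b0" for t
 unfolding m_def
 proof (rule dd_local[of "{..<b0}" t M "%t. 0"])
 show "M s = 0" if "s : {..<b0}" for s using that h by (simp add: M_def divide_le_0_iff)
 qed (use that in auto)
 have mH: "m H = U"
 unfolding m_def
 proof (rule dd_local[of "{(H + b0) / 2<..}" H M "%t. 1 + U * (t - H)"])
 show "M s = 1 + U * (s - H)" if "s : {(H + b0) / 2<..}" for s
 proof -
 have "(s - b0) / h >= 1" using that h by (simp add: h_def field_simps)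
 thus ?thesis by (simp add: M_def)
 qed
 show "((%t. 1 + U * (t - H)) has_real_derivative U) (at H)" by (auto intro!: derivative_eq_intros)
 qed (use LH in auto)
 have MH: "M H = 1" "M (-H) = 0"
 proof -
 have "(H - b0) / h >= 1" using LH by (simp add: h_def)
 thus "M H = 1" by (simp add: M_def)
 have "(-H - b0) / h <= 0" using LH h by (intro divide_nonpos_pos) auto
 thus "M (-H) = 0" by (simp add: M_def)
 qed
 have mH': "m (-H) = 0" by (rule m0) (use LH in simp)
 obtain Gm gm where gm: "profile H Gm m gm" by (rule profile_smooth[OF ms mH']) blast
 have Gm0: "Gm >= 0" using gm abs_ge_zero order_trans unfolding profile_def by blast
 obtain m1 where m1: "m1 >= 0" "!!t. t : {-H..H} ==> (abs (m t)) <= m1" using bounded_on_interval[OF ms] by metis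
 obtain m2 where m2: "m2 >= 0" "!!t. t : {-H..H} ==> (abs (dd m t)) <= m2" using bounded_on_interval[OF smooth_dd[OF ms]] by metis
 \<comment> \<open>Ensures \<open>2 * G * e <= et\<close>. The strip width \<open>ta\<close> is
   derived from \<open>e\<close>, and all constants that contain \<open>ta\<close> end up in
   \<open>K\<close>.\<close>
 define e where "e = et / (2 * (G + 1))"
 have e: "e > 0" using et G by (simp add: e_def)
 obtain ta where ta: "0 < ta" "ta < L - a0" and Le: "L2n ?M (indicat_real {x. x$1 < -L + ta \<or> x$1 > L - ta}) < e"
 using thin_sides[OF S e, of "L - a0"] LH by auto
 define io :: "real^2 => real" where "io = indicat_real {x. x$1 < -L + ta \<or> x$1 > L - ta}"
 \<comment> \<open>The transitions happen strictly inside the strips, and \<open>l\<close>,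
   \<open>r\<close> are constant near the sides. On the sides the second component, which contains
   \<open>dd l\<close> or \<open>dd r\<close>, is therefore 0 and the first one is the prescribed
   profile.\<close>
 define l where "l t = 1 - step ((t - (-L + ta/4)) / (ta/2))" for t
 define r where "r t = step ((t - (L - 3*ta/4)) / (ta/2))" for t
 have sm: "smooth l" "smooth r" unfolding l_def[abs_def] r_def[abs_def]
 by (intro smooth_diff smooth_const smooth_step_scaled)+
 have l1: "l t = 1" if "t < -L + ta/4" for t
 proof -
 have "(t - (-L + ta/4)) / (ta/2) <= 0" using that ta by (intro divide_nonpos_pos) auto
 thus ?thesis by (simp only: l_def step_le_0 diff_zero)
 qed
 have l0: "l t = 0" if "t > -L + 3*ta/4" for t
 proof -
 have "(t - (-L + ta/4)) / (ta/2) >= 1" using that ta by (simp add: field_simps)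
 thus ?thesis by (simp only: l_def step_ge_1 diff_self)
 qed
 have r0: "r t = 0" if "t < L - 3*ta/4" for t
 proof -
 have "(t - (L - 3*ta/4)) / (ta/2) <= 0" using that ta by (intro divide_nonpos_pos) auto
 thus ?thesis by (simp only: r_def step_le_0)
 qed
 have r1: "r t = 1" if "t > L - ta/4" for t
 proof -
 have "(t - (L - 3*ta/4)) / (ta/2) >= 1" using that ta by (simp add: field_simps)
 thus ?thesis by (simp only: r_def step_ge_1)
 qed
 have dl1: "dd l t = 0" if "t < -L + ta/4" for t
 by (rule dd_local[of "{..< -L + ta/4}" t l "%t. 1"]) (use that l1 in auto)
 have dl0: "dd l t = 0" if "t > -L + 3*ta/4" for t
 by (rule dd_local[of "{-L + 3*ta/4<..}" t l "%t. 0"]) (use that l0 in auto)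
 have dr0: "dd r t = 0" if "t < L - 3*ta/4" for t
 by (rule dd_local[of "{..< L - 3*ta/4}" t r "%t. 0"]) (use that r0 in auto)
 have dr1: "dd r t = 0" if "t > L - ta/4" for t
 by (rule dd_local[of "{L - ta/4<..}" t r "%t. 1"]) (use that r1 in auto)
 have lbl: "(abs (l t)) <= 1" for t
 unfolding l_def using step_bounds[of "(t - (-L + ta/4)) / (ta/2)"] by linarith
 have lbr: "(abs (r t)) <= 1" for t
 unfolding r_def using step_bounds[of "(t - (L - 3*ta/4)) / (ta/2)"] by linarith
 note lb = lbl lbr
 have io0: "io x >= 0" for x by (simp add: io_def)
 have lio1: "(abs (l (x$1))) <= io x" for x
 proof (cases "x$1 < -L + ta")
 case True
 thus ?thesis using lbl[of "x$1"] by (simp add: io_def)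
 next
 case False
 hence "l (x$1) = 0" using ta(1) by (intro l0) simp
 thus ?thesis using io0 by simp
 qed
 have lio2: "(abs (r (x$1))) <= io x" for x
 proof (cases "x$1 > L - ta")
 case True
 thus ?thesis using lbr[of "x$1"] by (simp add: io_def)
 next
 case False
 hence "r (x$1) = 0" using ta(1) by (intro r0) simp
 thus ?thesis using io0 by simp
 qed
 note lio = lio1 lio2
 obtain Al where Al: "Al >= 0" "!!t. t : {-L..L} ==> (abs (dd l t)) <= Al" using bounded_on_interval[OF smooth_dd[OF sm(1)]] by metis
 obtain Ar where Ar: "Ar >= 0" "!!t. t : {-L..L} ==> (abs (dd r t)) <= Ar" using bounded_on_interval[OF smooth_dd[OF sm(2)]] by metis
 obtain Bl where Bl: "Bl >= 0" "!!t. t : {-L..L} ==> (abs (dd (dd l) t)) <= Bl" using bounded_on_interval[OF smooth_dd[OF smooth_dd[OF sm(1)]]] by metis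
 obtain Br where Br: "Br >= 0" "!!t. t : {-L..L} ==> (abs (dd (dd r) t)) <= Br" using bounded_on_interval[OF smooth_dd[OF smooth_dd[OF sm(2)]]] by metis
 define ka where "ka = 1 + 2 * H * m1"
 have ka: "ka >= 0" using H m1 by (simp add: ka_def)
 define mu where "mu = L2n ?M (%x. 1::real)"
 define Kw where "Kw = 2 * H * m1 + (ka + Al * (2 * H * ka)) + (ka + Ar * (2 * H * ka))"
 define C where "C = 2 * H * m2 + (2 * (Al * ka) + Bl * (2 * H * ka)) + (2 * (Ar * ka) + Br * (2 * H * ka))"
 \<comment> \<open>\<open>Kw\<close> serves the supremum of the field, \<open>C * mu\<close> the
   derivative terms without a density, and \<open>4 * H * Gm * e\<close> the part of the density
   bound \<open>G1\<close> that is proportional to \<open>s\<close>; the other part contributes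
   \<open>2 * G * e <= et\<close>.\<close>
 define K where "K = Kw + C * mu + 4 * H * Gm * e"
 have Kw0: "Kw >= 0" unfolding Kw_def using H m1 ka Al Ar by simp
 have C0: "C >= 0" unfolding C_def using H m2 ka Al Ar Bl Br by simp
 have mu0: "mu >= 0" by (simp add: mu_def)
 have K0: "K >= 0" unfolding K_def using Kw0 C0 mu0 H Gm0 e by simp
 have inc: "x$1 : {-L..L}" "x$2 : {-H..H}" if "x : crect L H" for x using that by (auto simp: crect_def)
 show ?thesis
 proof (rule that[OF K0])
 fix Vin Vout :: "real => real" and c s :: real
 assume data: "boundary_profiles H G U s c Vin Vout"
 obtain gin gout where pin: "profile H G Vin gin" and pout: "profile H G Vout gout" using data unfolding boundary_profiles_def by blast
 have VH: "Vin H = c * U" "Vout H = c * U"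
 and int: "(LINT y:{-H<..<H}|lebesgue. Vin y) = c" "(LINT y:{-H<..<H}|lebesgue. Vout y) = c"
 and sup': "\<forall>y\<in>{-H..H}. (abs (Vin y)) <= s" "\<forall>y\<in>{-H..H}. (abs (Vout y)) <= s"
 using data unfolding boundary_profiles_def by blast+
 have sup: "!!y. y : {-H..H} ==> (abs (Vin y)) <= s" "!!y. y : {-H..H} ==> (abs (Vout y)) <= s" using sup' by auto
 have s0: "s >= 0" using sup(1)[of 0] H by auto
 \<comment> \<open>The flux is an integral of the data and thus controlled by their supremum, so
   everything that stems from the parallel flow is of order \<open>s\<close>.\<close>
 have c: "(abs c) <= 2 * H * s" using primitive_bound[OF pin H sup(1), of H] primitive_right[OF pin H] int H by simp
 define G1 where "G1 = G + 2 * H * s * Gm"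
 have G10: "G1 >= 0" unfolding G1_def using G H s0 Gm0 by simp
 \<comment> \<open>The correction profile vanishes at both ends and has zero flux, so its primitive
   vanishes at both ends as well. The factor \<open>1\<close> only matches the form of
   \<open>profile_diff\<close>.\<close>
 have side: "\<exists>g1. profile H ((abs 1) * G + (abs c) * Gm) (%y. 1 * V y - c * m y) g1 & (\<forall>y. (abs (g1 y)) <= G1) &
 1 * V H - c * m H = 0 & 1 * V (-H) - c * m (-H) = 0 & primitive H (%y. 1 * V y - c * m y) H = 0 & primitive H (%y. 1 * V y - c * m y) (-H) = 0 &
 (\<forall>y\<in>{-H..H}. (abs (1 * V y - c * m y)) <= ka * s) & (\<forall>y\<in>{-H..H}. (abs (primitive H (%y. 1 * V y - c * m y) y)) <= 2 * H * (ka * s))"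
 if V: "profile H G V g" "V H = c * U" "(LINT y:{-H<..<H}|lebesgue. V y) = c" "!!y. y : {-H..H} ==> (abs (V y)) <= s" for V g
 proof -
 let ?W = "%y. 1 * V y - c * m y" and ?g = "%y. 1 * g y - c * gm y"
 have p: "profile H ((abs 1) * G + (abs c) * Gm) ?W ?g" by (rule profile_diff[OF V(1) gm])
 have cG: "(abs c) * Gm <= 2 * H * s * Gm" using c Gm0 by (intro mult_right_mono) auto
 have gb: "(abs (?g y)) <= G1" for y
 proof -
 have "(abs (?g y)) <= (abs 1) * G + (abs c) * Gm" using p unfolding profile_def by blast
 thus ?thesis using cG by (simp add: G1_def)
 qed
 have Wb: "(abs (?W y)) <= ka * s" if "y : {-H..H}" for y
 proof -
 have "(abs (c * m y)) <= (2 * H * s) * m1" unfolding abs_mult using c m1(2)[OF that] m1(1) by (intro mult_mono) auto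
 hence "(abs (?W y)) <= s + (2 * H * s) * m1" using V(4)[OF that] by linarith
 also have "... = ka * s" by (simp add: ka_def algebra_simps)
 finally show ?thesis .
 qed
 have pl: "?W (-H) = 0" by (rule profile_left[OF p H])
 have i1: "set_integrable lebesgue {-H..H} V" using profile_set_integrable[OF V(1), of H] H by simp
 have i2: "set_integrable lebesgue {-H..H} m" using profile_set_integrable[OF gm, of H] H by simp
 have "primitive H ?W H = (LINT t:{-H..H}|lebesgue. V t) - c * (LINT t:{-H..H}|lebesgue. m t)"
 unfolding primitive_def using i1 i2 by (simp add: set_integral_diff(2))
 also have "(LINT t:{-H..H}|lebesgue. m t) = M H - M (-H)"
 by (rule integral_FTC_lebesgue[OF dM smooth_continuous_on[OF ms]]) (use H in simp)
 also have "(LINT t:{-H..H}|lebesgue. V t) = c" using primitive_right[OF V(1) H] V(3) by (simp add: primitive_def)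
 finally have pr: "primitive H ?W H = 0" using MH by simp
 have "(abs (primitive H ?W (-H))) <= 0"
 proof -
 have "primitive H ?W (-H) = 0"
 unfolding primitive_def set_lebesgue_integral_def
 proof (rule integral_eq_zero_AE)
 have "AE t in lebesgue. t ~= -H" using AE_completion[OF AE_lborel_singleton[of "-H"]] by simp
 thus "AE t in lebesgue. indicat_real {-H..-H} t *R ?W t = 0" by eventually_elim simp
 qed
 thus ?thesis by simp
 qed
 hence prl: "primitive H ?W (-H) = 0" by simp
 have "?W H = 0" using V(2) mH by simp
 thus ?thesis using p gb Wb pl pr prl primitive_bound[OF p H Wb] by blast
 qed
 define Vl where "Vl y = 1 * Vin y - c * m y" for y
 define Vr where "Vr y = 1 * Vout y - c * m y" for y
 define Fl where "Fl = primitive H Vl"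
 define Fr where "Fr = primitive H Vr"
 obtain gl where gl: "profile H ((abs 1) * G + (abs c) * Gm) Vl gl" "!!y. (abs (gl y)) <= G1" "Vl H = 0" "Vl (-H) = 0" "Fl H = 0" "Fl (-H) = 0"
 "!!y. y : {-H..H} ==> (abs (Vl y)) <= ka * s" "!!y. y : {-H..H} ==> (abs (Fl y)) <= 2 * H * (ka * s)"
 using side[OF pin VH(1) int(1) sup(1)] unfolding Vl_def[abs_def, symmetric] Vl_def[symmetric] Fl_def by blast
 obtain gr where gr: "profile H ((abs 1) * G + (abs c) * Gm) Vr gr" "!!y. (abs (gr y)) <= G1" "Vr H = 0" "Vr (-H) = 0" "Fr H = 0" "Fr (-H) = 0"
 "!!y. y : {-H..H} ==> (abs (Vr y)) <= ka * s" "!!y. y : {-H..H} ==> (abs (Fr y)) <= 2 * H * (ka * s)"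
 using side[OF pout VH(2) int(2) sup(2)] unfolding Vr_def[abs_def, symmetric] Vr_def[symmetric] Fr_def by blast
 let ?cm = "%t. c * m t" and ?cM = "%t. c * M t" and ?cd = "%t. c * dd m t"
 define b0' where "b0' = sfield (%t. 1) ?cm ?cM"
 define Db where "Db = sfield_deriv (%t. 1) ?cd ?cm ?cM"
 define wl where "wl = sfield l Vl Fl"
 define wr where "wr = sfield r Vr Fr"
 define Dl where "Dl = sfield_deriv l gl Vl Fl"
 define Dr where "Dr = sfield_deriv r gr Vr Fr"
 have bs: "smooth b0'" unfolding b0'_def by (intro smooth_sfield smooth_const smooth_mult ms Ms)
 have dcm: "(?cm has_real_derivative ?cd t) (at t)" for t by (intro DERIV_cmult dm)
 have dcM: "(?cM has_real_derivative ?cm t) (at t)" for t by (intro DERIV_cmult dM)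
 have bW: "W12 S b0' Db"
 proof -
 have "(%b x. fd b0' x b) = Db"
 unfolding b0'_def Db_def fun_eq_iff
 using sfield_frechet_derivative[OF smooth_const dcm dcM] by blast
 thus ?thesis using W12_smooth[OF bs Sb Sl] by simp
 qed
 obtain vl where vl: "!!n::nat. smooth (vl n)" "W12 S wl Dl" "(%n. H1_norm S (%x. wl x - vl n x)) ----> 0"
 "uniform_limit (crect L H) vl wl sequentially" "!!n x. l (x$1) = 0 ==> dd l (x$1) = 0 ==> vl n x = 0"
 unfolding wl_def Dl_def Fl_def by (rule sfield_approximation[OF S L H sm(1) gl(1)]) blast
 obtain vr where vr: "!!n::nat. smooth (vr n)" "W12 S wr Dr" "(%n. H1_norm S (%x. wr x - vr n x)) ----> 0"
 "uniform_limit (crect L H) vr wr sequentially" "!!n x. r (x$1) = 0 ==> dd r (x$1) = 0 ==> vr n x = 0"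
 unfolding wr_def Dr_def Fr_def by (rule sfield_approximation[OF S L H sm(2) gr(1)]) blast
 define w where "w x = b0' x + (wl x + wr x)" for x
 define D where "D b x = Db b x + (Dl b x + Dr b x)" for b x
 define v where "v n x = b0' x + (vl n x + vr n x)" for n x
 have W: "W12 S w D" unfolding w_def[abs_def] D_def[abs_def] by (intro W12_add bW vl(2) vr(2))
 have wn: "norm (w x) <= K * s" if x: "x : crect L H" for x
 proof -
 note i = inc[OF x]
 have "norm (b0' x) <= (2 * H * s) * m1"
 proof -
 have "norm (b0' x) <= (abs c) * (abs (m (x$2)))" unfolding b0'_def using sfield_norm_le[of "%t. 1" ?cm ?cM x] by (simp add: abs_mult)
 also have "... <= (2 * H * s) * m1" using c m1(1) m1(2)[OF i(2)] by (intro mult_mono) auto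
 finally show ?thesis .
 qed
 moreover have "norm (wl x) <= 1 * (ka * s) + Al * (2 * H * (ka * s))"
 unfolding wl_def using lb Al gl(7,8)[OF i(2)] i by (intro order_trans[OF sfield_norm_le] add_mono mult_mono) auto
 moreover have "norm (wr x) <= 1 * (ka * s) + Ar * (2 * H * (ka * s))"
 unfolding wr_def using lb Ar gr(7,8)[OF i(2)] i by (intro order_trans[OF sfield_norm_le] add_mono mult_mono) auto
 moreover have "norm (w x) <= norm (b0' x) + (norm (wl x) + norm (wr x))"
 unfolding w_def by (intro order_trans[OF norm_triangle_ineq] add_mono order_refl norm_triangle_ineq)
 moreover have "(2 * H * s) * m1 + ((1 * (ka * s) + Al * (2 * H * (ka * s))) + (1 * (ka * s) + Ar * (2 * H * (ka * s)))) = Kw * s"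
 by (simp add: Kw_def algebra_simps)
 moreover have "Kw * s <= K * s" using s0 C0 mu0 H Gm0 e by (intro mult_right_mono) (auto simp: K_def)
 ultimately show ?thesis by linarith
 qed
 have Dn: "norm (D b x) <= C * s + 2 * G1 * io x" if b: "b : Basis" and x: "x : crect L H" for b x
 proof -
 note i = inc[OF x]
 have nb: "norm b = 1" using b by simp
 have "norm (Db b x) <= (2 * H * s) * m2"
 proof -
 have "norm (Db b x) <= (abs c) * (abs (dd m (x$2)))"
 unfolding Db_def using sfield_deriv_norm_le[OF nb, of "%t. 1" ?cd ?cm ?cM x] by (simp add: abs_mult)
 also have "... <= (2 * H * s) * m2" using c m2(1) m2(2)[OF i(2)] by (intro mult_mono) auto
 finally show ?thesis .
 qed
 moreover have "norm (Dl b x) <= 2 * (Al * (ka * s)) + Bl * (2 * H * (ka * s)) + io x * G1"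
 unfolding Dl_def using lio(1)[of x] Al Bl gl(2)[of "x$2"] gl(7,8)[OF i(2)] i ka s0 H
 by (intro order_trans[OF sfield_deriv_norm_le[OF nb]] add_mono mult_mono) auto
 moreover have "norm (Dr b x) <= 2 * (Ar * (ka * s)) + Br * (2 * H * (ka * s)) + io x * G1"
 unfolding Dr_def using lio(2)[of x] Ar Br gr(2)[of "x$2"] gr(7,8)[OF i(2)] i ka s0 H
 by (intro order_trans[OF sfield_deriv_norm_le[OF nb]] add_mono mult_mono) auto
 moreover have "norm (D b x) <= norm (Db b x) + (norm (Dl b x) + norm (Dr b x))"
 unfolding D_def by (intro order_trans[OF norm_triangle_ineq] add_mono order_refl norm_triangle_ineq)
 moreover have "(2 * H * s) * m2 + ((2 * (Al * (ka * s)) + Bl * (2 * H * (ka * s)) + io x * G1) + (2 * (Ar * (ka * s)) + Br * (2 * H * (ka * s)) + io x * G1)) = C * s + 2 * G1 * io x"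
 by (simp add: C_def algebra_simps)
 ultimately show ?thesis by linarith
 qed
 have iom: "io : borel_measurable ?M" unfolding io_def
 proof (rule measurable_restrict_space1)
 have "open {x::real^2. x$1 < -L + ta \<or> x$1 > L - ta}" by (intro open_Collect_disj open_Collect_less continuous_intros)
 thus "indicat_real {x::real^2. x$1 < -L + ta \<or> x$1 > L - ta} : borel_measurable lebesgue"
 by (intro borel_measurable_indicator open_sets_lebesgue)
 qed
 have qio: "sq_integrable ?M io" by (rule sq_integrable_bounded(1)[OF fin iom, of 1]) (simp add: io_def indicator_def)
 have q1: "sq_integrable ?M (%x. 1::real)" by (rule sq_integrable_bounded(1)[OF fin, of _ 1]) auto
 have DL: "L2n ?M (D b) <= K * s + et" if b: "b : Basis" for b
 proof -
 have qa: "sq_integrable ?M (%x. (C * s) *R (1::real))" "sq_integrable ?M (%x. (2 * G1) *R io x)"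
 by (intro sq_integrable_scaleR q1 qio)+
 have "L2n ?M (D b) <= 1 * L2n ?M (%x. (C * s) *R (1::real) + (2 * G1) *R io x)"
 proof (rule L2n_bound[OF sq_integrable_add[OF qa]])
 show "AE x in ?M. norm (D b x) <= 1 * norm ((C * s) *R (1::real) + (2 * G1) *R io x)"
 proof (rule AE_I2)
 fix x assume "x : space ?M"
 hence "x : crect L H" using Sc by (auto simp: space_restrict_space)
 from Dn[OF b this] show "norm (D b x) <= 1 * norm ((C * s) *R (1::real) + (2 * G1) *R io x)"
 by (simp add: abs_le_iff)
 qed
 qed simp
 also have "... <= L2n ?M (%x. (C * s) *R (1::real)) + L2n ?M (%x. (2 * G1) *R io x)"
 using L2n_triangle[OF qa] by simp
 also have "... <= (C * s) * mu + (2 * G1) * L2n ?M io"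
 unfolding mu_def using C0 s0 G10
 by (intro add_mono L2n_bound q1 qio) (auto simp: abs_mult)
 also have "... <= (C * s) * mu + (2 * G1) * e"
 using Le G10 by (intro add_mono mult_left_mono order_refl) (auto simp: io_def)
 also have "... = (C * mu + 4 * H * Gm * e) * s + 2 * G * e" by (simp add: G1_def algebra_simps)
 also have "... <= K * s + et"
 proof (rule add_mono)
 show "(C * mu + 4 * H * Gm * e) * s <= K * s" using Kw0 s0 by (intro mult_right_mono) (auto simp: K_def)
 have ne: "2 * (G + 1) ~= 0" using G by (simp add: add_nonneg_eq_0_iff)
 have "et = e * (2 * (G + 1))" using nonzero_divide_eq_eq[OF ne, of et e] e_def by metis
 thus "2 * G * e <= et" using e by (simp add: algebra_simps)
 qed
 finally show ?thesis .
 qed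
 have dv: "D e1 x $ 1 + D e2 x $ 2 = 0" for x
 using sfield_divergence[of "%t. 1" ?cd ?cm ?cM x] sfield_divergence[of l gl Vl Fl x] sfield_divergence[of r gr Vr Fr x]
 unfolding D_def Db_def Dl_def Dr_def vector_add_component by linarith
 have vs: "smooth (v n)" for n unfolding v_def[abs_def] by (intro smooth_add bs vl vr)
 have "w x - v n x = (wl x - vl n x) + (wr x - vr n x)" for n x by (simp add: w_def v_def)
 hence lim: "(%n. H1_norm S (%x. w x - v n x)) ----> 0"
 using H1_norm_tendsto_add[OF S(1) W12_diff[OF vl(2) W12_smooth[OF vl(1) Sb Sl]] W12_diff[OF vr(2) W12_smooth[OF vr(1) Sb Sl]] vl(3) vr(3)] by simp
 have ul: "uniform_limit (crect L H) v w sequentially"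
 unfolding v_def[abs_def] w_def[abs_def] by (intro uniform_limit_add uniform_limit_const vl vr)
 have van: "v n x = 0" if "(abs (x$1)) < a0" "(abs (x$2)) < b0" for n x
 proof -
 have "x$1 > -L + 3*ta/4" "x$1 < L - 3*ta/4" using that(1) ta by (auto simp: abs_less_iff)
 hence "vl n x = 0" "vr n x = 0" using vl(5) vr(5) l0 dl0 r0 dr0 by auto
 moreover have "b0' x = 0" using m0[of "x$2"] that(2) by (simp add: b0'_def sfield_def abs_less_iff)
 ultimately show ?thesis by (simp add: v_def)
 qed
 have wb: "w x = 0" if "x : side_b L H" for x
 using that gl(4,6) gr(4,6) m0[of "-H"] LH by (simp add: side_b_def w_def b0'_def wl_def wr_def sfield_def)
 have wt: "w x = (c * U) *R e1" if "x : side_t L H" for x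
 using that gl(3,5) gr(3,5) mH by (simp add: side_t_def w_def b0'_def wl_def wr_def sfield_def)
 have wl': "w x = Vin (x$2) *R e1" if "x : side_l L H" for x
 proof -
 have x: "x$1 = -L" using that by (simp add: side_l_def)
 have "l (-L) = 1" "dd l (-L) = 0" "r (-L) = 0" "dd r (-L) = 0" using l1 dl1 r0 dr0 ta LH by simp_all
 thus ?thesis by (simp add: w_def b0'_def wl_def wr_def sfield_def x Vl_def scaleR_left_diff_distrib)
 qed
 have wr': "w x = Vout (x$2) *R e1" if "x : side_r L H" for x
 proof -
 have x: "x$1 = L" using that by (simp add: side_r_def)
 have "l L = 0" "dd l L = 0" "r L = 1" "dd r L = 0" using l0 dl0 r1 dr1 ta LH by simp_all
 thus ?thesis by (simp add: w_def b0'_def wl_def wr_def sfield_def x Vr_def scaleR_left_diff_distrib)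
 qed
 show "extendable S L H a0 b0 (K * s) et (c * U) Vin Vout"
 unfolding extendable_def
 by (intro exI[of _ w] exI[of _ D] exI[of _ v] conjI ballI allI impI W wn DL dv vs lim ul wb wt wl' wr')
 (auto intro: van)
 qed
qed

section \<open>Boundary traces\<close>

text \<open>The cover has \<open>N + 1\<close> pieces of length \<open>l / N\<close>, which costs
  the factor 2; only the finiteness of the length of the sides is drawn from it.\<close>

lemma hausdorff1_outer_segment:
 fixes p d :: "'a::euclidean_space"
 assumes d: "norm d = 1" and l: "l > 0"
 shows "hausdorff1_outer ((%t. p + t *R d) ` {0..l}) <= ennreal (2 * l)"
 unfolding hausdorff1_outer_def
proof (rule SUP_least)
 fix de :: real assume "de : {0<..}"
 hence de: "de > 0" by simp
 obtain N :: nat where N: "l / de < real N" using reals_Archimedean2 by blast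
 have N0: "real N > 0" using N l de by (meson divide_pos_pos less_trans)
 have lN: "l / real N <= de" using N de N0 by (simp add: field_simps)
 define C where "C i = (if i <= N then (%t. p + t *R d) ` {real i * (l / N)..real (Suc i) * (l / N)} else {})" for i
 have diam: "diameter (C i) <= l / real N" for i
 proof (rule diameter_le)
 fix x y assume xy: "x : C i" "y : C i"
 hence "i <= N" by (auto simp: C_def split: if_splits)
 hence "C i = (%t. p + t *R d) ` {real i * (l / N)..real (Suc i) * (l / N)}" by (simp only: C_def if_True)
 with xy obtain s t where st: "x = p + s *R d" "y = p + t *R d" "s : {real i * (l / N)..real (Suc i) * (l / N)}" "t : {real i * (l / N)..real (Suc i) * (l / N)}"
 by blast
 have "x - y = (s - t) *R d" by (simp add: st algebra_simps)
 hence "norm (x - y) = (abs (s - t))" using d by simp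
 also have "... <= real (Suc i) * (l / N) - real i * (l / N)" using st(3,4) by (auto simp: abs_le_iff)
 also have "... = l / real N" unfolding left_diff_distrib[symmetric] by simp
 finally show "norm (x - y) <= l / real N" .
 qed (use l in simp)
 have bd: "bounded (C i)" for i
 unfolding C_def by (auto intro!: compact_imp_bounded compact_continuous_image continuous_intros)
 have cover: "(%t. p + t *R d) ` {0..l} <= (\<Union>i. C i)"
 proof
 fix x assume "x : (%t. p + t *R d) ` {0..l}"
 then obtain t where t: "x = p + t *R d" "t : {0..l}" by (rule imageE)
 hence "0 <= t" "t <= l" by simp_all
 note t = t(1) this
 define i where "i = nat \<lfloor>t / (l / N)\<rfloor>"
 have lp: "l / N > 0" using l N0 by simp
 have q: "0 <= t / (l / N)" using t lp by simp
 have i1: "real i <= t / (l / N)" unfolding i_def using q by simp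
 have i2: "t / (l / N) < real i + 1" unfolding i_def using q by linarith
 have "t / (l / N) <= l / (l / N)" using t lp by (intro divide_right_mono) auto
 also have "... = real N" using l by simp
 finally have "i <= N" using i1 by linarith
 moreover have "real i * (l / N) <= t" using i1 lp by (simp only: pos_le_divide_eq)
 moreover have "t <= real (Suc i) * (l / N)" using i2 lp by (simp only: pos_divide_less_eq of_nat_Suc) (simp add: add.commute)
 ultimately have "x : C i" unfolding C_def t(1) by auto
 thus "x : (\<Union>i. C i)" by blast
 qed
 have "(\<Sum>i. ennreal (diameter (C i))) = (\<Sum>i\<le>N. ennreal (diameter (C i)))"
 by (rule suminf_finite) (auto simp: C_def)
 also have "... <= (\<Sum>i\<le>N. ennreal (l / real N))" by (intro sum_mono ennreal_leI diam)
 also have "... = ennreal (\<Sum>i\<le>N. l / real N)" using l by (intro sum_ennreal) auto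
 also have "... <= ennreal (2 * l)"
 proof (rule ennreal_leI)
 have "N >= 1" using N0 by simp
 hence "l / real N <= l" using l by (simp add: divide_le_eq)
 moreover have "(\<Sum>i\<le>N. l / real N) = l + l / real N" using N0 by (simp add: distrib_right add_divide_distrib)
 ultimately show "(\<Sum>i\<le>N. l / real N) <= 2 * l" by linarith
 qed
 finally have "(\<Sum>i. ennreal (diameter (C i))) <= ennreal (2 * l)" .
 moreover have "C : {C. (%t. p + t *R d) ` {0..l} <= (\<Union>i. C i) & (\<forall>i. bounded (C i) & diameter (C i) <= de)}"
 using cover bd diam lN order_trans by blast
 ultimately show "(INF C\<in>{C. (%t. p + t *R d) ` {0..l} <= (\<Union>i. C i) & (\<forall>i. bounded (C i) & diameter (C i) <= de)}. \<Sum>i. ennreal (diameter (C i))) <= ennreal (2 * l)"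
 by (rule INF_lower2[rotated])
qed

definition sides :: "real => real => (real^2) set" where
 "sides L H = side_b L H \<union> side_t L H \<union> side_l L H \<union> side_r L H"

lemma closed_sides: "closed (sides L H)"
 unfolding sides_def side_b_def side_t_def side_l_def side_r_def
 by (intro closed_Un closed_Collect_conj closed_Collect_le closed_Collect_eq continuous_intros)

lemma sides_subset_crect: "L > 0 ==> H > 0 ==> sides L H <= crect L H"
 by (auto simp: sides_def side_b_def side_t_def side_l_def side_r_def crect_def)

lemma hausdorff1_sides_finite:
 assumes "L > 0" "H > 0" shows "emeasure hausdorff1 (sides L H) < \<infinity>"
proof -
 have seg: "hausdorff1_outer A < \<infinity>" if "A <= (%t. p + t *R axis i 1) ` {0..l}" "l > 0" for A :: "(real^2) set" and p i and l :: real
 proof -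
 have "hausdorff1_outer A <= hausdorff1_outer ((%t. p + t *R axis i 1) ` {0..l})" by (rule hausdorff1_outer_mono[OF that(1)])
 also have "... <= ennreal (2 * l)" by (rule hausdorff1_outer_segment[OF norm_Basis[OF axis_Basis] that(2)])
 also have "... < \<infinity>" by simp
 finally show ?thesis .
 qed
 have b: "hausdorff1_outer (side_b L H) < \<infinity>"
 proof (rule seg[of _ "(-L) *R e1 + (-H) *R e2" 1 "2 * L"])
 show "side_b L H <= (%t. (-L) *R e1 + (-H) *R e2 + t *R axis 1 1) ` {0..2 * L}"
 proof
 fix x assume "x : side_b L H"
 hence "x = (-L) *R e1 + (-H) *R e2 + (x$1 + L) *R axis 1 1" "x$1 + L : {0..2 * L}"
 by (auto simp: side_b_def vec_eq_iff forall_2 axis_def)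
 thus "x : (%t. (-L) *R e1 + (-H) *R e2 + t *R axis 1 1) ` {0..2 * L}" by (rule image_eqI)
 qed
 qed (use assms in simp)
 have t: "hausdorff1_outer (side_t L H) < \<infinity>"
 proof (rule seg[of _ "(-L) *R e1 + H *R e2" 1 "2 * L"])
 show "side_t L H <= (%t. (-L) *R e1 + H *R e2 + t *R axis 1 1) ` {0..2 * L}"
 proof
 fix x assume "x : side_t L H"
 hence "x = (-L) *R e1 + H *R e2 + (x$1 + L) *R axis 1 1" "x$1 + L : {0..2 * L}"
 by (auto simp: side_t_def vec_eq_iff forall_2 axis_def)
 thus "x : (%t. (-L) *R e1 + H *R e2 + t *R axis 1 1) ` {0..2 * L}" by (rule image_eqI)
 qed
 qed (use assms in simp)
 have l: "hausdorff1_outer (side_l L H) < \<infinity>"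
 proof (rule seg[of _ "(-L) *R e1 + (-H) *R e2" 2 "2 * H"])
 show "side_l L H <= (%t. (-L) *R e1 + (-H) *R e2 + t *R axis 2 1) ` {0..2 * H}"
 proof
 fix x assume "x : side_l L H"
 hence "x = (-L) *R e1 + (-H) *R e2 + (x$2 + H) *R axis 2 1" "x$2 + H : {0..2 * H}"
 by (auto simp: side_l_def vec_eq_iff forall_2 axis_def)
 thus "x : (%t. (-L) *R e1 + (-H) *R e2 + t *R axis 2 1) ` {0..2 * H}" by (rule image_eqI)
 qed
 qed (use assms in simp)
 have r: "hausdorff1_outer (side_r L H) < \<infinity>"
 proof (rule seg[of _ "L *R e1 + (-H) *R e2" 2 "2 * H"])
 show "side_r L H <= (%t. L *R e1 + (-H) *R e2 + t *R axis 2 1) ` {0..2 * H}"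
 proof
 fix x assume "x : side_r L H"
 hence "x = L *R e1 + (-H) *R e2 + (x$2 + H) *R axis 2 1" "x$2 + H : {0..2 * H}"
 by (auto simp: side_r_def vec_eq_iff forall_2 axis_def)
 thus "x : (%t. L *R e1 + (-H) *R e2 + t *R axis 2 1) ` {0..2 * H}" by (rule image_eqI)
 qed
 qed (use assms in simp)
 have "emeasure hausdorff1 (sides L H) = hausdorff1_outer (sides L H)"
 by (rule emeasure_hausdorff1) (use closed_sides in simp)
 also have "... <= hausdorff1_outer (side_b L H) + hausdorff1_outer (side_t L H) + hausdorff1_outer (side_l L H) + hausdorff1_outer (side_r L H)"
 unfolding sides_def by (intro order_trans[OF hausdorff1_outer_subadditive_2] add_mono order_refl)
 also have "... < \<infinity>" using b t l r by simp
 finally show ?thesis .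
qed

lemma H1_norm_minus_commute:
 assumes "open S" "W12 S f D" "W12 S g E"
 shows "H1_norm S (%x. f x - g x) = H1_norm S (%x. g x - f x)"
 unfolding H1_norm_W12[OF assms(1) W12_diff[OF assms(2,3)]] H1_norm_W12[OF assms(1) W12_diff[OF assms(3,2)]]
 by (simp add: L2n_minus_commute[of _ f g] L2n_minus_commute[of _ "D _" "E _"])

lemma power2_norm_sum_le: "(norm (x + y :: 'a::real_normed_vector))^2 <= 2 * (norm x)^2 + 2 * (norm y)^2"
proof -
 have "(norm (x + y))^2 <= (norm x + norm y)^2" by (intro power_mono norm_triangle_ineq) simp
 also have "... <= 2 * (norm x)^2 + 2 * (norm y)^2"
 using sum_squares_bound[of "norm x" "norm y"] by (simp add: power2_sum)
 finally show ?thesis .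
qed

lemma ennreal_tendsto_0I:
 fixes f :: "nat => ennreal"
 assumes "!!e. e > 0 ==> \<forall>\<^sub>F n in sequentially. f n <= ennreal e"
 shows "f ----> 0"
proof (rule order_tendstoI)
 fix a :: ennreal assume a: "0 < a"
 obtain e where e: "e > 0" "ennreal e < a"
 proof (cases a)
 case (real r)
 thus ?thesis using a by (intro that[of "r / 2"]) (auto simp: ennreal_less_iff)
 next
 case top
 thus ?thesis by (intro that[of 1]) auto
 qed
 show "\<forall>\<^sub>F n in sequentially. f n < a"
 using assms[OF e(1)]
 proof eventually_elim
 case (elim n)
 thus ?case using e(2) by (rule le_less_trans)
 qed
qed simp

lemma has_trace_diff:
 assumes S: "open S" "bounded S" and u: "has_trace S u g" "has_trace S u' g'"
 shows "has_trace S (%x. u x - u' x) (%x. g x - g' x)"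
proof -
 have Sl: "S : sets lebesgue" using S by simp
 obtain v where v: "u : H1 S" "g : borel_measurable borel" "!!n. smooth (v n)" "(%n. H1_norm S (%x. u x - v n x)) ----> 0"
 "(%n. \<integral>\<^sup>+x\<in>frontier S. ennreal ((norm (v n x - g x))^2) \<partial>hausdorff1) ----> 0"
 using u(1) by (auto simp: has_trace_def)
 obtain v' where v': "u' : H1 S" "g' : borel_measurable borel" "!!n. smooth (v' n)" "(%n. H1_norm S (%x. u' x - v' n x)) ----> 0"
 "(%n. \<integral>\<^sup>+x\<in>frontier S. ennreal ((norm (v' n x - g' x))^2) \<partial>hausdorff1) ----> 0"
 using u(2) by (auto simp: has_trace_def)
 obtain D where D: "W12 S u D" using v(1) H1_iff by blast
 obtain D' where D': "W12 S u' D'" using v'(1) H1_iff by blast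
 note W = W12_smooth[OF v(3) S(2) Sl] and W' = W12_smooth[OF v'(3) S(2) Sl]
 have eq: "(%x. u x - u' x - (v n x - v' n x)) = (%x. (u x - v n x) + (v' n x - u' x))" for n by (simp add: fun_eq_iff)
 have lim: "(%n. H1_norm S (%x. u x - u' x - (v n x - v' n x))) ----> 0"
 unfolding eq by (rule H1_norm_tendsto_add[OF S(1) W12_diff[OF D W] W12_diff[OF W' D'] v(4) v'(4)[unfolded H1_norm_minus_commute[OF S(1) D' W']]])
 have fm: "frontier S : sets borel" by (simp add: frontier_closed)
 have vm: "v n : borel_measurable borel" "v' n : borel_measurable borel" for n
 by (intro borel_measurable_continuous_onI smooth_continuous_on v v')+
 have gm: "g : borel_measurable borel" "g' : borel_measurable borel" by (rule v v')+
 have b: "(\<integral>\<^sup>+x\<in>frontier S. ennreal ((norm (v n x - v' n x - (g x - g' x)))^2) \<partial>hausdorff1) <=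
 2 * (\<integral>\<^sup>+x\<in>frontier S. ennreal ((norm (v n x - g x))^2) \<partial>hausdorff1) + 2 * (\<integral>\<^sup>+x\<in>frontier S. ennreal ((norm (v' n x - g' x))^2) \<partial>hausdorff1)" for n
 proof -
 have mm: "(%x. ennreal ((norm (v n x - g x))^2) * indicator (frontier S) x) : borel_measurable hausdorff1"
 "(%x. ennreal ((norm (v' n x - g' x))^2) * indicator (frontier S) x) : borel_measurable hausdorff1"
 using vm gm fm by measurable
 have "(\<integral>\<^sup>+x\<in>frontier S. ennreal ((norm (v n x - v' n x - (g x - g' x)))^2) \<partial>hausdorff1) <=
 (nn_integral hausdorff1 (%x. 2 * (ennreal ((norm (v n x - g x))^2) * indicator (frontier S) x) + 2 * (ennreal ((norm (v' n x - g' x))^2) * indicator (frontier S) x)))"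
 proof (rule nn_integral_mono)
 fix x
 have eq: "v n x - v' n x - (g x - g' x) = (v n x - g x) + (g' x - v' n x)" by simp
 have "(norm (v n x - v' n x - (g x - g' x)))^2 <= 2 * (norm (v n x - g x))^2 + 2 * (norm (v' n x - g' x))^2"
 unfolding eq norm_minus_commute[of "v' n x"] by (rule power2_norm_sum_le)
 hence "ennreal ((norm (v n x - v' n x - (g x - g' x)))^2) <= ennreal (2 * (norm (v n x - g x))^2 + 2 * (norm (v' n x - g' x))^2)"
 by (rule ennreal_leI)
 also have "... = 2 * ennreal ((norm (v n x - g x))^2) + 2 * ennreal ((norm (v' n x - g' x))^2)"
 by (simp add: ennreal_mult)
 finally show "ennreal ((norm (v n x - v' n x - (g x - g' x)))^2) * indicator (frontier S) x <=
 2 * (ennreal ((norm (v n x - g x))^2) * indicator (frontier S) x) + 2 * (ennreal ((norm (v' n x - g' x))^2) * indicator (frontier S) x)"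
 by (simp add: indicator_def)
 qed
 also have "... = 2 * (\<integral>\<^sup>+x\<in>frontier S. ennreal ((norm (v n x - g x))^2) \<partial>hausdorff1) + 2 * (\<integral>\<^sup>+x\<in>frontier S. ennreal ((norm (v' n x - g' x))^2) \<partial>hausdorff1)"
 using mm by (simp add: nn_integral_add nn_integral_cmult)
 finally show ?thesis .
 qed
 have "(%n. \<integral>\<^sup>+x\<in>frontier S. ennreal ((norm (v n x - v' n x - (g x - g' x)))^2) \<partial>hausdorff1) ----> 0"
 proof (rule ennreal_tendsto_0I)
 fix e :: real assume e: "e > 0"
 have e4: "0 < ennreal (e / 4)" using e by simp
 show "\<forall>\<^sub>F n in sequentially. (\<integral>\<^sup>+x\<in>frontier S. ennreal ((norm (v n x - v' n x - (g x - g' x)))^2) \<partial>hausdorff1) <= ennreal e"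
 using order_tendstoD(2)[OF v(5) e4] order_tendstoD(2)[OF v'(5) e4]
 proof eventually_elim
 case (elim n)
 have "2 * (\<integral>\<^sup>+x\<in>frontier S. ennreal ((norm (v n x - g x))^2) \<partial>hausdorff1) + 2 * (\<integral>\<^sup>+x\<in>frontier S. ennreal ((norm (v' n x - g' x))^2) \<partial>hausdorff1)
 <= 2 * ennreal (e / 4) + 2 * ennreal (e / 4)"
 using elim by (intro add_mono mult_left_mono) auto
 also have "2 * ennreal (e / 4) = ennreal (e / 2)" using ennreal_mult[of 2 "e / 4"] e by simp
 also have "ennreal (e / 2) + ennreal (e / 2) = ennreal e" using e by (subst ennreal_plus[symmetric]) auto
 finally show ?case by (rule order_trans[OF b])
 qed
 qed
 moreover have "(%x. g x - g' x) : borel_measurable borel" using gm by measurable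
 moreover have "smooth (%x. v n x - v' n x)" for n by (intro smooth_diff v v')
 ultimately show ?thesis
 unfolding has_trace_def using H1_diff[OF v(1) v'(1)] lim
 by (intro conjI exI[of _ "%n x. v n x - v' n x"]) auto
qed

text \<open>Differences of the two approximating sequences witness the zero trace. On the frontier
  of \<open>B\<close> the \<open>v n\<close> vanish and the \<open>q n\<close> tend to 0 in the
  mean; on the sides the \<open>q n\<close> tend to \<open>g\<close> in the mean and the
  \<open>v n\<close> tend to \<open>w\<close>, which equals \<open>g\<close>, uniformly. Finite
  length of the sides turns the latter into convergence in the mean.\<close>

lemma trace_match_imp_H10:
 assumes LH: "L > 0" "H > 0" and B: "compact B" "convex B" "cball b r <= B" "r > 0"
 and core: "!!x. x : B ==> (abs (x$1)) < a0 & (abs (x$2)) < b0" and sub: "B <= channel L H"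
 defines "S \<equiv> channel L H - B"
 assumes d: "has_trace S d g"
 and g: "AE x in hausdorff1. (x : frontier B --> g x = 0) & (x : sides L H --> g x = w x)"
 and w: "W12 S w D" and v: "!!n::nat. smooth (v n)" "(%n. H1_norm S (%x. w x - v n x)) ----> 0"
 "uniform_limit (crect L H) v w sequentially" "!!n x. (abs (x$1)) < a0 ==> (abs (x$2)) < b0 ==> v n x = 0"
 shows "(%x. d x - w x) : H10 S"
proof -
 have S: "open S" "bounded S" unfolding S_def by (rule open_fluid[OF B(1)], rule bounded_fluid)
 have Sl: "S : sets lebesgue" using S by simp
 obtain Ds Kd rh where ex: "exit_directions S Ds Kd rh" unfolding S_def by (rule exit_directions_fluid[OF B(2,1,3,4)]) blast
 obtain q where q: "d : H1 S" "g : borel_measurable borel" "!!n. smooth (q n)" "(%n. H1_norm S (%x. d x - q n x)) ----> 0"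
 "(%n. \<integral>\<^sup>+x\<in>frontier S. ennreal ((norm (q n x - g x))^2) \<partial>hausdorff1) ----> 0"
 using d by (auto simp: has_trace_def)
 obtain E where E: "W12 S d E" using q(1) H1_iff by blast
 note Wq = W12_smooth[OF q(3) S(2) Sl] and Wv = W12_smooth[OF v(1) S(2) Sl]
 have eq: "(%x. d x - w x - (q n x - v n x)) = (%x. (d x - q n x) + (v n x - w x))" for n by (simp add: fun_eq_iff)
 have lim: "(%n. H1_norm S (%x. d x - w x - (q n x - v n x))) ----> 0"
 unfolding eq by (rule H1_norm_tendsto_add[OF S(1) W12_diff[OF E Wq] W12_diff[OF Wv w] q(4) v(2)[unfolded H1_norm_minus_commute[OF S(1) w Wv]]])
 let ?P = "%n. \<integral>\<^sup>+x\<in>frontier S. ennreal ((norm (q n x - g x))^2) \<partial>hausdorff1"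
 have fm: "frontier S : sets borel" by (simp add: frontier_closed)
 have sm: "sides L H : sets borel" using closed_sides by simp
 have qm: "q n : borel_measurable borel" for n
 by (intro borel_measurable_continuous_onI smooth_continuous_on q)
 have fB: "frontier B <= B" using B(1) by (simp add: compact_imp_closed frontier_subset_closed)
 have fS: "frontier S <= frontier B \<union> sides L H"
 using frontier_fluid_subset[OF B(1) sub] unfolding S_def sides_def by blast
 have b: "(\<integral>\<^sup>+x\<in>frontier S. ennreal ((norm (q n x - v n x))^2) \<partial>hausdorff1) <= 2 * ?P n + ennreal (2 * e\<^sup>2) * emeasure hausdorff1 (sides L H)"
 if e: "!!x. x : crect L H ==> dist (v n x) (w x) < e" for n e
 proof -
 have mm: "(%x. ennreal ((norm (q n x - g x))^2) * indicator (frontier S) x) : borel_measurable hausdorff1"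
 using qm q(2) fm by measurable
 have "(\<integral>\<^sup>+x\<in>frontier S. ennreal ((norm (q n x - v n x))^2) \<partial>hausdorff1) <=
 (nn_integral hausdorff1 (%x. 2 * (ennreal ((norm (q n x - g x))^2) * indicator (frontier S) x) + ennreal (2 * e\<^sup>2) * indicator (sides L H) x))"
 proof (rule nn_integral_mono_AE)
 show "AE x in hausdorff1. ennreal ((norm (q n x - v n x))^2) * indicator (frontier S) x <=
 2 * (ennreal ((norm (q n x - g x))^2) * indicator (frontier S) x) + ennreal (2 * e\<^sup>2) * indicator (sides L H) x"
 using g
 proof eventually_elim
 case (elim x)
 show ?case
 proof (cases "x : frontier S")
 case True
 have eq: "q n x - v n x = (q n x - g x) + (g x - v n x)" by simp
 have n2: "(norm (q n x - v n x))^2 <= 2 * (norm (q n x - g x))^2 + 2 * (norm (g x - v n x))^2"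
 unfolding eq by (rule power2_norm_sum_le)
 show ?thesis
 proof (cases "x : frontier B")
 case True
 hence "x : B" using fB by blast
 hence "v n x = 0" using core v(4) by blast
 hence "(norm (q n x - v n x))^2 <= 2 * (norm (q n x - g x))^2" using True elim by simp
 hence "ennreal ((norm (q n x - v n x))^2) <= ennreal (2 * (norm (q n x - g x))^2)" by (rule ennreal_leI)
 also have "... = 2 * ennreal ((norm (q n x - g x))^2)" by (simp add: ennreal_mult)
 finally show ?thesis using \<open>x : frontier S\<close> by (simp add: add_increasing2)
 next
 case False
 hence x: "x : sides L H" using \<open>x : frontier S\<close> fS by blast
 hence "x : crect L H" using sides_subset_crect[OF LH] by blast
 from e[OF this] have "norm (g x - v n x) <= e" using elim x by (simp add: dist_norm norm_minus_commute)
 hence "(norm (g x - v n x))^2 <= e\<^sup>2" by (intro power_mono) auto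
 hence "(norm (q n x - v n x))^2 <= 2 * (norm (q n x - g x))^2 + 2 * e\<^sup>2" using n2 by linarith
 hence "ennreal ((norm (q n x - v n x))^2) <= ennreal (2 * (norm (q n x - g x))^2 + 2 * e\<^sup>2)" by (rule ennreal_leI)
 also have "... = 2 * ennreal ((norm (q n x - g x))^2) + ennreal (2 * e\<^sup>2)"
 by (subst ennreal_plus) (auto simp: ennreal_mult)
 finally show ?thesis using \<open>x : frontier S\<close> x by simp
 qed
 qed simp
 qed
 qed
 also have "... = 2 * ?P n + ennreal (2 * e\<^sup>2) * emeasure hausdorff1 (sides L H)"
 using mm sm by (simp add: nn_integral_add nn_integral_cmult nn_integral_cmult_indicator)
 finally show ?thesis .
 qed
 obtain mu where mu: "emeasure hausdorff1 (sides L H) = ennreal mu" "mu >= 0"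
 using hausdorff1_sides_finite[OF LH] by (cases "emeasure hausdorff1 (sides L H)") auto
 have bd: "(%n. \<integral>\<^sup>+x\<in>frontier S. ennreal ((norm (q n x - v n x))^2) \<partial>hausdorff1) ----> 0"
 proof (rule ennreal_tendsto_0I)
 fix ep :: real assume ep: "ep > 0"
 have e4: "0 < ennreal (ep / 4)" using ep by simp
 define e where "e = sqrt (ep / (4 * (mu + 1)))"
 have e: "e > 0" using ep mu by (simp add: e_def)
 have e2: "2 * e\<^sup>2 * mu <= ep / 2"
 proof -
 have "e\<^sup>2 = ep / (4 * (mu + 1))" using ep mu by (simp add: e_def)
 moreover have "4 * (mu + 1) ~= 0" using mu(2) by (simp add: add_nonneg_eq_0_iff)
 ultimately have "ep = e\<^sup>2 * (4 * (mu + 1))" by (metis nonzero_divide_eq_eq)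
 thus ?thesis by (simp add: algebra_simps)
 qed
 show "\<forall>\<^sub>F n in sequentially. (\<integral>\<^sup>+x\<in>frontier S. ennreal ((norm (q n x - v n x))^2) \<partial>hausdorff1) <= ennreal ep"
 using order_tendstoD(2)[OF q(5) e4] uniform_limitD[OF v(3) e]
 proof eventually_elim
 case (elim n)
 have "(\<integral>\<^sup>+x\<in>frontier S. ennreal ((norm (q n x - v n x))^2) \<partial>hausdorff1) <= 2 * ?P n + ennreal (2 * e\<^sup>2) * ennreal mu"
 using b[of n e] elim(2) unfolding mu by blast
 also have "... <= 2 * ennreal (ep / 4) + ennreal (ep / 2)"
 proof (rule add_mono)
 show "2 * ?P n <= 2 * ennreal (ep / 4)" using elim(1) by (intro mult_left_mono) auto
 have "ennreal (2 * e\<^sup>2) * ennreal mu = ennreal (2 * e\<^sup>2 * mu)" using mu by (simp add: ennreal_mult)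
 thus "ennreal (2 * e\<^sup>2) * ennreal mu <= ennreal (ep / 2)" using e2 by (simp add: ennreal_leI)
 qed
 also have "2 * ennreal (ep / 4) = ennreal (ep / 2)" using ennreal_mult[of 2 "ep / 4"] ep by simp
 also have "ennreal (ep / 2) + ennreal (ep / 2) = ennreal ep" using ep by (subst ennreal_plus[symmetric]) auto
 finally show ?case .
 qed
 qed
 show ?thesis
 by (rule zero_trace_imp_H10[OF S ex W12_diff[OF E w] _ lim bd]) (intro smooth_diff q v)
qed

lemma compact_subset_channel_core:
 assumes "compact B" "B ~= {}" "B <= channel L H"
 obtains a0 b0 where "0 < a0" "a0 < L" "0 < b0" "b0 < H" "!!x. x : B ==> (abs (x$1)) < a0 & (abs (x$2)) < b0"
proof -
 have ex: "\<exists>y\<in>B. \<forall>x\<in>B. (abs (x$i)) <= (abs (y$i))" for i :: 2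
 by (rule continuous_attains_sup[OF assms(1,2)]) (intro continuous_intros)
 obtain y z where y: "y : B" "!!x. x : B ==> (abs (x$1)) <= (abs (y$1))" and z: "z : B" "!!x. x : B ==> (abs (x$2)) <= (abs (z$2))"
 using ex[of 1] ex[of 2] by blast
 have l: "(abs (y$1)) < L" "(abs (z$2)) < H" using y(1) z(1) assms(3) by (auto simp: channel_def abs_less_iff)
 show ?thesis
 proof (rule that[of "((abs (y$1)) + L) / 2" "((abs (z$2)) + H) / 2"])
 show "(abs (x$1)) < ((abs (y$1)) + L) / 2 & (abs (x$2)) < ((abs (z$2)) + H) / 2" if "x : B" for x
 by (intro conjI le_less_trans[OF y(2)[OF that]] le_less_trans[OF z(2)[OF that]]) (use l in simp_all)
 next
 have *: "0 < (p + q) / 2 & (p + q) / 2 < q" if "0 <= p" "p < q" for p q :: real using that by simp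
 show "0 < ((abs (y$1)) + L) / 2" "((abs (y$1)) + L) / 2 < L" using *[OF abs_ge_zero l(1)] by blast+
 show "0 < ((abs (z$2)) + H) / 2" "((abs (z$2)) + H) / 2 < H" using *[OF abs_ge_zero l(2)] by blast+
 qed
qed

text \<open>\<open>K\<close> may depend on \<open>et\<close> but not on the data, so
  \<open>s\<close> can be made small after \<open>K\<close> is known. The intended \<open>d\<close>
  is the difference of two velocities.\<close>

definition lifting_bound :: "real => real => (real^2) set => real => real => real => real => bool" where
 "lifting_bound L H B G U K et \<longleftrightarrow> K >= 0 &
 (\<forall>d g Vin Vout c s. has_trace (channel L H - B) d g -->
 (AE x in hausdorff1. (x : frontier B --> g x = 0) & (x : side_b L H --> g x = 0) & (x : side_t L H --> g x = (c * U) *R e1) &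
 (x : side_l L H --> g x = Vin (x$2) *R e1) & (x : side_r L H --> g x = Vout (x$2) *R e1)) -->
 boundary_profiles H G U s c Vin Vout -->
 (\<exists>w. w : H1 (channel L H - B) & (\<forall>x\<in>channel L H - B. norm (w x) <= K * s) &
 L2n (lebesgue_on (channel L H - B)) (grad (channel L H - B) w) <= 2 * (K * s + et) &
 (AE x in lebesgue_on (channel L H - B). divergence (channel L H - B) w x = 0) & (%x. d x - w x) : H10 (channel L H - B)))"

lemma boundary_lifting:
 assumes core: "0 < a0" "a0 < L" "0 < b0" "b0 < H" "!!x. x : B ==> (abs (x$1)) < a0 & (abs (x$2)) < b0"
 and B: "compact B" "convex B" "cball b r <= B" "r > 0" "B <= channel L H" and G: "G >= 0" and et: "et > 0"
 shows "\<exists>K. lifting_bound L H B G U K et"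
proof -
 define S where "S = channel L H - B"
 have S: "open S" "S <= channel L H" unfolding S_def by (rule open_fluid[OF B(1)]) auto
 have LH: "L > 0" "H > 0" using core by auto
 obtain K where K: "K >= 0" and ext: "!!Vin Vout c s. boundary_profiles H G U s c Vin Vout ==> extendable S L H a0 b0 (K * s) et (c * U) Vin Vout"
 by (rule solenoidal_extension[OF core(1-4) S G et, of U]) blast
 show ?thesis
 unfolding lifting_bound_def S_def[symmetric]
 proof (intro exI[of _ K] conjI K allI impI)
 fix d g Vin Vout c s
 assume d: "has_trace S d g"
 and g: "AE x in hausdorff1. (x : frontier B --> g x = 0) & (x : side_b L H --> g x = 0) & (x : side_t L H --> g x = (c * U) *R e1) &
 (x : side_l L H --> g x = Vin (x$2) *R e1) & (x : side_r L H --> g x = Vout (x$2) *R e1)"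
 and data: "boundary_profiles H G U s c Vin Vout"
 obtain w D v where W: "W12 S w D" "\<forall>x\<in>crect L H. norm (w x) <= K * s"
 "\<forall>b\<in>Basis. L2n (lebesgue_on S) (D b) <= K * s + et" "\<forall>x. D e1 x $ 1 + D e2 x $ 2 = 0"
 "\<forall>n::nat. smooth (v n)" "(%n. H1_norm S (%x. w x - v n x)) ----> 0"
 "uniform_limit (crect L H) v w sequentially" "\<forall>n x. (abs (x$1)) < a0 & (abs (x$2)) < b0 --> v n x = 0"
 "\<forall>x\<in>side_b L H. w x = 0" "\<forall>x\<in>side_t L H. w x = (c * U) *R e1"
 "\<forall>x\<in>side_l L H. w x = Vin (x$2) *R e1" "\<forall>x\<in>side_r L H. w x = Vout (x$2) *R e1"
 using ext[OF data, unfolded extendable_def] by (elim exE conjE) (rule that; assumption)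
 have w: "W12 S w D" "!!x. x : crect L H ==> norm (w x) <= K * s"
 "!!b. b : Basis ==> L2n (lebesgue_on S) (D b) <= K * s + et" "!!x. D e1 x $ 1 + D e2 x $ 2 = 0"
 and v: "!!n::nat. smooth (v n)" "(%n. H1_norm S (%x. w x - v n x)) ----> 0"
 "uniform_limit (crect L H) v w sequentially" "!!n x. (abs (x$1)) < a0 ==> (abs (x$2)) < b0 ==> v n x = 0"
 using W by simp_all
 note bd = W(9-12)
 have g': "AE x in hausdorff1. (x : frontier B --> g x = 0) & (x : sides L H --> g x = w x)"
 using g by eventually_elim (auto simp: sides_def bd)
 have z: "(%x. d x - w x) : H10 S"
 unfolding S_def
 by (rule trace_match_imp_H10[OF LH B(1-4) core(5) B(5) d[unfolded S_def] g' w(1)[unfolded S_def] v(1) v(2)[unfolded S_def] v(3,4)])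
 have "(L2n (lebesgue_on S) (grad S w))^2 = (L2n (lebesgue_on S) (D e1))^2 + (L2n (lebesgue_on S) (D e2))^2"
 unfolding grad_sq_integrable(2)[OF S(1) w(1)] Basis_real2 using e1_neq_e2 by simp
 also have "... <= (K * s + et)^2 + (K * s + et)^2" by (intro add_mono power_mono w(3) axis_Basis) auto
 also have "... <= (2 * (K * s + et))^2" unfolding power_mult_distrib by simp
 finally have "(L2n (lebesgue_on S) (grad S w))^2 <= (2 * (K * s + et))^2" .
 moreover have "2 * (K * s + et) >= 0" using order_trans[OF L2n_nonneg w(3)[OF axis_Basis]] by simp
 ultimately have gw: "L2n (lebesgue_on S) (grad S w) <= 2 * (K * s + et)" by (rule power2_le_imp_le)
 have "AE x in lebesgue_on S. divergence S w x = 0"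
 using divergence_W12_AE[OF S(1) w(1)] by eventually_elim (simp add: w(4))
 moreover have "norm (w x) <= K * s" if "x : S" for x using w(2) that S(2) channel_subset_crect by blast
 moreover have "w : H1 S" using w(1) H1_iff by blast
 ultimately show "\<exists>w. w : H1 S & (\<forall>x\<in>S. norm (w x) <= K * s) & L2n (lebesgue_on S) (grad S w) <= 2 * (K * s + et) &
 (AE x in lebesgue_on S. divergence S w x = 0) & (%x. d x - w x) : H10 S"
 using gw z by blast
 qed
qed

section \<open>The lift without pressure\<close>

lemma smooth_directional_derivative:
 assumes "smooth f"
 shows "((%t. f (x + t *R b)) has_derivative (%h. h *R fd f (x + t *R b) b)) (at t within T)"
proof -
 note d = smooth_has_derivative[OF assms, of "x + t *R b"]
 have "((%t. f (x + t *R b)) has_derivative (%s. fd f (x + t *R b) (s *R b))) (at t)"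
 by (rule derivative_along_line[OF d])
 thus ?thesis
 by (simp add: linear_cmul[OF has_derivative_linear[OF d]] has_derivative_at_withinI)
qed

lemma smooth_directional_real_derivative:
 fixes f :: "'a::euclidean_space => real"
 assumes "smooth f"
 shows "((%t. f (x + t *R b)) has_real_derivative fd f (x + t *R b) b) (at t within T)"
 using smooth_directional_derivative[OF assms, of x b t T]
 unfolding has_field_derivative_def real_scaleR_def mult.commute[of _ "fd f (x + t *R b) b"] .

text \<open>Differentiating under the integral sign writes the increment of one derivative along
  \<open>b\<close> as the integral of the mixed derivative; differentiating this in the upper limit
  exchanges the order.\<close>

lemma smooth_mixed_derivatives:
 fixes f :: "'a::euclidean_space => real"
 assumes f: "smooth f"
 shows "fd (%x. frechet_derivative f (at x) a) x b = fd (%x. frechet_derivative f (at x) b) x a"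
proof -
 let ?Da = "%x. fd f x a" and ?Db = "%x. fd f x b"
 let ?Dab = "%x. fd ?Db x a" and ?Dba = "%x. fd ?Da x b"
 \<comment> \<open>Places \<open>x\<close> at the parameter \<open>1/2\<close>, an interior point of
   \<open>{0..1}\<close>, where the derivative within the interval is the two-sided one.\<close>
 define y where "y = x - (1/2) *R b"
 have sa: "smooth ?Da" and sb: "smooth ?Db" by (intro smooth_frechet f)+
 have sab: "smooth ?Dab" by (rule smooth_frechet[OF sb])
 have shift: "(y + s *R a) + ta *R b = (y + ta *R b) + s *R a" for s ta by simp
 have eq: "?Da (y + t *R b) - ?Da y = integral {0..t} (%ta. ?Dab (y + ta *R b))" if t: "t >= 0" for t
 proof -
 have 1: "((%s. integral (cbox 0 t) (%ta. ?Db ((y + s *R a) + ta *R b))) has_real_derivative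
 integral (cbox 0 t) (%ta. ?Dab ((y + 0 *R a) + ta *R b))) (at 0 within UNIV)"
 proof (rule leibniz_rule_field_derivative)
 show "((%s. ?Db ((y + s *R a) + ta *R b)) has_real_derivative ?Dab ((y + s *R a) + ta *R b)) (at s within UNIV)" for s ta
 unfolding shift by (rule smooth_directional_real_derivative[OF sb])
 show "(%ta. ?Db ((y + s *R a) + ta *R b)) integrable_on cbox 0 t" for s
 by (rule integrable_continuous, rule continuous_on_compose2[OF smooth_continuous_on[OF sb, of UNIV]]) (auto intro!: continuous_intros)
 show "continuous_on (UNIV \<times> cbox 0 t) (%(s, ta). ?Dab ((y + s *R a) + ta *R b))"
 unfolding case_prod_beta
 by (rule continuous_on_compose2[OF smooth_continuous_on[OF sab, of UNIV]]) (auto intro!: continuous_intros)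
 qed auto
 have 2: "integral (cbox 0 t) (%ta. ?Db ((y + s *R a) + ta *R b)) = f ((y + t *R b) + s *R a) - f (y + s *R a)" for s
 proof -
 have "((%ta. ?Db ((y + s *R a) + ta *R b)) has_integral f ((y + s *R a) + t *R b) - f ((y + s *R a) + 0 *R b)) {0..t}"
 by (rule fundamental_theorem_of_calculus[OF t])
 (use smooth_directional_real_derivative[OF f, of "y + s *R a" b] in \<open>auto simp: has_real_derivative_iff_has_vector_derivative\<close>)
 from integral_unique[OF this] show ?thesis unfolding shift by (simp add: cbox_interval)
 qed
 have "((%s. f ((y + t *R b) + s *R a) - f (y + s *R a)) has_real_derivative ?Da ((y + t *R b) + 0 *R a) - ?Da (y + 0 *R a)) (at 0 within UNIV)"
 by (intro DERIV_diff smooth_directional_real_derivative f)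
 from DERIV_unique[OF this[unfolded 2[symmetric]] 1] show ?thesis by (simp add: cbox_interval)
 qed
 have h: "(1/2::real) : {0..1}" by simp
 have cont: "continuous_on {0..1} (%ta. ?Dab (y + ta *R b))"
 by (rule continuous_on_compose2[OF smooth_continuous_on[OF sab, of UNIV]]) (auto intro!: continuous_intros)
 have r: "((%t. integral {0..t} (%ta. ?Dab (y + ta *R b))) has_real_derivative ?Dab (y + (1/2) *R b)) (at (1/2) within {0..1})"
 by (rule integral_has_real_derivative[OF cont h])
 have "((%t. ?Da (y + t *R b) - ?Da y) has_real_derivative ?Dba (y + (1/2) *R b) - 0) (at (1/2) within {0..1})"
 by (intro DERIV_diff smooth_directional_real_derivative sa DERIV_const)
 hence l: "((%t. integral {0..t} (%ta. ?Dab (y + ta *R b))) has_real_derivative ?Dba (y + (1/2) *R b) - 0) (at (1/2) within {0..1})"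
 by (rule has_field_derivative_transform_within[OF _ zero_less_one h]) (use eq in auto)
 have at: "at (1/2) within {0..1::real} = at (1/2)" by (rule at_within_Icc_at) auto
 have "?Dba (y + (1/2) *R b) = ?Dab (y + (1/2) *R b)" using DERIV_unique[OF l[unfolded at] r[unfolded at]] by simp
 thus ?thesis by (simp add: y_def)
qed

lemma matrix_nth: "matrix f $ i $ j = f (axis j 1) $ i"
 by (simp add: matrix_def)

lemma inner_matrix2: "(A :: real^2^2) \<bullet> B = A$1$1 * B$1$1 + A$1$2 * B$1$2 + (A$2$1 * B$2$1 + A$2$2 * B$2$2)"
 by (simp add: inner_vec_def sum_2)

lemma smooth_component:
 fixes f :: "'a::euclidean_space => real^2"
 shows "smooth f ==> smooth (%x. f x $ i)"
 by (rule smooth_bounded_linear[OF bounded_linear_vec_nth])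

lemma frechet_derivative_component:
 fixes f :: "'a::euclidean_space => real^2"
 assumes "smooth f"
 shows "fd (%x. f x $ i) x h = fd f x h $ i"
 using fun_cong[OF frechet_derivative_at[OF bounded_linear.has_derivative[OF bounded_linear_vec_nth smooth_has_derivative[OF assms]], symmetric]] .

lemma test_functions_component:
 fixes f :: "'a::euclidean_space => real^2"
 assumes "f : test_functions S" shows "(%x. f x $ i) : test_functions S"
proof -
 obtain K where K: "smooth f" "compact K" "K <= S" "!!x. x ~: K ==> f x = 0" using assms by (rule test_functionsE) blast
 show ?thesis by (rule test_functionsI[OF smooth_component[OF K(1)] K(2,3)]) (simp add: K(4))
qed

lemma test_functions_add:
 assumes "f : test_functions S" "g : test_functions S"
 shows "(%x. f x + g x) : test_functions S"
proof -
 obtain K where K: "smooth f" "compact K" "K <= S" "!!x. x ~: K ==> f x = 0" using assms(1) by (rule test_functionsE) blast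
 obtain K' where K': "smooth g" "compact K'" "K' <= S" "!!x. x ~: K' ==> g x = 0" using assms(2) by (rule test_functionsE) blast
 show ?thesis by (rule test_functionsI[of _ "K \<union> K'"]) (use K K' in auto)
qed

text \<open>Integration by parts moves the derivatives onto \<open>th\<close>; after the mixed
  derivatives are exchanged the integrand is minus \<open>u\<close> applied to the gradient of the
  divergence \<open>ze\<close> of \<open>th\<close>, and \<open>u\<close> is divergence-free. This
  bridges the symmetric stress in the lift and the plain gradient in the weak formulation.\<close>

lemma transpose_grad_test:
 fixes th :: "real^2 => real^2"
 assumes S: "open S" and u: "u : H1 S" and dv: "AE x in lebesgue_on S. divergence S u x = 0" and th: "th : test_functions S"
 shows "(LINT x|lebesgue_on S. transpose (grad S u x) \<bullet> matrix (fd th x)) = 0"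
proof -
 let ?M = "lebesgue_on S"
 have Sl: "S : sets lebesgue" using S by simp
 have sm: "smooth th" by (rule test_functions_smooth[OF th])
 define d where "d i j x = fd th x (axis j 1) $ i" for i j x
 have dt: "d i j : test_functions S" for i j
 unfolding d_def[abs_def] by (intro test_functions_component test_functions_frechet th)
 have ds: "smooth (d i j)" for i j by (rule test_functions_smooth[OF dt])
 have W: "W12 S u (%b. weak_deriv S b u)" by (rule H1_W12[OF u S])
 have h: "has_weak_deriv S (axis i 1) (%x. u x $ j) (%x. weak_deriv S (axis i 1) u x $ j)" for i j
 by (rule has_weak_deriv_bounded_linear[OF bounded_linear_vec_nth W12_has_weak_deriv[OF W axis_Basis]])
 have i1: "integrable ?M (%x. fd (d i j) x b * u x $ k)" for i j k b
 proof -
 have "locally_integrable S (%x. u x $ k)" using h[of 1 k] by (simp add: has_weak_deriv_def)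
 from set_integrable_test_function_scaleR[OF test_functions_frechet[OF dt] this]
 show ?thesis by (simp add: set_integrable_lebesgue_on[OF Sl])
 qed
 have i2: "integrable ?M (%x. d i j x * weak_deriv S (axis k 1) u x $ l)" for i j k l
 proof -
 have "locally_integrable S (%x. weak_deriv S (axis k 1) u x $ l)" using h[of k l] by (simp add: has_weak_deriv_def)
 from set_integrable_test_function_scaleR[OF dt this]
 show ?thesis by (simp add: set_integrable_lebesgue_on[OF Sl])
 qed
 have e: "(LINT x|?M. d i j x * weak_deriv S (axis k 1) u x $ l) = - (LINT x|?M. fd (d i j) x (axis k 1) * u x $ l)" for i j k l
 using h[of k l] dt[of i j] unfolding has_weak_deriv_def by (simp add: LINT_lebesgue_on[OF Sl])
 have sym: "fd (d i j) x (axis k 1) = fd (d i k) x (axis j 1)" for i j k x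
 using smooth_mixed_derivatives[OF smooth_component[OF sm, of i], of "axis j 1" x "axis k 1"]
 unfolding frechet_derivative_component[OF sm] d_def[abs_def] .
 define ze where "ze x = d 1 1 x + d 2 2 x" for x
 have ze: "ze : test_functions S" unfolding ze_def[abs_def] by (intro test_functions_add dt)
 have dze: "fd ze x b = fd (d 1 1) x b + fd (d 2 2) x b" for x b
 unfolding ze_def[abs_def]
 using fun_cong[OF frechet_derivative_at[OF has_derivative_add[OF smooth_has_derivative[OF ds[of 1 1], of x] smooth_has_derivative[OF ds[of 2 2], of x]], symmetric], of b] .
 have "(LINT x|?M. transpose (grad S u x) \<bullet> matrix (fd th x)) =
 (LINT x|?M. (d 1 1 x * weak_deriv S (axis 1 1) u x $ 1 + d 1 2 x * weak_deriv S (axis 1 1) u x $ 2) +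
 (d 2 1 x * weak_deriv S (axis 2 1) u x $ 1 + d 2 2 x * weak_deriv S (axis 2 1) u x $ 2))"
 by (rule Bochner_Integration.integral_cong) (simp_all add: inner_matrix2 transpose_def grad_def matrix_nth d_def mult.commute)
 also have "... = - ((LINT x|?M. fd (d 1 1) x e1 * u x $ 1) + (LINT x|?M. fd (d 1 2) x e1 * u x $ 2) +
 ((LINT x|?M. fd (d 2 1) x e2 * u x $ 1) + (LINT x|?M. fd (d 2 2) x e2 * u x $ 2)))"
 by (simp add: i2 e)
 also have "(LINT x|?M. fd (d 1 1) x e1 * u x $ 1) + (LINT x|?M. fd (d 1 2) x e1 * u x $ 2) +
 ((LINT x|?M. fd (d 2 1) x e2 * u x $ 1) + (LINT x|?M. fd (d 2 2) x e2 * u x $ 2)) =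
 (LINT x|?M. (fd (d 1 1) x e1 * u x $ 1 + fd (d 1 2) x e1 * u x $ 2) +
 (fd (d 2 1) x e2 * u x $ 1 + fd (d 2 2) x e2 * u x $ 2))"
 by (simp add: i1)
 also have "... = (LINT x|?M. fd ze x e1 * u x $ 1 + fd ze x e2 * u x $ 2)"
 unfolding dze sym[of 1 2 _ 1] sym[of 2 1 _ 2] by (rule Bochner_Integration.integral_cong) (simp_all add: distrib_right)
 also have "... = 0" by (rule divergence_free_test(2)[OF S u dv ze])
 finally show ?thesis by simp
qed

section \<open>The lift as a functional of the velocity\<close>

lemma plateau:
 fixes p q :: real
 assumes "0 < p" "p < q"
 obtains rh :: "real => real" where "smooth rh" "!!t. (abs t) < p ==> rh t = 1" "!!t. (abs t) > q ==> rh t = 0"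
proof -
 let ?h = "q - p"
 let ?rh = "%t. (1 - step ((-p/?h) + t * (1/?h))) * (1 - step ((-p/?h) + t * (-1/?h)))"
 have arg: "(-p/?h) + t * (1/?h) = (t - p) / ?h" "(-p/?h) + t * (-1/?h) = (-t - p) / ?h" for t
 by (simp_all add: diff_divide_distrib)
 show ?thesis
 proof (rule that[of ?rh])
 show "smooth ?rh" by (intro smooth_mult smooth_diff smooth_const smooth_real_affine smooth_step)
 show "?rh t = 1" if "(abs t) < p" for t
 proof -
 have "(t - p) / ?h <= 0" "(-t - p) / ?h <= 0" using that assms by (auto intro!: divide_nonpos_pos)
 thus ?thesis unfolding arg by (simp only: step_le_0) simp
 qed
 show "?rh t = 0" if "(abs t) > q" for t
 proof (cases "t >= 0")
 case True
 hence "(t - p) / ?h >= 1" using that assms by (simp add: pos_le_divide_eq)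
 thus ?thesis unfolding arg by (simp only: step_ge_1) simp
 next
 case False
 hence "(-t - p) / ?h >= 1" using that assms by (simp add: pos_le_divide_eq)
 thus ?thesis unfolding arg by (simp only: step_ge_1) simp
 qed
 qed
qed

text \<open>Near the body the stream function is \<open>- x$1\<close>, whose rotated gradient is
  \<open>e2\<close>; multiplying the stream function, and not the field, by plateau functions
  preserves the divergence.\<close>

lemma solenoidal_vertical_field:
 assumes "0 < a0" "a0 < a1" "0 < b0" "b0 < b1"
 obtains ps :: "real^2 => real^2" where "smooth ps" "!!x. (abs (x$1)) < a0 ==> (abs (x$2)) < b0 ==> ps x = e2"
 "!!x. (abs (x$1)) > a1 \<or> (abs (x$2)) > b1 ==> ps x = 0" "!!x. trace (matrix (fd ps x)) = 0"
proof -
 obtain rh :: "real => real" where rh: "smooth rh" "!!t. (abs t) < a0 ==> rh t = 1" "!!t. (abs t) > a1 ==> rh t = 0" by (rule plateau[OF assms(1,2)]) blast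
 obtain Q :: "real => real" where Q: "smooth Q" "!!t. (abs t) < b0 ==> Q t = 1" "!!t. (abs t) > b1 ==> Q t = 0" by (rule plateau[OF assms(3,4)]) blast
 define a where "a t = - (t * rh t)" for t
 have as: "smooth a" unfolding a_def[abs_def] by (intro smooth_minus smooth_mult smooth_ident rh)
 have op: "open {t::real. (abs t) < c}" "open {t::real. (abs t) > c}" for c by (intro open_Collect_less continuous_intros)+
 have da: "dd a t = -1" if "(abs t) < a0" for t
 proof (rule dd_local[OF op(1)[of a0], of t a "%t. - t"])
 show "((%t. - t) has_real_derivative - 1) (at t)" by (auto intro!: derivative_eq_intros)
 qed (use that in \<open>auto simp: a_def rh(2)\<close>)
 have da0: "dd a t = 0" if "(abs t) > a1" for t
 by (rule dd_local[OF op(2)[of a1], of t a "%t. 0"]) (use that in \<open>auto simp: a_def rh(3)\<close>)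
 have dQ: "dd Q t = 0" if "(abs t) < b0" for t
 by (rule dd_local[OF op(1)[of b0], of t Q "%t. 1"]) (use that in \<open>auto simp: Q(2)\<close>)
 have dQ0: "dd Q t = 0" if "(abs t) > b1" for t
 by (rule dd_local[OF op(2)[of b1], of t Q "%t. 0"]) (use that in \<open>auto simp: Q(3)\<close>)
 have Qs: "smooth (dd Q)" by (rule smooth_dd[OF Q(1)])
 show ?thesis
 proof (rule that[of "sfield a (dd Q) Q"])
 show "smooth (sfield a (dd Q) Q)" by (intro smooth_sfield as Qs Q)
 show "sfield a (dd Q) Q x = e2" if "(abs (x$1)) < a0" "(abs (x$2)) < b0" for x
 by (simp add: sfield_def da[OF that(1)] dQ[OF that(2)] Q(2)[OF that(2)])
 show "sfield a (dd Q) Q x = 0" if "(abs (x$1)) > a1 \<or> (abs (x$2)) > b1" for x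
 using that
 proof
 assume "(abs (x$1)) > a1"
 thus ?thesis by (simp add: sfield_def a_def da0 rh(3))
 next
 assume "(abs (x$2)) > b1"
 thus ?thesis by (simp add: sfield_def dQ0 Q(3))
 qed
 show "trace (matrix (fd (sfield a (dd Q) Q) x)) = 0" for x
 unfolding trace_def sum_2 matrix_nth
 sfield_frechet_derivative[OF as smooth_has_real_derivative[OF Qs] smooth_has_real_derivative[OF Q(1)]]
 by (rule sfield_divergence)
 qed
qed

lemma smooth_bounded_on:
 fixes f :: "'a::euclidean_space => 'b::euclidean_space"
 assumes "smooth f" "bounded S" obtains C where "C > 0" "!!x. x : S ==> norm (f x) <= C"
proof -
 have "bounded (f ` closure S)"
 using assms by (intro compact_imp_bounded compact_continuous_image smooth_continuous_on) simp_all
 then obtain C where C: "C > 0" "\<forall>y\<in>f ` closure S. norm y <= C" unfolding bounded_pos by blast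
 show ?thesis
 proof (rule that[OF C(1)])
 show "norm (f x) <= C" if "x : S" for x using C(2) closure_subset that by blast
 qed
qed

lemma grad_smooth_AE:
 assumes "open S" "bounded S" "smooth f"
 shows "AE x in lebesgue_on S. grad S f x = matrix (fd f x)"
 using grad_AE[OF assms(1) W12_smooth[OF assms(3,2)]] assms(1) by (simp add: matrix_def)

lemma matrix_frechet_sq_integrable:
 assumes "open S" "bounded S" "smooth f"
 shows "sq_integrable (lebesgue_on S) (%x. matrix (fd f x) :: real^2^2)"
 by (rule sq_integrable_cong_AE[OF grad_sq_integrable(1)[OF assms(1) W12_smooth[OF assms(3,2)]] grad_smooth_AE[OF assms]])
 (use assms(1) in simp_all)

lemma norm_transpose: "norm (transpose (A :: real^2^2)) = norm A"
proof -
 have "(norm (transpose A))^2 = (norm A)^2"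
 unfolding power2_norm_eq_inner inner_matrix2 by (simp add: transpose_def)
 thus ?thesis by simp
qed

lemma transpose_sq_integrable:
 fixes A :: "'a => real^2^2"
 assumes "sq_integrable M A"
 shows "sq_integrable M (%x. transpose (A x))" "L2n M (%x. transpose (A x)) = L2n M A"
proof -
 have "linear (transpose :: real^2^2 => real^2^2)" by (rule linearI) (simp_all add: transpose_def vec_eq_iff)
 hence "continuous_on UNIV (transpose :: real^2^2 => real^2^2)" by (simp add: linear_continuous_on linear_linear)
 hence "(%x. transpose (A x)) : borel_measurable M"
 using borel_measurable_continuous_onI measurable_compose sq_integrable_measurable[OF assms] by blast
 thus "sq_integrable M (%x. transpose (A x))" using assms by (simp add: sq_integrable_def norm_transpose)
 show "L2n M (%x. transpose (A x)) = L2n M A" by (simp add: L2n_def norm_transpose)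
qed

text \<open>The generalised Green formula with a solenoidal field \<open>ps\<close> in place of the
  cutoff times \<open>e2\<close>: the pressure is paired with the trace of the Jacobian of
  \<open>ps\<close>, which is 0.\<close>

definition lift_functional :: "(real^2) set => (real^2 => real^2) => (real^2 => real^2) => real" where
 "lift_functional S ps u =
 (LINT x|lebesgue_on S. (grad S u x + transpose (grad S u x)) \<bullet> matrix (fd ps x))
 + (LINT x|lebesgue_on S. (grad S u x *v u x) \<bullet> ps x)"

text \<open>For every cutoff the difference \<open>th\<close> of the cutoff times \<open>e2\<close>
  and \<open>ps\<close> vanishes near the body and near the outer boundary, so it is an admissible
  test field; by the weak formulation and \<open>transpose_grad_test\<close> it contributes nothing.
  In particular the value is the same for all cutoffs.\<close>

lemma vertical_stress_pairing_eq:
 assumes LH: "0 < a0" "a0 < a1" "a1 < L" "0 < b0" "b0 < b1" "b1 < H" and B: "compact B"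
 and core: "!!x. x : B ==> (abs (x$1)) < a0 & (abs (x$2)) < b0"
 and ps: "smooth ps" "!!x. (abs (x$1)) < a0 ==> (abs (x$2)) < b0 ==> ps x = e2"
 "!!x. (abs (x$1)) > a1 \<or> (abs (x$2)) > b1 ==> ps x = 0" "!!x. trace (matrix (fd ps x)) = 0"
 and sol: "weak_solution L H B U lam Vin Vout u p"
 shows "vertical_stress_pairing L H B u p = lift_functional (channel L H - B) ps u"
proof -
 define S where "S = channel L H - B"
 let ?M = "lebesgue_on S" and ?g = "grad S u"
 have S: "open S" "bounded S" unfolding S_def by (rule open_fluid[OF B], rule bounded_fluid)
 have Sl: "S : sets lebesgue" using S by simp
 have uH: "u : H1 S" and dv: "AE x in ?M. divergence S u x = 0" and pS: "p : Lp_space 2 S"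
 and weak: "!!ph. ph : H10 S ==> (LINT x:S|lebesgue. ?g x \<bullet> grad S ph x) + (LINT x:S|lebesgue. convection S u x \<bullet> ph x)
 - (LINT x:S|lebesgue. p x * divergence S ph x) = 0"
 using sol unfolding weak_solution_def Let_def V_star_def H1_star_def L20_def S_def by auto
 have g: "sq_integrable ?M ?g" by (rule H1_grad_sq_integrable[OF S(1) uH])
 have gt: "sq_integrable ?M (%x. transpose (?g x))" by (rule transpose_sq_integrable(1)[OF g])
 have uq: "sq_integrable ?M u" by (rule H1_sq_integrable[OF uH])
 have p: "sq_integrable ?M p" using pS by (simp add: Lp_space_2)
 define N0 :: "(real^2) set" where "N0 = {x. (abs (x$1)) < a0 & (abs (x$2)) < b0}"
 define N1 :: "(real^2) set" where "N1 = {x. (abs (x$1)) > a1 \<or> (abs (x$2)) > b1}"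
 have oN: "open N0" "open N1" unfolding N0_def N1_def
 by (intro open_Collect_conj open_Collect_disj open_Collect_less continuous_intros)+
 have fr: "x : N1" if "x ~: channel L H" for x
 using that LH by (auto simp: channel_def N1_def abs_real_def split: if_splits)
 have eq: "s = lift_functional S ps u"
 if ph: "cutoff L H B ph" and s: "s = (LINT x:S|lebesgue. stress S u p x \<bullet> matrix (fd (%y. ph y *R e2) x))
 + (LINT x:S|lebesgue. convection S u x \<bullet> (ph x *R e2))" for ph s
 proof -
 obtain N N' where N: "smooth ph" "open N" "B <= N" "!!x. x : N ==> ph x = 1"
 and N': "open N'" "frontier (channel L H) <= N'" "!!x. x : N' ==> ph x = 0"
 using ph unfolding cutoff_def by blast
 define Ph where "Ph x = ph x *R e2" for x
 have Phs: "smooth Ph" unfolding Ph_def[abs_def] by (intro smooth_scaleR smooth_const N)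
 \<comment> \<open>A cutoff is unrestricted outside the channel away from the frontier, so the
   difference is set to 0 there. It stays smooth because \<open>Ph\<close> and \<open>ps\<close>
   both vanish near the frontier.\<close>
 define th where "th x = (if x : channel L H then Ph x - ps x else 0)" for x
 define K where "K = closure (channel L H) - (N \<inter> N0) - (N' \<inter> N1)"
 have th0: "th x = 0" if "x : N' \<inter> N1" for x
 using that N'(3) ps(3) by (simp add: th_def Ph_def N1_def)
 have ths: "smooth th"
 proof (rule smooth_cong_local)
 fix x
 consider "x : channel L H" | "x ~: closure (channel L H)" | "x : frontier (channel L H)"
 using open_channel[of L H] by (auto simp: frontier_def interior_open)
 thus "\<exists>N g. open N & x : N & smooth g & (\<forall>y\<in>N. th y = g y)"
 proof cases
 case 1
 have "smooth (%x. Ph x - ps x)" by (intro smooth_diff Phs ps)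
 thus ?thesis using 1 open_channel[of L H]
 by (intro exI[of _ "channel L H"] exI[of _ "%x. Ph x - ps x"]) (simp add: th_def)
 next
 case 2
 have "th y = 0" if "y : - closure (channel L H)" for y using that closure_subset by (auto simp: th_def)
 thus ?thesis using 2
 by (intro exI[of _ "- closure (channel L H)"] exI[of _ "%x. 0"]) (simp add: open_Compl)
 next
 case 3
 hence "x ~: channel L H" using open_channel[of L H] by (auto simp: frontier_def interior_open)
 hence "x : N' \<inter> N1" using 3 N'(2) fr by blast
 thus ?thesis using th0 N'(1) oN(2)
 by (intro exI[of _ "N' \<inter> N1"] exI[of _ "%x. 0"]) (simp add: open_Int)
 qed
 qed
 have th: "th : test_functions S"
 proof (rule test_functionsI[OF ths, of K])
 have "closed K" unfolding K_def using N(2) N'(1) oN by (intro closed_Diff closed_closure open_Int)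
 moreover have "bounded K" unfolding K_def
 by (rule bounded_subset[OF bounded_closure[OF bounded_channel[of L H]]]) auto
 ultimately show "compact K" by (simp add: compact_eq_bounded_closed)
 show "K <= S"
 proof
 fix x assume x: "x : K"
 have "x ~: B" using x N(3) core by (auto simp: K_def N0_def)
 moreover have "x : channel L H"
 proof (rule ccontr)
 assume n: "x ~: channel L H"
 hence "x : frontier (channel L H)" using x open_channel[of L H] by (simp add: K_def frontier_def interior_open)
 hence "x : N' \<inter> N1" using N'(2) fr[OF n] by blast
 thus False using x by (simp add: K_def)
 qed
 ultimately show "x : S" by (simp add: S_def)
 qed
 show "th x = 0" if xK: "x ~: K" for x
 proof -
 consider "x ~: channel L H" | "x : N \<inter> N0" | "x : N' \<inter> N1"
 using xK closure_subset[of "channel L H"] unfolding K_def by blast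
 thus ?thesis
 proof cases
 case 1
 thus ?thesis by (simp add: th_def)
 next
 case 2
 thus ?thesis using N(4)[of x] ps(2)[of x] by (simp add: th_def Ph_def N0_def)
 next
 case 3
 thus ?thesis by (rule th0)
 qed
 qed
 qed
 let ?G = "%f x. matrix (fd f x) :: real^2^2"
 have sp: "?G Ph x = ?G ps x + ?G th x" "Ph x = ps x + th x" if "x : S" for x
 proof -
 have x: "x : channel L H" using that by (simp add: S_def)
 thus "Ph x = ps x + th x" by (simp add: th_def)
 have "(Ph has_derivative (%h. fd ps x h + fd th x h)) (at x)"
 by (rule has_derivative_transform_within_open[OF has_derivative_add[OF smooth_has_derivative[OF ps(1)] smooth_has_derivative[OF ths]] open_channel x])
 (simp add: th_def)
 from frechet_derivative_at[OF this, symmetric] show "?G Ph x = ?G ps x + ?G th x"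
 by (simp add: vec_eq_iff matrix_nth)
 qed
 have spc: "space ?M = S" by (simp add: space_restrict_space)
 have qG: "sq_integrable ?M (?G ps)" "sq_integrable ?M (?G th)" by (intro matrix_frechet_sq_integrable S ps ths)+
 obtain C1 where C1: "C1 > 0" "!!x. x : S ==> norm (ps x) <= C1" by (rule smooth_bounded_on[OF ps(1) S(2)]) blast
 obtain C2 where C2: "C2 > 0" "!!x. x : S ==> norm (th x) <= C2" by (rule smooth_bounded_on[OF ths S(2)]) blast
 have m: "ps : borel_measurable ?M" "th : borel_measurable ?M"
 by (intro continuous_imp_measurable_on_sets_lebesgue smooth_continuous_on ps ths Sl)+
 have c1: "integrable ?M (%x. (?g x *v u x) \<bullet> ps x)"
 by (rule convection_bounded_bound(1)[OF g uq m(1), of C1]) (simp_all add: C1 spc less_imp_le)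
 have c2: "integrable ?M (%x. (?g x *v u x) \<bullet> th x)"
 by (rule convection_bounded_bound(1)[OF g uq m(2), of C2]) (simp_all add: C2 spc less_imp_le)
 have cI: "(LINT x:S|lebesgue. convection S u x \<bullet> (ph x *R e2)) = (LINT x|?M. (?g x *v u x) \<bullet> ps x) + (LINT x|?M. (?g x *v u x) \<bullet> th x)"
 proof -
 have "(LINT x:S|lebesgue. convection S u x \<bullet> (ph x *R e2)) = (LINT x|?M. (?g x *v u x) \<bullet> ps x + (?g x *v u x) \<bullet> th x)"
 unfolding LINT_lebesgue_on[OF Sl] Ph_def[symmetric]
 by (rule Bochner_Integration.integral_cong) (simp_all add: convection_def sp(2) spc inner_add_right)
 thus ?thesis using c1 c2 by simp
 qed
 have tr: "mat 1 \<bullet> A = trace A" for A :: "real^2^2"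
 by (simp add: inner_matrix2 trace_def sum_2 mat_def)
 have trm: "integrable ?M (%x. p x * trace (?G th x))"
 proof -
 have "integrable ?M (%x. (p x *R mat 1) \<bullet> ?G th x)"
 proof (rule L2_inner_bound(1)[OF _ qG(2)])
 have mm: "(%x. p x *R (mat 1 :: real^2^2)) : borel_measurable ?M"
 using sq_integrable_measurable[OF p] by measurable
 show "sq_integrable ?M (%x. p x *R (mat 1 :: real^2^2))"
 by (rule sq_integrable_bound[OF p mm, of "norm (mat 1 :: real^2^2)"]) (simp add: mult.commute)
 qed
 thus ?thesis by (simp add: tr)
 qed
 note I1 = L2_inner_bound(1)[OF g qG(1)] and I2 = L2_inner_bound(1)[OF g qG(2)]
 and I3 = L2_inner_bound(1)[OF gt qG(1)] and I4 = L2_inner_bound(1)[OF gt qG(2)]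
 have sI: "(LINT x:S|lebesgue. stress S u p x \<bullet> matrix (fd (%y. ph y *R e2) x)) =
 (LINT x|?M. (?g x + transpose (?g x)) \<bullet> ?G ps x) + ((LINT x|?M. ?g x \<bullet> ?G th x) + (LINT x|?M. transpose (?g x) \<bullet> ?G th x) - (LINT x|?M. p x * trace (?G th x)))"
 proof -
 have "(LINT x:S|lebesgue. stress S u p x \<bullet> matrix (fd (%y. ph y *R e2) x)) =
 (LINT x|?M. (?g x \<bullet> ?G ps x + transpose (?g x) \<bullet> ?G ps x) + ((?g x \<bullet> ?G th x + transpose (?g x) \<bullet> ?G th x) - p x * trace (?G th x)))"
 unfolding LINT_lebesgue_on[OF Sl] Ph_def[abs_def, symmetric]
 proof (rule Bochner_Integration.integral_cong[OF refl])
 fix x assume "x : space ?M"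
 hence x: "x : S" by (simp add: spc)
 show "stress S u p x \<bullet> matrix (fd Ph x) =
 (?g x \<bullet> ?G ps x + transpose (?g x) \<bullet> ?G ps x) + ((?g x \<bullet> ?G th x + transpose (?g x) \<bullet> ?G th x) - p x * trace (?G th x))"
 unfolding sp(1)[OF x] stress_def
 by (simp add: inner_add_left inner_add_right inner_diff_left tr ps(4))
 qed
 thus ?thesis using I1 I2 I3 I4 trm by (simp add: inner_add_left)
 qed
 have "(LINT x:S|lebesgue. ?g x \<bullet> grad S th x) = (LINT x|?M. ?g x \<bullet> ?G th x)"
 unfolding LINT_lebesgue_on[OF Sl]
 proof (rule integral_cong_AE)
 show "AE x in ?M. ?g x \<bullet> grad S th x = ?g x \<bullet> ?G th x" using grad_smooth_AE[OF S ths] by eventually_elim simp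
 have "th : H1 S" by (rule H10_imp_H1[OF test_function_H10[OF th S]])
 from L2_inner_bound(1)[OF g H1_grad_sq_integrable[OF S(1) this]]
 show "(%x. ?g x \<bullet> grad S th x) : borel_measurable ?M" by simp
 show "(%x. ?g x \<bullet> ?G th x) : borel_measurable ?M" using I2 by simp
 qed
 moreover have "(LINT x:S|lebesgue. p x * divergence S th x) = (LINT x|?M. p x * trace (?G th x))"
 unfolding LINT_lebesgue_on[OF Sl]
 proof (rule integral_cong_AE)
 show ae: "AE x in ?M. p x * divergence S th x = p x * trace (?G th x)"
 using grad_smooth_AE[OF S ths] by eventually_elim (simp add: divergence_def)
 show tm: "(%x. p x * trace (?G th x)) : borel_measurable ?M" using trm by simp
 have ae': "AE x in ?M. p x * trace (?G th x) = p x * divergence S th x" using ae by eventually_elim (rule sym)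
 show "(%x. p x * divergence S th x) : borel_measurable ?M"
 by (rule borel_measurable_lebesgue_on_AE[OF tm ae' Sl])
 qed
 moreover have "(LINT x:S|lebesgue. convection S u x \<bullet> th x) = (LINT x|?M. (?g x *v u x) \<bullet> th x)"
 unfolding LINT_lebesgue_on[OF Sl] convection_def ..
 ultimately have "(LINT x|?M. ?g x \<bullet> ?G th x) + (LINT x|?M. (?g x *v u x) \<bullet> th x) - (LINT x|?M. p x * trace (?G th x)) = 0"
 using weak[OF test_function_H10[OF th S]] by simp
 thus ?thesis
 unfolding s sI cI lift_functional_def transpose_grad_test[OF S(1) uH dv th] by simp
 qed
 \<comment> \<open>Without any cutoff the condition under \<open>THE\<close> would hold for every
   number.\<close>
 have ex: "\<exists>ph. cutoff L H B ph"
 proof -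
 obtain rh where rh: "smooth rh" "!!t. (abs t) < a0 ==> rh t = (1::real)" "!!t. (abs t) > a1 ==> rh t = 0" by (rule plateau[OF LH(1,2)]) blast
 obtain si where si: "smooth si" "!!t. (abs t) < b0 ==> si t = (1::real)" "!!t. (abs t) > b1 ==> si t = 0" by (rule plateau[OF LH(4,5)]) blast
 let ?ph = "%x::real^2. rh (x$1) * si (x$2)"
 have "smooth ?ph" by (intro smooth_mult smooth_compose_component rh si)
 moreover have "B <= N0" using core by (auto simp: N0_def)
 moreover have "\<forall>x\<in>N0. ?ph x = 1" using rh si by (simp add: N0_def)
 moreover have "\<forall>x\<in>N1. ?ph x = 0" using rh si by (auto simp: N1_def)
 moreover have "frontier (channel L H) <= N1"
 using fr open_channel[of L H] by (auto simp: frontier_def interior_open)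
 ultimately have "cutoff L H B ?ph" unfolding cutoff_def using oN by blast
 thus ?thesis by (intro exI)
 qed
 show ?thesis
 unfolding vertical_stress_pairing_def Let_def S_def[symmetric]
 proof (rule the_equality)
 show "\<forall>ph. cutoff L H B ph --> lift_functional S ps u =
 (LINT x:S|lebesgue. stress S u p x \<bullet> matrix (fd (%y. ph y *R e2) x))
 + (LINT x:S|lebesgue. convection S u x \<bullet> (ph x *R e2))"
 using eq[OF _ refl] by simp
 show "s = lift_functional S ps u" if "\<forall>ph. cutoff L H B ph --> s =
 (LINT x:S|lebesgue. stress S u p x \<bullet> matrix (fd (%y. ph y *R e2) x))
 + (LINT x:S|lebesgue. convection S u x \<bullet> (ph x *R e2))" for s
 using ex that eq by blast
 qed
qed

text \<open>The functional is the sum of a linear and a quadratic part; the increment is expanded at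
  \<open>u0\<close> and each term is bounded with the smooth field \<open>ps\<close> taken in the
  supremum norm, so no L4 norm is involved.\<close>

lemma lift_functional_diff:
 assumes S: "open S" "bounded S" and ps: "smooth ps" and u: "u0 : H1 S"
 obtains C where "C >= 0" "!!d :: real^2 => real^2. d : H1 S ==> (abs (lift_functional S ps (%x. u0 x + d x) - lift_functional S ps u0)) <=
 C * (L2n (lebesgue_on S) (grad S d) * (1 + L2n (lebesgue_on S) d) + L2n (lebesgue_on S) d)"
proof -
 let ?M = "lebesgue_on S" and ?G = "%x. matrix (fd ps x) :: real^2^2" and ?g = "grad S"
 have Sl: "S : sets lebesgue" using S by simp
 have spc: "space ?M = S" by (simp add: space_restrict_space)
 have qG: "sq_integrable ?M ?G" by (intro matrix_frechet_sq_integrable S ps)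
 obtain C1 where C1: "C1 > 0" "!!x. x : S ==> norm (ps x) <= C1" by (rule smooth_bounded_on[OF ps S(2)]) blast
 have m: "ps : borel_measurable ?M"
 by (intro continuous_imp_measurable_on_sets_lebesgue smooth_continuous_on ps Sl)
 define A where "A = L2n ?M ?G"
 define N where "N = L2n ?M u0"
 define t where "t = L2n ?M (?g u0)"
 have nn: "A >= 0" "N >= 0" "t >= 0" by (simp_all add: A_def N_def t_def)
 define C where "C = 2 * A + C1 * (N + t + 1)"
 show ?thesis
 proof (rule that[of C])
 show "C >= 0" unfolding C_def using nn C1 by simp
 fix d :: "real^2 => real^2" assume d: "d : H1 S"
 let ?u = "%x. u0 x + d x"
 have uH: "?u : H1 S" by (rule H1_add[OF u d])
 note G = H1_grad_sq_integrable[OF S(1)]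
 have gu: "AE x in ?M. ?g ?u x = ?g u0 x + ?g d x" by (rule grad_add_AE[OF S(1) u d])
 note gd = G[OF d] and g0 = G[OF u] and g1 = G[OF uH]
 note T = transpose_sq_integrable
 have I: "integrable ?M (%x. (?g v x + transpose (?g v x)) \<bullet> ?G x)"
 "(abs (\<integral>x. (?g v x + transpose (?g v x)) \<bullet> ?G x \<partial>?M)) <= 2 * L2n ?M (?g v) * A" if "v : H1 S" for v
 proof -
 have q: "sq_integrable ?M (%x. ?g v x + transpose (?g v x))" by (intro sq_integrable_add G that T)
 note * = L2_inner_bound[OF q qG]
 show "integrable ?M (%x. (?g v x + transpose (?g v x)) \<bullet> ?G x)" by (rule *(1))
 have "L2n ?M (%x. ?g v x + transpose (?g v x)) <= 2 * L2n ?M (?g v)"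
 using L2n_triangle[OF G[OF that] T(1)[OF G[OF that]]] T(2)[OF G[OF that]] by simp
 hence "L2n ?M (%x. ?g v x + transpose (?g v x)) * A <= 2 * L2n ?M (?g v) * A" using nn by (intro mult_right_mono) auto
 thus "(abs (\<integral>x. (?g v x + transpose (?g v x)) \<bullet> ?G x \<partial>?M)) <= 2 * L2n ?M (?g v) * A"
 using *(2) unfolding A_def by linarith
 qed
 have tadd: "transpose (X + Y) = transpose X + transpose Y" for X Y :: "real^2^2" by (simp add: transpose_def vec_eq_iff)
 have e1: "(LINT x|?M. (?g ?u x + transpose (?g ?u x)) \<bullet> ?G x) =
 (LINT x|?M. (?g u0 x + transpose (?g u0 x)) \<bullet> ?G x) + (LINT x|?M. (?g d x + transpose (?g d x)) \<bullet> ?G x)"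
 proof -
 have "(LINT x|?M. (?g ?u x + transpose (?g ?u x)) \<bullet> ?G x) =
 (LINT x|?M. (?g u0 x + transpose (?g u0 x)) \<bullet> ?G x + (?g d x + transpose (?g d x)) \<bullet> ?G x)"
 proof (rule integral_cong_AE)
 show "AE x in ?M. (?g ?u x + transpose (?g ?u x)) \<bullet> ?G x = (?g u0 x + transpose (?g u0 x)) \<bullet> ?G x + (?g d x + transpose (?g d x)) \<bullet> ?G x"
 using gu by eventually_elim (simp add: tadd inner_add_left)
 qed (use I(1)[OF uH] I(1)[OF u] I(1)[OF d] in auto)
 thus ?thesis using I(1)[OF u] I(1)[OF d] by simp
 qed
 have C1': "x : space ?M ==> norm (ps x) <= C1" for x using C1 spc by simp
 have C10: "C1 >= 0" using C1 by simp
 note B = convection_bounded_bound[OF _ _ m C1' C10]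
 note uq = H1_sq_integrable
 note B1 = B[OF gd uq[OF u]] and B2 = B[OF gd uq[OF d]] and B3 = B[OF g0 uq[OF d]]
 have e2: "(LINT x|?M. (?g ?u x *v ?u x) \<bullet> ps x) = (LINT x|?M. (?g u0 x *v u0 x) \<bullet> ps x) +
 ((LINT x|?M. (?g d x *v u0 x) \<bullet> ps x) + ((LINT x|?M. (?g d x *v d x) \<bullet> ps x) + (LINT x|?M. (?g u0 x *v d x) \<bullet> ps x)))"
 proof -
 have "(LINT x|?M. (?g ?u x *v ?u x) \<bullet> ps x) = (LINT x|?M. (?g u0 x *v u0 x) \<bullet> ps x +
 ((?g d x *v u0 x) \<bullet> ps x + ((?g d x *v d x) \<bullet> ps x + (?g u0 x *v d x) \<bullet> ps x)))"
 proof (rule integral_cong_AE)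
 show "AE x in ?M. (?g ?u x *v ?u x) \<bullet> ps x = (?g u0 x *v u0 x) \<bullet> ps x +
 ((?g d x *v u0 x) \<bullet> ps x + ((?g d x *v d x) \<bullet> ps x + (?g u0 x *v d x) \<bullet> ps x))"
 using gu by eventually_elim
 (simp add: matrix_vector_mult_add_rdistrib matrix_vector_right_distrib inner_add_left)
 qed (use B(1)[OF g1 uq[OF uH]] B(1)[OF g0 uq[OF u]] B1(1) B2(1) B3(1) in auto)
 thus ?thesis using B(1)[OF g0 uq[OF u]] B1(1) B2(1) B3(1) by simp
 qed
 define X where "X = L2n ?M (?g d)"
 define Y where "Y = L2n ?M d"
 have XY: "X >= 0" "Y >= 0" by (simp_all add: X_def Y_def)
 have "(abs (lift_functional S ps ?u - lift_functional S ps u0)) <= 2 * X * A + C1 * (X * N) + C1 * (X * Y) + C1 * (t * Y)"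
 unfolding lift_functional_def e1 e2
 using I(2)[OF d] B1(2) B2(2) B3(2) unfolding X_def[symmetric] Y_def[symmetric] N_def[symmetric] t_def[symmetric] by linarith
 also have "... <= C * (X * (1 + Y) + Y)"
 proof -
 have "0 <= 2 * A * (X * Y) + 2 * A * Y + C1 * (N * (X * Y)) + C1 * (N * Y) + C1 * (t * X) + C1 * (t * (X * Y)) + C1 * X + C1 * Y"
 using nn XY C10 by (intro add_nonneg_nonneg mult_nonneg_nonneg) auto
 moreover have "C * (X * (1 + Y) + Y) = (2 * X * A + C1 * (X * N) + C1 * (X * Y) + C1 * (t * Y)) +
 (2 * A * (X * Y) + 2 * A * Y + C1 * (N * (X * Y)) + C1 * (N * Y) + C1 * (t * X) + C1 * (t * (X * Y)) + C1 * X + C1 * Y)"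
 by (simp add: C_def algebra_simps)
 ultimately show ?thesis by linarith
 qed
 finally show "(abs (lift_functional S ps (%x. u0 x + d x) - lift_functional S ps u0)) <= C * (X * (1 + Y) + Y)" .
 qed
qed

section \<open>Stability of the lift\<close>

lemma profile_mono: "profile H G V g ==> G <= G' ==> profile H G' V g"
 unfolding profile_def by (meson order_trans)

text \<open>The difference is \<open>a' * (V' - V) + (a' - a) * V\<close>: small in supremum when
  the data are close. Its density, by contrast, keeps the bound \<open>2 * \<Lambda> * r\<close>
  however close the data are.\<close>

lemma flow_difference:
 fixes a a' \<Lambda> :: real
 assumes H: "H > 0" and r: "r > 0" and V: "(Vin, Vout) : flow_shapes H r U" "V : {Vin, Vout}"
 and V': "(Vin', Vout') : flow_shapes H r U" "V' : {Vin', Vout'}"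
 and lam: "0 <= a" "a <= \<Lambda>" "0 <= a'" "a' <= \<Lambda>" and close: "!!y. y : {-H..H} ==> (abs (V' y - V y)) <= de"
 obtains g where "profile H (2 * \<Lambda> * r) (%y. a' * V' y - a * V y) g" "a' * V' H - a * V H = (a' - a) * U"
 "(LINT y:{-H<..<H}|lebesgue. a' * V' y - a * V y) = a' - a"
 "!!y. y : {-H..H} ==> (abs (a' * V' y - a * V y)) <= \<Lambda> * de + (abs (a' - a)) * (2 * H * r)"
proof -
 obtain g where g: "profile H r V g" "V H = U" "(LINT y:{-H<..<H}|lebesgue. V y) = 1"
 by (rule flow_shapes_profile[OF H V r]) blast
 obtain g' where g': "profile H r V' g'" "V' H = U" "(LINT y:{-H<..<H}|lebesgue. V' y) = 1"
 by (rule flow_shapes_profile[OF H V' r]) blast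
 have p: "profile H ((abs a') * r + (abs a) * r) (%y. a' * V' y - a * V y) (%y. a' * g' y - a * g y)"
 by (rule profile_diff[OF g'(1) g(1)])
 have "(abs a') * r + (abs a) * r <= \<Lambda> * r + \<Lambda> * r" using lam r by (intro add_mono mult_right_mono) auto
 hence le: "(abs a') * r + (abs a) * r <= 2 * \<Lambda> * r" by simp
 have i: "set_integrable lebesgue {-H<..<H} W" if "profile H r W h" for W h
 proof -
 have "set_integrable lebesgue {-H..H} W" using profile_set_integrable[OF that, of H] H by simp
 thus ?thesis by (rule set_integrable_subset) auto
 qed
 have "(LINT y:{-H<..<H}|lebesgue. a' * V' y - a * V y) = (LINT y:{-H<..<H}|lebesgue. a' * V' y) - (LINT y:{-H<..<H}|lebesgue. a * V y)"
 using i[OF g(1)] i[OF g'(1)] by (intro set_integral_diff set_integrable_mult_right) auto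
 hence int: "(LINT y:{-H<..<H}|lebesgue. a' * V' y - a * V y) = a' - a" using g(3) g'(3) by simp
 have bd: "(abs (a' * V' y - a * V y)) <= \<Lambda> * de + (abs (a' - a)) * (2 * H * r)" if y: "y : {-H..H}" for y
 proof -
 have eq: "a' * V' y - a * V y = a' * (V' y - V y) + (a' - a) * V y" by (simp add: algebra_simps)
 have "(abs (a' * (V' y - V y))) <= \<Lambda> * de" unfolding abs_mult using lam close[OF y] by (intro mult_mono) auto
 moreover have "(abs ((a' - a) * V y)) <= (abs (a' - a)) * (2 * H * r)"
 unfolding abs_mult using profile_bounded[OF g(1) y] by (intro mult_left_mono) (auto simp: algebra_simps)
 ultimately show ?thesis unfolding eq by linarith
 qed
 have val: "a' * V' H - a * V H = (a' - a) * U" unfolding g(2) g'(2) by (simp add: left_diff_distrib)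
 show ?thesis by (rule that[OF profile_mono[OF p le] val int bd])
qed

lemma weak_solutionD:
 assumes "weak_solution L H B U lam Vin Vout u p" "compact B"
 defines "S \<equiv> channel L H - B"
 shows "u : H1 S" "AE x in lebesgue_on S. divergence S u x = 0"
 and "\<exists>g. has_trace S u g & (AE x in hausdorff1. (x : frontier B --> g x = 0) & (x : side_b L H --> g x = 0) &
 (x : side_t L H --> g x = (lam * U) *R e1) & (x : side_l L H --> g x = (lam * Vin (x$2)) *R e1) &
 (x : side_r L H --> g x = (lam * Vout (x$2)) *R e1))"
 and "z : H10 S ==> AE x in lebesgue_on S. divergence S z x = 0 ==>
 (LINT x|lebesgue_on S. grad S u x \<bullet> grad S z x) + (LINT x|lebesgue_on S. (grad S u x *v u x) \<bullet> z x) = 0"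
proof -
 have Sl: "S : sets lebesgue" unfolding S_def by (intro open_sets_lebesgue open_fluid assms)
 show "u : H1 S" "AE x in lebesgue_on S. divergence S u x = 0"
 using assms(1) unfolding weak_solution_def Let_def V_star_def H1_star_def S_def by auto
 show "\<exists>g. has_trace S u g & (AE x in hausdorff1. (x : frontier B --> g x = 0) & (x : side_b L H --> g x = 0) &
 (x : side_t L H --> g x = (lam * U) *R e1) & (x : side_l L H --> g x = (lam * Vin (x$2)) *R e1) &
 (x : side_r L H --> g x = (lam * Vout (x$2)) *R e1))"
 using assms(1) unfolding weak_solution_def Let_def attains_boundary_data_def S_def by blast
 assume z: "z : H10 S" and dv: "AE x in lebesgue_on S. divergence S z x = 0"
 have "(LINT x:S|lebesgue. grad S u x \<bullet> grad S z x) + (LINT x:S|lebesgue. convection S u x \<bullet> z x)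
 - (LINT x:S|lebesgue. p x * divergence S z x) = 0"
 using assms(1) z unfolding weak_solution_def Let_def S_def by blast
 moreover have "(LINT x:S|lebesgue. p x * divergence S z x) = 0"
 unfolding LINT_lebesgue_on[OF Sl]
 proof (rule integral_eq_zero_AE)
 show "AE x in lebesgue_on S. p x * divergence S z x = 0" using dv by eventually_elim simp
 qed
 ultimately show "(LINT x|lebesgue_on S. grad S u x \<bullet> grad S z x) + (LINT x|lebesgue_on S. (grad S u x *v u x) \<bullet> z x) = 0"
 unfolding LINT_lebesgue_on[OF Sl] convection_def by simp
qed

lemma divergence_diff_AE:
 assumes "open S" "u : H1 S" "v : H1 S" "AE x in lebesgue_on S. divergence S u x = 0" "AE x in lebesgue_on S. divergence S v x = 0"
 shows "AE x in lebesgue_on S. divergence S (%x. u x - v x) x = 0"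
 using grad_diff_AE[OF assms(1-3)] assms(4,5)
 by eventually_elim (simp add: divergence_def trace_sub)

lemma L2n_grad_add:
 assumes "open S" "u : H1 S" "v : H1 S"
 shows "L2n (lebesgue_on S) (grad S (%x. u x + v x)) <= L2n (lebesgue_on S) (grad S u) + L2n (lebesgue_on S) (grad S v)"
proof -
 note G = H1_grad_sq_integrable[OF assms(1)]
 have "L2n (lebesgue_on S) (grad S (%x. u x + v x)) = L2n (lebesgue_on S) (%x. grad S u x + grad S v x)"
 using G[OF assms(2)] G[OF assms(3)] G[OF H1_add[OF assms(2,3)]]
 by (intro L2n_cong_AE[OF grad_add_AE[OF assms]]) (auto simp: sq_integrable_def)
 thus ?thesis using L2n_triangle[OF G[OF assms(2)] G[OF assms(3)]] by simp
qed

lemma uniqueness_thresholdD: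
 assumes "uniqueness_threshold L H r D \<alpha> U \<Lambda>" "B : bodies \<alpha> D" "(Vin, Vout) : flow_shapes H r U" "lam : {0..\<Lambda>}"
 shows "has_unique_weak_solution L H B U lam Vin Vout"
 and "weak_solution L H B U lam Vin Vout u p ==> Lp_norm 2 (channel L H - B) (grad (channel L H - B) u) < S0 (channel L H - B)"
proof -
 obtain C where "\<forall>B \<in> bodies \<alpha> D. \<forall>(Vin, Vout) \<in> flow_shapes H r U. \<forall>lam \<in> {0..\<Lambda>}.
 has_unique_weak_solution L H B U lam Vin Vout &
 (\<forall>u p. weak_solution L H B U lam Vin Vout u p -->
 Lp_norm 2 (channel L H - B) (grad (channel L H - B) u) < S0 (channel L H - B) &
 Lp_norm 2 (channel L H - B) (grad (channel L H - B) u) <= C * lam)"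
 using assms(1) unfolding uniqueness_threshold_def by (elim conjE exE) (rule that; assumption)
 note * = bspec[OF bspec[OF bspec[OF this assms(2)] assms(3), unfolded prod.case] assms(4)]
 show "has_unique_weak_solution L H B U lam Vin Vout"
 "weak_solution L H B U lam Vin Vout u p ==> Lp_norm 2 (channel L H - B) (grad (channel L H - B) u) < S0 (channel L H - B)"
 using * by blast+
qed

text \<open>All solutions with nearby parameters are covered at once, \<open>lam\<close> and both
  flow shapes varying together; fixing the shapes gives continuity in \<open>lam\<close>, and the
  approximating shapes give the limit.\<close>

definition lift_close where
 "lift_close L H r U B \<Lambda> Vin Vout lam l e de \<longleftrightarrow> (\<forall>lam'\<in>{0..\<Lambda>}. \<forall>Vin' Vout' u' p'. (Vin', Vout') : flow_shapes H r U --> (abs (lam' - lam)) < de -->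
 (\<forall>y\<in>{-H..H}. (abs (Vin' y - Vin y)) < de) --> (\<forall>y\<in>{-H..H}. (abs (Vout' y - Vout y)) < de) -->
 weak_solution L H B U lam' Vin' Vout' u' p' --> (abs (lift L H B u' p' - l)) < e)"

text \<open>The constants are chosen in the order \<open>ep\<close>, \<open>et\<close>,
  \<open>de1\<close>, \<open>K\<close>, \<open>s\<close>, \<open>de\<close>. Since \<open>K\<close>
  belongs to the tolerance \<open>de1 / 4\<close>, the closeness of the data can be prescribed only
  after it.\<close>

theorem lift_stability:
 assumes geom: "L > H" "H > 0" "D <= channel L H" "0 < \<alpha>" "r > 0" "B : bodies \<alpha> D"
 and thr: "uniqueness_threshold L H r D \<alpha> U \<Lambda>"
 and V: "(Vin, Vout) : flow_shapes H r U" and lam: "lam : {0..\<Lambda>}"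
 and sol: "weak_solution L H B U lam Vin Vout u0 p0" and e: "e > 0"
 shows "\<exists>de>0. lift_close L H r U B \<Lambda> Vin Vout lam (lift L H B u0 p0) e de"
proof -
 have B: "B ~= {}" "compact B" "convex B" "B <= D" "measure lebesgue B > 0" using geom by (auto simp: bodies_def)
 have BR: "B <= channel L H" using B geom by blast
 obtain c rh where cb: "rh > 0" "cball c rh <= B" by (rule convex_interior_cball[OF B(3,5)]) blast
 obtain a0 b0 where core: "0 < a0" "a0 < L" "0 < b0" "b0 < H" "!!x. x : B ==> (abs (x$1)) < a0 & (abs (x$2)) < b0"
 by (rule compact_subset_channel_core[OF B(2,1) BR]) blast
 have \<Lambda>: "\<Lambda> > 0" using thr by (simp add: uniqueness_threshold_def)
 have lam': "0 <= lam" "lam <= \<Lambda>" using lam by auto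
 define S where "S = channel L H - B"
 let ?M = "lebesgue_on S" and ?g = "grad S"
 have S: "open S" "bounded S" unfolding S_def by (rule open_fluid[OF B(2)], rule bounded_fluid)
 have Sl: "S : sets lebesgue" using S by simp
 have spc: "space ?M = S" by (simp add: space_restrict_space)
 have fin: "finite_measure ?M" by (rule finite_measure_bounded_lebesgue_on[OF S(2) Sl])
 \<comment> \<open>Fourth root of the area: it converts suprema into L4 norms and L4 norms into L2
   norms.\<close>
 define m where "m = sqrt (sqrt (measure ?M (space ?M)))"
 have m0: "m >= 0" by (simp add: m_def)
 note D0 = weak_solutionD[OF sol B(2), folded S_def]
 define t where "t = L2n ?M (?g u0)"
 have t0: "t >= 0" by (simp add: t_def)
 \<comment> \<open>The threshold also yields \<open>S0 S > 0\<close>, because \<open>t\<close> is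
   nonnegative; the L4 estimates rest on this.\<close>
 have "t < S0 S" using uniqueness_thresholdD(2)[OF thr geom(6) V lam sol] by (simp add: t_def S_def[symmetric] Lp_norm_2[OF Sl])
 hence S0: "S0 S > 0" "t < S0 S" using t0 by auto
 define k where "k = 1 / sqrt (S0 S)"
 have k0: "k >= 0" using S0 by (simp add: k_def)
 have "t * k\<^sup>2 = t / S0 S" using S0 by (simp add: k_def power_divide)
 hence tk: "t * k\<^sup>2 < 1" using S0 by simp
 define G where "G = 2 * \<Lambda> * r"
 have G0: "G >= 0" using \<Lambda> geom by (simp add: G_def)
 obtain g0 where g0: "has_trace S u0 g0" "AE x in hausdorff1. (x : frontier B --> g0 x = 0) & (x : side_b L H --> g0 x = 0) &
 (x : side_t L H --> g0 x = (lam * U) *R e1) & (x : side_l L H --> g0 x = (lam * Vin (x$2)) *R e1) &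
 (x : side_r L H --> g0 x = (lam * Vout (x$2)) *R e1)"
 using D0(3) by blast
 have lifting: "\<exists>K. lifting_bound L H B G U K et" if "et > 0" for et
 by (rule boundary_lifting[OF core B(2,3) cb(2,1) BR G0 that])
 \<comment> \<open>Obtained by lifting the boundary data of \<open>u0\<close> itself, written as a
   difference with second coefficient 0: \<open>u0\<close> is a bounded field plus an element of
   \<open>H10\<close>, and both are fourth-power integrable.\<close>
 have u04: "L4_integrable ?M u0"
 proof -
 obtain K where "lifting_bound L H B G U K 1" using lifting[OF zero_less_one] ..
 note K = this[unfolded lifting_bound_def, folded S_def]
 obtain gi where gi: "profile H (2 * \<Lambda> * r) (%y. lam * Vin y - 0 * Vin y) gi" "lam * Vin H - 0 * Vin H = (lam - 0) * U"
 "(LINT y:{-H<..<H}|lebesgue. lam * Vin y - 0 * Vin y) = lam - 0"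
 "!!y. y : {-H..H} ==> (abs (lam * Vin y - 0 * Vin y)) <= \<Lambda> * 0 + (abs (lam - 0)) * (2 * H * r)"
 by (rule flow_difference[OF geom(2,5) V _ V, of Vin Vin 0 \<Lambda> lam 0]) (use lam' in auto)
 obtain go where go: "profile H (2 * \<Lambda> * r) (%y. lam * Vout y - 0 * Vout y) go" "lam * Vout H - 0 * Vout H = (lam - 0) * U"
 "(LINT y:{-H<..<H}|lebesgue. lam * Vout y - 0 * Vout y) = lam - 0"
 "!!y. y : {-H..H} ==> (abs (lam * Vout y - 0 * Vout y)) <= \<Lambda> * 0 + (abs (lam - 0)) * (2 * H * r)"
 by (rule flow_difference[OF geom(2,5) V _ V, of Vout Vout 0 \<Lambda> lam 0]) (use lam' in auto)
 have ae: "AE x in hausdorff1. (x : frontier B --> g0 x = 0) & (x : side_b L H --> g0 x = 0) & (x : side_t L H --> g0 x = ((lam - 0) * U) *R e1) &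
 (x : side_l L H --> g0 x = (lam * Vin (x$2) - 0 * Vin (x$2)) *R e1) & (x : side_r L H --> g0 x = (lam * Vout (x$2) - 0 * Vout (x$2)) *R e1)"
 using g0(2) by simp
 have sb: "\<forall>y\<in>{-H..H}. (abs (lam * Vin y - 0 * Vin y)) <= \<Lambda> * 0 + (abs (lam - 0)) * (2 * H * r)"
 "\<forall>y\<in>{-H..H}. (abs (lam * Vout y - 0 * Vout y)) <= \<Lambda> * 0 + (abs (lam - 0)) * (2 * H * r)"
 using gi(4) go(4) by blast+
 have "boundary_profiles H G U (\<Lambda> * 0 + (abs (lam - 0)) * (2 * H * r)) (lam - 0) (%y. lam * Vin y - 0 * Vin y) (%y. lam * Vout y - 0 * Vout y)"
 unfolding boundary_profiles_def G_def using gi go sb by blast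
 from conjunct2[OF K, rule_format, OF g0(1) ae this]
 obtain w where w: "w : H1 S" "\<forall>x\<in>S. norm (w x) <= K * (\<Lambda> * 0 + (abs (lam - 0)) * (2 * H * r))" "(%x. u0 x - w x) : H10 S" by blast
 have "K * (\<Lambda> * 0 + (abs (lam - 0)) * (2 * H * r)) >= 0" using K geom by simp
 hence w4: "L4_integrable ?M w"
 using w(2) spc by (intro L4_bounded(1)[OF fin sq_integrable_measurable[OF H1_sq_integrable[OF w(1)]], of "K * (\<Lambda> * 0 + (abs (lam - 0)) * (2 * H * r))"]) auto
 have "L4_integrable ?M (%x. (u0 x - w x) + w x)" by (intro L4_add w4 S0_bound(1)[OF S(1) S0(1) w(3)])
 thus ?thesis by simp
 qed
 define N where "N = L4n ?M u0"
 have N0: "N >= 0" by (simp add: N_def)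
 have a1: "a0 < (a0 + L) / 2" "(a0 + L) / 2 < L" "b0 < (b0 + H) / 2" "(b0 + H) / 2 < H" using core by auto
 obtain ps :: "real^2 => real^2" where ps: "smooth ps" "!!x. (abs (x$1)) < a0 ==> (abs (x$2)) < b0 ==> ps x = e2"
 "!!x. (abs (x$1)) > (a0 + L) / 2 \<or> (abs (x$2)) > (b0 + H) / 2 ==> ps x = 0" "!!x. trace (matrix (fd ps x)) = 0"
 by (rule solenoidal_vertical_field[OF core(1) a1(1) core(3) a1(3)]) blast
 have lift_eq: "vertical_stress_pairing L H B v q = lift_functional S ps v" if "weak_solution L H B U l W W' v q" for l W W' v q
 unfolding S_def by (rule vertical_stress_pairing_eq[OF core(1) a1(1,2) core(3) a1(3,4) B(2) core(5) ps that])
 obtain C where C: "C >= 0" "!!d :: real^2 => real^2. d : H1 S ==> (abs (lift_functional S ps (%x. u0 x + d x) - lift_functional S ps u0)) <=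
 C * (L2n ?M (?g d) * (1 + L2n ?M d) + L2n ?M d)"
 by (rule lift_functional_diff[OF S ps(1) D0(1)]) blast
 \<comment> \<open>For \<open>ep <= 1\<close> the bound of \<open>lift_functional_diff\<close> is at
   most \<open>C * (ep * (1 + 1) + ep)\<close>, and this is below \<open>e\<close>.\<close>
 define ep where "ep = min 1 (e / (4 * (C + 1)))"
 have ep: "ep > 0" "ep <= 1" using e C(1) by (auto simp: ep_def)
 have Cep: "C * (3 * ep) < e"
 proof -
 have c4: "4 * (C + 1) > 0" using C(1) by simp
 have "ep <= e / (4 * (C + 1))" by (simp add: ep_def)
 hence "ep * (4 * (C + 1)) <= e" using pos_le_divide_eq[OF c4] by blast
 moreover have "ep * (4 * (C + 1)) = C * (3 * ep) + (C * ep + 4 * ep)" by (simp add: algebra_simps)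
 moreover have "C * ep >= 0" using C(1) ep by simp
 ultimately show ?thesis using ep(1) by linarith
 qed
 \<comment> \<open>The gradient of the difference will be at most \<open>2 * et\<close> and its L2
   norm at most \<open>m * (k + 1) * et\<close>, where \<open>k * et\<close> bounds the L4 norm of
   \<open>z\<close> and \<open>et\<close> that of \<open>w\<close>; both have to stay below
   \<open>ep\<close>.\<close>
 define et where "et = ep / (2 + m * (k + 1))"
 have P: "2 + m * (k + 1) > 0" using m0 k0 by (intro add_pos_nonneg) auto
 have et: "et > 0" using ep P by (simp add: et_def)
 have "et * (2 + m * (k + 1)) = ep" using P by (simp add: et_def)
 hence et2: "2 * et <= ep" "m * (k + 1) * et <= ep"
 proof -
 assume h: "et * (2 + m * (k + 1)) = ep"
 have "et * (2 + m * (k + 1)) = 2 * et + m * (k + 1) * et" by (simp add: algebra_simps)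
 moreover have "0 <= m * (k + 1) * et" using m0 k0 et by simp
 ultimately show "2 * et <= ep" "m * (k + 1) * et <= ep" using h et by linarith+
 qed
 obtain de1 where de1: "de1 > 0" "de1 <= et"
 "!!X y a b. 0 <= X ==> 0 <= y ==> 0 <= a ==> 0 <= b ==> a <= de1 ==> b <= de1 ==> y <= k * X ==>
 X\<^sup>2 <= a * X + a * (N * y) + a * (y * y) + a * (b * y) + t * (y * y) + t * (b * y) ==> X <= et"
 by (rule small_energy[OF k0 t0 N0 tk et]) blast
 have de4: "de1 / 4 > 0" using de1 by simp
 obtain K where "lifting_bound L H B G U K (de1 / 4)" using lifting[OF de4] ..
 hence K: "K >= 0" and Kb: "!!d g Vin Vout c s. has_trace S d g ==>
 AE x in hausdorff1. (x : frontier B --> g x = 0) & (x : side_b L H --> g x = 0) & (x : side_t L H --> g x = (c * U) *R e1) &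
 (x : side_l L H --> g x = Vin (x$2) *R e1) & (x : side_r L H --> g x = Vout (x$2) *R e1) ==>
 boundary_profiles H G U s c Vin Vout ==>
 \<exists>w. w : H1 S & (\<forall>x\<in>S. norm (w x) <= K * s) & L2n ?M (?g w) <= 2 * (K * s + de1 / 4) &
 (AE x in ?M. divergence S w x = 0) & (%x. d x - w x) : H10 S"
 unfolding lifting_bound_def S_def[symmetric] by blast+
 \<comment> \<open>With this \<open>s\<close> the lifted field has gradient norm at most
   \<open>2 * (K * s + de1 / 4) <= de1\<close> and L4 norm at most \<open>K * s * m <= de1\<close>,
   the two inputs of \<open>small_energy\<close>.\<close>
 define s where "s = de1 / (4 * ((K + 1) * (m + 1)))"
 have Km: "4 * ((K + 1) * (m + 1)) > 0" using K m0 by (intro mult_pos_pos) auto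
 have s0: "s > 0" using de1 Km by (simp add: s_def)
 have s4: "s * (4 * ((K + 1) * (m + 1))) = de1"
 using Km nonzero_divide_eq_eq[of "4 * ((K + 1) * (m + 1))" de1 s] s_def by (metis less_irrefl)
 have sK: "K * s <= de1 / 4" "K * s * m <= de1"
 proof -
 have "s * (4 * ((K + 1) * (m + 1))) = 4 * (K * s) + 4 * (K * s * m) + 4 * (s * m) + 4 * s" by (simp add: algebra_simps)
 moreover have "0 <= K * s" "0 <= K * s * m" "0 <= s * m" using K s0 m0 by auto
 ultimately show "K * s <= de1 / 4" "K * s * m <= de1" using s4 s0 by linarith+
 qed
 \<comment> \<open>Makes the supremum bound of \<open>flow_difference\<close> at most
   \<open>s\<close>.\<close>
 define de where "de = s / (\<Lambda> + 2 * H * r)"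
 have Q: "\<Lambda> + 2 * H * r > 0" using \<Lambda> geom by (intro add_pos_nonneg) auto
 have de: "de > 0" using s0 Q by (simp add: de_def)
 have des: "\<Lambda> * de + de * (2 * H * r) = s"
 proof -
 have "de * (\<Lambda> + 2 * H * r) = s" using Q by (simp add: de_def)
 thus ?thesis by (simp add: algebra_simps)
 qed
 show ?thesis
 unfolding lift_close_def
 proof (intro exI[of _ de] conjI de ballI allI impI)
 fix lam1 Vin' Vout' u' p'
 assume l1: "lam1 : {0..\<Lambda>}" and V': "(Vin', Vout') : flow_shapes H r U" and cl: "(abs (lam1 - lam)) < de"
 and cV: "\<forall>y\<in>{-H..H}. (abs (Vin' y - Vin y)) < de" "\<forall>y\<in>{-H..H}. (abs (Vout' y - Vout y)) < de"
 and sol': "weak_solution L H B U lam1 Vin' Vout' u' p'"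
 note D1 = weak_solutionD[OF sol' B(2), folded S_def]
 have l1': "0 <= lam1" "lam1 <= \<Lambda>" using l1 by auto
 have sle: "\<Lambda> * de + (abs (lam1 - lam)) * (2 * H * r) <= s"
 proof -
 have "(abs (lam1 - lam)) * (2 * H * r) <= de * (2 * H * r)" using cl geom by (intro mult_right_mono) auto
 thus ?thesis using des by linarith
 qed
 have cVi: "(abs (Vin' y - Vin y)) <= de" if "y : {-H..H}" for y using cV(1) that by (simp add: less_imp_le)
 have cVo: "(abs (Vout' y - Vout y)) <= de" if "y : {-H..H}" for y using cV(2) that by (simp add: less_imp_le)
 obtain gi where gi: "profile H (2 * \<Lambda> * r) (%y. lam1 * Vin' y - lam * Vin y) gi" "lam1 * Vin' H - lam * Vin H = (lam1 - lam) * U"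
 "(LINT y:{-H<..<H}|lebesgue. lam1 * Vin' y - lam * Vin y) = lam1 - lam"
 "!!y. y : {-H..H} ==> (abs (lam1 * Vin' y - lam * Vin y)) <= \<Lambda> * de + (abs (lam1 - lam)) * (2 * H * r)"
 by (rule flow_difference[OF geom(2,5) V insertI1 V' insertI1 lam' l1' cVi]) blast+
 obtain go where go: "profile H (2 * \<Lambda> * r) (%y. lam1 * Vout' y - lam * Vout y) go" "lam1 * Vout' H - lam * Vout H = (lam1 - lam) * U"
 "(LINT y:{-H<..<H}|lebesgue. lam1 * Vout' y - lam * Vout y) = lam1 - lam"
 "!!y. y : {-H..H} ==> (abs (lam1 * Vout' y - lam * Vout y)) <= \<Lambda> * de + (abs (lam1 - lam)) * (2 * H * r)"
 by (rule flow_difference[OF geom(2,5) V insertI2[OF singletonI] V' insertI2[OF singletonI] lam' l1' cVo]) blast+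
 obtain g1 where g1: "has_trace S u' g1" "AE x in hausdorff1. (x : frontier B --> g1 x = 0) & (x : side_b L H --> g1 x = 0) &
 (x : side_t L H --> g1 x = (lam1 * U) *R e1) & (x : side_l L H --> g1 x = (lam1 * Vin' (x$2)) *R e1) &
 (x : side_r L H --> g1 x = (lam1 * Vout' (x$2)) *R e1)"
 using D1(3) by blast
 have tr: "has_trace S (%x. u' x - u0 x) (%x. g1 x - g0 x)" by (rule has_trace_diff[OF S g1(1) g0(1)])
 have ae: "AE x in hausdorff1. (x : frontier B --> g1 x - g0 x = 0) & (x : side_b L H --> g1 x - g0 x = 0) &
 (x : side_t L H --> g1 x - g0 x = ((lam1 - lam) * U) *R e1) &
 (x : side_l L H --> g1 x - g0 x = (lam1 * Vin' (x$2) - lam * Vin (x$2)) *R e1) &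
 (x : side_r L H --> g1 x - g0 x = (lam1 * Vout' (x$2) - lam * Vout (x$2)) *R e1)"
 using g1(2) g0(2) by eventually_elim (auto simp: left_diff_distrib scaleR_left_diff_distrib)
 have sb: "\<forall>y\<in>{-H..H}. (abs (lam1 * Vin' y - lam * Vin y)) <= s" "\<forall>y\<in>{-H..H}. (abs (lam1 * Vout' y - lam * Vout y)) <= s"
 using order_trans[OF gi(4) sle] order_trans[OF go(4) sle] by blast+
 have "boundary_profiles H G U s (lam1 - lam) (%y. lam1 * Vin' y - lam * Vin y) (%y. lam1 * Vout' y - lam * Vout y)"
 unfolding boundary_profiles_def G_def using gi go sb by blast
 from Kb[OF tr ae this]
 obtain w where w: "w : H1 S" "\<forall>x\<in>S. norm (w x) <= K * s" "L2n ?M (?g w) <= 2 * (K * s + de1 / 4)"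
 "AE x in ?M. divergence S w x = 0" "(%x. u' x - u0 x - w x) : H10 S" by blast
 define z where "z x = u' x - u0 x - w x" for x
 have z: "z : H10 S" unfolding z_def[abs_def] by (rule w(5))
 have zH: "z : H1 S" by (rule H10_imp_H1[OF z])
 have Ks: "K * s >= 0" using K s0 by simp
 have wb: "x : space ?M ==> norm (w x) <= K * s" for x using w(2) spc by simp
 have w4: "L4_integrable ?M w" "L4n ?M w <= K * s * sqrt (sqrt (measure ?M (space ?M)))"
 using L4_bounded[OF fin sq_integrable_measurable[OF H1_sq_integrable[OF w(1)]] wb Ks] by simp_all
 have z4: "L4_integrable ?M z" by (rule S0_bound(1)[OF S(1) S0(1) z])
 have dz: "AE x in ?M. divergence S z x = 0"
 unfolding z_def[abs_def]
 by (rule divergence_diff_AE[OF S(1) H1_diff[OF D1(1) D0(1)] w(1) divergence_diff_AE[OF S(1) D1(1) D0(1) D1(2) D0(2)] w(4)])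
 define X where "X = L2n ?M (?g z)"
 define a where "a = L2n ?M (?g w)"
 define y where "y = L4n ?M z"
 define b where "b = L4n ?M w"
 have nn: "X >= 0" "a >= 0" "y >= 0" "b >= 0" by (simp_all add: X_def a_def y_def b_def)
 have "2 * (K * s + de1 / 4) <= 2 * (de1 / 4 + de1 / 4)" using sK(1) by (intro mult_left_mono add_right_mono) auto
 also have "... = de1" by simp
 finally have ad: "a <= de1" unfolding a_def by (rule order_trans[OF w(3)])
 have bd: "b <= de1" unfolding b_def by (rule order_trans[OF w4(2) sK(2)[unfolded m_def]])
 have yk: "y <= k * X" using L4n_le_grad[OF S(1) S0(1) z] by (simp add: y_def X_def k_def)
 have "X\<^sup>2 <= a * X + a * (N * y) + a * (y * y) + a * (b * y) + t * (y * y) + t * (b * y)"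
 unfolding X_def a_def y_def b_def N_def t_def
 by (rule energy_estimate[OF S S0(1) D0(1) u04 D1(1,2) z w(1) w4(1) _ D0(4)[OF z dz] D1(4)[OF z dz]]) (simp add: z_def)
 from de1(3)[OF nn(1,3,2,4) ad bd yk this] have Xet: "X <= et" .
 define d where "d x = z x + w x" for x
 have dH: "d : H1 S" unfolding d_def[abs_def] by (rule H1_add[OF zH w(1)])
 have "L2n ?M (?g d) <= X + a" unfolding d_def[abs_def] X_def a_def by (rule L2n_grad_add[OF S(1) zH w(1)])
 hence Xd: "L2n ?M (?g d) <= ep" using Xet ad de1(2) et2(1) by linarith
 have "L2n ?M d <= L2n ?M z + L2n ?M w"
 unfolding d_def[abs_def] by (rule L2n_triangle[OF H1_sq_integrable[OF zH] H1_sq_integrable[OF w(1)]])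
 also have "... <= y * m + b * m"
 unfolding y_def b_def m_def by (intro add_mono L2n_le_L4n(2)[OF fin] z4 w4(1))
 also have "... <= (k * et) * m + et * m"
 proof (intro add_mono mult_right_mono m0)
 show "y <= k * et" using yk mult_left_mono[OF Xet k0] by linarith
 show "b <= et" using bd de1(2) by linarith
 qed
 also have "... = m * (k + 1) * et" by (simp add: algebra_simps)
 finally have Yd: "L2n ?M d <= ep" using et2(2) by linarith
 have "L2n ?M (?g d) * (1 + L2n ?M d) + L2n ?M d <= ep * (1 + 1) + ep"
 using Xd Yd ep by (intro add_mono mult_mono) auto
 hence "C * (L2n ?M (?g d) * (1 + L2n ?M d) + L2n ?M d) <= C * (3 * ep)" using C(1) by (intro mult_left_mono) auto
 moreover have "(%x. u0 x + d x) = u'" by (auto simp: d_def z_def)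
 ultimately have "(abs (lift_functional S ps u' - lift_functional S ps u0)) < e" using C(2)[OF dH] Cep by simp
 thus "(abs (lift L H B u' p' - lift L H B u0 p0)) < e"
 unfolding lift_def lift_eq[OF sol] lift_eq[OF sol'] by linarith
 qed
qed

theorem theorem2p8:
  fixes L H r U \<alpha> \<Lambda> :: real
    and D B :: "(real^2) set"
    and Vin Vout :: "real \<Rightarrow> real"
    and Vin_eps Vout_eps :: "real \<Rightarrow> real \<Rightarrow> real"
    and u :: "real \<Rightarrow> real^2 \<Rightarrow> real^2"
    and p :: "real \<Rightarrow> real^2 \<Rightarrow> real"
  assumes "L > H" and "H > 0"
    and "homothetic_closed_rectangle L H D" and "D \<subseteq> channel L H"
    and "0 < \<alpha>" and "\<alpha> < measure lebesgue D"
    and "r > 0" and "U \<in> {0, 1}"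
    and "B \<in> bodies \<alpha> D"
    and "(Vin, Vout) \<in> flow_shapes H r U"
    and "uniqueness_threshold L H r D \<alpha> U \<Lambda>"
    and "\<And>lam. lam \<in> {0..\<Lambda>} \<Longrightarrow> weak_solution L H B U lam Vin Vout (u lam) (p lam)"
    and "\<And>\<epsilon>. \<epsilon> > 0 \<Longrightarrow> (Vin_eps \<epsilon>, Vout_eps \<epsilon>) \<in> flow_shapes H r U"
    and "weak_star_W1inf H Vin_eps Vin (at_right 0)"
    and "weak_star_W1inf H Vout_eps Vout (at_right 0)"
  shows "(\<forall>\<epsilon>>0. \<forall>lam\<in>{0..\<Lambda>}. has_unique_weak_solution L H B U lam (Vin_eps \<epsilon>) (Vout_eps \<epsilon>)) \<and>
    (\<forall>u_eps p_eps.
       (\<forall>\<epsilon>>0. \<forall>lam\<in>{0..\<Lambda>}.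
          weak_solution L H B U lam (Vin_eps \<epsilon>) (Vout_eps \<epsilon>) (u_eps \<epsilon> lam) (p_eps \<epsilon> lam)) \<longrightarrow>
       continuous_on {0..\<Lambda>} (\<lambda>lam. lift L H B (u lam) (p lam)) \<and>
       (\<forall>\<epsilon>>0. continuous_on {0..\<Lambda>} (\<lambda>lam. lift L H B (u_eps \<epsilon> lam) (p_eps \<epsilon> lam))) \<and>
       ((\<lambda>\<epsilon>. C_norm 0 \<Lambda> (\<lambda>lam. lift L H B (u_eps \<epsilon> lam) (p_eps \<epsilon> lam)
                                - lift L H B (u lam) (p lam))) \<longlongrightarrow> 0) (at_right 0))"
proof (intro conjI allI impI ballI)
 note V = assms(10) and thr = assms(11) and sol = assms(12) and Ve = assms(13)
 have \<Lambda>: "\<Lambda> > 0" using thr by (simp add: uniqueness_threshold_def)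
 note stab = lift_stability[OF assms(1,2,4,5,7,9) thr]
 show "has_unique_weak_solution L H B U lam (Vin_eps ep) (Vout_eps ep)" if "ep > 0" "lam : {0..\<Lambda>}" for ep lam
 by (rule uniqueness_thresholdD(1)[OF thr assms(9) Ve[OF that(1)] that(2)])
 \<comment> \<open>Stability with the flow shapes kept fixed; it serves for the limit flow and for
   each approximating flow.\<close>
 have cont: "continuous_on {0..\<Lambda>} (%lam. lift L H B (v lam) (q lam))"
 if W: "(W, W') : flow_shapes H r U" and v: "!!lam. lam : {0..\<Lambda>} ==> weak_solution L H B U lam W W' (v lam) (q lam)" for W W' v q
 unfolding continuous_on_iff
 proof (intro ballI allI impI)
 fix lam e :: real assume lam: "lam : {0..\<Lambda>}" and e: "0 < e"
 from stab[OF W lam v[OF lam] e] obtain de where de: "de > 0" "lift_close L H r U B \<Lambda> W W' lam (lift L H B (v lam) (q lam)) e de" by blast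
 show "\<exists>d>0. \<forall>x'\<in>{0..\<Lambda>}. dist x' lam < d --> dist (lift L H B (v x') (q x')) (lift L H B (v lam) (q lam)) < e"
 proof (intro exI[of _ de] conjI de(1) ballI impI)
 fix x assume x: "x : {0..\<Lambda>}" "dist x lam < de"
 show "dist (lift L H B (v x) (q x)) (lift L H B (v lam) (q lam)) < e"
 using bspec[OF de(2)[unfolded lift_close_def] x(1)] W x v[OF x(1)] de(1) by (simp add: dist_real_def)
 qed
 qed
 fix u_eps p_eps
 assume sole: "\<forall>ep>0. \<forall>lam\<in>{0..\<Lambda>}. weak_solution L H B U lam (Vin_eps ep) (Vout_eps ep) (u_eps ep lam) (p_eps ep lam)"
 show "continuous_on {0..\<Lambda>} (%lam. lift L H B (u lam) (p lam))" by (rule cont[OF V sol])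
 show "continuous_on {0..\<Lambda>} (%lam. lift L H B (u_eps ep lam) (p_eps ep lam))" if "ep > 0" for ep
 using sole that by (intro cont[OF Ve[OF that]]) blast
 \<comment> \<open>Membership in \<open>flow_shapes\<close> is available for positive
   \<open>ep\<close>, hence eventually along \<open>at_right 0\<close>.\<close>
 have unif: "\<forall>\<^sub>F ep in at_right 0. \<forall>y\<in>{-H..H}. (abs (We ep y - W y)) < de"
 if ws: "weak_star_W1inf H We W (at_right 0)" and W: "W : {Vin, Vout}" and We: "!!ep. We ep : {Vin_eps ep, Vout_eps ep}" and de: "de > 0"
 for We W and de :: real
 proof -
 obtain g where g: "profile H r W g" "!!y. y : {-H..H} ==> W y = (LINT t:{-H<..<H}|lebesgue. weak_deriv {-H<..<H} 1 W t * indicator {-H..y} t)"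
 by (rule flow_shapes_profile[OF assms(2) V W assms(7)]) blast
 have "(\<exists>g. profile H r (We ep) g) & (\<forall>y\<in>{-H..H}. We ep y = (LINT t:{-H<..<H}|lebesgue. weak_deriv {-H<..<H} 1 (We ep) t * indicator {-H..y} t))"
 if "ep > 0" for ep
 by (rule flow_shapes_profile[OF assms(2) Ve[OF that] We assms(7)]) blast
 hence "\<forall>\<^sub>F ep in at_right 0. (\<exists>g. profile H r (We ep) g) &
 (\<forall>y\<in>{-H..H}. We ep y = (LINT t:{-H<..<H}|lebesgue. weak_deriv {-H<..<H} 1 (We ep) t * indicator {-H..y} t))"
 using eventually_at_right_less[of "0::real"] by (rule eventually_mono[rotated])
 from weak_star_imp_uniform[OF assms(2,7) ws g this de] show ?thesis .
 qed
 show "((%ep. C_norm 0 \<Lambda> (%lam. lift L H B (u_eps ep lam) (p_eps ep lam) - lift L H B (u lam) (p lam))) \<longlongrightarrow> 0) (at_right 0)"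
 proof (rule tendstoI)
 fix e :: real assume e: "e > 0"
 hence e3: "e / 3 > 0" by simp
 \<comment> \<open>The radii come from the limit flow alone, so the finite subcover and the minimal
   radius \<open>m\<close> do not depend on \<open>ep\<close>. At each \<open>lam\<close> both lifts
   are compared with the limit lift at the centre of a ball containing \<open>lam\<close>, which
   gives \<open>2 * e / 3\<close>.\<close>
 have "\<forall>lam\<in>{0..\<Lambda>}. \<exists>de>0. lift_close L H r U B \<Lambda> Vin Vout lam (lift L H B (u lam) (p lam)) (e / 3) de"
 using stab[OF V _ sol e3] by blast
 then obtain de where de: "\<forall>lam\<in>{0..\<Lambda>}. de lam > 0 & lift_close L H r U B \<Lambda> Vin Vout lam (lift L H B (u lam) (p lam)) (e / 3) (de lam)"
 by (rule bchoice[THEN exE])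
 have "{0..\<Lambda>} <= (\<Union>lam\<in>{0..\<Lambda>}. ball lam (de lam))" using de by force
 then obtain F where F: "F <= {0..\<Lambda>}" "finite F" "{0..\<Lambda>} <= (\<Union>lam\<in>F. ball lam (de lam))"
 by (rule compactE_image[OF compact_Icc open_ball])
 have F0: "F ~= {}" using F(3) \<Lambda> by auto
 define m where "m = Min (de ` F)"
 have m: "m > 0" unfolding m_def using F F0 de by (subst Min_gr_iff) auto
 have mle: "m <= de l" if "l : F" for l unfolding m_def using F(2) that by (intro Min_le) auto
 have ev: "\<forall>\<^sub>F ep in at_right 0. \<forall>y\<in>{-H..H}. (abs (Vin_eps ep y - Vin y)) < m"
 "\<forall>\<^sub>F ep in at_right 0. \<forall>y\<in>{-H..H}. (abs (Vout_eps ep y - Vout y)) < m"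
 by (rule unif[OF assms(14) _ _ m] unif[OF assms(15) _ _ m]; simp)+
 show "\<forall>\<^sub>F ep in at_right 0. dist (C_norm 0 \<Lambda> (%lam. lift L H B (u_eps ep lam) (p_eps ep lam) - lift L H B (u lam) (p lam))) 0 < e"
 using ev eventually_at_right_less[of "0::real"]
 proof eventually_elim
 case (elim ep)
 let ?f = "%lam. lift L H B (u_eps ep lam) (p_eps ep lam) - lift L H B (u lam) (p lam)"
 have bd: "(abs (?f lam)) <= 2 * e / 3" if lam: "lam : {0..\<Lambda>}" for lam
 proof -
 obtain l where l: "l : F" "lam : ball l (de l)" using F(3) lam by blast
 hence lF: "l : {0..\<Lambda>}" and dl: "(abs (lam - l)) < de l" using F(1) by (auto simp: dist_real_def abs_minus_commute)
 have ci: "\<forall>y\<in>{-H..H}. (abs (Vin_eps ep y - Vin y)) < de l" "\<forall>y\<in>{-H..H}. (abs (Vout_eps ep y - Vout y)) < de l"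
 using elim(1,2) mle[OF l(1)] by (meson less_le_trans)+
 have c0: "\<forall>y\<in>{-H..H}. (abs (Vin y - Vin y)) < de l" "\<forall>y\<in>{-H..H}. (abs (Vout y - Vout y)) < de l" using de lF by auto
 have "lift_close L H r U B \<Lambda> Vin Vout l (lift L H B (u l) (p l)) (e / 3) (de l)" using de lF by blast
 note st = bspec[OF this[unfolded lift_close_def] lam]
 have sl: "weak_solution L H B U lam (Vin_eps ep) (Vout_eps ep) (u_eps ep lam) (p_eps ep lam)" using sole elim(3) lam by blast
 have "(abs (lift L H B (u_eps ep lam) (p_eps ep lam) - lift L H B (u l) (p l))) < e / 3"
 using st Ve[OF elim(3)] dl ci sl by blast
 moreover have "(abs (lift L H B (u lam) (p lam) - lift L H B (u l) (p l))) < e / 3"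
 using st V dl c0 sol[OF lam] by blast
 ultimately show ?thesis by linarith
 qed
 have ne: "{0..\<Lambda>} ~= {}" and z: "0 : {0..\<Lambda>}" using \<Lambda> by auto
 have le: "C_norm 0 \<Lambda> ?f <= 2 * e / 3" unfolding C_norm_def by (rule cSUP_least[OF ne bd])
 \<comment> \<open>A real supremum is informative only over a set that is bounded above; the value
   at 0 then shows that the norm is nonnegative.\<close>
 have "bdd_above ((%t. (abs (?f t))) ` {0..\<Lambda>})" using bd by (intro bdd_aboveI2)
 from cSUP_upper[OF z this] have "0 <= C_norm 0 \<Lambda> ?f" unfolding C_norm_def by linarith
 thus ?case using le e by (simp add: dist_real_def)
 qed
 qed
qed

end
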